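(* Let $a>0$, $\alpha_0\in\mathbb R$ and $V_0\in L^\infty(\mathbb R;\mathbb R)$. Let $\mathsf H^\Omega_{\mathrm i\alpha_0,V_0}$, $\mathcal M_+$, $\mathcal M_-$, $\mathcal M_0$ and $\{\mu_n\}_{n\in\mathbb N_0}$ be as defined in the context. Then, with respect to the involution $(Ju)(x,y)=u(x,-y)$ on $L^2(\Omega)$, $$\sigma_{++}(\mathsf H^\Omega_{\mathrm i\alpha_0,V_0})=\mathcal M_+\setminus(\mathcal M_-\cup\mathcal M_0),\qquad \sigma_{--}(\mathsf H^\Omega_{\mathrm i\alpha_0,V_0})=\mathcal M_-\setminus(\mathcal M_+\cup\mathcal M_0),$$ $$\sigma_{00}(\mathsf H^\Omega_{\mathrm i\alpha_0,V_0})=\mathcal M_0\cup(\mathcal M_+\cap\mathcal M_-).$$ In particular, for $V_0\equiv0$, writing $\mathsf H^\Omega_{\mathrm i\alpha_0}:=\mathsf H^\Omega_{\mathrm i\alpha_0,0}$, $$\sigma_{++}(\mathsf H^\Omega_{\mathrm i\alpha_0})=[\mu_0,\mu_1),\qquad \sigma_{--}(\mathsf H^\Omega_{\mathrm i\alpha_0})=\varnothing,\qquad \sigma_{00}(\mathsf H^\Omega_{\mathrm i\alpha_0})=[\mu_1,\infty).$$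
   Context: Let $\mathbb I:=(-a,a)$ and $\Omega:=\mathbb R\times\mathbb I$. Spectra of definite type. For a densely defined closed operator $T$ in a Hilbert space and a bounded symmetric involution $J$ ($J=J^*$, $J^2=I$), $\sigma_{\rm app}(T)$ is the approximate point spectrum; an approximate eigensequence for $\lambda$ is $\{f_n\}\subset\operatorname{dom}T$ with $\|f_n\|=1$, $\|(T-\lambda)f_n\|\to0$. $\sigma_{++}(T)$ (resp. $\sigma_{--}(T)$) is the set of $\lambda\in\sigma_{\rm app}(T)$ such that every approximate eigensequence $\{f_n\}$ for $\lambda$ satisfies $\liminf_n(Jf_n,f_n)>0$ (resp. $\limsup_n(Jf_n,f_n)<0$), and $\sigma_{00}(T):=\sigma_{\rm app}(T)\setminus(\sigma_{++}(T)\cup\sigma_{--}(T))$. Operators. The longitudinal operator is the self-adjoint operator $\mathsf H^{\mathbb R}_{V_0}\psi:=-\psi''+V_0\psi$, $\operatorname{dom}\mathsf H^{\mathbb R}_{V_0}:=H^2(\mathbb R)$, in $L^2(\mathbb R)$. The transversal operator is the m-sectorial operator in $L^2(\mathbb I)$ $$\mathsf H^{\mathbb I}_{\mathrm i\alpha_0}\psi:=-\psi'',\qquad\operatorname{dom}\mathsf H^{\mathbb I}_{\mathrm i\alpha_0}:=\{\psi\in H^2(\mathbb I):\psi'(\pm a)=-\mathrm i\alpha_0\psi(\pm a)\}.$$ In $L^2(\Omega)=L^2(\mathbb R)\otimes L^2(\mathbb I)$, $\mathsf H^\Omega_{\mathrm i\alpha_0,V_0}$ is the (m-sectorial) closure of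 $\mathsf H^{\mathbb R}_{V_0}\odot I_{L^2(\mathbb I)}+I_{L^2(\mathbb R)}\odot\mathsf H^{\mathbb I}_{\mathrm i\alpha_0}$, where $\odot$ is the algebraic tensor product. Eigenvalues of the transversal operator. $\sigma(\mathsf H^{\mathbb I}_{\mathrm i\alpha_0})=\{\lambda_n\}_{n\in\mathbb N_0}$ with $\lambda_0=\alpha_0^2$ and $\lambda_n=(\pi n/(2a))^2$ for $n\in\mathbb N=\{1,2,\dots\}$; $\{\mu_n\}_{n\in\mathbb N_0}$ denotes the sequence $\{\lambda_n\}_{n\in\mathbb N_0}$ rearranged in non-decreasing order (with algebraic multiplicities, so a coincidence $\lambda_0=\lambda_{n}$, $n\geq 1$, is listed twice). Sets $\mathcal M_\mu$. With $\sigma_{\mu\mu}(\mathsf H^{\mathbb I}_{\mathrm i\alpha_0})$, $\mu\in\{+,-,0\}$, taken with respect to the involution $(\mathcal P\psi)(y):=\psi(-y)$ in $L^2(\mathbb I)$, $$\mathcal M_\mu:=\sigma_{\mu\mu}(\mathsf H^{\mathbb I}_{\mathrm i\alpha_0})+\sigma(\mathsf H^{\mathbb R}_{V_0}),\qquad\mu\in\{+,-,0\}.$$ Here $A+B=\{x+y:x\in A,y\in B\}$ (Minkowski sum). *)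

theory Defs
  imports "HOL-Analysis.Analysis"
begin

section \<open>Operators in \<open>L\<^sup>2\<close> spaces\<close>

text \<open>
  An element of \<open>L\<^sup>2(M)\<close> is given by a measurable, square-integrable representative; two
  representatives denote the same element iff they agree almost everywhere. For the Borel \<open>\<sigma>\<close>-algebra
  this is the usual space, since each class of Lebesgue measurable functions contains a Borel
  measurable one. A linear operator is given by its graph, as a set of pairs of representatives; all
  operators below are invariant under changing either component on a null set.
\<close>

type_synonym 'a operator = "(('a \<Rightarrow> complex) \<times> ('a \<Rightarrow> complex)) set"

definition L2 :: "'a measure \<Rightarrow> ('a \<Rightarrow> complex) set" where
  "L2 M = {f \<in> borel_measurable M. integrable M (\<lambda>x. (cmod (f x))\<^sup>2)}"

definition l2_inner :: "'a measure \<Rightarrow> ('a \<Rightarrow> complex) \<Rightarrow> ('a \<Rightarrow> complex) \<Rightarrow> complex" where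
  "l2_inner M f g = (LINT x|M. f x * cnj (g x))"

definition l2_norm :: "'a measure \<Rightarrow> ('a \<Rightarrow> complex) \<Rightarrow> real" where
  "l2_norm M f = sqrt (LINT x|M. (cmod (f x))\<^sup>2)"

definition op_id :: "'a measure \<Rightarrow> 'a operator" where
  "op_id M = {(f, g). f \<in> L2 M \<and> g \<in> L2 M \<and> (AE x in M. g x = f x)}"

text \<open>The sum is defined on the intersection of the two domains.\<close>

definition op_sum :: "'a measure \<Rightarrow> 'a operator \<Rightarrow> 'a operator \<Rightarrow> 'a operator" where
  "op_sum M S T = {(u, w). w \<in> L2 M \<and>
     (\<exists>v1 v2. (u, v1) \<in> S \<and> (u, v2) \<in> T \<and> (AE z in M. w z = v1 z + v2 z))}"

text \<open>The algebraic tensor product \<open>A \<odot> B\<close>, with domain the span of the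
  \<open>f \<otimes> g\<close> for \<open>f \<in> dom A\<close> and \<open>g \<in> dom B\<close>.\<close>

definition op_tensor ::
    "('a \<times> 'b) measure \<Rightarrow> 'a operator \<Rightarrow> 'b operator \<Rightarrow> ('a \<times> 'b) operator" where
  "op_tensor M A B = {(u, w). u \<in> L2 M \<and> w \<in> L2 M \<and>
     (\<exists>(n::nat) f f' g g'.
        (\<forall>i<n. (f i, f' i) \<in> A \<and> (g i, g' i) \<in> B) \<and>
        (AE z in M. u z = (\<Sum>i<n. f i (fst z) * g i (snd z))) \<and>
        (AE z in M. w z = (\<Sum>i<n. f' i (fst z) * g' i (snd z))))}"

text \<open>The closure of an operator: closure of its graph in \<open>L\<^sup>2(M) \<times> L\<^sup>2(M)\<close>.\<close>

definition op_closure :: "'a measure \<Rightarrow> 'a operator \<Rightarrow> 'a operator" where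
  "op_closure M T = {(u, w). u \<in> L2 M \<and> w \<in> L2 M \<and>
     (\<exists>U W. (\<forall>n. (U n, W n) \<in> T) \<and>
        (\<lambda>n. l2_norm M (\<lambda>x. U n x - u x)) \<longlonglongrightarrow> 0 \<and>
        (\<lambda>n. l2_norm M (\<lambda>x. W n x - w x)) \<longlonglongrightarrow> 0)}"

section \<open>Spectra\<close>

text \<open>The bound below makes \<open>T - \<zeta>\<close> injective with bounded inverse.\<close>

definition resolvent_set :: "'a measure \<Rightarrow> 'a operator \<Rightarrow> complex set" where
  "resolvent_set M T = {\<zeta>.
     (\<forall>h\<in>L2 M. \<exists>f g. (f, g) \<in> T \<and> (AE x in M. g x - \<zeta> * f x = h x)) \<and>
     (\<exists>C. \<forall>f g. (f, g) \<in> T \<longrightarrow> l2_norm M f \<le> C * l2_norm M (\<lambda>x. g x - \<zeta> * f x))}"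

definition spectrum :: "'a measure \<Rightarrow> 'a operator \<Rightarrow> complex set" where
  "spectrum M T = - resolvent_set M T"

definition approx_eigenseq ::
    "'a measure \<Rightarrow> 'a operator \<Rightarrow> complex \<Rightarrow> (nat \<Rightarrow> 'a \<Rightarrow> complex) \<Rightarrow> bool" where
  "approx_eigenseq M T \<zeta> f \<longleftrightarrow> (\<forall>n. l2_norm M (f n) = 1) \<and>
     (\<exists>g. (\<forall>n. (f n, g n) \<in> T) \<and> (\<lambda>n. l2_norm M (\<lambda>x. g n x - \<zeta> * f n x)) \<longlonglongrightarrow> 0)"

definition spec_app :: "'a measure \<Rightarrow> 'a operator \<Rightarrow> complex set" where
  "spec_app M T = {\<zeta>. \<exists>f. approx_eigenseq M T \<zeta> f}"

text \<open>
  In the following \<open>J\<close> is a bounded symmetric involution, so \<open>(J f, f)\<close> is real. The limits are taken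
  in the extended reals, where \<open>liminf\<close> and \<open>limsup\<close> always exist.
\<close>

definition spec_pp ::
    "'a measure \<Rightarrow> (('a \<Rightarrow> complex) \<Rightarrow> 'a \<Rightarrow> complex) \<Rightarrow> 'a operator \<Rightarrow> complex set" where
  "spec_pp M J T = {\<zeta> \<in> spec_app M T. \<forall>f. approx_eigenseq M T \<zeta> f \<longrightarrow>
     liminf (\<lambda>n. ereal (Re (l2_inner M (J (f n)) (f n)))) > 0}"

definition spec_mm ::
    "'a measure \<Rightarrow> (('a \<Rightarrow> complex) \<Rightarrow> 'a \<Rightarrow> complex) \<Rightarrow> 'a operator \<Rightarrow> complex set" where
  "spec_mm M J T = {\<zeta> \<in> spec_app M T. \<forall>f. approx_eigenseq M T \<zeta> f \<longrightarrow>
     limsup (\<lambda>n. ereal (Re (l2_inner M (J (f n)) (f n)))) < 0}"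

definition spec_00 ::
    "'a measure \<Rightarrow> (('a \<Rightarrow> complex) \<Rightarrow> 'a \<Rightarrow> complex) \<Rightarrow> 'a operator \<Rightarrow> complex set" where
  "spec_00 M J T = spec_app M T - (spec_pp M J T \<union> spec_mm M J T)"

section \<open>The Sobolev space \<open>H\<^sup>2\<close> of an open subset of the line\<close>

definition meas_on :: "'a::euclidean_space set \<Rightarrow> 'a measure" where
  "meas_on S = restrict_space lborel S"

text \<open>Real-valued test functions suffice, by linearity.\<close>

definition test_fun :: "real set \<Rightarrow> (real \<Rightarrow> real) \<Rightarrow> bool" where
  "test_fun S \<phi> \<longleftrightarrow> (\<forall>n x. ((deriv ^^ n) \<phi>) field_differentiable (at x)) \<and>
     (\<exists>K. compact K \<and> K \<subseteq> S \<and> (\<forall>x. x \<notin> K \<longrightarrow> \<phi> x = 0))"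

definition weak_deriv :: "real set \<Rightarrow> (real \<Rightarrow> complex) \<Rightarrow> (real \<Rightarrow> complex) \<Rightarrow> bool" where
  "weak_deriv S f f' \<longleftrightarrow> (\<forall>\<phi>. test_fun S \<phi> \<longrightarrow>
     (LINT x|meas_on S. f x * of_real (deriv \<phi> x)) = - (LINT x|meas_on S. f' x * of_real (\<phi> x)))"

text \<open>\<open>\<psi> \<in> H\<^sup>2(S)\<close> with first and second weak derivatives \<open>\<psi>1\<close> and \<open>\<psi>2\<close>.\<close>

definition H2_derivs ::
    "real set \<Rightarrow> (real \<Rightarrow> complex) \<Rightarrow> (real \<Rightarrow> complex) \<Rightarrow> (real \<Rightarrow> complex) \<Rightarrow> bool" where
  "H2_derivs S \<psi> \<psi>1 \<psi>2 \<longleftrightarrow>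
     \<psi> \<in> L2 (meas_on S) \<and> \<psi>1 \<in> L2 (meas_on S) \<and> \<psi>2 \<in> L2 (meas_on S) \<and>
     weak_deriv S \<psi> \<psi>1 \<and> weak_deriv S \<psi>1 \<psi>2"

section \<open>The operators\<close>

definition Linfty_real :: "(real \<Rightarrow> real) set" where
  "Linfty_real = {V \<in> borel_measurable lebesgue. \<exists>C. AE x in lebesgue. \<bar>V x\<bar> \<le> C}"

abbreviation II :: "real \<Rightarrow> real set" where
  "II a \<equiv> {-a<..<a}"

abbreviation Om :: "real \<Rightarrow> (real \<times> real) set" where
  "Om a \<equiv> UNIV \<times> II a"

definition H_R :: "(real \<Rightarrow> real) \<Rightarrow> real operator" where
  "H_R V0 = {(\<psi>, h). h \<in> L2 (meas_on UNIV) \<and>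
     (\<exists>\<psi>1 \<psi>2. H2_derivs UNIV \<psi> \<psi>1 \<psi>2 \<and>
        (AE x in meas_on UNIV. h x = - \<psi>2 x + of_real (V0 x) * \<psi> x))}"

text \<open>The boundary values of \<open>\<psi>\<close> and \<open>\<psi>'\<close> at \<open>\<plusminus>a\<close> are those of the representatives
  \<open>u0\<close> and \<open>u1\<close> that are continuous on \<open>[-a, a]\<close>.\<close>

definition H_I :: "real \<Rightarrow> real \<Rightarrow> real operator" where
  "H_I a \<alpha>0 = {(\<psi>, h). h \<in> L2 (meas_on (II a)) \<and>
     (\<exists>\<psi>1 \<psi>2. H2_derivs (II a) \<psi> \<psi>1 \<psi>2 \<and>
        (\<exists>u0 u1. continuous_on {-a..a} u0 \<and> continuous_on {-a..a} u1 \<and>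
           (AE y in meas_on (II a). u0 y = \<psi> y) \<and> (AE y in meas_on (II a). u1 y = \<psi>1 y) \<and>
           u1 a = - \<i> * of_real \<alpha>0 * u0 a \<and> u1 (-a) = - \<i> * of_real \<alpha>0 * u0 (-a)) \<and>
        (AE y in meas_on (II a). h y = - \<psi>2 y))}"

definition H_Om :: "real \<Rightarrow> real \<Rightarrow> (real \<Rightarrow> real) \<Rightarrow> (real \<times> real) operator" where
  "H_Om a \<alpha>0 V0 = op_closure (meas_on (Om a))
     (op_sum (meas_on (Om a))
        (op_tensor (meas_on (Om a)) (H_R V0) (op_id (meas_on (II a))))
        (op_tensor (meas_on (Om a)) (op_id (meas_on UNIV)) (H_I a \<alpha>0)))"

definition par_I :: "(real \<Rightarrow> complex) \<Rightarrow> real \<Rightarrow> complex" where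
  "par_I \<psi> = (\<lambda>y. \<psi> (- y))"

definition par_Om :: "(real \<times> real \<Rightarrow> complex) \<Rightarrow> real \<times> real \<Rightarrow> complex" where
  "par_Om u = (\<lambda>(x, y). u (x, - y))"

definition M_plus :: "real \<Rightarrow> real \<Rightarrow> (real \<Rightarrow> real) \<Rightarrow> complex set" where
  "M_plus a \<alpha>0 V0 = {s + t |s t.
     s \<in> spec_pp (meas_on (II a)) par_I (H_I a \<alpha>0) \<and> t \<in> spectrum (meas_on UNIV) (H_R V0)}"

definition M_minus :: "real \<Rightarrow> real \<Rightarrow> (real \<Rightarrow> real) \<Rightarrow> complex set" where
  "M_minus a \<alpha>0 V0 = {s + t |s t.
     s \<in> spec_mm (meas_on (II a)) par_I (H_I a \<alpha>0) \<and> t \<in> spectrum (meas_on UNIV) (H_R V0)}"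

definition M_zero :: "real \<Rightarrow> real \<Rightarrow> (real \<Rightarrow> real) \<Rightarrow> complex set" where
  "M_zero a \<alpha>0 V0 = {s + t |s t.
     s \<in> spec_00 (meas_on (II a)) par_I (H_I a \<alpha>0) \<and> t \<in> spectrum (meas_on UNIV) (H_R V0)}"

section \<open>The ordered sequence of transversal eigenvalues\<close>

definition ev :: "real \<Rightarrow> real \<Rightarrow> nat \<Rightarrow> real" where
  "ev a \<alpha>0 n = (if n = 0 then \<alpha>0\<^sup>2 else (pi * real n / (2 * a))\<^sup>2)"

definition sorted_rearrangement :: "(nat \<Rightarrow> real) \<Rightarrow> (nat \<Rightarrow> real) \<Rightarrow> bool" where
  "sorted_rearrangement l m \<longleftrightarrow> mono m \<and> (\<exists>\<pi>. bij \<pi> \<and> m = l \<circ> \<pi>)"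

definition ev_sorted :: "real \<Rightarrow> real \<Rightarrow> nat \<Rightarrow> real" where
  "ev_sorted a \<alpha>0 = (THE m. sorted_rearrangement (ev a \<alpha>0) m)"

lemma sorted_rearrangement_unique:
  assumes fin: "\<And>t. finite {k. l k \<le> t}"
    and "sorted_rearrangement l m" "sorted_rearrangement l m'"
  shows "m = m'"
proof -
  have le_iff: "m n \<le> t \<longleftrightarrow> n < card {k. l k \<le> t}"
    if "sorted_rearrangement l m" for m n t
  proof -
    from that obtain \<pi> where mon: "mono m" and bij: "bij \<pi>" and m: "m = l \<circ> \<pi>"
      by (auto simp: sorted_rearrangement_def)
    have "bij_betw \<pi> {k. m k \<le> t} {k. l k \<le> t}"
    proof (rule bij_betw_imageI)
      show "inj_on \<pi> {k. m k \<le> t}"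
        using bij by (meson bij_is_inj inj_on_subset subset_UNIV)
      show "\<pi> ` {k. m k \<le> t} = {k. l k \<le> t}"
      proof
        show "{k. l k \<le> t} \<subseteq> \<pi> ` {k. m k \<le> t}"
        proof
          fix k assume k: "k \<in> {k. l k \<le> t}"
          obtain j where "k = \<pi> j" using bij by (meson bij_pointE)
          with k show "k \<in> \<pi> ` {k. m k \<le> t}" by (auto simp: m)
        qed
      qed (auto simp: m)
    qed
    hence c: "card {k. m k \<le> t} = card {k. l k \<le> t}" and f: "finite {k. m k \<le> t}"
      using bij_betw_same_card bij_betw_finite fin by blast+
    show ?thesis
    proof
      assume "m n \<le> t"
      hence "{..n} \<subseteq> {k. m k \<le> t}" using mon by (auto dest: monoD intro: order_trans)
      from card_mono[OF f this] show "n < card {k. l k \<le> t}" using c by simp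
    next
      assume n: "n < card {k. l k \<le> t}"
      show "m n \<le> t"
      proof (rule ccontr)
        assume "\<not> m n \<le> t"
        hence "{k. m k \<le> t} \<subseteq> {..<n}"
          using monoD[OF mon, of n] by (force simp: not_le)
        from card_mono[OF _ this] show False using n c by simp
      qed
    qed
  qed
  show ?thesis
  proof
    fix n
    show "m n = m' n"
      using le_iff[OF assms(2), of n] le_iff[OF assms(3), of n] by (meson order_antisym order_refl)
  qed
qed

lemma sorted_rearrangement_ev_sorted:
  assumes a: "a > 0"
  shows "sorted_rearrangement (ev a \<alpha>0) (ev_sorted a \<alpha>0)"
proof -
  let ?l = "ev a \<alpha>0"
  define c where "c = pi / (2 * a)"
  have c: "c > 0" using a by (simp add: c_def)
  have l: "?l n = (c * real n)\<^sup>2" if "n > 0" for n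
    using that by (simp add: ev_def c_def)
  have l_mono: "?l i \<le> ?l j" if "0 < i" "i \<le> j" for i j
    using that c by (auto simp: l intro!: power_mono)
  have fin: "finite {k. ?l k \<le> t}" for t
  proof (rule finite_subset)
    show "{k. ?l k \<le> t} \<subseteq> insert 0 {..nat \<lceil>sqrt t / c\<rceil>}"
    proof
      fix k assume k: "k \<in> {k. ?l k \<le> t}"
      show "k \<in> insert 0 {..nat \<lceil>sqrt t / c\<rceil>}"
      proof (cases "k = 0")
        case False
        hence "(c * real k)\<^sup>2 \<le> t" using k l by auto
        hence "c * real k \<le> sqrt t" by (rule real_le_rsqrt)
        hence "real k \<le> sqrt t / c" using c by (simp add: field_simps)
        thus ?thesis by simp linarith
      qed simp
    qed
  qed simp
  define S where "S = {k. 0 < k \<and> ?l k < ?l 0}"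
  have "finite S" by (rule finite_subset[OF _ fin[of "?l 0"]]) (auto simp: S_def)
  define N where "N = (LEAST k. 0 < k \<and> ?l 0 \<le> ?l k) - 1"
  have "\<exists>k. 0 < k \<and> ?l 0 \<le> ?l k"
  proof (rule ccontr)
    assume "\<not> ?thesis"
    hence less: "?l k < ?l 0" if "0 < k" for k using that by (meson not_le)
    have "S = {0<..}" unfolding S_def using less by blast
    with \<open>finite S\<close> show False by (simp add: infinite_Ioi)
  qed
  hence k: "0 < (LEAST k. 0 < k \<and> ?l 0 \<le> ?l k) \<and> ?l 0 \<le> ?l (LEAST k. 0 < k \<and> ?l 0 \<le> ?l k)"
    by (rule LeastI_ex)
  hence SN: "(LEAST k. 0 < k \<and> ?l 0 \<le> ?l k) = Suc N" by (simp add: N_def)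
  have N1: "?l 0 \<le> ?l (Suc N)" using k SN by simp
  have N2: "?l k \<le> ?l 0" if "0 < k" "k \<le> N" for k
    using not_less_Least[of k "\<lambda>k. 0 < k \<and> ?l 0 \<le> ?l k"] that SN by simp
  define \<pi> where "\<pi> = (\<lambda>n. if n < N then Suc n else if n = N then 0 else n)"
  have "bij \<pi>"
    by (rule o_bij[where g = "\<lambda>n. if n = 0 then N else if n \<le> N then n - 1 else n"])
       (auto simp: \<pi>_def fun_eq_iff)
  moreover have "mono (?l \<circ> \<pi>)"
  proof (rule mono_iff_le_Suc[THEN iffD2], rule allI)
    fix n
    consider "Suc n < N" | "Suc n = N" | "n = N" | "n > N" by linarith
    thus "(?l \<circ> \<pi>) n \<le> (?l \<circ> \<pi>) (Suc n)"
      by cases (simp_all add: \<pi>_def N1 N2 l_mono)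
  qed
  ultimately have "sorted_rearrangement ?l (?l \<circ> \<pi>)"
    unfolding sorted_rearrangement_def by blast
  hence "\<exists>!m. sorted_rearrangement ?l m"
    using sorted_rearrangement_unique[of ?l, OF fin] by blast
  thus ?thesis
    unfolding ev_sorted_def by (rule theI')
qed

end

theory Submission
  imports Defs
begin

text \<open>
  The transversal eigenfunctions \<open>\<psi>\<^sub>k\<close> satisfy \<open>P \<psi>\<^sub>k = \<plusminus> cnj \<psi>\<^sub>k\<close>, and the transversal operator is
  symmetric for the bilinear form \<open>\<integral> f g\<close>. Hence \<open>u \<mapsto> \<integral> u(\<cdot>, y) \<psi>\<^sub>k(y) dy\<close> intertwines the operator on the
  strip with \<open>H_R + \<lambda>\<^sub>k\<close>, apart from a Jordan block if \<open>\<alpha>\<^sup>2\<close> is a degenerate eigenvalue. The family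
  \<open>\<psi>\<^sub>k\<close> is controlled by Parseval's identity for the cosines \<open>cos (\<pi> k (y + a) / (2 a))\<close>, to which
  its coefficient functionals for \<open>k \<ge> 1\<close> are carried by the Volterra operator \<open>1 - i \<alpha> V\<close>.

  Since \<open>H_R\<close> is self-adjoint, \<open>H_R - t\<close> is bounded below unless \<open>t\<close> lies in its spectrum, and it is
  bounded below uniformly for large \<open>\<lambda>\<^sub>k\<close> when \<open>t = \<zeta> - \<lambda>\<^sub>k\<close>. An approximate eigensequence for \<open>\<zeta>\<close>
  therefore concentrates on the finitely many components with \<open>\<zeta> - \<lambda>\<^sub>k \<in> \<sigma>(H_R)\<close>, where the form
  \<open>(J u, u)\<close> is definite as soon as the numbers \<open>(P \<psi>\<^sub>k, \<psi>\<^sub>k)\<close> have a common strict sign. Conversely,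
  tensor products of approximate eigensequences of the two factors realise every type that occurs.

  For \<open>V\<^sub>0 = 0\<close> it remains to observe that the lowest eigenvalue has positive type (if it is simple)
  and that the next one has a nonpositive type.
\<close>

section \<open>Square-integrable functions\<close>

text \<open>The operator on the strip is not self-adjoint and is given only as the closure of finite
  tensor sums, so there is no functional calculus to start from. Lower bounds take its place. A
  bound for a single coefficient is an estimate for \<open>H_R\<close> on finite tensor sums, and it
  passes to the closure because coefficients depend continuously on u. As the psi_k are not
  orthogonal, coefficient bounds add up to a bound for u only through a two-sided frame inequality,
  whose constant is the same on all fibres. The sign comes from N_k = (P psi_k, psi_k): up to an
  error that tends to 0, (J u, u) equals the sum of |c_k|^2 / N_k over the components that survive.
  The quotient makes sense because N_k = 0 happens only if lambda_k is degenerate, and such an index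
  never survives when a sign is claimed. Neither inclusion calls for a description of the spectrum
  of the transversal operator: products accept every approximate eigensequence of it, and
  definiteness asks only for the type of each lambda_k, which a single eigenfunction tests.\<close>

lemma L2_measurable [measurable_dest]: "f \<in> L2 M \<Longrightarrow> f \<in> borel_measurable M"
  by (simp add: L2_def)

lemma L2_integrable_sq: "f \<in> L2 M \<Longrightarrow> integrable M (\<lambda>x. (cmod (f x))\<^sup>2)"
  by (simp add: L2_def)

lemma L2_cong_AE:
  assumes "f \<in> L2 M" "g \<in> borel_measurable M" "AE x in M. g x = f x"
  shows "g \<in> L2 M"
proof -
  have [measurable]: "f \<in> borel_measurable M" "g \<in> borel_measurable M" using assms by (auto simp: L2_def)
  have "integrable M (\<lambda>x. (cmod (g x))\<^sup>2)"
    by (rule integrable_cong_AE_imp[OF L2_integrable_sq[OF assms(1)]]) (use assms in auto)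
  thus ?thesis using assms by (simp add: L2_def)
qed

lemma L2_bound:
  assumes "g \<in> L2 M" "f \<in> borel_measurable M" "AE x in M. cmod (f x) \<le> C * cmod (g x)"
  shows "f \<in> L2 M"
proof -
  have [measurable]: "f \<in> borel_measurable M" "g \<in> borel_measurable M" using assms by (auto simp: L2_def)
  have "integrable M (\<lambda>x. (cmod (f x))\<^sup>2)"
  proof (rule Bochner_Integration.integrable_bound)
    show "integrable M (\<lambda>x. C\<^sup>2 * (cmod (g x))\<^sup>2)" using L2_integrable_sq[OF assms(1)] by simp
    show "AE x in M. norm ((cmod (f x))\<^sup>2) \<le> norm (C\<^sup>2 * (cmod (g x))\<^sup>2)"
      using assms(3)
    proof eventually_elim
      case (elim x)
      have "(cmod (f x))\<^sup>2 \<le> (C * cmod (g x))\<^sup>2" using elim by (intro power_mono) auto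
      thus ?case by (simp add: power_mult_distrib)
    qed
  qed simp
  thus ?thesis using assms by (simp add: L2_def)
qed

lemma L2_zero [simp]: "(\<lambda>x. 0) \<in> L2 M"
  by (simp add: L2_def)

lemma L2_scale: "f \<in> L2 M \<Longrightarrow> (\<lambda>x. c * f x) \<in> L2 M"
  by (rule L2_bound[where C = "cmod c"]) (auto simp: norm_mult intro: L2_measurable)

lemma L2_uminus: "f \<in> L2 M \<Longrightarrow> (\<lambda>x. - f x) \<in> L2 M"
  using L2_scale[of f M "-1"] by simp

lemma borel_measurable_cnj [measurable]: "cnj \<in> borel_measurable borel"
  by (intro borel_measurable_continuous_onI continuous_intros)

lemma L2_cnj: "f \<in> L2 M \<Longrightarrow> (\<lambda>x. cnj (f x)) \<in> L2 M"
  by (rule L2_bound[where C = 1]) auto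

lemma L2_add:
  assumes "f \<in> L2 M" "g \<in> L2 M"
  shows "(\<lambda>x. f x + g x) \<in> L2 M"
proof -
  have [measurable]: "f \<in> borel_measurable M" "g \<in> borel_measurable M" using assms by (auto simp: L2_def)
  have "integrable M (\<lambda>x. (cmod (f x + g x))\<^sup>2)"
  proof (rule Bochner_Integration.integrable_bound)
    show "integrable M (\<lambda>x. 2 * (cmod (f x))\<^sup>2 + 2 * (cmod (g x))\<^sup>2)"
      using assms by (simp add: L2_def)
    have "(cmod (f x + g x))\<^sup>2 \<le> 2 * (cmod (f x))\<^sup>2 + 2 * (cmod (g x))\<^sup>2" for x
    proof -
      have "(cmod (f x + g x))\<^sup>2 \<le> (cmod (f x) + cmod (g x))\<^sup>2"
        by (intro power_mono norm_triangle_ineq) auto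
      also have "\<dots> \<le> 2 * (cmod (f x))\<^sup>2 + 2 * (cmod (g x))\<^sup>2"
        using sum_squares_bound[of "cmod (f x)" "cmod (g x)"] by (simp add: power2_sum)
      finally show ?thesis .
    qed
    thus "AE x in M. norm ((cmod (f x + g x))\<^sup>2) \<le> norm (2 * (cmod (f x))\<^sup>2 + 2 * (cmod (g x))\<^sup>2)"
      by simp
  qed simp
  thus ?thesis by (simp add: L2_def)
qed

lemma L2_diff: "f \<in> L2 M \<Longrightarrow> g \<in> L2 M \<Longrightarrow> (\<lambda>x. f x - g x) \<in> L2 M"
  using L2_add[of f M "\<lambda>x. - g x"] L2_uminus[of g M] by simp

lemma L2_sum:
  assumes "\<And>i. i \<in> A \<Longrightarrow> f i \<in> L2 M"
  shows "(\<lambda>x. \<Sum>i\<in>A. f i x) \<in> L2 M"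
  using assms by (induction A rule: infinite_finite_induct) (auto intro: L2_add)

lemma integrable_L2_mult:
  assumes "f \<in> L2 M" "g \<in> L2 M"
  shows "integrable M (\<lambda>x. f x * g x)"
proof -
  have [measurable]: "f \<in> borel_measurable M" "g \<in> borel_measurable M" using assms by (auto simp: L2_def)
  show ?thesis
  proof (rule Bochner_Integration.integrable_bound)
    show "integrable M (\<lambda>x. (cmod (f x))\<^sup>2 + (cmod (g x))\<^sup>2)"
      using assms by (simp add: L2_def)
    have "cmod (f x * g x) \<le> (cmod (f x))\<^sup>2 + (cmod (g x))\<^sup>2" for x
    proof -
      have "2 * (cmod (f x) * cmod (g x)) \<le> (cmod (f x))\<^sup>2 + (cmod (g x))\<^sup>2"
        using sum_squares_bound[of "cmod (f x)" "cmod (g x)"] by simp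
      moreover have "0 \<le> cmod (f x) * cmod (g x)" by simp
      ultimately show ?thesis unfolding norm_mult by linarith
    qed
    thus "AE x in M. norm (f x * g x) \<le> norm ((cmod (f x))\<^sup>2 + (cmod (g x))\<^sup>2)" by simp
  qed simp
qed

section \<open>Norm, Cauchy-Schwarz inequality and completeness\<close>

lemma l2_norm_nonneg [simp]: "0 \<le> l2_norm M f"
  by (simp add: l2_norm_def)

lemma l2_norm_sq: "(l2_norm M f)\<^sup>2 = (LINT x|M. (cmod (f x))\<^sup>2)"
  by (simp add: l2_norm_def)

lemma l2_norm_zero [simp]: "l2_norm M (\<lambda>x. 0) = 0"
  by (simp add: l2_norm_def)

lemma l2_norm_cong_AE:
  assumes "f \<in> borel_measurable M" "g \<in> borel_measurable M" "AE x in M. f x = g x"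
  shows "l2_norm M f = l2_norm M g"
  unfolding l2_norm_def
  by (rule arg_cong[where f = sqrt], rule integral_cong_AE) (use assms in auto)

lemma l2_norm_scale: "l2_norm M (\<lambda>x. c * f x) = cmod c * l2_norm M f"
  by (simp add: l2_norm_def norm_mult power_mult_distrib real_sqrt_mult)

lemma l2_norm_uminus: "l2_norm M (\<lambda>x. - f x) = l2_norm M f"
  by (simp add: l2_norm_def)

lemma l2_norm_minus_commute: "l2_norm M (\<lambda>x. f x - g x) = l2_norm M (\<lambda>x. g x - f x)"
  by (simp add: l2_norm_def norm_minus_commute)

lemma nn_integral_L2:
  assumes "f \<in> L2 M"
  shows "(\<integral>\<^sup>+x. ennreal ((cmod (f x))\<^sup>2) \<partial>M) = ennreal ((l2_norm M f)\<^sup>2)"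
  unfolding l2_norm_sq by (rule nn_integral_eq_integral) (use assms in \<open>auto simp: L2_def\<close>)

lemma L2_nn_integralI:
  assumes "f \<in> borel_measurable M" "(\<integral>\<^sup>+x. ennreal ((cmod (f x))\<^sup>2) \<partial>M) < \<infinity>"
  shows "f \<in> L2 M"
  unfolding L2_def using assms by (auto intro!: integrableI_nonneg)

text \<open>Estimates are often made with the nonnegative extended integral, where Fatou and Tonelli
  ask for no integrability; this brings them back, giving membership and norm at once.\<close>

lemma l2_norm_le_nn:
  assumes "f \<in> borel_measurable M" "(\<integral>\<^sup>+x. ennreal ((cmod (f x))\<^sup>2) \<partial>M) \<le> ennreal (C\<^sup>2)" "0 \<le> C"
  shows "f \<in> L2 M" "l2_norm M f \<le> C"
proof -
  show f: "f \<in> L2 M" by (rule L2_nn_integralI) (use assms in \<open>auto simp: le_less_trans\<close>)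
  have "(l2_norm M f)\<^sup>2 \<le> C\<^sup>2" using assms(2) nn_integral_L2[OF f] by (simp add: ennreal_le_iff)
  thus "l2_norm M f \<le> C" using assms(3) by (rule power2_le_imp_le)
qed

lemma l2_norm_eq_0:
  assumes "f \<in> L2 M"
  shows "l2_norm M f = 0 \<longleftrightarrow> (AE x in M. f x = 0)"
proof -
  have "l2_norm M f = 0 \<longleftrightarrow> (LINT x|M. (cmod (f x))\<^sup>2) = 0" by (simp add: l2_norm_def)
  also have "\<dots> \<longleftrightarrow> (AE x in M. (cmod (f x))\<^sup>2 = 0)"
    by (rule integral_nonneg_eq_0_iff_AE) (use assms in \<open>auto simp: L2_def\<close>)
  finally show ?thesis by simp
qed

lemma l2_norm_mono:
  assumes "g \<in> L2 M" "f \<in> borel_measurable M" "AE x in M. cmod (f x) \<le> C * cmod (g x)" "0 \<le> C"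
  shows "l2_norm M f \<le> C * l2_norm M g"
proof -
  have f: "f \<in> L2 M" using L2_bound assms by blast
  have "(l2_norm M f)\<^sup>2 \<le> (LINT x|M. C\<^sup>2 * (cmod (g x))\<^sup>2)"
    unfolding l2_norm_sq
  proof (rule integral_mono_AE)
    show "AE x in M. (cmod (f x))\<^sup>2 \<le> C\<^sup>2 * (cmod (g x))\<^sup>2"
      using assms(3)
    proof eventually_elim
      case (elim x)
      have "(cmod (f x))\<^sup>2 \<le> (C * cmod (g x))\<^sup>2" using elim by (intro power_mono) auto
      thus ?case by (simp add: power_mult_distrib)
    qed
  qed (use f assms(1) in \<open>auto simp: L2_def\<close>)
  also have "\<dots> = (C * l2_norm M g)\<^sup>2" by (simp add: power_mult_distrib l2_norm_sq)
  finally show ?thesis using assms(4) by (rule power2_le_imp_le[OF _ mult_nonneg_nonneg]) simp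
qed

lemma Cauchy_Schwarz_abs:
  assumes "f \<in> L2 M" "g \<in> L2 M"
  shows "(LINT x|M. cmod (f x) * cmod (g x)) \<le> l2_norm M f * l2_norm M g"
proof (cases "l2_norm M f = 0 \<or> l2_norm M g = 0")
  case True
  have [measurable]: "f \<in> borel_measurable M" "g \<in> borel_measurable M" using assms by (auto simp: L2_def)
  have "AE x in M. cmod (f x) * cmod (g x) = 0"
    using True l2_norm_eq_0[OF assms(1)] l2_norm_eq_0[OF assms(2)] by auto
  hence "(LINT x|M. cmod (f x) * cmod (g x)) = 0"
    by (rule integral_eq_zero_AE)
  thus ?thesis by simp
next
  case False
  define A B where "A = l2_norm M f" and "B = l2_norm M g"
  have AB: "A > 0" "B > 0" using False l2_norm_nonneg[of M f] l2_norm_nonneg[of M g]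
    unfolding A_def B_def by linarith+
  have i: "integrable M (\<lambda>x. (cmod (f x))\<^sup>2)" "integrable M (\<lambda>x. (cmod (g x))\<^sup>2)"
    using assms by (auto simp: L2_def)
  \<comment> \<open>The weights balance the two squares: each of them contributes A B / 2 after
    integration. They divide by both norms, hence the separate case of a vanishing norm.\<close>
  have "(LINT x|M. cmod (f x) * cmod (g x)) \<le> (LINT x|M. (B / (2*A)) * (cmod (f x))\<^sup>2 + (A / (2*B)) * (cmod (g x))\<^sup>2)"
  proof (rule integral_mono)
    show "integrable M (\<lambda>x. cmod (f x) * cmod (g x))"
      using integrable_norm[OF integrable_L2_mult[OF assms]] by (simp add: norm_mult)
    show "integrable M (\<lambda>x. (B / (2*A)) * (cmod (f x))\<^sup>2 + (A / (2*B)) * (cmod (g x))\<^sup>2)"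
      using i by simp
    fix x
    have "0 \<le> (B * cmod (f x) - A * cmod (g x))\<^sup>2" by simp
    hence "2 * A * B * (cmod (f x) * cmod (g x)) \<le> B\<^sup>2 * (cmod (f x))\<^sup>2 + A\<^sup>2 * (cmod (g x))\<^sup>2"
      by (simp add: power2_eq_square algebra_simps)
    thus "cmod (f x) * cmod (g x) \<le> (B / (2*A)) * (cmod (f x))\<^sup>2 + (A / (2*B)) * (cmod (g x))\<^sup>2"
      using AB by (simp add: field_simps power2_eq_square)
  qed
  also have "\<dots> = (B / (2*A)) * A\<^sup>2 + (A / (2*B)) * B\<^sup>2"
    using i by (simp add: A_def B_def l2_norm_sq)
  also have "\<dots> = A * B" using AB by (simp add: power2_eq_square field_simps)
  finally show ?thesis by (simp add: A_def B_def)
qed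

lemma Cauchy_Schwarz_mult:
  assumes "f \<in> L2 M" "g \<in> L2 M"
  shows "cmod (LINT x|M. f x * g x) \<le> l2_norm M f * l2_norm M g"
proof -
  have "cmod (LINT x|M. f x * g x) \<le> (LINT x|M. cmod (f x * g x))" by (rule integral_norm_bound)
  also have "\<dots> \<le> l2_norm M f * l2_norm M g"
    using Cauchy_Schwarz_abs[OF assms] by (simp add: norm_mult)
  finally show ?thesis .
qed

lemma l2_norm_cnj [simp]: "l2_norm M (\<lambda>x. cnj (f x)) = l2_norm M f"
  by (simp add: l2_norm_def)

lemma Cauchy_Schwarz_L2:
  assumes "f \<in> L2 M" "g \<in> L2 M"
  shows "cmod (l2_inner M f g) \<le> l2_norm M f * l2_norm M g"
  unfolding l2_inner_def using Cauchy_Schwarz_mult[OF assms(1) L2_cnj[OF assms(2)]] by simp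

lemma l2_norm_triangle:
  assumes "f \<in> L2 M" "g \<in> L2 M"
  shows "l2_norm M (\<lambda>x. f x + g x) \<le> l2_norm M f + l2_norm M g"
proof -
  have i: "integrable M (\<lambda>x. (cmod (f x))\<^sup>2)" "integrable M (\<lambda>x. (cmod (g x))\<^sup>2)"
    "integrable M (\<lambda>x. cmod (f x) * cmod (g x))"
    using assms integrable_norm[OF integrable_L2_mult[OF assms]] by (auto simp: L2_def norm_mult)
  have "(l2_norm M (\<lambda>x. f x + g x))\<^sup>2 \<le> (LINT x|M. (cmod (f x))\<^sup>2 + (cmod (g x))\<^sup>2 + 2 * (cmod (f x) * cmod (g x)))"
    unfolding l2_norm_sq
  proof (rule integral_mono)
    show "integrable M (\<lambda>x. (cmod (f x + g x))\<^sup>2)" using L2_add[OF assms] by (simp add: L2_def)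
    show "integrable M (\<lambda>x. (cmod (f x))\<^sup>2 + (cmod (g x))\<^sup>2 + 2 * (cmod (f x) * cmod (g x)))"
      using i by simp
    fix x
    have "(cmod (f x + g x))\<^sup>2 \<le> (cmod (f x) + cmod (g x))\<^sup>2"
      by (intro power_mono norm_triangle_ineq) auto
    thus "(cmod (f x + g x))\<^sup>2 \<le> (cmod (f x))\<^sup>2 + (cmod (g x))\<^sup>2 + 2 * (cmod (f x) * cmod (g x))"
      by (simp add: power2_sum)
  qed
  also have "\<dots> = (l2_norm M f)\<^sup>2 + (l2_norm M g)\<^sup>2 + 2 * (LINT x|M. cmod (f x) * cmod (g x))"
    using i by (simp add: l2_norm_sq)
  also have "\<dots> \<le> (l2_norm M f)\<^sup>2 + (l2_norm M g)\<^sup>2 + 2 * (l2_norm M f * l2_norm M g)"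
    using Cauchy_Schwarz_abs[OF assms] by simp
  also have "\<dots> = (l2_norm M f + l2_norm M g)\<^sup>2" by (simp add: power2_sum)
  finally show ?thesis by (rule power2_le_imp_le) simp
qed

lemma l2_norm_triangle_diff:
  assumes "f \<in> L2 M" "g \<in> L2 M"
  shows "l2_norm M (\<lambda>x. f x - g x) \<le> l2_norm M f + l2_norm M g"
  using l2_norm_triangle[OF assms(1) L2_uminus[OF assms(2)]] by (simp add: l2_norm_uminus)

lemma l2_norm_triangle_le:
  assumes "f \<in> L2 M" "g \<in> L2 M"
  shows "l2_norm M f \<le> l2_norm M (\<lambda>x. f x - g x) + l2_norm M g"
  using l2_norm_triangle[OF L2_diff[OF assms] assms(2)] by simp

lemma l2_norm_tendsto:
  assumes "\<And>n. F n \<in> L2 M" "f \<in> L2 M" "(\<lambda>n. l2_norm M (\<lambda>x. F n x - f x)) \<longlonglongrightarrow> 0"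
  shows "(\<lambda>n. l2_norm M (F n)) \<longlonglongrightarrow> l2_norm M f"
proof (rule LIM_zero_cancel, rule Lim_null_comparison[OF always_eventually assms(3)], rule allI)
  fix n
  show "norm (l2_norm M (F n) - l2_norm M f) \<le> l2_norm M (\<lambda>x. F n x - f x)"
    using l2_norm_triangle_le[OF assms(1)[of n] assms(2)] l2_norm_triangle_le[OF assms(2) assms(1)[of n]]
    by (simp add: abs_le_iff l2_norm_minus_commute[of M f])
qed

lemma l2_norm_sq_inner: "l2_inner M f f = of_real ((l2_norm M f)\<^sup>2)"
  unfolding l2_inner_def l2_norm_sq complex_norm_square[symmetric]
  using integral_complex_of_real[of M "\<lambda>x. (cmod (f x))\<^sup>2"] by simp

text \<open>Riesz-Fischer. Along a subsequence whose increments have norm at most 4^-k the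
  representatives converge almost everywhere, and Fatou's lemma shows that the pointwise limit is
  also the limit in norm.\<close>

lemma L2_complete:
  assumes F: "\<And>n. F n \<in> L2 M"
    and C: "\<And>e. e > 0 \<Longrightarrow> \<exists>N. \<forall>m\<ge>N. \<forall>n\<ge>N. l2_norm M (\<lambda>x. F m x - F n x) < e"
  shows "\<exists>f\<in>L2 M. (\<lambda>n. l2_norm M (\<lambda>x. F n x - f x)) \<longlonglongrightarrow> 0"
proof -
  have [measurable]: "F n \<in> borel_measurable M" for n using F by (auto simp: L2_def)
  define N where "N k = (SOME N. \<forall>m\<ge>N. \<forall>n\<ge>N. l2_norm M (\<lambda>x. F m x - F n x) < (1/4)^k)" for k
  have N: "l2_norm M (\<lambda>x. F m x - F n x) < (1/4)^k" if "m \<ge> N k" "n \<ge> N k" for m n k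
    using someI_ex[OF C[of "(1/4)^k"]] that unfolding N_def by auto
  \<comment> \<open>Summing the thresholds makes \<open>r\<close> monotone and at least
    \<open>N k\<close>; the added k makes it tend to infinity even if every threshold is 0.\<close>
  define r where "r k = (\<Sum>i\<le>k. N i) + k" for k
  have r: "r k \<ge> N k" for k
    unfolding r_def by (simp add: sum.atMost_Suc trans_le_add1 member_le_sum)
  have rmono: "r k \<le> r (Suc k)" for k by (simp add: r_def)
  have rk: "r k \<ge> k" for k by (simp add: r_def)
  define d where "d n x = F (r (Suc n)) x - F (r n) x" for n x
  have dL: "d n \<in> L2 M" for n unfolding d_def by (intro L2_diff F)
  have [measurable]: "d n \<in> borel_measurable M" for n using dL by (auto simp: L2_def)
  \<comment> \<open>Squared increments decay like 16^-n, which leaves room for the weight 4^n: the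
    weighted sum still has finite integral, and its finiteness at x bounds |d_n(x)| by a geometric
    sequence of ratio 1/2.\<close>
  have dn: "l2_norm M (d n) \<le> (1/4)^n" for n
    unfolding d_def using N[of n "r (Suc n)" "r n"] r[of n] rmono[of n] by force
  have "(\<integral>\<^sup>+x. (\<Sum>n. ennreal (4^n * (cmod (d n x))\<^sup>2)) \<partial>M) = (\<Sum>n. (\<integral>\<^sup>+x. ennreal (4^n * (cmod (d n x))\<^sup>2) \<partial>M))"
    by (rule nn_integral_suminf) simp
  also have "\<dots> \<le> (\<Sum>n. ennreal ((1/4)^n))"
  proof (rule suminf_le)
    fix n
    have "(\<integral>\<^sup>+x. ennreal (4^n * (cmod (d n x))\<^sup>2) \<partial>M) = (\<integral>\<^sup>+x. ennreal (4^n) * ennreal ((cmod (d n x))\<^sup>2) \<partial>M)"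
      by (simp add: ennreal_mult)
    also have "\<dots> = ennreal (4^n) * ennreal ((l2_norm M (d n))\<^sup>2)"
      by (subst nn_integral_cmult) (auto simp: nn_integral_L2[OF dL])
    also have "\<dots> = ennreal (4^n * (l2_norm M (d n))\<^sup>2)"
      by (simp add: ennreal_mult)
    also have "\<dots> \<le> ennreal (4^n * ((1/4)^n)\<^sup>2)"
      using dn[of n] by (intro ennreal_leI mult_left_mono power_mono) auto
    also have "4^n * ((1/4)^n)\<^sup>2 = (1/4::real)^n"
      by (simp add: power_mult_distrib power2_eq_square power_one_over field_simps)
    finally show "(\<integral>\<^sup>+x. ennreal (4^n * (cmod (d n x))\<^sup>2) \<partial>M) \<le> ennreal ((1/4)^n)" .
  qed auto
  also have "\<dots> = ennreal (\<Sum>n. (1/4)^n)"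
    by (rule suminf_ennreal2) auto
  also have "\<dots> < \<infinity>" by simp
  finally have "(\<integral>\<^sup>+x. (\<Sum>n. ennreal (4^n * (cmod (d n x))\<^sup>2)) \<partial>M) \<noteq> \<infinity>" by simp
  hence AE1: "AE x in M. (\<Sum>n. ennreal (4^n * (cmod (d n x))\<^sup>2)) \<noteq> \<infinity>"
    by (intro nn_integral_noteq_infinite) auto
  define f where "f x = lim (\<lambda>n. F (r n) x)" for x
  have [measurable]: "f \<in> borel_measurable M"
    unfolding f_def by (rule borel_measurable_lim_metric) simp
  have conv: "AE x in M. (\<lambda>n. F (r n) x) \<longlonglongrightarrow> f x"
    using AE1
  proof eventually_elim
    case (elim x)
    have "summable (\<lambda>n. 4^n * (cmod (d n x))\<^sup>2)"
      by (rule summable_suminf_not_top) (use elim in auto)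
    hence "Bseq (\<lambda>n. 4^n * (cmod (d n x))\<^sup>2)"
      by (intro convergent_imp_Bseq) (auto dest: summable_LIMSEQ_zero simp: convergent_def)
    then obtain K where K: "K > 0" "\<And>n. norm (4^n * (cmod (d n x))\<^sup>2) \<le> K" by (auto simp: Bseq_def)
    have "summable (\<lambda>n. d n x)"
    proof (rule summable_comparison_test')
      show "summable (\<lambda>n. sqrt K * (1/2)^n)" by (intro summable_mult summable_geometric) simp
      fix n
      have "(2^n * cmod (d n x))\<^sup>2 \<le> K"
      proof -
        have "(2^n * cmod (d n x))\<^sup>2 = 4^n * (cmod (d n x))\<^sup>2"
          by (simp add: power2_eq_square flip: power_mult_distrib)
        thus ?thesis using K(2)[of n] by simp
      qed
      hence "2^n * cmod (d n x) \<le> sqrt K" by (rule real_le_rsqrt)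
      thus "norm (d n x) \<le> sqrt K * (1/2)^n" by (simp add: power_one_over field_simps)
    qed
    hence "convergent (\<lambda>n. \<Sum>i<n. d i x)" by (simp add: summable_iff_convergent)
    moreover have "(\<Sum>i<n. d i x) = F (r n) x - F (r 0) x" for n
      unfolding d_def by (rule sum_lessThan_telescope)
    ultimately have "convergent (\<lambda>n. F (r n) x - F (r 0) x + F (r 0) x)"
      by (intro convergent_add convergent_const) simp
    thus ?case by (simp add: f_def convergent_LIMSEQ_iff)
  qed
  \<comment> \<open>Fatou in the second index, with m fixed: along \<open>r n\<close> the distances
    from \<open>F m\<close> are eventually at most 4^-k.\<close>
  have est: "(\<lambda>x. F m x - f x) \<in> L2 M \<and> l2_norm M (\<lambda>x. F m x - f x) \<le> (1/4)^k" if m: "m \<ge> N k" for m k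
  proof -
    have "(\<integral>\<^sup>+x. ennreal ((cmod (F m x - f x))\<^sup>2) \<partial>M) = (\<integral>\<^sup>+x. liminf (\<lambda>n. ennreal ((cmod (F m x - F (r n) x))\<^sup>2)) \<partial>M)"
    proof (rule nn_integral_cong_AE, use conv in eventually_elim)
      case (elim x)
      have "(\<lambda>n. ennreal ((cmod (F m x - F (r n) x))\<^sup>2)) \<longlonglongrightarrow> ennreal ((cmod (F m x - f x))\<^sup>2)"
        by (intro tendsto_ennrealI tendsto_intros elim)
      thus ?case by (rule lim_imp_Liminf[OF sequentially_bot, symmetric])
    qed
    also have "\<dots> \<le> liminf (\<lambda>n. (\<integral>\<^sup>+x. ennreal ((cmod (F m x - F (r n) x))\<^sup>2) \<partial>M))"
      by (rule nn_integral_liminf) simp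
    also have "\<dots> = liminf (\<lambda>n. ennreal ((l2_norm M (\<lambda>x. F m x - F (r n) x))\<^sup>2))"
      by (simp add: nn_integral_L2[OF L2_diff[OF F F]])
    also have "\<dots> \<le> ennreal (((1/4)^k)\<^sup>2)"
    proof (rule Liminf_le)
      have "eventually (\<lambda>n. n \<ge> N k) sequentially" by (rule eventually_ge_at_top)
      thus "\<forall>\<^sub>F n in sequentially. ennreal ((l2_norm M (\<lambda>x. F m x - F (r n) x))\<^sup>2) \<le> ennreal (((1/4)^k)\<^sup>2)"
      proof eventually_elim
        case (elim n)
        have "r n \<ge> N k" using rk[of n] elim by simp
        thus ?case using N[OF m, of "r n"] by (intro ennreal_leI power_mono) auto
      qed
    qed simp
    finally show ?thesis using l2_norm_le_nn[of "\<lambda>x. F m x - f x" M "(1/4)^k"] by auto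
  qed
  show ?thesis
  proof (rule bexI[of _ f])
    have "(\<lambda>x. F (N 0) x - (F (N 0) x - f x)) \<in> L2 M"
      by (rule L2_diff[OF F]) (use est[of 0 "N 0"] in auto)
    thus "f \<in> L2 M" by simp
    show "(\<lambda>n. l2_norm M (\<lambda>x. F n x - f x)) \<longlonglongrightarrow> 0"
    proof (rule LIMSEQ_I)
      fix e :: real assume "e > 0"
      then obtain k where k: "(1/4::real)^k < e" using real_arch_pow_inv[of e "1/4"] by auto
      show "\<exists>no. \<forall>n\<ge>no. norm (l2_norm M (\<lambda>x. F n x - f x) - 0) < e"
        using est[of k] k by (intro exI[of _ "N k"]) force
    qed
  qed
qed

section \<open>Test functions\<close>

definition smooth :: "(real \<Rightarrow> real) \<Rightarrow> bool" where
  "smooth f \<longleftrightarrow> (\<forall>n x. ((deriv ^^ n) f) field_differentiable (at x))"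

text \<open>By induction every n-th derivative stays in the class. This spares a formula for n-th
  derivatives: each function below is put into a class closed under differentiation.\<close>

lemma smooth_coinduct:
  assumes "f \<in> A" "\<And>g. g \<in> A \<Longrightarrow> \<exists>g'\<in>A. \<forall>x. (g has_real_derivative g' x) (at x)"
  shows "smooth f"
proof -
  have d: "deriv g \<in> A" if g: "g \<in> A" for g
  proof -
    obtain g' where g': "g' \<in> A" "\<forall>x. (g has_real_derivative g' x) (at x)" using assms(2)[OF g] by blast
    hence "deriv g = g'" by (auto intro!: ext DERIV_imp_deriv)
    thus ?thesis using g' by simp
  qed
  have "(deriv ^^ n) f \<in> A" for n by (induction n) (use assms(1) d in auto)
  thus ?thesis unfolding smooth_def field_differentiable_def using assms(2) by blast
qed

lemma smooth_deriv: "smooth f \<Longrightarrow> smooth (deriv f)"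
  unfolding smooth_def by (metis funpow_Suc_right comp_apply)

lemma smooth_DERIV: "smooth f \<Longrightarrow> (f has_real_derivative deriv f x) (at x)"
  unfolding smooth_def by (metis DERIV_deriv_iff_field_differentiable funpow_0)

lemma smooth_continuous_on: "smooth f \<Longrightarrow> continuous_on A f"
  by (meson DERIV_isCont continuous_at_imp_continuous_on smooth_DERIV)

lemma smoothI:
  assumes "\<And>x. (f has_real_derivative f' x) (at x)" "smooth f'"
  shows "smooth f"
proof (rule smooth_coinduct[of f "insert f {g. smooth g}"])
  fix g assume "g \<in> insert f {g. smooth g}"
  then consider "g = f" | "smooth g" by auto
  thus "\<exists>g'\<in>insert f {g. smooth g}. \<forall>x. (g has_real_derivative g' x) (at x)"
    using assms smooth_deriv smooth_DERIV by cases blast+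
qed simp

text \<open>Products alone are not closed under differentiation, but their finite sums are, by the
  Leibniz rule; this is the class that coinduction wants.\<close>

inductive_set prod_span :: "(real \<Rightarrow> real) set" where
  base: "smooth f \<Longrightarrow> smooth g \<Longrightarrow> (\<lambda>x. f x * g x) \<in> prod_span"
| add: "f \<in> prod_span \<Longrightarrow> g \<in> prod_span \<Longrightarrow> (\<lambda>x. f x + g x) \<in> prod_span"

lemma prod_span_smooth: "f \<in> prod_span \<Longrightarrow> smooth f"
proof (erule smooth_coinduct)
  fix g assume "g \<in> prod_span"
  thus "\<exists>g'\<in>prod_span. \<forall>x. (g has_real_derivative g' x) (at x)"
  proof induction
    case (base f g)
    have "(\<lambda>x. deriv f x * g x + f x * deriv g x) \<in> prod_span"
      using base smooth_deriv by (intro prod_span.intros)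
    moreover have "\<forall>x. ((\<lambda>x. f x * g x) has_real_derivative deriv f x * g x + f x * deriv g x) (at x)"
      using base by (auto intro!: derivative_eq_intros smooth_DERIV)
    ultimately show ?case by (intro bexI[of _ "\<lambda>x. deriv f x * g x + f x * deriv g x"]) auto
  next
    case (add f g)
    then obtain f' g' where "f' \<in> prod_span" "\<forall>x. (f has_real_derivative f' x) (at x)"
      "g' \<in> prod_span" "\<forall>x. (g has_real_derivative g' x) (at x)" by blast
    thus ?case
      by (intro bexI[of _ "\<lambda>x. f' x + g' x"]) (auto intro!: derivative_eq_intros prod_span.add)
  qed
qed

lemma smooth_mult: "smooth f \<Longrightarrow> smooth g \<Longrightarrow> smooth (\<lambda>x. f x * g x)"
  by (rule prod_span_smooth[OF prod_span.base])

lemma smooth_const: "smooth (\<lambda>x. c)"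
  by (rule smooth_coinduct[of _ "range (\<lambda>c x. c)"]) (auto intro!: derivative_eq_intros)

lemma smooth_add:
  assumes "smooth f" "smooth g"
  shows "smooth (\<lambda>x. f x + g x)"
  \<comment> \<open>A summand enters the class as its product with the constant 1.\<close>
  using prod_span_smooth[OF prod_span.add[OF prod_span.base[OF smooth_const[of 1] assms(1)]
      prod_span.base[OF smooth_const[of 1] assms(2)]]] by simp

lemma smooth_affine:
  assumes "smooth f"
  shows "smooth (\<lambda>x. f (c * x + d))"
\<comment> \<open>The factor k absorbs the inner derivative c of the chain rule.\<close>
proof (rule smooth_coinduct[of _ "{\<lambda>x. k * g (c * x + d) |k g. smooth g}"])
  show "(\<lambda>x. f (c * x + d)) \<in> {\<lambda>x. k * g (c * x + d) |k g. smooth g}"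
    using assms by (intro CollectI exI[of _ "1::real"] exI[of _ f]) auto
  fix h assume "h \<in> {\<lambda>x. k * g (c * x + d) |k g. smooth g}"
  then obtain k g where h: "h = (\<lambda>x. k * g (c * x + d))" "smooth g" by blast
  have "(h has_real_derivative (k * c) * deriv g (c * x + d)) (at x)" for x
    unfolding h by (auto intro!: derivative_eq_intros DERIV_chain2[OF smooth_DERIV[OF h(2)]])
  moreover have "(\<lambda>x. (k * c) * deriv g (c * x + d)) \<in> {\<lambda>x. k * g (c * x + d) |k g. smooth g}"
    using smooth_deriv[OF h(2)] by blast
  ultimately show "\<exists>g'\<in>{\<lambda>x. k * g (c * x + d) |k g. smooth g}. \<forall>x. (h has_real_derivative g' x) (at x)"
    by (intro bexI[of _ "\<lambda>x. (k * c) * deriv g (c * x + d)"]) auto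
qed

section \<open>Flat functions and compactly supported bumps\<close>

definition flat_exp :: "real poly \<Rightarrow> real \<Rightarrow> real" where
  "flat_exp p x = (if x > 0 then poly p (1 / x) * exp (- 1 / x) else 0)"

lemma poly_exp_tendsto_0: "((\<lambda>t. poly p t * exp (- t)) \<longlongrightarrow> (0::real)) at_top"
proof -
  have "((\<lambda>t. \<Sum>i\<le>degree p. coeff p i * (t ^ i / exp t)) \<longlongrightarrow> (\<Sum>i\<le>degree p. coeff p i * 0)) at_top"
    by (intro tendsto_intros tendsto_power_div_exp_0)
  thus ?thesis by (simp add: poly_altdef sum_distrib_right sum_divide_distrib exp_minus field_simps)
qed

text \<open>The polynomial factor is there to close the family under differentiation: with t = 1/x
  and dt/dx = -t^2, the derivative of p(t) exp(-t) is t^2 (p(t) - p'(t)) exp(-t). At 0 the right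
  difference quotient is t p(t) exp(-t), which tends to 0 as t grows.\<close>

lemma flat_exp_DERIV:
  "(flat_exp p has_real_derivative flat_exp (monom 1 2 * (p - pderiv p)) x) (at x)"
proof -
  consider "x > 0" | "x < 0" | "x = 0" by linarith
  thus ?thesis
  proof cases
    case 1
    have i: "((\<lambda>x. 1 / x) has_real_derivative - ((1 / x) ^ 2)) (at x)"
      using 1 by (auto intro!: derivative_eq_intros simp: power2_eq_square)
    have i': "((\<lambda>x. - 1 / x) has_real_derivative (1 / x) ^ 2) (at x)"
      using DERIV_minus[OF i] by simp
    have "((\<lambda>x. poly p (1 / x) * exp (- 1 / x)) has_real_derivative
       (poly (pderiv p) (1 / x) * (- ((1 / x) ^ 2))) * exp (- 1 / x) + (exp (- 1 / x) * (1 / x) ^ 2) * poly p (1 / x)) (at x)"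
      by (rule DERIV_mult[OF DERIV_chain2[OF poly_DERIV i] DERIV_chain2[OF DERIV_exp i']])
    also have "(poly (pderiv p) (1 / x) * (- ((1 / x) ^ 2))) * exp (- 1 / x) + (exp (- 1 / x) * (1 / x) ^ 2) * poly p (1 / x) =
        flat_exp (monom 1 2 * (p - pderiv p)) x"
      using 1 by (simp add: flat_exp_def poly_monom right_diff_distrib mult_ac power_one_over)
    finally have "((\<lambda>x. poly p (1 / x) * exp (- 1 / x)) has_real_derivative
       flat_exp (monom 1 2 * (p - pderiv p)) x) (at x)" .
    moreover have "\<forall>\<^sub>F y in nhds x. poly p (1 / y) * exp (- 1 / y) = flat_exp p y"
      using eventually_nhds_in_open[of "{0<..}" x] 1 by (auto simp: flat_exp_def elim!: eventually_mono)
    ultimately show ?thesis by (simp only: DERIV_cong_ev[OF refl _ refl])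
  next
    case 2
    have "((\<lambda>x. 0) has_real_derivative flat_exp (monom 1 2 * (p - pderiv p)) x) (at x)"
      using 2 by (auto simp: flat_exp_def)
    moreover have "\<forall>\<^sub>F y in nhds x. 0 = flat_exp p y"
      using eventually_nhds_in_open[of "{..<0}" x] 2 by (auto simp: flat_exp_def elim!: eventually_mono)
    ultimately show ?thesis by (simp only: DERIV_cong_ev[OF refl _ refl])
  next
    case 3
    have "((\<lambda>h. flat_exp p h / h) \<longlongrightarrow> 0) (at 0)"
      proof (rule filterlim_split_at)
      have "\<forall>\<^sub>F h in at_left 0. 0 = flat_exp p h / h"
        by (auto simp: eventually_at_filter flat_exp_def)
      thus "((\<lambda>h. flat_exp p h / h) \<longlongrightarrow> 0) (at_left 0)"
        by (rule Lim_transform_eventually[OF tendsto_const])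
      have "((\<lambda>h. poly (pCons 0 p) (inverse h) * exp (- inverse h)) \<longlongrightarrow> 0) (at_right 0)"
        by (rule filterlim_compose[OF poly_exp_tendsto_0 filterlim_inverse_at_top_right])
      moreover have "\<forall>\<^sub>F h in at_right 0. poly (pCons 0 p) (inverse h) * exp (- inverse h) = flat_exp p h / h"
        by (auto simp: eventually_at_filter flat_exp_def field_simps)
      ultimately show "((\<lambda>h. flat_exp p h / h) \<longlongrightarrow> 0) (at_right 0)"
        by (rule Lim_transform_eventually)
    qed
    thus ?thesis using 3 by (simp add: DERIV_def flat_exp_def)
  qed
qed

lemma smooth_flat_exp: "smooth (flat_exp p)"
  by (rule smooth_coinduct[of _ "range flat_exp"]) (use flat_exp_DERIV in blast)+

text \<open>For \<open>c \<rightarrow> \<infinity>\<close> these bumps increase to the indicator function of the interval.\<close>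

definition bump :: "real \<Rightarrow> real \<Rightarrow> real \<Rightarrow> real \<Rightarrow> real" where
  "bump p q c x = flat_exp 1 (c * (x - p)) * flat_exp 1 (c * (q - x))"

lemma smooth_bump: "smooth (bump p q c)"
proof -
  have "smooth (\<lambda>x. flat_exp 1 (c * x + - c * p) * flat_exp 1 (- c * x + c * q))"
    by (intro smooth_mult smooth_affine smooth_flat_exp)
  thus ?thesis by (simp add: bump_def[abs_def] algebra_simps)
qed

lemma bump_nonneg: "0 \<le> bump p q c x"
  by (simp add: bump_def flat_exp_def)

lemma bump_le_1: "bump p q c x \<le> 1"
  unfolding bump_def by (intro mult_le_one) (auto simp: flat_exp_def)

lemma bump_zero: "c > 0 \<Longrightarrow> x \<notin> {p<..<q} \<Longrightarrow> bump p q c x = 0"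
  by (auto simp: bump_def flat_exp_def zero_less_mult_iff)

lemma bump_pos: "c > 0 \<Longrightarrow> x \<in> {p<..<q} \<Longrightarrow> bump p q c x > 0"
  by (auto simp: bump_def flat_exp_def zero_less_mult_iff)

lemma bump_tendsto:
  assumes "x \<in> {p<..<q}"
  shows "(\<lambda>n. bump p q (real (Suc n)) x) \<longlonglongrightarrow> 1"
proof -
  have "(\<lambda>n. exp (- (1 / real (Suc n)) * (1 / (x - p))) * exp (- (1 / real (Suc n)) * (1 / (q - x)))) \<longlonglongrightarrow>
     exp (- 0 * (1 / (x - p))) * exp (- 0 * (1 / (q - x)))"
    by (intro tendsto_intros LIMSEQ_Suc[OF lim_1_over_n])
  moreover have "bump p q (real (Suc n)) x = exp (- (1 / real (Suc n)) * (1 / (x - p))) * exp (- (1 / real (Suc n)) * (1 / (q - x)))" for n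
  proof -
    have "real (Suc n) * (x - p) > 0" "real (Suc n) * (q - x) > 0" using assms by auto
    thus ?thesis by (simp add: bump_def flat_exp_def del: of_nat_Suc)
  qed
  ultimately show ?thesis by simp
qed

lemma test_fun_iff: "test_fun S \<phi> \<longleftrightarrow> smooth \<phi> \<and> (\<exists>K. compact K \<and> K \<subseteq> S \<and> (\<forall>x. x \<notin> K \<longrightarrow> \<phi> x = 0))"
  by (simp add: test_fun_def smooth_def)

section \<open>Open intervals and the lemma of du Bois-Reymond\<close>

definition interval_open :: "real set \<Rightarrow> bool" where
  "interval_open S \<longleftrightarrow> open S \<and> is_interval S \<and> S \<noteq> {}"

lemma interval_open_UNIV [simp]: "interval_open UNIV"
  by (simp add: interval_open_def)

lemma interval_open_Ioo [simp]: "p < q \<Longrightarrow> interval_open {p<..<q}"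
  by (simp add: interval_open_def is_interval_oo)

lemma interval_open_Icc_subset:
  assumes "interval_open S" "p \<in> S" "q \<in> S"
  shows "{p..q} \<subseteq> S"
  using assms unfolding interval_open_def is_interval_1 by fastforce

lemma interval_open_sets [measurable]: "interval_open S \<Longrightarrow> S \<in> sets borel"
  by (auto simp: interval_open_def)

text \<open>The hull of the support is enlarged on both sides by half the radius of a ball inside S.
  This leaves room for phi and phi' to vanish at p and q themselves, so that no boundary terms arise
  later.\<close>

lemma test_fun_supp:
  assumes S: "interval_open S" and "test_fun S \<phi>"
  obtains p q where "p < q" "{p..q} \<subseteq> S" "\<And>x. x \<notin> {p<..<q} \<Longrightarrow> \<phi> x = 0" "\<And>x. x \<notin> {p<..<q} \<Longrightarrow> deriv \<phi> x = 0"
proof -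
  obtain K where K: "compact K" "K \<subseteq> S" "\<And>x. x \<notin> K \<Longrightarrow> \<phi> x = 0" using assms(2) by (auto simp: test_fun_iff)
  obtain x0 where x0: "x0 \<in> S" using S by (auto simp: interval_open_def)
  \<comment> \<open>The extra point keeps the compact set nonempty when phi vanishes identically and
    K is empty.\<close>
  define K' where "K' = insert x0 K"
  have K': "compact K'" "K' \<subseteq> S" "K' \<noteq> {}" using K x0 by (auto simp: K'_def)
  obtain m where m: "m \<in> K'" "\<And>x. x \<in> K' \<Longrightarrow> m \<le> x" using compact_attains_inf[of K'] K' by blast
  obtain M where M: "M \<in> K'" "\<And>x. x \<in> K' \<Longrightarrow> x \<le> M" using compact_attains_sup[of K'] K' by blast
  have "open S" using S by (simp add: interval_open_def)
  obtain e1 where e1: "e1 > 0" "ball m e1 \<subseteq> S" using \<open>open S\<close> m(1) K'(2) openE by blast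
  obtain e2 where e2: "e2 > 0" "ball M e2 \<subseteq> S" using \<open>open S\<close> M(1) K'(2) openE by blast
  define p q where "p = m - e1/2" and "q = M + e2/2"
  have "p \<in> ball m e1" "q \<in> ball M e2" using e1(1) e2(1) by (auto simp: p_def q_def dist_real_def)
  hence pq: "p \<in> S" "q \<in> S" using e1 e2 by auto
  have lt: "p < m" "M < q" "m \<le> M" using e1 e2 m M by (auto simp: p_def q_def)
  have z: "\<phi> x = 0" if "x \<notin> {m..M}" for x using that K(3)[of x] m M by (auto simp: K'_def)
  have z': "deriv \<phi> x = 0" if "x \<notin> {m..M}" for x
  proof -
    have "x \<in> - {m..M}" "open (- {m..M})" using that by auto
    hence "\<forall>\<^sub>F y in nhds x. \<phi> y = 0" using eventually_nhds_in_open[of "- {m..M}" x] z by (auto elim!: eventually_mono)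
    hence "deriv \<phi> x = deriv (\<lambda>x. 0) x" by (intro deriv_cong_ev) auto
    thus ?thesis by simp
  qed
  show thesis
    by (rule that[of p q]) (use lt z z' interval_open_Icc_subset[OF S pq] in auto)
qed

text \<open>The setting of the lemma of du Bois-Reymond. Primitives of L2 functions on the line need
  not be in L2, but they are locally integrable.\<close>

definition loc_integrable :: "real set \<Rightarrow> (real \<Rightarrow> complex) \<Rightarrow> bool" where
  "loc_integrable S f \<longleftrightarrow> (\<forall>p q. {p..q} \<subseteq> S \<longrightarrow> set_integrable lborel {p..q} f)"

lemma integral_meas_on_supp:
  fixes p q :: real and f :: "real \<Rightarrow> complex"
  assumes S: "S \<in> sets borel" and "{p..q} \<subseteq> S" and z: "\<And>x. x \<notin> {p<..<q} \<Longrightarrow> \<phi> x = 0"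
  shows "(LINT x|meas_on S. f x * complex_of_real (\<phi> x)) = (LINT x:{p..q}|lborel. f x * complex_of_real (\<phi> x))"
proof -
  have "(LINT x|meas_on S. f x * complex_of_real (\<phi> x)) = (LINT x:S|lborel. f x * complex_of_real (\<phi> x))"
    unfolding meas_on_def set_lebesgue_integral_def using S by (subst integral_restrict_space) auto
  also have "\<dots> = (LINT x:{p..q}|lborel. f x * complex_of_real (\<phi> x))"
    unfolding set_lebesgue_integral_def
  proof (rule Bochner_Integration.integral_cong[OF refl])
    fix x show "indicat_real S x *\<^sub>R (f x * complex_of_real (\<phi> x)) = indicat_real {p..q} x *\<^sub>R (f x * complex_of_real (\<phi> x))"
    proof (cases "x \<in> {p..q}")
      case False
      hence "x \<notin> {p<..<q}" by auto
      from z[OF this] show ?thesis by simp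
    qed (use assms(2) in \<open>auto simp: indicator_def\<close>)
  qed
  finally show ?thesis .
qed

lemma bump_integral_tendsto:
  fixes f :: "real \<Rightarrow> complex"
  assumes "set_integrable lborel {P..Q} f" "{p..q} \<subseteq> {P..Q}"
  shows "(\<lambda>n. LINT x:{P..Q}|lborel. f x * complex_of_real (bump p q (real (Suc n)) x)) \<longlonglongrightarrow> (LINT x:{p..q}|lborel. f x)"
  unfolding set_lebesgue_integral_def
proof (rule integral_dominated_convergence[where w = "\<lambda>x. norm (indicator {P..Q} x *\<^sub>R f x)"])
  have [measurable]: "(\<lambda>x. indicator {P..Q} x *\<^sub>R f x) \<in> borel_measurable borel"
    using assms(1) unfolding set_integrable_def by (simp add: integrable_iff_bounded)
  have [measurable]: "bump p q c \<in> borel_measurable borel" for c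
    by (intro borel_measurable_continuous_onI smooth_continuous_on smooth_bump)
  have eq: "(\<lambda>x. indicator {p..q} x *\<^sub>R (indicator {P..Q} x *\<^sub>R f x)) = (\<lambda>x. indicator {p..q} x *\<^sub>R f x)"
    using assms(2) by (auto simp: fun_eq_iff indicator_def)
  have "(\<lambda>x. indicator {p..q} x *\<^sub>R (indicator {P..Q} x *\<^sub>R f x)) \<in> borel_measurable lborel"
    by measurable
  thus "(\<lambda>x. indicator {p..q} x *\<^sub>R f x) \<in> borel_measurable lborel" by (simp only: eq)
  have "(\<lambda>x. (indicator {P..Q} x *\<^sub>R f x) * complex_of_real (bump p q (real (Suc n)) x)) \<in> borel_measurable lborel" for n
    by measurable
  thus "(\<lambda>x. indicator {P..Q} x *\<^sub>R (f x * complex_of_real (bump p q (real (Suc n)) x))) \<in> borel_measurable lborel" for n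
    by (simp only: mult_scaleR_left)
  show "integrable lborel (\<lambda>x. norm (indicator {P..Q} x *\<^sub>R f x))"
    using assms(1) unfolding set_integrable_def by (rule integrable_norm)
  \<comment> \<open>At the end points the bumps vanish for every n, whereas the indicator of the
    closed interval is 1 there; two points form a null set.\<close>
  have "AE x in lborel. x \<noteq> p" "AE x in lborel. x \<noteq> q" by (rule AE_lborel_singleton)+
  thus "AE x in lborel. (\<lambda>n. indicator {P..Q} x *\<^sub>R (f x * complex_of_real (bump p q (real (Suc n)) x))) \<longlonglongrightarrow> indicator {p..q} x *\<^sub>R f x"
  proof eventually_elim
    case (elim x)
    show ?case
    proof (cases "x \<in> {p<..<q}")
      case True
      hence "x \<in> {P..Q}" using assms(2) by auto
      moreover have "(\<lambda>n. f x * complex_of_real (bump p q (real (Suc n)) x)) \<longlonglongrightarrow> f x * complex_of_real 1"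
        by (intro tendsto_intros bump_tendsto[OF True])
      ultimately show ?thesis using True by simp
    next
      case False
      hence "x \<notin> {p..q}" using elim by auto
      thus ?thesis using bump_zero[of _ x p q] False by simp
    qed
  qed
  show "AE x in lborel. norm (indicator {P..Q} x *\<^sub>R (f x * complex_of_real (bump p q (real (Suc n)) x))) \<le> norm (indicator {P..Q} x *\<^sub>R f x)" for n
    using bump_le_1 bump_nonneg by (auto simp: norm_mult indicator_def intro!: mult_left_le)
qed

text \<open>Sets over which v integrates to 0 form a Dynkin system: the total integral handles
  complements, countable additivity handles disjoint unions. Intervals generate the Borel sets, so v
  has integral 0 over all of them.\<close>

lemma integrable_zero_AE_of_intervals:
  fixes v :: "real \<Rightarrow> complex"
  assumes v: "integrable lborel v" and z: "\<And>p q. p \<le> q \<Longrightarrow> (LINT x:{p..q}|lborel. v x) = 0"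
    and z0: "(LINT x|lborel. v x) = 0"
  shows "AE x in lborel. v x = 0"
proof (rule sigma_finite_measure.density_zero[OF sigma_finite_lborel v])
  fix A :: "real set" assume "A \<in> sets lborel"
  hence "A \<in> sets borel" by simp
  have si: "set_integrable lborel B v" if "B \<in> sets borel" for B
    unfolding set_integrable_def by (rule integrable_mult_indicator) (use that v in auto)
  show "(LINT x:A|lborel. v x) = 0"
    using \<open>A \<in> sets borel\<close>
  proof (induction rule: borel_set_induct)
    case (compl A)
    have "(LINT x:A \<union> (-A)|lborel. v x) = (LINT x:A|lborel. v x) + (LINT x:-A|lborel. v x)"
      by (rule set_integral_Un) (use compl si in auto)
    thus ?case using compl z0 by (simp add: set_lebesgue_integral_def)
  next
    case (union f)
    have "(LINT x:(\<Union>i. f i)|lborel. v x) = (\<Sum>i. (LINT x:f i|lborel. v x))"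
      by (rule lebesgue_integral_countable_add) (use union si in \<open>auto simp: disjoint_family_on_def\<close>)
    thus ?case using union by simp
  qed (use z in \<open>auto simp: set_lebesgue_integral_def\<close>)
qed

lemma loc_zero_AE:
  assumes S: "interval_open S" and u: "loc_integrable S u"
    and z: "\<And>p q. p \<le> q \<Longrightarrow> {p..q} \<subseteq> S \<Longrightarrow> (LINT x:{p..q}|lborel. u x) = 0"
  shows "AE x in lborel. x \<in> S \<longrightarrow> u x = 0"
proof -
  have *: "AE x in lborel. x \<in> {p..q} \<longrightarrow> u x = 0" if pq: "{p..q} \<subseteq> S" for p q
  proof -
    have "AE x in lborel. indicator {p..q} x *\<^sub>R u x = 0"
    proof (rule integrable_zero_AE_of_intervals)
      show "integrable lborel (\<lambda>x. indicator {p..q} x *\<^sub>R u x)"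
        using u pq unfolding loc_integrable_def set_integrable_def by blast
      fix p' q' :: real
      have "(\<lambda>x. indicator {p'..q'} x *\<^sub>R indicator {p..q} x *\<^sub>R u x) = (\<lambda>x. indicator {max p p'..min q q'} x *\<^sub>R u x)"
        by (auto simp: fun_eq_iff indicator_def)
      moreover have "(LINT x:{max p p'..min q q'}|lborel. u x) = 0"
      proof (cases "max p p' \<le> min q q'")
        case True
        thus ?thesis using pq by (intro z) (auto intro: order_trans)
      qed (simp add: set_lebesgue_integral_def)
      ultimately show "(LINT x:{p'..q'}|lborel. indicator {p..q} x *\<^sub>R u x) = 0"
        by (simp add: set_lebesgue_integral_def)
    next
      show "(LINT x|lborel. indicator {p..q} x *\<^sub>R u x) = 0"
        using z[of p q] pq by (cases "p \<le> q") (auto simp: set_lebesgue_integral_def)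
    qed
    thus ?thesis by (auto elim!: eventually_mono simp: indicator_def)
  qed
  \<comment> \<open>Intervals with rational end points suffice to reach every point of S, and there
    are only countably many exceptional null sets to unite.\<close>
  have "AE x in lborel. \<forall>p\<in>\<rat>. \<forall>q\<in>\<rat>. {p..q} \<subseteq> S \<longrightarrow> x \<in> {p..q} \<longrightarrow> u x = 0"
    by (intro AE_ball_countable[THEN iffD2] ballI countable_rat AE_impI *)
  thus ?thesis
  proof eventually_elim
    case (elim x)
    show ?case
    proof
      assume x: "x \<in> S"
      have "open S" using S by (simp add: interval_open_def)
      then obtain e where e: "e > 0" "ball x e \<subseteq> S" using x openE by blast
      obtain p where p: "p \<in> \<rat>" "x - e < p" "p < x" using Rats_dense_in_real[of "x - e" x] e by auto
      obtain q where q: "q \<in> \<rat>" "x < q" "q < x + e" using Rats_dense_in_real[of x "x + e"] e by auto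
      have "p \<in> ball x e" "q \<in> ball x e" using p q by (auto simp: dist_real_def)
      hence "p \<in> S" "q \<in> S" using e by auto
      hence "{p..q} \<subseteq> S" by (rule interval_open_Icc_subset[OF S])
      thus "u x = 0" using elim p q by auto
    qed
  qed
qed

text \<open>A primitive of g is constant on each side of [p, q]. Vanishing of the integral makes the
  two constants equal, and subtracting this constant leaves a function supported in [p, q].\<close>

lemma test_fun_primitive:
  assumes g: "smooth g" and pq: "p \<le> q" and z: "\<And>x. x \<notin> {p<..<q} \<Longrightarrow> g x = 0"
    and I: "(LINT x:{p..q}|lborel. g x) = 0" and S: "{p..q} \<subseteq> S"
  obtains \<phi> where "test_fun S \<phi>" "deriv \<phi> = g"
proof -
  have "isCont g x" for x using g DERIV_isCont smooth_DERIV by blast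
  then obtain G where G: "\<And>x. (G has_vector_derivative g x) (at x)"
    using einterval_antiderivative[of "-\<infinity>" \<infinity> g] by auto
  have fund: "(LINT x:{s..t}|lborel. g x) = G t - G s" if "s \<le> t" for s t
    unfolding set_lebesgue_integral_def
    by (rule integral_FTC_atLeastAtMost)
      (use that G smooth_continuous_on[OF g] in \<open>auto intro: has_vector_derivative_at_within\<close>)
  have c1: "G x = G p" if "x \<le> p" for x
  proof -
    have "(LINT y:{x..p}|lborel. g y) = 0"
      unfolding set_lebesgue_integral_def
      by (rule integral_eq_zero_AE) (use z in \<open>auto simp: indicator_def\<close>)
    thus ?thesis using fund[OF that] by simp
  qed
  have c2: "G x = G q" if "q \<le> x" for x
  proof -
    have "(LINT y:{q..x}|lborel. g y) = 0"
      unfolding set_lebesgue_integral_def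
      by (rule integral_eq_zero_AE) (use z in \<open>auto simp: indicator_def\<close>)
    thus ?thesis using fund[OF that] by simp
  qed
  have Gpq: "G q = G p" using fund[OF pq] I by simp
  define \<phi> where "\<phi> x = G x - G p" for x
  have D: "(\<phi> has_real_derivative g x) (at x)" for x
    using G[of x] unfolding \<phi>_def has_real_derivative_iff_has_vector_derivative
    by (auto intro!: derivative_eq_intros)
  have "smooth \<phi>" by (rule smoothI[OF D g])
  moreover have "\<phi> x = 0" if "x \<notin> {p..q}" for x using that c1[of x] c2[of x] Gpq by (auto simp: \<phi>_def)
  ultimately have "test_fun S \<phi>" unfolding test_fun_iff using S by (intro conjI exI[of _ "{p..q}"]) auto
  moreover have "deriv \<phi> = g" using D by (auto intro!: ext DERIV_imp_deriv)
  ultimately show thesis using that by blast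
qed

text \<open>The lemma of du Bois-Reymond: test functions whose derivative approximates a difference of two
  normalised indicator functions show that all means of \<open>u\<close> over intervals agree.\<close>

lemma du_Bois_Reymond:
  assumes S: "interval_open S" and u: "loc_integrable S u"
    and w: "\<And>\<phi>. test_fun S \<phi> \<Longrightarrow> (LINT x|meas_on S. u x * complex_of_real (deriv \<phi> x)) = 0"
  obtains c where "AE x in lborel. x \<in> S \<longrightarrow> u x = c"
proof -
  have means: "(LINT x:{p..q}|lborel. u x) * (q' - p') = (LINT x:{p'..q'}|lborel. u x) * (q - p)"
    if pq: "p \<le> q" "{p..q} \<subseteq> S" and pq': "p' \<le> q'" "{p'..q'} \<subseteq> S" for p q p' q'
  proof -
    define P Q where "P = min p p'" and "Q = max q q'"
    have PQS: "P \<in> S" "Q \<in> S" using pq pq' by (auto simp: P_def Q_def min_def max_def)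
    have sub: "{P..Q} \<subseteq> S" "P \<le> Q" "{p..q} \<subseteq> {P..Q}" "{p'..q'} \<subseteq> {P..Q}"
      using interval_open_Icc_subset[OF S PQS] pq pq' by (auto simp: P_def Q_def)
    have sub2: "{p<..<q} \<subseteq> {P<..<Q}" "{p'<..<q'} \<subseteq> {P<..<Q}" by (auto simp: P_def Q_def)
    define b b' where "b n = bump p q (real (Suc n))" and "b' n = bump p' q' (real (Suc n))" for n
    define I where "I f = (LINT x:{P..Q}|lborel. f x)" for f :: "real \<Rightarrow> real"
    define U where "U f = (LINT x:{P..Q}|lborel. u x * complex_of_real (f x))" for f :: "real \<Rightarrow> real"
    have uI: "set_integrable lborel {P..Q} u" using u sub unfolding loc_integrable_def by blast
    have uUi: "set_integrable lborel {P..Q} (\<lambda>x. u x * complex_of_real (f x))" if "smooth f" "\<And>x. \<bar>f x\<bar> \<le> 1" for f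
      unfolding set_integrable_def
    proof (rule Bochner_Integration.integrable_bound)
      show "integrable lborel (\<lambda>x. indicator {P..Q} x *\<^sub>R u x)" using uI by (simp add: set_integrable_def)
      hence [measurable]: "(\<lambda>x. indicator {P..Q} x *\<^sub>R u x) \<in> borel_measurable borel"
        by (simp add: integrable_iff_bounded)
      have [measurable]: "f \<in> borel_measurable borel"
        by (intro borel_measurable_continuous_onI smooth_continuous_on that)
      have "(\<lambda>x. (indicator {P..Q} x *\<^sub>R u x) * complex_of_real (f x)) \<in> borel_measurable lborel"
        by measurable
      thus "(\<lambda>x. indicator {P..Q} x *\<^sub>R (u x * complex_of_real (f x))) \<in> borel_measurable lborel"
        by (simp only: mult_scaleR_left)
      show "AE x in lborel. norm (indicator {P..Q} x *\<^sub>R (u x * complex_of_real (f x))) \<le> norm (indicator {P..Q} x *\<^sub>R u x)"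
        using that(2) by (auto simp: norm_mult indicator_def intro!: mult_left_le)
    qed
    have sm: "smooth (b n)" "smooth (b' n)" for n by (auto simp: b_def b'_def smooth_bump)
    have bd: "\<bar>b n x\<bar> \<le> 1" "\<bar>b' n x\<bar> \<le> 1" for n x
      by (auto simp: b_def b'_def bump_nonneg bump_le_1 simp del: of_nat_Suc)
    have fI: "set_integrable lborel {P..Q} (b n)" "set_integrable lborel {P..Q} (b' n)" for n
      by (intro borel_integrable_atLeastAtMost' smooth_continuous_on sm)+
    have key: "U (b n) * I (b' n) = U (b' n) * I (b n)" for n
    proof -
      \<comment> \<open>The coefficients are chosen to cancel the integrals of the two bumps, so g
        is the derivative of a test function and u pairs to 0 with it.\<close>
      define g where "g x = I (b' n) * b n x + (- I (b n)) * b' n x" for x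
      have "smooth g" unfolding g_def by (intro smooth_add smooth_mult smooth_const sm)
      moreover have "g x = 0" if "x \<notin> {P<..<Q}" for x
      proof -
        have "x \<notin> {p<..<q}" "x \<notin> {p'<..<q'}" using that sub2 by blast+
        thus ?thesis unfolding g_def b_def b'_def by (simp add: bump_zero del: of_nat_Suc)
      qed
      moreover have "(LINT x:{P..Q}|lborel. g x) = 0"
      proof -
        have "(LINT x:{P..Q}|lborel. g x) = I (b' n) * (LINT x:{P..Q}|lborel. b n x) + (- I (b n)) * (LINT x:{P..Q}|lborel. b' n x)"
          unfolding g_def set_integral_mult_right[symmetric]
          by (intro set_integral_add(2) set_integrable_mult_right fI)
        thus ?thesis by (simp add: I_def)
      qed
      ultimately obtain \<phi> where \<phi>: "test_fun S \<phi>" "deriv \<phi> = g"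
        using test_fun_primitive[of g P Q S] sub by blast
      have "0 = (LINT x:{P..Q}|lborel. u x * complex_of_real (g x))"
        using w[OF \<phi>(1)] integral_meas_on_supp[of S P Q g u] \<phi>(2) sub S
          \<open>\<And>x. x \<notin> {P<..<Q} \<Longrightarrow> g x = 0\<close> by (simp add: interval_open_sets)
      also have "\<dots> = (LINT x:{P..Q}|lborel. of_real (I (b' n)) * (u x * complex_of_real (b n x)) + of_real (- I (b n)) * (u x * complex_of_real (b' n x)))"
        by (simp add: g_def algebra_simps)
      also have "\<dots> = of_real (I (b' n)) * U (b n) + of_real (- I (b n)) * U (b' n)"
        unfolding U_def set_integral_mult_right[symmetric]
        by (intro set_integral_add(2) set_integrable_mult_right uUi sm bd)
      finally show ?thesis by (simp add: algebra_simps)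
    qed
    have Ib: "(\<lambda>n. complex_of_real (I (bump p q (real (Suc n))))) \<longlonglongrightarrow> of_real (q - p)"
      if "p \<le> q" "{p..q} \<subseteq> {P..Q}" for p q
    proof -
      have "(\<lambda>n. LINT x:{P..Q}|lborel. 1 * complex_of_real (bump p q (real (Suc n)) x)) \<longlonglongrightarrow> (LINT x:{p..q}|lborel. 1)"
        by (rule bump_integral_tendsto) (use that in \<open>auto simp: set_integrable_def\<close>)
      moreover have "(LINT x:{p..q}|lborel. (1::complex)) = of_real (q - p)"
        using that by (simp add: set_lebesgue_integral_def scaleR_conv_of_real)
      moreover have "(LINT x:{P..Q}|lborel. complex_of_real (f x)) = complex_of_real (I f)" for f
        unfolding I_def by (rule set_integral_complex_of_real)
      ultimately show ?thesis by simp
    qed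
    have "(\<lambda>n. U (b n) * I (b' n)) \<longlonglongrightarrow> (LINT x:{p..q}|lborel. u x) * of_real (q' - p')"
      unfolding U_def b_def b'_def by (intro tendsto_mult bump_integral_tendsto uI Ib sub pq')
    moreover have "(\<lambda>n. U (b' n) * I (b n)) \<longlonglongrightarrow> (LINT x:{p'..q'}|lborel. u x) * of_real (q - p)"
      unfolding U_def b_def b'_def by (intro tendsto_mult bump_integral_tendsto uI Ib sub pq)
    ultimately show ?thesis unfolding key by (rule LIMSEQ_unique)
  qed
  obtain x0 where x0: "x0 \<in> S" using S by (auto simp: interval_open_def)
  obtain e where e: "e > 0" "ball x0 e \<subseteq> S" using x0 S openE unfolding interval_open_def by blast
  have "x0 + e/2 \<in> S" using e by (auto simp: dist_real_def subset_eq)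
  hence sub0: "{x0..x0 + e/2} \<subseteq> S" using interval_open_Icc_subset[OF S x0] by simp
  \<comment> \<open>The mean over one fixed interval; by \<open>means\<close> every other interval
    has the same mean.\<close>
  define c where "c = (LINT x:{x0..x0 + e/2}|lborel. u x) / (e/2)"
  have cI: "set_integrable lborel {p..q} (\<lambda>x. c)" for p q :: real
    by (intro borel_integrable_atLeastAtMost' continuous_on_const)
  have "AE x in lborel. x \<in> S \<longrightarrow> u x - c = 0"
  proof (rule loc_zero_AE[OF S])
    show "loc_integrable S (\<lambda>x. u x - c)"
      using u cI unfolding loc_integrable_def by (auto intro!: set_integral_diff)
    fix p q :: real assume pq: "p \<le> q" "{p..q} \<subseteq> S"
    have "(LINT x:{p..q}|lborel. u x - c) = (LINT x:{p..q}|lborel. u x) - (LINT x:{p..q}|lborel. c)"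
      by (rule set_integral_diff) (use u cI pq in \<open>auto simp: loc_integrable_def\<close>)
    also have "(LINT x:{p..q}|lborel. c) = (q - p) * c"
      using pq by (simp add: set_lebesgue_integral_def scaleR_conv_of_real)
    also have "(q - p) * c = (LINT x:{p..q}|lborel. u x)"
      using means[OF pq, of x0 "x0 + e/2"] sub0 e(1) unfolding c_def by (simp add: field_simps)
    finally show "(LINT x:{p..q}|lborel. u x - c) = 0" by simp
  qed
  thus thesis by (intro that[of c]) auto
qed

section \<open>Primitives and weak derivatives\<close>

lemma AE_meas_on:
  "S \<in> sets borel \<Longrightarrow> (AE x in meas_on S. P x) \<longleftrightarrow> (AE x in lborel. x \<in> S \<longrightarrow> P x)"
  unfolding meas_on_def by (subst AE_restrict_space_iff) auto

lemma borel_measurable_meas_on: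
  fixes f :: "'a::euclidean_space \<Rightarrow> complex"
  shows "S \<in> sets borel \<Longrightarrow> f \<in> borel_measurable (meas_on S) \<longleftrightarrow> (\<lambda>x. indicator S x *\<^sub>R f x) \<in> borel_measurable borel"
  unfolding meas_on_def by (subst borel_measurable_restrict_space_iff) auto

lemma L2_loc_integrable:
  assumes S: "interval_open S" and f: "f \<in> L2 (meas_on S)"
  shows "loc_integrable S f"
  unfolding loc_integrable_def set_integrable_def
proof (intro allI impI)
  fix p q :: real assume pq: "{p..q} \<subseteq> S"
  have [measurable]: "S \<in> sets borel" using S by (rule interval_open_sets)
  have m: "(\<lambda>x. indicator S x *\<^sub>R f x) \<in> borel_measurable borel"
    using L2_measurable[OF f] borel_measurable_meas_on[of S f] by simp
  have m2: "(\<lambda>x. indicator {p..q} x *\<^sub>R indicator S x *\<^sub>R f x) \<in> borel_measurable borel"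
    by (rule borel_measurable_scaleR[OF _ m]) auto
  have eq: "indicator {p..q} x *\<^sub>R indicator S x *\<^sub>R f x = indicator {p..q} x *\<^sub>R f x" for x
    using pq by (auto simp: indicator_def)
  have i: "integrable lborel (\<lambda>x. indicator S x *\<^sub>R (cmod (f x))\<^sup>2)"
    using L2_integrable_sq[OF f] unfolding meas_on_def by (subst (asm) integrable_restrict_space) auto
  show "integrable lborel (\<lambda>x. indicator {p..q} x *\<^sub>R f x)"
  proof (rule Bochner_Integration.integrable_bound)
    show "integrable lborel (\<lambda>x. indicator {p..q} x + indicator S x *\<^sub>R (cmod (f x))\<^sup>2)"
      by (intro Bochner_Integration.integrable_add i integrable_real_indicator) (auto simp: emeasure_lborel_Icc_eq)
    show "(\<lambda>x. indicator {p..q} x *\<^sub>R f x) \<in> borel_measurable lborel"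
      using m2 by (simp only: eq) simp
    show "AE x in lborel. norm (indicator {p..q} x *\<^sub>R f x) \<le> norm (indicator {p..q} x + indicator S x *\<^sub>R (cmod (f x))\<^sup>2)"
    proof (rule AE_I2)
      fix x
      have "cmod (f x) \<le> 1 + (cmod (f x))\<^sup>2"
        using sum_squares_bound[of "cmod (f x)" 1] zero_le_power2[of "cmod (f x)"] by (simp; linarith?)
      thus "norm (indicator {p..q} x *\<^sub>R f x) \<le> norm (indicator {p..q} x + indicator S x *\<^sub>R (cmod (f x))\<^sup>2)"
        using pq by (auto simp: indicator_def)
    qed
  qed
qed

lemma integrable_prod_mult:
  fixes f :: "'a \<Rightarrow> 'c::{real_normed_field, banach, second_countable_topology}"
  assumes M1: "sigma_finite_measure M1" and M2: "sigma_finite_measure M2"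
    and f: "integrable M1 f" and g: "integrable M2 g"
  shows "integrable (M1 \<Otimes>\<^sub>M M2) (\<lambda>z. f (fst z) * g (snd z))"
proof -
  interpret pair_sigma_finite M1 M2 using M1 M2 by (simp add: pair_sigma_finite_def)
  have [measurable]: "f \<in> borel_measurable M1" "g \<in> borel_measurable M2" using f g by auto
  have "integrable (M1 \<Otimes>\<^sub>M M2) (\<lambda>(x, y). f x * g y)"
    by (rule Fubini_integrable) (use f g in \<open>auto simp: norm_mult\<close>)
  thus ?thesis by (simp add: case_prod_unfold)
qed

lemma set_integrable_mult_continuous:
  fixes f \<phi> :: "real \<Rightarrow> complex"
  assumes f: "set_integrable lborel {p..q} f" and \<phi>: "continuous_on {p..q} \<phi>"
  shows "set_integrable lborel {p..q} (\<lambda>x. f x * \<phi> x)"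
proof -
  have m: "(\<lambda>t. indicator {p..q} t *\<^sub>R \<phi> t) \<in> borel_measurable borel"
    by (rule borel_measurable_continuous_on_indicator) (auto intro: \<phi>)
  obtain B where B: "\<forall>x\<in>{p..q}. norm (\<phi> x) \<le> B"
    using compact_imp_bounded[OF compact_continuous_image[OF \<phi> compact_Icc]] by (auto simp: bounded_iff)
  define ff where "ff x = indicator {p..q} x *\<^sub>R f x" for x
  have ffi: "integrable lborel ff" using f by (simp add: ff_def[abs_def] set_integrable_def)
  hence [measurable]: "ff \<in> borel_measurable borel" by auto
  have "integrable lborel (\<lambda>t. ff t * (indicator {p..q} t *\<^sub>R \<phi> t))"
  proof (rule Bochner_Integration.integrable_bound)
    show "integrable lborel (\<lambda>t. of_real B * ff t)" using ffi by simp
    show "(\<lambda>t. ff t * (indicator {p..q} t *\<^sub>R \<phi> t)) \<in> borel_measurable lborel"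
        using borel_measurable_times[OF _ m, of ff] by simp
    show "AE x in lborel. norm (ff x * indicator {p..q} x *\<^sub>R \<phi> x) \<le> norm (complex_of_real B * ff x)"
    proof (rule AE_I2)
      fix x show "norm (ff x * indicator {p..q} x *\<^sub>R \<phi> x) \<le> norm (complex_of_real B * ff x)"
      proof (cases "x \<in> {p..q}")
        case True
        hence "norm (\<phi> x) \<le> \<bar>B\<bar>" using B by fastforce
        thus ?thesis using True by (simp add: norm_mult mult.commute mult_right_mono)
      qed simp
    qed
  qed
  moreover have "(\<lambda>t. ff t * (indicator {p..q} t *\<^sub>R \<phi> t)) = (\<lambda>t. indicator {p..q} t *\<^sub>R (f t * \<phi> t))"
    by (auto simp: ff_def fun_eq_iff indicator_def)
  ultimately show ?thesis by (simp add: set_integrable_def)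
qed

text \<open>F is only absolutely continuous, so no product is differentiated. The double integral of
  f(t) phi'(x) over the triangle p <= t <= x <= q is evaluated in both orders instead: one order
  yields F - F(p), the other phi(q) - phi.\<close>

lemma integral_by_parts_AC:
  fixes f F \<phi> \<phi>' :: "real \<Rightarrow> complex"
  assumes pq: "p \<le> q" and f: "set_integrable lborel {p..q} f"
    and F: "\<And>x. x \<in> {p..q} \<Longrightarrow> F x - F p = (LINT t:{p..x}|lborel. f t)"
    and \<phi>: "\<And>x. x \<in> {p..q} \<Longrightarrow> (\<phi> has_vector_derivative \<phi>' x) (at x within {p..q})"
    and \<phi>': "continuous_on {p..q} \<phi>'"
  shows "(LINT x:{p..q}|lborel. F x * \<phi>' x) + (LINT x:{p..q}|lborel. f x * \<phi> x) = F q * \<phi> q - F p * \<phi> p"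
proof -
  define ff where "ff t = indicator {p..q} t *\<^sub>R f t" for t
  define gg where "gg x = indicator {p..q} x *\<^sub>R \<phi>' x" for x
  have ffi: "integrable lborel ff" using f by (simp add: set_integrable_def ff_def[abs_def])
  have ggi: "integrable lborel gg"
    using borel_integrable_atLeastAtMost'[OF \<phi>'] by (simp add: set_integrable_def gg_def[abs_def])
  have FTC: "(LINT x:{s..q}|lborel. \<phi>' x) = \<phi> q - \<phi> s" if "s \<in> {p..q}" for s
    unfolding set_lebesgue_integral_def
    by (rule integral_FTC_atLeastAtMost)
      (use that in \<open>auto intro: has_vector_derivative_within_subset[OF \<phi>] continuous_on_subset[OF \<phi>']\<close>)
  have \<phi>c: "continuous_on {p..q} \<phi>" using \<phi> continuous_on_vector_derivative by blast
  define H where "H z = indicator {z :: real \<times> real. fst z \<le> snd z} z *\<^sub>R (ff (fst z) * gg (snd z))" for z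
  have "integrable (lborel \<Otimes>\<^sub>M lborel) H"
    unfolding H_def
  proof (rule integrable_mult_indicator)
    show "{z :: real \<times> real. fst z \<le> snd z} \<in> sets (lborel \<Otimes>\<^sub>M lborel)"
      by (subst lborel_prod) (auto intro!: borel_closed closed_Collect_le continuous_intros)
    show "integrable (lborel \<Otimes>\<^sub>M lborel) (\<lambda>z. ff (fst z) * gg (snd z))"
      by (intro integrable_prod_mult ffi ggi sigma_finite_lborel)
  qed
  hence Hi: "integrable (lborel \<Otimes>\<^sub>M lborel) (\<lambda>(t, x). H (t, x))" by simp
  have "(LINT x|lborel. LINT t|lborel. H (t, x)) = (LINT t|lborel. LINT x|lborel. H (t, x))"
    by (rule lborel_pair.Fubini_integral[OF Hi])
  moreover have "(LINT t|lborel. H (t, x)) = gg x * (F x - F p)" for x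
  proof (cases "x \<in> {p..q}")
    case True
    have "H (t, x) = gg x * (indicator {p..x} t *\<^sub>R f t)" for t
      using True by (auto simp: H_def ff_def indicator_def)
    hence "(LINT t|lborel. H (t, x)) = gg x * (LINT t:{p..x}|lborel. f t)"
      by (simp add: set_lebesgue_integral_def del: mult_scaleR_right)
    thus ?thesis using F[OF True] by simp
  next
    case False
    thus ?thesis by (simp add: H_def gg_def)
  qed
  moreover have "(LINT x|lborel. H (t, x)) = ff t * (\<phi> q - \<phi> t)" for t
  proof (cases "t \<in> {p..q}")
    case True
    have "H (t, x) = ff t * (indicator {t..q} x *\<^sub>R \<phi>' x)" for x
      using True by (auto simp: H_def gg_def indicator_def)
    hence "(LINT x|lborel. H (t, x)) = ff t * (LINT x:{t..q}|lborel. \<phi>' x)"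
      by (simp add: set_lebesgue_integral_def del: mult_scaleR_right)
    thus ?thesis using FTC[OF True] by simp
  next
    case False
    thus ?thesis by (simp add: H_def ff_def)
  qed
  ultimately have *: "(LINT x|lborel. gg x * (F x - F p)) = (LINT t|lborel. ff t * (\<phi> q - \<phi> t))" by simp
  have fphi: "integrable lborel (\<lambda>t. ff t * \<phi> t)"
    using set_integrable_mult_continuous[OF f \<phi>c] by (simp add: set_integrable_def ff_def)
  have Fcont: "continuous_on {p..q} F"
  proof -
    have "continuous_on {p..q} (\<lambda>x. F p + integral {p..x} f)"
      by (intro continuous_intros indefinite_integral_continuous_1 set_borel_integral_eq_integral f)
    moreover have "F p + integral {p..x} f = F x" if "x \<in> {p..q}" for x
    proof -
      have "set_integrable lborel {p..x} f" using f that by (auto intro: set_integrable_subset)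
      thus ?thesis using F[OF that] set_borel_integral_eq_integral(2)[of "{p..x}" f] by (simp add: algebra_simps)
    qed
    ultimately show ?thesis by (rule continuous_on_eq)
  qed
  have Fphi: "integrable lborel (\<lambda>x. gg x * F x)"
    using borel_integrable_atLeastAtMost'[OF continuous_on_mult[OF \<phi>' Fcont]]
    by (simp add: set_integrable_def gg_def[abs_def])
  have "(LINT x|lborel. gg x * (F x - F p)) = (LINT x|lborel. gg x * F x) - (LINT x|lborel. gg x) * F p"
    using Fphi ggi by (simp add: right_diff_distrib)
  also have "(LINT x|lborel. gg x) = \<phi> q - \<phi> p"
    using FTC[of p] pq by (simp add: gg_def set_lebesgue_integral_def)
  finally have L: "(LINT x|lborel. gg x * (F x - F p)) = (LINT x:{p..q}|lborel. F x * \<phi>' x) - (\<phi> q - \<phi> p) * F p"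
    by (simp add: gg_def set_lebesgue_integral_def mult.commute)
  have "(LINT t|lborel. ff t * (\<phi> q - \<phi> t)) = (LINT t|lborel. ff t) * \<phi> q - (LINT t|lborel. ff t * \<phi> t)"
    using fphi ffi by (simp add: right_diff_distrib)
  also have "(LINT t|lborel. ff t) = F q - F p"
    using F[of q] pq by (simp add: ff_def set_lebesgue_integral_def)
  finally have R: "(LINT t|lborel. ff t * (\<phi> q - \<phi> t)) = (F q - F p) * \<phi> q - (LINT x:{p..q}|lborel. f x * \<phi> x)"
    by (simp add: ff_def set_lebesgue_integral_def)
  show ?thesis using trans[OF L[symmetric] trans[OF * R]] by (simp add: algebra_simps)
qed

text \<open>Stated through integrals rather than derivatives, so that f may be merely locally
  integrable. On an open interval such an F is then automatically continuous.\<close>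

definition is_prim :: "real set \<Rightarrow> (real \<Rightarrow> complex) \<Rightarrow> (real \<Rightarrow> complex) \<Rightarrow> bool" where
  "is_prim S F f \<longleftrightarrow> (\<forall>p\<in>S. \<forall>q\<in>S. p \<le> q \<longrightarrow> F q - F p = (LINT x:{p..q}|lborel. f x))"

lemma is_primD: "is_prim S F f \<Longrightarrow> p \<in> S \<Longrightarrow> q \<in> S \<Longrightarrow> p \<le> q \<Longrightarrow> F q - F p = (LINT x:{p..q}|lborel. f x)"
  by (simp add: is_prim_def)

lemma ex_is_prim:
  assumes S: "interval_open S" and f: "loc_integrable S f"
  shows "\<exists>F. is_prim S F f"
proof -
  obtain x0 where x0: "x0 \<in> S" using S by (auto simp: interval_open_def)
  define F where "F x = (if x0 \<le> x then integral {x0..x} f else - integral {x..x0} f)" for x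
  have int: "f integrable_on {p..q}" "(LINT x:{p..q}|lborel. f x) = integral {p..q} f" if "p \<in> S" "q \<in> S" for p q
    using f interval_open_Icc_subset[OF S that] set_borel_integral_eq_integral unfolding loc_integrable_def by blast+
  have "F q - F p = integral {p..q} f" if pq: "p \<in> S" "q \<in> S" "p \<le> q" for p q
  proof -
    consider "x0 \<le> p" | "p < x0" "x0 \<le> q" | "q < x0" by linarith
    thus ?thesis
    proof cases
      case 1
      have "integral {x0..p} f + integral {p..q} f = integral {x0..q} f"
        by (rule Henstock_Kurzweil_Integration.integral_combine) (use 1 pq int x0 in auto)
      thus ?thesis using 1 pq by (simp add: F_def algebra_simps)
    next
      case 2
      have "integral {p..x0} f + integral {x0..q} f = integral {p..q} f"
        by (rule Henstock_Kurzweil_Integration.integral_combine) (use 2 pq int x0 in auto)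
      thus ?thesis using 2 pq by (simp add: F_def algebra_simps)
    next
      case 3
      have "integral {p..q} f + integral {q..x0} f = integral {p..x0} f"
        by (rule Henstock_Kurzweil_Integration.integral_combine) (use 3 pq int x0 in auto)
      thus ?thesis using 3 pq by (simp add: F_def algebra_simps)
    qed
  qed
  thus ?thesis using int(2) unfolding is_prim_def by (intro exI[of _ F]) auto
qed

lemma is_prim_continuous:
  assumes S: "interval_open S" and f: "loc_integrable S f" and F: "is_prim S F f"
  shows "continuous_on S F"
proof -
  have "isCont F x" if x: "x \<in> S" for x
  proof -
    obtain e where e: "e > 0" "ball x e \<subseteq> S" using x S openE unfolding interval_open_def by blast
    define p q where "p = x - e/2" and "q = x + e/2"
    have "p \<in> ball x e" "q \<in> ball x e" using e(1) by (auto simp: p_def q_def dist_real_def)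
    hence pq: "p \<in> S" "q \<in> S" using e by auto
    have sub: "{p..q} \<subseteq> S" using interval_open_Icc_subset[OF S pq] .
    have fi: "set_integrable lborel {p..q} f" using f sub by (simp add: loc_integrable_def)
    have "continuous_on {p..q} (\<lambda>x. F p + integral {p..x} f)"
      by (intro continuous_intros indefinite_integral_continuous_1 set_borel_integral_eq_integral fi)
    moreover have "F p + integral {p..x} f = F x" if "x \<in> {p..q}" for x
    proof -
      have "set_integrable lborel {p..x} f" using fi that by (auto intro: set_integrable_subset)
      moreover have "F x - F p = (LINT t:{p..x}|lborel. f t)"
        by (rule is_primD[OF F]) (use that pq sub in auto)
      ultimately show ?thesis using set_borel_integral_eq_integral(2)[of "{p..x}" f] by (simp add: algebra_simps)
    qed
    ultimately have "continuous_on {p..q} F" by (rule continuous_on_eq)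
    moreover have "x \<in> interior {p..q}" using e(1) by (auto simp: p_def q_def)
    ultimately show ?thesis by (rule continuous_on_interior)
  qed
  thus ?thesis by (simp add: continuous_at_imp_continuous_on)
qed

lemma is_prim_of_deriv:
  assumes S: "interval_open S" and F: "\<And>x. x \<in> S \<Longrightarrow> (F has_vector_derivative f x) (at x)"
    and f: "continuous_on S f"
  shows "is_prim S F f" "loc_integrable S f"
proof -
  show "loc_integrable S f"
    using f unfolding loc_integrable_def by (auto intro!: borel_integrable_atLeastAtMost' intro: continuous_on_subset)
  show "is_prim S F f" unfolding is_prim_def
  proof (intro ballI impI)
    fix p q assume pq: "p \<in> S" "q \<in> S" "p \<le> q"
    have sub: "{p..q} \<subseteq> S" using interval_open_Icc_subset[OF S pq(1,2)] .
    have "(LINT x:{p..q}|lborel. f x) = F q - F p"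
      unfolding set_lebesgue_integral_def
    proof (rule integral_FTC_atLeastAtMost)
      show "(F has_vector_derivative f x) (at x within {p..q})" if "p \<le> x" "x \<le> q" for x
      proof -
        have "x \<in> S" using that sub by auto
        from has_vector_derivative_at_within[OF F[OF this]] show ?thesis .
      qed
    qed (use pq continuous_on_subset[OF f sub] in auto)
    thus "F q - F p = (LINT x:{p..q}|lborel. f x)" by simp
  qed
qed

lemma is_prim_has_deriv:
  assumes S: "interval_open S" and f: "continuous_on S f" and F: "is_prim S F f" and x: "x \<in> S"
  shows "(F has_vector_derivative f x) (at x)"
proof -
  obtain e where e: "e > 0" "ball x e \<subseteq> S" using x S openE unfolding interval_open_def by blast
  define p q where "p = x - e/2" and "q = x + e/2"
  have "p \<in> ball x e" "q \<in> ball x e" using e(1) by (auto simp: p_def q_def dist_real_def)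
  hence pq: "p \<in> S" "q \<in> S" using e by auto
  have sub: "{p..q} \<subseteq> S" using interval_open_Icc_subset[OF S pq] .
  have fc: "continuous_on {p..q} f" using f sub continuous_on_subset by blast
  have xpq: "x \<in> {p<..<q}" using e(1) by (auto simp: p_def q_def)
  have "((\<lambda>u. integral {p..u} f) has_vector_derivative f x) (at x within {p..q})"
    by (rule integral_has_vector_derivative[OF fc]) (use xpq in auto)
  hence "((\<lambda>u. integral {p..u} f) has_vector_derivative f x) (at x)"
    using at_within_interior[of x "{p..q}"] xpq by simp
  hence "((\<lambda>u. F p + integral {p..u} f) has_vector_derivative f x) (at x)"
    by (auto intro!: derivative_eq_intros)
  thus ?thesis
  proof (rule has_vector_derivative_transform_within_open[where S = "{p<..<q}"])
    fix y assume y: "y \<in> {p<..<q}"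
    have "F y - F p = (LINT t:{p..y}|lborel. f t)" by (rule is_primD[OF F]) (use y pq sub in auto)
    also have "\<dots> = integral {p..y} f"
      by (rule set_borel_integral_eq_integral) (use y fc in \<open>auto intro!: borel_integrable_atLeastAtMost' intro: continuous_on_subset\<close>)
    finally show "F p + integral {p..y} f = F y" by (simp add: algebra_simps)
  qed (use xpq in auto)
qed

lemma set_integral_cong_meas_on:
  fixes p q :: real and f g :: "real \<Rightarrow> complex"
  assumes S: "S \<in> sets borel" and "{p..q} \<subseteq> S" "f \<in> borel_measurable (meas_on S)" "g \<in> borel_measurable (meas_on S)"
    "AE x in meas_on S. f x = g x"
  shows "(LINT x:{p..q}|lborel. f x) = (LINT x:{p..q}|lborel. g x)"
proof -
  have *: "(\<lambda>x. indicator {p..q} x *\<^sub>R h x) \<in> borel_measurable borel" if "h \<in> borel_measurable (meas_on S)" for h :: "real \<Rightarrow> complex"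
  proof -
    have m: "(\<lambda>x. indicator S x *\<^sub>R h x) \<in> borel_measurable borel" using that borel_measurable_meas_on[OF S, of h] by simp
    have "(\<lambda>x. indicator {p..q} x *\<^sub>R indicator S x *\<^sub>R h x) \<in> borel_measurable borel"
      by (rule borel_measurable_scaleR[OF _ m]) auto
    moreover have "(\<lambda>x. indicator {p..q} x *\<^sub>R indicator S x *\<^sub>R h x) = (\<lambda>x. indicator {p..q} x *\<^sub>R h x)"
      using assms(2) by (auto simp: fun_eq_iff indicator_def)
    ultimately show ?thesis by (simp only:)
  qed
  show ?thesis
    unfolding set_lebesgue_integral_def
  proof (rule integral_cong_AE)
    show "AE x in lborel. indicator {p..q} x *\<^sub>R f x = indicator {p..q} x *\<^sub>R g x"
      using assms(5) unfolding AE_meas_on[OF S] by eventually_elim (use assms(2) in \<open>auto simp: indicator_def\<close>)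
  qed (use * assms in auto)
qed

lemma weak_deriv_of_prim:
  assumes S: "interval_open S" and f: "loc_integrable S f" and F: "is_prim S F f"
  shows "weak_deriv S F f"
  unfolding weak_deriv_def
proof (intro allI impI)
  fix \<phi> assume t: "test_fun S \<phi>"
  obtain p q where pq: "p < q" "{p..q} \<subseteq> S" "\<And>x. x \<notin> {p<..<q} \<Longrightarrow> \<phi> x = 0" "\<And>x. x \<notin> {p<..<q} \<Longrightarrow> deriv \<phi> x = 0"
    using test_fun_supp[OF S t] by metis
  have sm: "smooth \<phi>" using t by (simp add: test_fun_iff)
  have "(LINT x:{p..q}|lborel. F x * complex_of_real (deriv \<phi> x)) + (LINT x:{p..q}|lborel. f x * complex_of_real (\<phi> x)) =
    F q * complex_of_real (\<phi> q) - F p * complex_of_real (\<phi> p)"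
  proof (rule integral_by_parts_AC)
    show "set_integrable lborel {p..q} f" using f pq by (simp add: loc_integrable_def)
    show "F x - F p = (LINT t:{p..x}|lborel. f t)" if "x \<in> {p..q}" for x
      by (rule is_primD[OF F]) (use that pq in auto)
    show "((\<lambda>x. complex_of_real (\<phi> x)) has_vector_derivative complex_of_real (deriv \<phi> x)) (at x within {p..q})" for x
      using smooth_DERIV[OF sm, of x]
      by (intro has_vector_derivative_of_real has_vector_derivative_at_within)
         (simp add: has_real_derivative_iff_has_vector_derivative)
    show "continuous_on {p..q} (\<lambda>x. complex_of_real (deriv \<phi> x))"
      by (intro continuous_intros smooth_continuous_on smooth_deriv sm)
  qed (use pq in auto)
  moreover have "\<phi> p = 0" "\<phi> q = 0" using pq by auto
  ultimately show "(LINT x|meas_on S. F x * complex_of_real (deriv \<phi> x)) = - (LINT x|meas_on S. f x * complex_of_real (\<phi> x))"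
    using integral_meas_on_supp[of S p q "deriv \<phi>" F] integral_meas_on_supp[of S p q \<phi> f] S pq
    by (simp add: interval_open_sets eq_neg_iff_add_eq_0)
qed

text \<open>Subtract a primitive G of f': the difference has weak derivative 0, so du Bois-Reymond
  makes it constant, and G plus this constant is the wanted representative.\<close>

lemma weak_deriv_prim:
  assumes S: "interval_open S" and w: "weak_deriv S f f'" and f: "loc_integrable S f" and f': "loc_integrable S f'"
  obtains F where "is_prim S F f'" "AE x in lborel. x \<in> S \<longrightarrow> f x = F x"
proof -
  obtain G where G: "is_prim S G f'" using ex_is_prim[OF S f'] by blast
  have Gc: "continuous_on S G" by (rule is_prim_continuous[OF S f' G])
  have Gi: "loc_integrable S G"
    using Gc unfolding loc_integrable_def by (auto intro!: borel_integrable_atLeastAtMost' intro: continuous_on_subset)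
  have wG: "weak_deriv S G f'" by (rule weak_deriv_of_prim[OF S f' G])
  obtain c where c: "AE x in lborel. x \<in> S \<longrightarrow> f x - G x = c"
  proof (rule du_Bois_Reymond[OF S])
    show "loc_integrable S (\<lambda>x. f x - G x)"
      using f Gi unfolding loc_integrable_def by (auto intro!: set_integral_diff)
    fix \<phi> assume t: "test_fun S \<phi>"
    obtain p q where pq: "p < q" "{p..q} \<subseteq> S" "\<And>x. x \<notin> {p<..<q} \<Longrightarrow> \<phi> x = 0" "\<And>x. x \<notin> {p<..<q} \<Longrightarrow> deriv \<phi> x = 0"
      using test_fun_supp[OF S t] by metis
    have dc: "continuous_on {p..q} (\<lambda>x. complex_of_real (deriv \<phi> x))"
      using t by (auto intro!: continuous_intros smooth_continuous_on smooth_deriv simp: test_fun_iff)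
    note sup = integral_meas_on_supp[where \<phi> = "deriv \<phi>", OF interval_open_sets[OF S] pq(2,4)]
    have "(LINT x:{p..q}|lborel. (f x - G x) * complex_of_real (deriv \<phi> x)) =
       (LINT x:{p..q}|lborel. f x * complex_of_real (deriv \<phi> x)) - (LINT x:{p..q}|lborel. G x * complex_of_real (deriv \<phi> x))"
      unfolding left_diff_distrib
      by (rule set_integral_diff) (use f Gi pq dc in \<open>auto intro!: set_integrable_mult_continuous simp: loc_integrable_def\<close>)
    also have "\<dots> = 0"
      using w wG t sup[where f = f] sup[where f = G] unfolding weak_deriv_def by simp
    finally show "(LINT x|meas_on S. (f x - G x) * complex_of_real (deriv \<phi> x)) = 0"
      using sup[where f = "\<lambda>x. f x - G x"] by simp
  qed
  show thesis
  proof
    show "is_prim S (\<lambda>x. G x + c) f'" using G by (simp add: is_prim_def)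
    show "AE x in lborel. x \<in> S \<longrightarrow> f x = G x + c" using c by eventually_elim (auto simp: algebra_simps)
  qed
qed

lemma is_prim_cong:
  assumes S: "interval_open S" and F: "is_prim S F f" and "f \<in> borel_measurable (meas_on S)" "g \<in> borel_measurable (meas_on S)"
    "AE x in meas_on S. f x = g x"
  shows "is_prim S F g"
  using F set_integral_cong_meas_on[OF interval_open_sets[OF S] interval_open_Icc_subset[OF S] assms(3-5)]
  unfolding is_prim_def by simp

lemma continuous_on_meas_on:
  fixes F :: "'a::euclidean_space \<Rightarrow> complex"
  shows "continuous_on S F \<Longrightarrow> S \<in> sets borel \<Longrightarrow> F \<in> borel_measurable (meas_on S)"
  by (subst borel_measurable_meas_on) (auto intro: borel_measurable_continuous_on_indicator)

text \<open>The two representatives are of different quality: psi2 is only in L2, so F1 is a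
  primitive in the integral sense, while F1 is continuous and hence F0 is differentiable in the
  classical sense.\<close>

lemma H2_derivs_classical:
  assumes S: "interval_open S" and H: "H2_derivs S \<psi> \<psi>1 \<psi>2"
  obtains F0 F1 where "is_prim S F1 \<psi>2" "continuous_on S F1" "\<And>x. x \<in> S \<Longrightarrow> (F0 has_vector_derivative F1 x) (at x)"
    "AE x in meas_on S. \<psi> x = F0 x" "AE x in meas_on S. \<psi>1 x = F1 x"
proof -
  note Sb = interval_open_sets[OF S]
  have L: "\<psi> \<in> L2 (meas_on S)" "\<psi>1 \<in> L2 (meas_on S)" "\<psi>2 \<in> L2 (meas_on S)" "weak_deriv S \<psi> \<psi>1" "weak_deriv S \<psi>1 \<psi>2"
    using H by (auto simp: H2_derivs_def)
  note li = L2_loc_integrable[OF S]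
  obtain F1 where F1: "is_prim S F1 \<psi>2" "AE x in lborel. x \<in> S \<longrightarrow> \<psi>1 x = F1 x"
    using weak_deriv_prim[OF S L(5) li[OF L(2)] li[OF L(3)]] by blast
  obtain F0 where F0: "is_prim S F0 \<psi>1" "AE x in lborel. x \<in> S \<longrightarrow> \<psi> x = F0 x"
    using weak_deriv_prim[OF S L(4) li[OF L(1)] li[OF L(2)]] by blast
  have c1: "continuous_on S F1" by (rule is_prim_continuous[OF S li[OF L(3)] F1(1)])
  have "is_prim S F0 F1"
    by (rule is_prim_cong[OF S F0(1) L2_measurable[OF L(2)] continuous_on_meas_on[OF c1 Sb]])
      (use F1(2) in \<open>simp add: AE_meas_on[OF Sb]\<close>)
  from that[OF F1(1) c1 is_prim_has_deriv[OF S c1 this]] show thesis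
    using F0(2) F1(2) by (simp add: AE_meas_on[OF Sb])
qed

section \<open>Lower bounds and perturbation\<close>

lemma meas_on_UNIV [simp]: "meas_on UNIV = lborel"
  unfolding meas_on_def by (rule measure_eqI) (auto simp: sets_restrict_space emeasure_restrict_space)

text \<open>For m > 0 this is a quantitative way to say that t is outside the approximate point
  spectrum. All real m are allowed, which lets the shift lemma be stated without a case for large
  displacements.\<close>

definition bdd_below_at :: "'a measure \<Rightarrow> 'a operator \<Rightarrow> complex \<Rightarrow> real \<Rightarrow> bool" where
  "bdd_below_at M T t m \<longleftrightarrow> (\<forall>f g. (f, g) \<in> T \<longrightarrow> m * l2_norm M f \<le> l2_norm M (\<lambda>x. g x - t * f x))"

definition surj_at :: "'a measure \<Rightarrow> 'a operator \<Rightarrow> complex \<Rightarrow> bool" where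
  "surj_at M T t \<longleftrightarrow> (\<forall>h\<in>L2 M. \<exists>f g. (f, g) \<in> T \<and> (AE x in M. g x - t * f x = h x))"

lemma bdd_below_at_mono: "bdd_below_at M T t m \<Longrightarrow> m' \<le> m \<Longrightarrow> bdd_below_at M T t m'"
  unfolding bdd_below_at_def by (meson l2_norm_nonneg mult_right_mono order_trans)

definition diff_closed :: "'a measure \<Rightarrow> 'a operator \<Rightarrow> bool" where
  "diff_closed M T \<longleftrightarrow> T \<subseteq> L2 M \<times> L2 M \<and>
     (\<forall>f g f' g'. (f, g) \<in> T \<longrightarrow> (f', g') \<in> T \<longrightarrow> ((\<lambda>x. f x - f' x), (\<lambda>x. g x - g' x)) \<in> T)"

lemma bdd_below_at_shift:
  assumes "bdd_below_at M T t m" "T \<subseteq> L2 M \<times> L2 M"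
  shows "bdd_below_at M T z (m - cmod (z - t))"
  unfolding bdd_below_at_def
proof (intro allI impI)
  fix f g assume fg: "(f, g) \<in> T"
  hence L: "f \<in> L2 M" "g \<in> L2 M" using assms(2) by auto
  have "m * l2_norm M f \<le> l2_norm M (\<lambda>x. g x - t * f x)" using assms(1) fg by (simp add: bdd_below_at_def)
  also have "\<dots> = l2_norm M (\<lambda>x. (g x - z * f x) + (z - t) * f x)" by (simp add: algebra_simps)
  also have "\<dots> \<le> l2_norm M (\<lambda>x. g x - z * f x) + l2_norm M (\<lambda>x. (z - t) * f x)"
    by (intro l2_norm_triangle L2_diff L2_scale L)
  finally show "(m - cmod (z - t)) * l2_norm M f \<le> l2_norm M (\<lambda>x. g x - z * f x)"
    unfolding l2_norm_scale by (simp only: left_diff_distrib)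
qed

text \<open>Let F solve T - t. A fixed point u of v -> h - W F v gives the solution F u of the
  perturbed equation, and the map contracts with factor c / m because F has Lipschitz constant 1 /
  m. With W constant this moves t, with W a potential it changes the operator.\<close>

lemma surj_at_perturb:
  assumes T: "diff_closed M T" and s: "surj_at M T t" and b: "bdd_below_at M T t m"
    and W: "W \<in> borel_measurable M" "\<And>x. cmod (W x) \<le> c" and c: "c < m"
  shows "\<forall>h\<in>L2 M. \<exists>f g. (f, g) \<in> T \<and> (AE x in M. g x - t * f x + W x * f x = h x)"
proof
  fix h assume h: "h \<in> L2 M"
  have [measurable]: "W \<in> borel_measurable M" by fact
  have c0: "0 \<le> c" using W(2)[of undefined] norm_ge_zero order_trans by blast
  have m0: "m > 0" using c c0 by simp
  have TL: "T \<subseteq> L2 M \<times> L2 M" using T by (simp add: diff_closed_def)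
  \<comment> \<open>Solutions are picked one by one, so F is not known to be linear; its Lipschitz
    bound comes from the lower bound, applied to differences of solutions.\<close>
  obtain F G where FG: "\<And>v. v \<in> L2 M \<Longrightarrow> (F v, G v) \<in> T" "\<And>v. v \<in> L2 M \<Longrightarrow> (AE x in M. G v x - t * F v x = v x)"
    using s unfolding surj_at_def by metis
  have L: "F v \<in> L2 M" "G v \<in> L2 M" if "v \<in> L2 M" for v using FG(1)[OF that] TL by auto
  have lip: "l2_norm M (\<lambda>x. F v x - F w x) \<le> (1 / m) * l2_norm M (\<lambda>x. v x - w x)" if v: "v \<in> L2 M" "w \<in> L2 M" for v w
  proof -
    have "((\<lambda>x. F v x - F w x), (\<lambda>x. G v x - G w x)) \<in> T"
      using T FG(1)[OF v(1)] FG(1)[OF v(2)] unfolding diff_closed_def by blast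
    hence "m * l2_norm M (\<lambda>x. F v x - F w x) \<le> l2_norm M (\<lambda>x. (G v x - G w x) - t * (F v x - F w x))"
      using b unfolding bdd_below_at_def by blast
    also have "\<dots> = l2_norm M (\<lambda>x. v x - w x)"
    proof (rule l2_norm_cong_AE)
      show "AE x in M. (G v x - G w x) - t * (F v x - F w x) = v x - w x"
        using FG(2)[OF v(1)] FG(2)[OF v(2)] by eventually_elim (simp add: algebra_simps)
    qed (use v L in \<open>auto intro!: borel_measurable_diff borel_measurable_times L2_measurable\<close>)
    finally show ?thesis using m0 by (simp add: field_simps)
  qed
  have WL: "(\<lambda>x. W x * f x) \<in> L2 M" "l2_norm M (\<lambda>x. W x * f x) \<le> c * l2_norm M f" if "f \<in> L2 M" for f
  proof -
    have ae: "AE x in M. cmod (W x * f x) \<le> c * cmod (f x)"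
      using W(2) by (auto simp: norm_mult intro!: mult_right_mono)
    have mm: "(\<lambda>x. W x * f x) \<in> borel_measurable M" using L2_measurable[OF that] by measurable
    show "(\<lambda>x. W x * f x) \<in> L2 M" by (rule L2_bound[OF that mm ae])
    show "l2_norm M (\<lambda>x. W x * f x) \<le> c * l2_norm M f" by (rule l2_norm_mono[OF that mm ae c0])
  qed
  define N where "N v x = h x - W x * F v x" for v x
  have NL: "N v \<in> L2 M" if "v \<in> L2 M" for v unfolding N_def by (intro L2_diff h WL L that)
  have Nlip: "l2_norm M (\<lambda>x. N v x - N w x) \<le> (c / m) * l2_norm M (\<lambda>x. v x - w x)" if v: "v \<in> L2 M" "w \<in> L2 M" for v w
  proof -
    have "l2_norm M (\<lambda>x. N v x - N w x) = l2_norm M (\<lambda>x. W x * (F w x - F v x))"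
      by (simp add: N_def algebra_simps)
    also have "\<dots> \<le> c * l2_norm M (\<lambda>x. F w x - F v x)" by (intro WL L2_diff L v)
    also have "\<dots> \<le> c * ((1 / m) * l2_norm M (\<lambda>x. w x - v x))" by (intro mult_left_mono lip v c0)
    finally show ?thesis using l2_norm_minus_commute[of M w v] by simp
  qed
  define v where "v = rec_nat h (\<lambda>_. N)"
  have v0: "v 0 = h" and vS: "v (Suc n) = N (v n)" for n by (auto simp: v_def)
  have vL: "v n \<in> L2 M" for n by (induction n) (auto simp: v0 vS h NL)
  define r where "r = c / m"
  have r: "0 \<le> r" "r < 1" using c c0 m0 by (auto simp: r_def)
  define D where "D = l2_norm M (\<lambda>x. v 1 x - v 0 x)"
  have D0: "0 \<le> D" by (simp add: D_def)
  have step: "l2_norm M (\<lambda>x. v (Suc n) x - v n x) \<le> r ^ n * D" for n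
  proof (induction n)
    case (Suc n)
    have "l2_norm M (\<lambda>x. v (Suc (Suc n)) x - v (Suc n) x) \<le> r * l2_norm M (\<lambda>x. v (Suc n) x - v n x)"
      using Nlip[OF vL vL, of "Suc n" n] by (simp add: vS r_def)
    also have "\<dots> \<le> r * (r ^ n * D)" using Suc r by (intro mult_left_mono)
    finally show ?case by simp
  qed (simp add: D_def)
  have tele: "l2_norm M (\<lambda>x. v (n + k) x - v n x) \<le> r ^ n * D / (1 - r)" for n k
  proof -
    have "l2_norm M (\<lambda>x. v (n + k) x - v n x) \<le> (\<Sum>i<k. r ^ (n + i) * D)"
    proof (induction k)
      case (Suc k)
      have "l2_norm M (\<lambda>x. v (n + Suc k) x - v n x) = l2_norm M (\<lambda>x. (v (Suc (n + k)) x - v (n + k) x) + (v (n + k) x - v n x))"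
        by simp
      also have "\<dots> \<le> l2_norm M (\<lambda>x. v (Suc (n + k)) x - v (n + k) x) + l2_norm M (\<lambda>x. v (n + k) x - v n x)"
        by (intro l2_norm_triangle L2_diff vL)
      also have "\<dots> \<le> r ^ (n + k) * D + (\<Sum>i<k. r ^ (n + i) * D)" by (intro add_mono step Suc)
      finally show ?case by simp
    qed simp
    also have "\<dots> = r ^ n * D * (\<Sum>i<k. r ^ i)" by (simp add: sum_distrib_left power_add mult_ac)
    also have "(\<Sum>i<k. r ^ i) = (1 - r ^ k) / (1 - r)" using r by (simp add: sum_gp_strict)
    also have "r ^ n * D * ((1 - r ^ k) / (1 - r)) \<le> r ^ n * D * (1 / (1 - r))"
      using r D0 by (intro mult_left_mono divide_right_mono) auto
    finally show ?thesis by simp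
  qed
  have "\<exists>u\<in>L2 M. (\<lambda>n. l2_norm M (\<lambda>x. v n x - u x)) \<longlonglongrightarrow> 0"
  proof (rule L2_complete[OF vL])
    fix e :: real assume e: "e > 0"
    have "(\<lambda>n. r ^ n * D / (1 - r)) \<longlonglongrightarrow> 0 * D / (1 - r)"
      by (intro tendsto_intros LIMSEQ_power_zero) (use r in auto)
    hence "eventually (\<lambda>n. r ^ n * D / (1 - r) < e) sequentially"
      using e by (intro order_tendstoD(2)) auto
    then obtain N0 where N0: "\<And>n. n \<ge> N0 \<Longrightarrow> r ^ n * D / (1 - r) < e" by (auto simp: eventually_sequentially)
    have *: "l2_norm M (\<lambda>x. v m x - v n x) < e" if "n \<ge> N0" "m \<ge> n" for m n
      using tele[of n "m - n"] N0[OF that(1)] that by simp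
    show "\<exists>N. \<forall>m\<ge>N. \<forall>n\<ge>N. l2_norm M (\<lambda>x. v m x - v n x) < e"
    proof (intro exI[of _ N0] allI impI)
      fix m n assume mn: "N0 \<le> m" "N0 \<le> n"
      show "l2_norm M (\<lambda>x. v m x - v n x) < e"
        using *[of n m] *[of m n] mn by (cases "n \<le> m") (auto simp: l2_norm_minus_commute[of M "v m"])
    qed
  qed
  then obtain u where u: "u \<in> L2 M" "(\<lambda>n. l2_norm M (\<lambda>x. v n x - u x)) \<longlonglongrightarrow> 0" by blast
  have "l2_norm M (\<lambda>x. u x - N u x) \<le> l2_norm M (\<lambda>x. v (Suc n) x - u x) + r * l2_norm M (\<lambda>x. v n x - u x)" for n
  proof -
    have "l2_norm M (\<lambda>x. u x - N u x) = l2_norm M (\<lambda>x. (N (v n) x - N u x) - (v (Suc n) x - u x))" by (simp add: vS)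
    also have "\<dots> \<le> l2_norm M (\<lambda>x. N (v n) x - N u x) + l2_norm M (\<lambda>x. v (Suc n) x - u x)"
      by (intro l2_norm_triangle_diff L2_diff NL vL u)
    finally show ?thesis using Nlip[OF vL u(1), of n] by (simp add: r_def)
  qed
  moreover have "(\<lambda>n. l2_norm M (\<lambda>x. v (Suc n) x - u x) + r * l2_norm M (\<lambda>x. v n x - u x)) \<longlonglongrightarrow> 0 + r * 0"
    by (intro tendsto_intros u(2) LIMSEQ_Suc[OF u(2)])
  ultimately have "l2_norm M (\<lambda>x. u x - N u x) \<le> 0"
    by (intro LIMSEQ_le_const[where X = "\<lambda>n. l2_norm M (\<lambda>x. v (Suc n) x - u x) + r * l2_norm M (\<lambda>x. v n x - u x)"]) auto
  hence "l2_norm M (\<lambda>x. u x - N u x) = 0" using l2_norm_nonneg[of M "\<lambda>x. u x - N u x"] by linarith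
  hence "AE x in M. u x - N u x = 0" using l2_norm_eq_0[OF L2_diff[OF u(1) NL[OF u(1)]]] by simp
  with FG(2)[OF u(1)] have "AE x in M. G u x - t * F u x + W x * F u x = h x"
    by eventually_elim (simp add: N_def algebra_simps)
  thus "\<exists>f g. (f, g) \<in> T \<and> (AE x in M. g x - t * f x + W x * f x = h x)"
    using FG(1)[OF u(1)] by blast
qed

lemma surj_at_near:
  assumes T: "diff_closed M T" and s: "surj_at M T t" and b: "bdd_below_at M T t m" and z: "cmod (z - t) < m"
  shows "surj_at M T z"
  unfolding surj_at_def
proof
  fix h assume h: "h \<in> L2 M"
  obtain f g where fg: "(f, g) \<in> T" "AE x in M. g x - t * f x + (t - z) * f x = h x"
    using surj_at_perturb[OF T s b, of "\<lambda>_. t - z" "cmod (z - t)"] z h by (auto simp: norm_minus_commute)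
  have "AE x in M. g x - z * f x = h x" using fg(2) by eventually_elim (simp add: algebra_simps)
  thus "\<exists>f g. (f, g) \<in> T \<and> (AE x in M. g x - z * f x = h x)" using fg(1) by blast
qed

text \<open>Method of continuity: the lower bound is uniform along the segment, so surjectivity
  spreads from t0 in equal steps that are shorter than m.\<close>

lemma surj_at_segment:
  assumes T: "diff_closed M T" and s: "surj_at M T t0" and m: "m > 0"
    and b: "\<And>s. 0 \<le> s \<Longrightarrow> s \<le> 1 \<Longrightarrow> bdd_below_at M T (t0 + of_real s * (t1 - t0)) m"
  shows "surj_at M T t1"
proof -
  obtain N :: nat where N: "real N > cmod (t1 - t0) / m" using reals_Archimedean2 by blast
  have N0: "real N > 0" using N m by (smt (verit) divide_nonneg_pos norm_ge_zero)
  have st: "cmod (t1 - t0) / real N < m" using N N0 m by (simp add: field_simps)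
  have "surj_at M T (t0 + of_real (real k / real N) * (t1 - t0))" if "k \<le> N" for k
    using that
  proof (induction k)
    case 0
    thus ?case using s by simp
  next
    case (Suc k)
    show ?case
    proof (rule surj_at_near[OF T])
      show "surj_at M T (t0 + of_real (real k / real N) * (t1 - t0))" using Suc by simp
      show "bdd_below_at M T (t0 + of_real (real k / real N) * (t1 - t0)) m"
        by (rule b) (use Suc.prems N0 in \<open>auto simp: field_simps\<close>)
      have "t0 + of_real (real (Suc k) / real N) * (t1 - t0) - (t0 + of_real (real k / real N) * (t1 - t0)) = of_real (1 / real N) * (t1 - t0)"
        by (simp add: add_divide_distrib algebra_simps)
      hence "cmod (t0 + of_real (real (Suc k) / real N) * (t1 - t0) - (t0 + of_real (real k / real N) * (t1 - t0))) = cmod (t1 - t0) / real N"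
        by (simp add: norm_mult norm_divide)
      thus "cmod (t0 + of_real (real (Suc k) / real N) * (t1 - t0) - (t0 + of_real (real k / real N) * (t1 - t0))) < m"
        using st by simp
    qed
  qed
  from this[of N] show ?thesis using N0 by simp
qed

lemma approx_eigenseq_of_not_bdd_below:
  assumes sc: "\<And>f g c. (f, g) \<in> T \<Longrightarrow> ((\<lambda>x. c * f x), (\<lambda>x. c * g x)) \<in> T"
    and nb: "\<And>m. m > 0 \<Longrightarrow> \<not> bdd_below_at M T t m"
  shows "\<exists>f. approx_eigenseq M T t f"
proof -
  have "\<exists>f g. (f, g) \<in> T \<and> l2_norm M f = 1 \<and> l2_norm M (\<lambda>x. g x - t * f x) \<le> 1 / real (Suc n)" for n
  proof -
    obtain f g where fg: "(f, g) \<in> T" "l2_norm M (\<lambda>x. g x - t * f x) < 1 / real (Suc n) * l2_norm M f"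
      using nb[of "1 / real (Suc n)"] unfolding bdd_below_at_def by (auto simp: not_le)
    \<comment> \<open>The violated bound is strict, so a witness of norm 0 is impossible and can be
      normalised.\<close>
    have p: "l2_norm M f > 0"
    proof (rule ccontr)
      assume "\<not> ?thesis"
      hence "l2_norm M f = 0" using l2_norm_nonneg[of M f] by linarith
      thus False using fg(2) l2_norm_nonneg[of M "\<lambda>x. g x - t * f x"] by simp
    qed
    define c where "c = complex_of_real (1 / l2_norm M f)"
    have c: "cmod c = 1 / l2_norm M f" using p by (simp add: c_def norm_divide)
    have "(\<lambda>x. c * g x - t * (c * f x)) = (\<lambda>x. c * (g x - t * f x))" by (simp add: algebra_simps)
    hence "l2_norm M (\<lambda>x. c * g x - t * (c * f x)) = cmod c * l2_norm M (\<lambda>x. g x - t * f x)" by (simp add: l2_norm_scale)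
    also have "\<dots> \<le> 1 / real (Suc n)" using fg(2) p by (simp add: c field_simps)
    finally show ?thesis using sc[OF fg(1), of c] p c
      by (intro exI[of _ "\<lambda>x. c * f x"] exI[of _ "\<lambda>x. c * g x"]) (simp add: l2_norm_scale)
  qed
  then obtain f g where fg: "\<And>n. (f n, g n) \<in> T" "\<And>n. l2_norm M (f n) = 1" "\<And>n. l2_norm M (\<lambda>x. g n x - t * f n x) \<le> 1 / real (Suc n)"
    by metis
  have "(\<lambda>n. l2_norm M (\<lambda>x. g n x - t * f n x)) \<longlonglongrightarrow> 0"
    by (rule tendsto_sandwich[OF _ _ tendsto_const LIMSEQ_Suc[OF lim_1_over_n]]) (use fg(3) in auto)
  thus ?thesis unfolding approx_eigenseq_def using fg by blast
qed

section \<open>The longitudinal operator\<close>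

text \<open>The operator \<open>H_R\<close> only depends on the class of the potential.\<close>

lemma Linfty_real_borel:
  assumes "V0 \<in> Linfty_real"
  obtains V B where "V \<in> borel_measurable borel" "0 \<le> B" "\<And>x. \<bar>V x\<bar> \<le> B" "H_R V0 = H_R V"
proof -
  obtain C where V0: "V0 \<in> borel_measurable lebesgue" and C: "AE x in lebesgue. \<bar>V0 x\<bar> \<le> C"
    using assms by (auto simp: Linfty_real_def)
  obtain V1 where V1: "V1 \<in> borel_measurable lborel" "AE x in lborel. V0 x = V1 x"
    using completion_ex_borel_measurable_real[OF V0] by blast
  have C': "AE x in lborel. \<bar>V0 x\<bar> \<le> C" using C by (simp add: AE_completion_iff)
  define B where "B = max 0 C"
  define V where "V x = max (-B) (min B (V1 x))" for x
  have ae: "AE x in lborel. V0 x = V x"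
    using V1(2) C' by eventually_elim (auto simp: V_def B_def)
  show thesis
  proof (rule that[of V B])
    show "V \<in> borel_measurable borel" using V1(1) unfolding V_def by simp
    show "0 \<le> B" by (simp add: B_def)
    show "\<bar>V x\<bar> \<le> B" for x by (auto simp: V_def B_def)
    have "(AE x in lborel. h x = - \<psi>2 x + of_real (V0 x) * \<psi> x) \<longleftrightarrow> (AE x in lborel. h x = - \<psi>2 x + of_real (V x) * \<psi> x)" for h \<psi> \<psi>2 :: "real \<Rightarrow> complex"
      using ae by (intro iffI; elim AE_mp) (auto elim!: eventually_mono)
    thus "H_R V0 = H_R V" unfolding H_R_def meas_on_UNIV by simp
  qed
qed

section \<open>Linear structure of the Sobolev space and of \<open>H_R\<close>\<close>

lemma test_fun_L2:
  assumes S: "interval_open S" and t: "test_fun S \<phi>"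
  shows "(\<lambda>x. complex_of_real (\<phi> x)) \<in> L2 (meas_on S)" "(\<lambda>x. complex_of_real (deriv \<phi> x)) \<in> L2 (meas_on S)"
proof -
  obtain p q where pq: "p < q" "{p..q} \<subseteq> S" "\<And>x. x \<notin> {p<..<q} \<Longrightarrow> \<phi> x = 0" "\<And>x. x \<notin> {p<..<q} \<Longrightarrow> deriv \<phi> x = 0"
    using test_fun_supp[OF S t] by metis
  have *: "(\<lambda>x. complex_of_real (f x)) \<in> L2 (meas_on S)" if f: "continuous_on UNIV f" "\<And>x. x \<notin> {p<..<q} \<Longrightarrow> f x = 0" for f
  proof -
    have [measurable]: "f \<in> borel_measurable borel" by (rule borel_measurable_continuous_onI[OF f(1)])
    have Sb: "S \<in> sets borel" using S by (rule interval_open_sets)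
    have "integrable lborel (\<lambda>x. indicator {p..q} x *\<^sub>R (cmod (complex_of_real (f x)))\<^sup>2)"
      by (intro borel_integrable_compact) (auto intro!: continuous_intros continuous_on_subset[OF f(1)])
    moreover have "indicator {p..q} x *\<^sub>R (cmod (complex_of_real (f x)))\<^sup>2 = indicator S x *\<^sub>R (cmod (complex_of_real (f x)))\<^sup>2" for x
    proof (cases "x \<in> {p..q}")
      case False
      hence "x \<notin> {p<..<q}" by auto
      thus ?thesis using f(2) by simp
    qed (use pq in \<open>auto simp: indicator_def\<close>)
    ultimately have "integrable lborel (\<lambda>x. indicator S x *\<^sub>R (cmod (complex_of_real (f x)))\<^sup>2)"
      by (simp only:)
    hence "integrable (meas_on S) (\<lambda>x. (cmod (complex_of_real (f x)))\<^sup>2)"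
      unfolding meas_on_def using Sb by (subst integrable_restrict_space) auto
    moreover have "(\<lambda>x. complex_of_real (f x)) \<in> borel_measurable (meas_on S)"
      unfolding meas_on_def by (intro measurable_restrict_space1) simp
    ultimately show ?thesis by (simp add: L2_def)
  qed
  have sm: "smooth \<phi>" using t by (simp add: test_fun_iff)
  show "(\<lambda>x. complex_of_real (\<phi> x)) \<in> L2 (meas_on S)" "(\<lambda>x. complex_of_real (deriv \<phi> x)) \<in> L2 (meas_on S)"
    by (intro * smooth_continuous_on smooth_deriv sm pq; assumption)+
qed

lemma weak_deriv_lincomb:
  assumes S: "interval_open S" and L: "f \<in> L2 (meas_on S)" "f' \<in> L2 (meas_on S)" "g \<in> L2 (meas_on S)" "g' \<in> L2 (meas_on S)"
    and w: "weak_deriv S f f'" "weak_deriv S g g'"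
  shows "weak_deriv S (\<lambda>x. c * f x + d * g x) (\<lambda>x. c * f' x + d * g' x)"
  unfolding weak_deriv_def
proof (intro allI impI)
  fix \<phi> assume t: "test_fun S \<phi>"
  note tL = test_fun_L2[OF S t]
  have *: "(LINT x|meas_on S. (c * h x + d * k x) * \<psi> x) = c * (LINT x|meas_on S. h x * \<psi> x) + d * (LINT x|meas_on S. k x * \<psi> x)"
    if "h \<in> L2 (meas_on S)" "k \<in> L2 (meas_on S)" "\<psi> \<in> L2 (meas_on S)" for h k \<psi>
    using integrable_L2_mult[OF that(1,3)] integrable_L2_mult[OF that(2,3)] by (simp add: distrib_right mult.assoc)
  show "(LINT x|meas_on S. (c * f x + d * g x) * complex_of_real (deriv \<phi> x)) =
      - (LINT x|meas_on S. (c * f' x + d * g' x) * complex_of_real (\<phi> x))"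
    using w t by (simp add: *[OF L(1,3) tL(2)] *[OF L(2,4) tL(1)] weak_deriv_def)
qed

lemma weak_deriv_cong_AE:
  assumes w: "weak_deriv S f f'" and m: "f \<in> borel_measurable (meas_on S)" "f1 \<in> borel_measurable (meas_on S)"
    and ae: "AE x in meas_on S. f1 x = f x" and S: "interval_open S"
  shows "weak_deriv S f1 f'"
  unfolding weak_deriv_def
proof (intro allI impI)
  fix \<phi> assume t: "test_fun S \<phi>"
  have "(LINT x|meas_on S. f1 x * complex_of_real (deriv \<phi> x)) = (LINT x|meas_on S. f x * complex_of_real (deriv \<phi> x))"
    by (rule integral_cong_AE) (use ae m L2_measurable[OF test_fun_L2(2)[OF S t]] in auto)
  thus "(LINT x|meas_on S. f1 x * complex_of_real (deriv \<phi> x)) = - (LINT x|meas_on S. f' x * complex_of_real (\<phi> x))"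
    using w t by (simp add: weak_deriv_def)
qed

lemma H2_derivs_lincomb:
  assumes S: "interval_open S" and "H2_derivs S f f1 f2" "H2_derivs S g g1 g2"
  shows "H2_derivs S (\<lambda>x. c * f x + d * g x) (\<lambda>x. c * f1 x + d * g1 x) (\<lambda>x. c * f2 x + d * g2 x)"
  using assms unfolding H2_derivs_def by (auto intro!: weak_deriv_lincomb L2_add L2_scale)

lemma H2_derivs_cong_AE:
  assumes S: "interval_open S" and "H2_derivs S f f1 f2" "g \<in> borel_measurable (meas_on S)" "AE x in meas_on S. g x = f x"
  shows "H2_derivs S g f1 f2"
  using assms unfolding H2_derivs_def by (auto intro: weak_deriv_cong_AE L2_cong_AE L2_measurable)

lemma H_R_L2: "(f, g) \<in> H_R V \<Longrightarrow> f \<in> L2 lborel \<and> g \<in> L2 lborel"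
  by (auto simp: H_R_def H2_derivs_def)

lemma H_RE:
  assumes "(f, g) \<in> H_R V"
  obtains f1 f2 where "g \<in> L2 lborel" "H2_derivs UNIV f f1 f2" "AE x in lborel. g x = - f2 x + of_real (V x) * f x"
  using assms unfolding H_R_def meas_on_UNIV by blast

lemma H_R_lincomb:
  assumes "(f, g) \<in> H_R V" "(f', g') \<in> H_R V"
  shows "((\<lambda>x. c * f x + d * f' x), (\<lambda>x. c * g x + d * g' x)) \<in> H_R V"
proof -
  obtain f1 f2 where f: "g \<in> L2 lborel" "H2_derivs UNIV f f1 f2" "AE x in lborel. g x = - f2 x + of_real (V x) * f x"
    using assms(1) by (rule H_RE)
  obtain h1 h2 where h: "g' \<in> L2 lborel" "H2_derivs UNIV f' h1 h2" "AE x in lborel. g' x = - h2 x + of_real (V x) * f' x"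
    using assms(2) by (rule H_RE)
  have "AE x in lborel. c * g x + d * g' x = - (c * f2 x + d * h2 x) + of_real (V x) * (c * f x + d * f' x)"
    using f(3) h(3)
  proof eventually_elim
    case (elim x)
    show ?case unfolding elim by (simp add: algebra_simps)
  qed
  thus ?thesis
    using H2_derivs_lincomb[OF interval_open_UNIV f(2) h(2), of c d] L2_add[OF L2_scale[OF f(1)] L2_scale[OF h(1)], of c d]
    unfolding H_R_def meas_on_UNIV by blast
qed

lemma H_R_scale: "(f, g) \<in> H_R V \<Longrightarrow> ((\<lambda>x. c * f x), (\<lambda>x. c * g x)) \<in> H_R V"
  using H_R_lincomb[of f g V f g c 0] by simp

lemma H_R_zero: "((\<lambda>x. 0), (\<lambda>x. 0)) \<in> H_R V"
proof -
  have "weak_deriv UNIV (\<lambda>x. 0) (\<lambda>x. 0)" by (simp add: weak_deriv_def)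
  thus ?thesis unfolding H_R_def H2_derivs_def
    by (auto intro!: exI[of _ "\<lambda>x. 0"])
qed

lemma H_R_sum:
  fixes n :: nat
  assumes "\<And>i. i < n \<Longrightarrow> (f i, g i) \<in> H_R V"
  shows "((\<lambda>x. \<Sum>i<n. c i * f i x), (\<lambda>x. \<Sum>i<n. c i * g i x)) \<in> H_R V"
  using assms
proof (induction n)
  case 0
  show ?case using H_R_zero by simp
next
  case (Suc n)
  hence "((\<lambda>x. \<Sum>i<n. c i * f i x), (\<lambda>x. \<Sum>i<n. c i * g i x)) \<in> H_R V" by simp
  from H_R_lincomb[OF this Suc.prems[of n], of 1 "c n"] show ?case by simp
qed

lemma H_R_cong_AE:
  assumes "(f, g) \<in> H_R V" "f' \<in> borel_measurable lborel" "g' \<in> borel_measurable lborel"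
    "AE x in lborel. f' x = f x" "AE x in lborel. g' x = g x"
  shows "(f', g') \<in> H_R V"
proof -
  obtain f1 f2 where f: "g \<in> L2 lborel" "H2_derivs UNIV f f1 f2" "AE x in lborel. g x = - f2 x + of_real (V x) * f x"
    using assms(1) by (rule H_RE)
  have "H2_derivs UNIV f' f1 f2" by (rule H2_derivs_cong_AE[OF interval_open_UNIV f(2)]) (simp_all only: meas_on_UNIV assms)
  moreover have "AE x in lborel. g' x = - f2 x + of_real (V x) * f' x"
    using f(3) assms(4,5) by eventually_elim simp
  moreover have "g' \<in> L2 lborel" using L2_cong_AE[OF f(1) assms(3,5)] .
  ultimately show ?thesis unfolding H_R_def meas_on_UNIV by blast
qed

lemma diff_closed_H_R: "diff_closed lborel (H_R V)"
  unfolding diff_closed_def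
proof (intro conjI allI impI)
  show "H_R V \<subseteq> L2 lborel \<times> L2 lborel" using H_R_L2 by auto
  fix f g f' g' assume "(f, g) \<in> H_R V" "(f', g') \<in> H_R V"
  from H_R_lincomb[OF this, of 1 "-1"] show "((\<lambda>x. f x - f' x), (\<lambda>x. g x - g' x)) \<in> H_R V" by simp
qed

section \<open>The quadratic form of \<open>H_R\<close>\<close>

lemma H2_form:
  assumes H: "H2_derivs UNIV \<psi> \<psi>1 \<psi>2"
  shows "(LINT x|lborel. \<psi>2 x * cnj (\<psi> x)) = - of_real ((l2_norm lborel \<psi>1)\<^sup>2)"
proof -
  obtain F1 F0 where F: "is_prim UNIV F1 \<psi>2" "continuous_on UNIV F1" "\<And>x. x \<in> UNIV \<Longrightarrow> (F0 has_vector_derivative F1 x) (at x)"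
    and ae': "AE x in meas_on UNIV. \<psi> x = F0 x" "AE x in meas_on UNIV. \<psi>1 x = F1 x"
    by (rule H2_derivs_classical[OF interval_open_UNIV H]) blast
  note F3 = F(3)[OF UNIV_I] and ae = ae'[unfolded meas_on_UNIV]
  have L: "\<psi> \<in> L2 lborel" "\<psi>1 \<in> L2 lborel" "\<psi>2 \<in> L2 lborel" using H by (auto simp: H2_derivs_def)
  have F0c: "continuous_on UNIV F0" using F3 by (meson continuous_at_imp_continuous_on has_vector_derivative_continuous)
  have m0: "F0 \<in> borel_measurable lborel" "F1 \<in> borel_measurable lborel"
    using F0c F(2) by (simp_all add: borel_measurable_continuous_onI)
  have FL: "F0 \<in> L2 lborel" "F1 \<in> L2 lborel"
    using L2_cong_AE[OF L(1) m0(1)] L2_cong_AE[OF L(2) m0(2)] ae by (simp_all add: eq_commute)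
  define P where "P x = F1 x * cnj (F1 x) + \<psi>2 x * cnj (F0 x)" for x
  define Q where "Q x = F1 x * cnj (F0 x)" for x
  have Pi: "integrable lborel P" unfolding P_def by (intro Bochner_Integration.integrable_add integrable_L2_mult L2_cnj FL L)
  have Qi: "integrable lborel Q" unfolding Q_def by (intro integrable_L2_mult L2_cnj FL)
  \<comment> \<open>Boundary terms at infinity are not known to vanish, so the product is cut off by
    b(x / N). Pointwise the cut-off tends to b 0 and dominated convergence applies, while the term
    with its derivative carries a factor 1 / N.\<close>
  define b where "b = bump (-1) 1 1"
  have sb: "smooth b" by (simp add: b_def smooth_bump)
  have [measurable]: "b \<in> borel_measurable borel" "deriv b \<in> borel_measurable borel"
    by (auto intro!: borel_measurable_continuous_onI smooth_continuous_on smooth_deriv sb)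
  have [measurable]: "P \<in> borel_measurable borel" "Q \<in> borel_measurable borel" using Pi Qi by auto
  obtain C where C: "\<forall>x\<in>{-1..1}. norm (deriv b x) \<le> C"
    using compact_imp_bounded[OF compact_continuous_image[OF smooth_continuous_on[OF smooth_deriv[OF sb]] compact_Icc], of "-1" 1]
    by (auto simp: bounded_iff)
  define I1 where "I1 n = (LINT x|lborel. indicator {-real (Suc n)..real (Suc n)} x *\<^sub>R (of_real (b (x / real (Suc n))) * P x))" for n
  define I2 where "I2 n = (LINT x|lborel. indicator {-real (Suc n)..real (Suc n)} x *\<^sub>R (of_real (deriv b (x / real (Suc n)) / real (Suc n)) * Q x))" for n
  have eq: "I1 n + I2 n = 0" for n
  proof -
    define N where "N = real (Suc n)"
    have N: "N > 0" by (simp add: N_def)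
    define \<phi> where "\<phi> x = of_real (b (x / N)) * cnj (F0 x)" for x
    define \<phi>' where "\<phi>' x = of_real (b (x / N)) * cnj (F1 x) + of_real (deriv b (x / N) / N) * cnj (F0 x)" for x
    have ib: "set_integrable lborel {-N..N} (\<lambda>x. F1 x * \<phi>' x)"
      unfolding \<phi>'_def using N
      by (intro borel_integrable_atLeastAtMost' continuous_intros continuous_on_subset[OF F(2)] continuous_on_subset[OF F0c]
          continuous_on_compose2[OF smooth_continuous_on[OF sb, of UNIV]] continuous_on_compose2[OF smooth_continuous_on[OF smooth_deriv[OF sb], of UNIV]]) auto
    have ic: "set_integrable lborel {-N..N} (\<lambda>x. \<psi>2 x * \<phi> x)"
    proof (rule set_integrable_mult_continuous)
      show "set_integrable lborel {-N..N} \<psi>2"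
        using L2_loc_integrable[OF interval_open_UNIV, of \<psi>2] L(3) by (simp add: loc_integrable_def)
      show "continuous_on {-N..N} \<phi>" unfolding \<phi>_def using N
        by (intro continuous_intros continuous_on_subset[OF F0c] continuous_on_compose2[OF smooth_continuous_on[OF sb, of UNIV]]) auto
    qed
    have "(LINT x:{-N..N}|lborel. F1 x * \<phi>' x) + (LINT x:{-N..N}|lborel. \<psi>2 x * \<phi> x) = F1 N * \<phi> N - F1 (-N) * \<phi> (-N)"
    proof (rule integral_by_parts_AC)
      show "set_integrable lborel {-N..N} \<psi>2"
        using L2_loc_integrable[OF interval_open_UNIV, of \<psi>2] L(3) by (simp add: loc_integrable_def)
      show "F1 x - F1 (-N) = (LINT t:{-N..x}|lborel. \<psi>2 t)" if "x \<in> {-N..N}" for x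
        by (rule is_primD[OF F(1)]) (use that in auto)
      show "continuous_on {-N..N} \<phi>'" unfolding \<phi>'_def using N
        by (intro continuous_intros continuous_on_subset[OF F0c] continuous_on_subset[OF F(2)] continuous_on_compose2[OF smooth_continuous_on[OF sb, of UNIV]]
            continuous_on_compose2[OF smooth_continuous_on[OF smooth_deriv[OF sb], of UNIV]]) auto
      fix x
      have "((\<lambda>x. b (x / N)) has_real_derivative deriv b (x / N) * (1 / N)) (at x)"
        by (rule DERIV_chain2[OF smooth_DERIV[OF sb]]) (use N in \<open>auto intro!: derivative_eq_intros\<close>)
      hence 1: "((\<lambda>x. complex_of_real (b (x / N))) has_vector_derivative of_real (deriv b (x / N) / N)) (at x)"
        by (intro has_vector_derivative_of_real) (simp add: has_real_derivative_iff_has_vector_derivative)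
      have 2: "((\<lambda>x. cnj (F0 x)) has_vector_derivative cnj (F1 x)) (at x)"
        by (rule has_vector_derivative_cnj[OF F3])
      show "(\<phi> has_vector_derivative \<phi>' x) (at x within {-N..N})"
        unfolding \<phi>_def \<phi>'_def
        using has_vector_derivative_mult[OF 1 2] by (rule has_vector_derivative_at_within)
    qed (use N in auto)
    moreover have "\<phi> N = 0" "\<phi> (-N) = 0" using N by (auto simp: \<phi>_def b_def bump_zero)
    ultimately have "(LINT x:{-N..N}|lborel. F1 x * \<phi>' x + \<psi>2 x * \<phi> x) = 0"
      using set_integral_add(2)[OF ib ic] by simp
    moreover have "F1 x * \<phi>' x + \<psi>2 x * \<phi> x = of_real (b (x / N)) * P x + of_real (deriv b (x / N) / N) * Q x" for x
      by (simp add: \<phi>_def \<phi>'_def P_def Q_def algebra_simps)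
    ultimately have 0: "(LINT x:{-N..N}|lborel. of_real (b (x / N)) * P x + of_real (deriv b (x / N) / N) * Q x) = 0" by simp
    have si: "set_integrable lborel {-N..N} (\<lambda>x. f x * of_real (g x))" if "integrable lborel f" "continuous_on UNIV g" for f :: "real \<Rightarrow> complex" and g
    proof (rule set_integrable_mult_continuous)
      show "set_integrable lborel {-N..N} f" unfolding set_integrable_def by (rule integrable_mult_indicator) (use that in auto)
      show "continuous_on {-N..N} (\<lambda>x. complex_of_real (g x))" by (intro continuous_intros continuous_on_subset[OF that(2)]) auto
    qed
    have c1: "continuous_on UNIV (\<lambda>x. b (x / N))" "continuous_on UNIV (\<lambda>x. deriv b (x / N) / N)"
      using N by (intro continuous_intros continuous_on_compose2[OF smooth_continuous_on[OF sb, of UNIV]]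
            continuous_on_compose2[OF smooth_continuous_on[OF smooth_deriv[OF sb], of UNIV]]; simp)+
    have "(LINT x:{-N..N}|lborel. P x * of_real (b (x / N)) + Q x * of_real (deriv b (x / N) / N)) =
      (LINT x:{-N..N}|lborel. P x * of_real (b (x / N))) + (LINT x:{-N..N}|lborel. Q x * of_real (deriv b (x / N) / N))"
      by (rule set_integral_add(2)[OF si[OF Pi c1(1)] si[OF Qi c1(2)]])
    moreover have "I1 n = (LINT x:{-N..N}|lborel. P x * of_real (b (x / N)))"
      unfolding I1_def N_def set_lebesgue_integral_def by (simp only: mult.commute)
    moreover have "I2 n = (LINT x:{-N..N}|lborel. Q x * of_real (deriv b (x / N) / N))"
      unfolding I2_def N_def set_lebesgue_integral_def by (simp only: mult.commute)
    moreover have "(LINT x:{-N..N}|lborel. P x * of_real (b (x / N)) + Q x * of_real (deriv b (x / N) / N)) = 0"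
      using 0 by (simp only: mult.commute)
    ultimately show ?thesis by simp
  qed
  have "I1 \<longlonglongrightarrow> (LINT x|lborel. of_real (b 0) * P x)"
    unfolding I1_def
  proof (rule integral_dominated_convergence[where w = "\<lambda>x. norm (P x)"])
    show "integrable lborel (\<lambda>x. norm (P x))" using Pi by (rule integrable_norm)
    show "AE x in lborel. (\<lambda>n. indicator {-real (Suc n)..real (Suc n)} x *\<^sub>R (of_real (b (x / real (Suc n))) * P x)) \<longlonglongrightarrow> of_real (b 0) * P x"
    proof (rule AE_I2)
      fix x :: real
      have "(\<lambda>n. x * (1 / real (Suc n))) \<longlonglongrightarrow> x * 0" by (intro tendsto_intros LIMSEQ_Suc[OF lim_1_over_n])
      hence "(\<lambda>n. x / real (Suc n)) \<longlonglongrightarrow> 0" by simp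
      hence "(\<lambda>n. b (x / real (Suc n))) \<longlonglongrightarrow> b 0"
        using continuous_on_tendsto_compose[OF smooth_continuous_on[OF sb, of UNIV]] by auto
      hence "(\<lambda>n. of_real (b (x / real (Suc n))) * P x) \<longlonglongrightarrow> of_real (b 0) * P x" by (intro tendsto_intros)
      moreover have "\<forall>\<^sub>F n in sequentially. of_real (b (x / real (Suc n))) * P x =
         indicator {-real (Suc n)..real (Suc n)} x *\<^sub>R (of_real (b (x / real (Suc n))) * P x)"
      proof -
        obtain n0 :: nat where "\<bar>x\<bar> \<le> real n0" using real_arch_simple by blast
        hence "x \<in> {- real (Suc n)..real (Suc n)}" if "n \<ge> n0" for n
          using that unfolding atLeastAtMost_iff by linarith
        thus ?thesis unfolding eventually_sequentially by (intro exI[of _ n0]) simp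
      qed
      ultimately show "(\<lambda>n. indicator {-real (Suc n)..real (Suc n)} x *\<^sub>R (of_real (b (x / real (Suc n))) * P x)) \<longlonglongrightarrow> of_real (b 0) * P x"
        by (rule Lim_transform_eventually)
    qed
    show "AE x in lborel. norm (indicator {-real (Suc n)..real (Suc n)} x *\<^sub>R (of_real (b (x / real (Suc n))) * P x)) \<le> norm (P x)" for n
      by (auto simp: norm_mult indicator_def b_def bump_nonneg bump_le_1 intro!: mult_left_le_one_le simp del: of_nat_Suc)
  qed simp_all
  moreover have "I2 \<longlonglongrightarrow> 0"
  proof (rule Lim_null_comparison)
    have "(\<lambda>n. (\<bar>C\<bar> * (LINT x|lborel. norm (Q x))) * (1 / real (Suc n))) \<longlonglongrightarrow> (\<bar>C\<bar> * (LINT x|lborel. norm (Q x))) * 0"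
      by (intro tendsto_intros LIMSEQ_Suc[OF lim_1_over_n])
    thus "(\<lambda>n. (\<bar>C\<bar> * (LINT x|lborel. norm (Q x))) * (1 / real (Suc n))) \<longlonglongrightarrow> 0" by simp
    show "\<forall>\<^sub>F n in sequentially. norm (I2 n) \<le> (\<bar>C\<bar> * (LINT x|lborel. norm (Q x))) * (1 / real (Suc n))"
    proof (rule always_eventually, rule allI)
      fix n
      define N where "N = real (Suc n)"
      have N: "N > 0" by (simp add: N_def)
      have pt: "norm (indicator {-N..N} x *\<^sub>R (of_real (deriv b (x / N) / N) * Q x)) \<le> (\<bar>C\<bar> / N) * norm (Q x)" for x
      proof (cases "x \<in> {-N..N}")
        case True
        hence "x / N \<in> {-1..1}" using N by (auto simp: field_simps)
        hence "\<bar>deriv b (x / N)\<bar> \<le> \<bar>C\<bar>" using C by fastforce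
        hence "\<bar>deriv b (x / N)\<bar> / N * norm (Q x) \<le> \<bar>C\<bar> / N * norm (Q x)"
          using N by (intro mult_right_mono divide_right_mono) auto
        thus ?thesis using True N by (simp add: norm_mult norm_divide)
      qed (use N in simp)
      have [measurable]: "(\<lambda>x. indicator {-N..N} x *\<^sub>R (complex_of_real (deriv b (x / N) / N) * Q x)) \<in> borel_measurable borel"
        by measurable
      have "norm (I2 n) \<le> (LINT x|lborel. norm (indicator {-N..N} x *\<^sub>R (of_real (deriv b (x / N) / N) * Q x)))"
        unfolding I2_def N_def by (rule integral_norm_bound)
      also have "\<dots> \<le> (LINT x|lborel. (\<bar>C\<bar> / N) * norm (Q x))"
      proof (rule integral_mono)
        show i: "integrable lborel (\<lambda>x. (\<bar>C\<bar> / N) * norm (Q x))" using Qi by simp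
        show "integrable lborel (\<lambda>x. norm (indicator {-N..N} x *\<^sub>R (complex_of_real (deriv b (x / N) / N) * Q x)))"
          by (rule Bochner_Integration.integrable_bound[OF i]) (use pt N in auto)
      qed (rule pt)
      finally show "norm (I2 n) \<le> (\<bar>C\<bar> * (LINT x|lborel. norm (Q x))) * (1 / real (Suc n))" by (simp add: N_def)
    qed
  qed
  ultimately have "(\<lambda>n. I1 n + I2 n) \<longlonglongrightarrow> (LINT x|lborel. of_real (b 0) * P x) + 0" by (rule tendsto_add)
  hence "(LINT x|lborel. of_real (b 0) * P x) = 0" by (simp add: eq LIMSEQ_const_iff)
  \<comment> \<open>The bump is not normalised at 0; being positive there is enough to divide by
    it.\<close>
  moreover have "b 0 > 0" by (simp add: b_def bump_pos)
  ultimately have "(LINT x|lborel. P x) = 0" by simp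
  hence "(LINT x|lborel. F1 x * cnj (F1 x)) + (LINT x|lborel. \<psi>2 x * cnj (F0 x)) = 0"
    unfolding P_def by (subst (asm) Bochner_Integration.integral_add) (auto intro!: integrable_L2_mult L2_cnj FL L)
  moreover have "(LINT x|lborel. F1 x * cnj (F1 x)) = of_real ((l2_norm lborel F1)\<^sup>2)"
    using l2_norm_sq_inner[of lborel F1] by (simp add: l2_inner_def)
  moreover have "l2_norm lborel F1 = l2_norm lborel \<psi>1"
    using l2_norm_cong_AE[OF m0(2) L2_measurable[OF L(2)]] ae(2) by (simp add: eq_commute)
  moreover have "(LINT x|lborel. \<psi>2 x * cnj (F0 x)) = (LINT x|lborel. \<psi>2 x * cnj (\<psi> x))"
  proof (rule integral_cong_AE)
    show "AE x in lborel. \<psi>2 x * cnj (F0 x) = \<psi>2 x * cnj (\<psi> x)" using ae(1) by eventually_elim simp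
  qed (use m0 L2_measurable[OF L(1)] L2_measurable[OF L(3)] in auto)
  ultimately show ?thesis by (simp add: add_eq_0_iff)
qed

lemma H_R_form:
  assumes V: "V \<in> borel_measurable borel" "\<And>x. \<bar>V x\<bar> \<le> B" and H: "(f, g) \<in> H_R V"
  obtains r where "l2_inner lborel g f = of_real r" "r \<ge> - B * (l2_norm lborel f)\<^sup>2"
proof -
  obtain f1 f2 where f: "g \<in> L2 lborel" "H2_derivs UNIV f f1 f2" "AE x in lborel. g x = - f2 x + of_real (V x) * f x"
    using H by (rule H_RE)
  have L: "f \<in> L2 lborel" "f2 \<in> L2 lborel" using f(2) by (auto simp: H2_derivs_def)
  have [measurable]: "f \<in> borel_measurable borel" "f2 \<in> borel_measurable borel" "g \<in> borel_measurable borel"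
    using L f(1) L2_measurable by fastforce+
  have B: "B \<ge> 0" using V(2)[of 0] by simp
  have i: "integrable lborel (\<lambda>x. V x * (cmod (f x))\<^sup>2)"
  proof (rule Bochner_Integration.integrable_bound)
    show "integrable lborel (\<lambda>x. B * (cmod (f x))\<^sup>2)" using L2_integrable_sq[OF L(1)] by simp
    show "(\<lambda>x. V x * (cmod (f x))\<^sup>2) \<in> borel_measurable lborel" using V(1) by simp
    show "AE x in lborel. norm (V x * (cmod (f x))\<^sup>2) \<le> norm (B * (cmod (f x))\<^sup>2)"
      using V(2) B by (auto simp: abs_mult intro!: mult_right_mono)
  qed
  have "l2_inner lborel g f = (LINT x|lborel. - (f2 x * cnj (f x)) + of_real (V x * (cmod (f x))\<^sup>2))"
    unfolding l2_inner_def
  proof (rule integral_cong_AE)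
    show "AE x in lborel. g x * cnj (f x) = - (f2 x * cnj (f x)) + of_real (V x * (cmod (f x))\<^sup>2)"
      using f(3)
    proof eventually_elim
      case (elim x)
      show ?case unfolding elim using complex_norm_square[of "f x"] by (simp add: algebra_simps)
    qed
  qed (use V(1) in auto)
  also have "\<dots> = (LINT x|lborel. - (f2 x * cnj (f x))) + (LINT x|lborel. of_real (V x * (cmod (f x))\<^sup>2))"
    by (rule Bochner_Integration.integral_add)
      (auto intro!: integrable_L2_mult L2_cnj L integrable_of_real i simp del: of_real_mult of_real_power)
  also have "(LINT x|lborel. complex_of_real (V x * (cmod (f x))\<^sup>2)) = of_real (LINT x|lborel. V x * (cmod (f x))\<^sup>2)"
    by (rule integral_complex_of_real)
  also have "(LINT x|lborel. - (f2 x * cnj (f x))) = of_real ((l2_norm lborel f1)\<^sup>2)"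
    using H2_form[OF f(2)] by simp
  finally have *: "l2_inner lborel g f = of_real ((l2_norm lborel f1)\<^sup>2 + (LINT x|lborel. V x * (cmod (f x))\<^sup>2))" by simp
  have "(LINT x|lborel. - B * (cmod (f x))\<^sup>2) \<le> (LINT x|lborel. V x * (cmod (f x))\<^sup>2)"
  proof (rule integral_mono[OF _ i])
    show "integrable lborel (\<lambda>x. - B * (cmod (f x))\<^sup>2)" using L2_integrable_sq[OF L(1)] by simp
    show "- B * (cmod (f x))\<^sup>2 \<le> V x * (cmod (f x))\<^sup>2" for x using V(2)[of x] by (intro mult_right_mono) auto
  qed
  hence "- B * (l2_norm lborel f)\<^sup>2 \<le> (LINT x|lborel. V x * (cmod (f x))\<^sup>2)"
    unfolding l2_norm_sq by simp
  thus thesis by (intro that[OF *]) (smt (verit) zero_le_power2)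
qed

text \<open>By Cauchy-Schwarz the form of T - t on f is at most the norm of (T - t) f times that of
  f; dividing by the norm of f turns a distance from the numerical range into a lower bound for the
  operator.\<close>

lemma bdd_below_at_of_form:
  assumes "\<And>f g. (f, g) \<in> T \<Longrightarrow> f \<in> L2 M \<and> g \<in> L2 M \<and> m * (l2_norm M f)\<^sup>2 \<le> cmod (l2_inner M (\<lambda>x. g x - t * f x) f)"
  shows "bdd_below_at M T t m"
  unfolding bdd_below_at_def
proof (intro allI impI)
  fix f g assume "(f, g) \<in> T"
  from assms[OF this] have L: "f \<in> L2 M" "g \<in> L2 M" and i: "m * (l2_norm M f)\<^sup>2 \<le> cmod (l2_inner M (\<lambda>x. g x - t * f x) f)" by auto
  have "m * (l2_norm M f)\<^sup>2 \<le> l2_norm M (\<lambda>x. g x - t * f x) * l2_norm M f"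
    using i Cauchy_Schwarz_L2[OF L2_diff[OF L(2) L2_scale[OF L(1)]] L(1), of t] by simp
  thus "m * l2_norm M f \<le> l2_norm M (\<lambda>x. g x - t * f x)"
    using l2_norm_nonneg[of M f] by (cases "l2_norm M f = 0") (auto simp: power2_eq_square)
qed

lemma l2_inner_shift:
  assumes "f \<in> L2 M" "g \<in> L2 M"
  shows "l2_inner M (\<lambda>x. g x - t * f x) f = l2_inner M g f - t * of_real ((l2_norm M f)\<^sup>2)"
proof -
  have "l2_inner M (\<lambda>x. g x - t * f x) f = (LINT x|M. g x * cnj (f x) - t * (f x * cnj (f x)))"
    unfolding l2_inner_def by (simp add: algebra_simps)
  also have "\<dots> = l2_inner M g f - t * l2_inner M f f"
    unfolding l2_inner_def by (simp add: integrable_L2_mult L2_cnj assms)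
  finally show ?thesis by (simp add: l2_norm_sq_inner)
qed

text \<open>The form of \<open>H_R\<close> is real, so t alone contributes to the imaginary
  part.\<close>

lemma bdd_below_H_R_Im:
  assumes V: "V \<in> borel_measurable borel" "\<And>x. \<bar>V x\<bar> \<le> B"
  shows "bdd_below_at lborel (H_R V) t \<bar>Im t\<bar>"
proof (rule bdd_below_at_of_form)
  fix f g assume fg: "(f, g) \<in> H_R V"
  note L = H_R_L2[OF fg]
  obtain r where r: "l2_inner lborel g f = of_real r" using H_R_form[OF V fg] by blast
  have "Im (l2_inner lborel (\<lambda>x. g x - t * f x) f) = - Im t * (l2_norm lborel f)\<^sup>2"
    using L by (simp add: l2_inner_shift r)
  hence "\<bar>Im t\<bar> * (l2_norm lborel f)\<^sup>2 = \<bar>Im (l2_inner lborel (\<lambda>x. g x - t * f x) f)\<bar>" by (simp add: abs_mult)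
  also have "\<dots> \<le> cmod (l2_inner lborel (\<lambda>x. g x - t * f x) f)" by (rule abs_Im_le_cmod)
  finally show "f \<in> L2 lborel \<and> g \<in> L2 lborel \<and> \<bar>Im t\<bar> * (l2_norm lborel f)\<^sup>2 \<le> cmod (l2_inner lborel (\<lambda>x. g x - t * f x) f)"
    using L by simp
qed

text \<open>The form of \<open>H_R\<close> is at least -B times the squared norm, so points to the
  left of -B are controlled by their horizontal distance from it.\<close>

lemma bdd_below_H_R_Re:
  assumes V: "V \<in> borel_measurable borel" "\<And>x. \<bar>V x\<bar> \<le> B"
  shows "bdd_below_at lborel (H_R V) t (- B - Re t)"
proof (rule bdd_below_at_of_form)
  fix f g assume fg: "(f, g) \<in> H_R V"
  note L = H_R_L2[OF fg]
  obtain r where r: "l2_inner lborel g f = of_real r" "r \<ge> - B * (l2_norm lborel f)\<^sup>2" using H_R_form[OF V fg] by blast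
  have "Re (l2_inner lborel (\<lambda>x. g x - t * f x) f) = r - Re t * (l2_norm lborel f)\<^sup>2"
    using L by (simp add: l2_inner_shift r)
  hence "(- B - Re t) * (l2_norm lborel f)\<^sup>2 \<le> Re (l2_inner lborel (\<lambda>x. g x - t * f x) f)" using r(2) by (simp add: algebra_simps)
  also have "\<dots> \<le> cmod (l2_inner lborel (\<lambda>x. g x - t * f x) f)" by (rule complex_Re_le_cmod)
  finally show "f \<in> L2 lborel \<and> g \<in> L2 lborel \<and> (- B - Re t) * (l2_norm lborel f)\<^sup>2 \<le> cmod (l2_inner lborel (\<lambda>x. g x - t * f x) f)"
    using L by simp
qed

section \<open>The Green's function of d/dx + kappa and the free resolvent\<close>

definition causal_conv :: "real \<Rightarrow> (real \<Rightarrow> complex) \<Rightarrow> real \<Rightarrow> complex" where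
  "causal_conv \<kappa> h x = (LINT t|lborel. of_real (indicator {0..} (x - t) * exp (- \<kappa> * (x - t))) * h t)"

lemma exp_kernel_nn_integral:
  assumes "\<kappa> > 0"
  shows "(\<integral>\<^sup>+t. ennreal (indicator {0..} t * exp (- \<kappa> * t)) \<partial>lborel) = ennreal (1 / \<kappa>)"
proof -
  have "(\<integral>\<^sup>+t. ennreal (exp (- \<kappa> * t)) * indicator {0..} t \<partial>lborel) = ennreal (0 - (- exp (- \<kappa> * 0) / \<kappa>))"
  proof (rule nn_integral_FTC_atLeast)
    show "((\<lambda>t. - exp (- \<kappa> * t) / \<kappa>) has_real_derivative exp (- \<kappa> * t)) (at t)" for t
      using assms by (auto intro!: derivative_eq_intros)
    have "((\<lambda>t. exp (- (\<kappa> * t))) \<longlongrightarrow> 0) at_top"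
      by (rule filterlim_compose[OF exp_at_bot])
         (use assms in \<open>auto intro!: filterlim_tendsto_pos_mult_at_top filterlim_ident simp: filterlim_uminus_at_top[symmetric]\<close>)
    from tendsto_divide[OF tendsto_minus[OF this] tendsto_const, of \<kappa>]
    show "((\<lambda>t. - exp (- \<kappa> * t) / \<kappa>) \<longlongrightarrow> 0) at_top" using assms by simp
  qed auto
  moreover have "ennreal (exp (- \<kappa> * t)) * indicator {0..} t = ennreal (indicator {0..} t * exp (- \<kappa> * t))" for t
    by (auto simp: indicator_def)
  ultimately show ?thesis by simp
qed

text \<open>Schur test: the kernel has mass 1 / kappa in each variable. Cauchy-Schwarz is applied to
  the kernel split into two square roots, and Tonelli then integrates the remaining factor.\<close>

lemma causal_conv_L2:
  assumes k: "\<kappa> > 0" and h: "h \<in> L2 lborel"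
  shows "causal_conv \<kappa> h \<in> L2 lborel"
proof -
  have [measurable]: "h \<in> borel_measurable borel" using L2_measurable[OF h] by simp
  define K where "K t = indicator {0..} t * exp (- \<kappa> * t)" for t :: real
  have [measurable]: "K \<in> borel_measurable borel" unfolding K_def by measurable
  have K0: "0 \<le> K t" for t by (simp add: K_def)
  have cc: "causal_conv \<kappa> h = (\<lambda>x. LINT t|lborel. of_real (K (x - t)) * h t)"
    by (simp add: causal_conv_def[abs_def] K_def)
  have m: "causal_conv \<kappa> h \<in> borel_measurable lborel"
    unfolding cc by measurable
  have K1: "(\<integral>\<^sup>+t. ennreal (K (x - t)) \<partial>lborel) = ennreal (1 / \<kappa>)" for x
  proof -
    have "(\<integral>\<^sup>+t. ennreal (K t) \<partial>lborel) = (\<integral>\<^sup>+t. ennreal (K (x + (-1) * t)) \<partial>lborel)"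
      by (subst nn_integral_real_affine[where c = "-1" and t = x]) auto
    thus ?thesis using exp_kernel_nn_integral[OF k] by (simp add: K_def)
  qed
  have K2: "(\<integral>\<^sup>+x. ennreal (K (x - t)) \<partial>lborel) = ennreal (1 / \<kappa>)" for t
  proof -
    have "(\<integral>\<^sup>+x. ennreal (K x) \<partial>lborel) = (\<integral>\<^sup>+x. ennreal (K (-t + 1 * x)) \<partial>lborel)"
      by (subst nn_integral_real_affine[where c = "1" and t = "-t"]) auto
    thus ?thesis using exp_kernel_nn_integral[OF k] by (simp add: K_def)
  qed
  have pt: "ennreal ((cmod (causal_conv \<kappa> h x))\<^sup>2) \<le> ennreal (1 / \<kappa>) * (\<integral>\<^sup>+t. ennreal (K (x - t) * (cmod (h t))\<^sup>2) \<partial>lborel)" for x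
  proof (cases "(\<integral>\<^sup>+t. ennreal (K (x - t) * (cmod (h t))\<^sup>2) \<partial>lborel) = \<infinity>")
    case True
    thus ?thesis using k by (simp add: ennreal_mult_top)
  next
    case False
    define f1 f2 where "f1 t = complex_of_real (sqrt (K (x - t)))" and "f2 t = complex_of_real (sqrt (K (x - t))) * h t" for t
    have f1sq: "(cmod (f1 t))\<^sup>2 = K (x - t)" for t using K0 by (simp add: f1_def)
    have f2sq: "(cmod (f2 t))\<^sup>2 = K (x - t) * (cmod (h t))\<^sup>2" for t using K0 by (simp add: f2_def norm_mult power_mult_distrib)
    have [measurable]: "f1 \<in> borel_measurable borel" "f2 \<in> borel_measurable borel"
      unfolding f1_def f2_def by measurable
    have n1: "f1 \<in> L2 lborel" by (rule L2_nn_integralI) (auto simp: f1sq K1)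
    have n2: "f2 \<in> L2 lborel" by (rule L2_nn_integralI) (use False in \<open>auto simp: f2sq less_top\<close>)
    have "causal_conv \<kappa> h x = (LINT t|lborel. f1 t * f2 t)"
      unfolding cc by (rule Bochner_Integration.integral_cong[OF refl])
        (simp add: f1_def f2_def K0 flip: of_real_mult mult.assoc)
    hence "cmod (causal_conv \<kappa> h x) \<le> l2_norm lborel f1 * l2_norm lborel f2"
      using Cauchy_Schwarz_mult[OF n1 n2] by simp
    hence "(cmod (causal_conv \<kappa> h x))\<^sup>2 \<le> (l2_norm lborel f1)\<^sup>2 * (l2_norm lborel f2)\<^sup>2"
      unfolding power_mult_distrib[symmetric] by (intro power_mono) auto
    hence "ennreal ((cmod (causal_conv \<kappa> h x))\<^sup>2) \<le> ennreal ((l2_norm lborel f1)\<^sup>2) * ennreal ((l2_norm lborel f2)\<^sup>2)"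
      by (subst ennreal_mult[symmetric]) (auto intro: ennreal_leI)
    thus ?thesis unfolding nn_integral_L2[OF n1, symmetric] nn_integral_L2[OF n2, symmetric] f1sq f2sq K1 .
  qed
  have "(\<integral>\<^sup>+x. ennreal ((cmod (causal_conv \<kappa> h x))\<^sup>2) \<partial>lborel) \<le>
     (\<integral>\<^sup>+x. ennreal (1 / \<kappa>) * (\<integral>\<^sup>+t. ennreal (K (x - t) * (cmod (h t))\<^sup>2) \<partial>lborel) \<partial>lborel)"
    by (intro nn_integral_mono pt)
  also have "\<dots> = ennreal (1 / \<kappa>) * (\<integral>\<^sup>+x. (\<integral>\<^sup>+t. ennreal (K (x - t) * (cmod (h t))\<^sup>2) \<partial>lborel) \<partial>lborel)"
    by (subst nn_integral_cmult) auto
  also have "(\<integral>\<^sup>+x. (\<integral>\<^sup>+t. ennreal (K (x - t) * (cmod (h t))\<^sup>2) \<partial>lborel) \<partial>lborel) =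
      (\<integral>\<^sup>+t. (\<integral>\<^sup>+x. ennreal (K (x - t) * (cmod (h t))\<^sup>2) \<partial>lborel) \<partial>lborel)"
    by (subst lborel_pair.Fubini') auto
  also have "\<dots> = (\<integral>\<^sup>+t. ennreal ((cmod (h t))\<^sup>2) * ennreal (1 / \<kappa>) \<partial>lborel)"
  proof (rule nn_integral_cong)
    fix t
    have "(\<integral>\<^sup>+x. ennreal (K (x - t) * (cmod (h t))\<^sup>2) \<partial>lborel) = (\<integral>\<^sup>+x. ennreal ((cmod (h t))\<^sup>2) * ennreal (K (x - t)) \<partial>lborel)"
      by (intro nn_integral_cong) (simp add: K0 ennreal_mult mult.commute)
    also have "\<dots> = ennreal ((cmod (h t))\<^sup>2) * ennreal (1 / \<kappa>)"
      by (subst nn_integral_cmult) (auto simp: K2)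
    finally show "(\<integral>\<^sup>+x. ennreal (K (x - t) * (cmod (h t))\<^sup>2) \<partial>lborel) = ennreal ((cmod (h t))\<^sup>2) * ennreal (1 / \<kappa>)" .
  qed
  also have "\<dots> = (\<integral>\<^sup>+t. ennreal ((cmod (h t))\<^sup>2) \<partial>lborel) * ennreal (1 / \<kappa>)"
    by (rule nn_integral_multc) simp
  also have "ennreal (1 / \<kappa>) * ((\<integral>\<^sup>+t. ennreal ((cmod (h t))\<^sup>2) \<partial>lborel) * ennreal (1 / \<kappa>)) < \<infinity>"
    unfolding nn_integral_L2[OF h] by (simp add: ennreal_mult_less_top)
  finally show ?thesis by (intro L2_nn_integralI m)
qed

text \<open>The convolution is exp(-kappa x) P(x), where P is the integral of exp(kappa t) h(t) up
  to x; integration by parts is the product rule for this factorisation, valid although P is only a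
  primitive in the integral sense.\<close>

lemma causal_conv_prim:
  assumes k: "\<kappa> > 0" and h: "h \<in> L2 lborel"
  shows "is_prim UNIV (causal_conv \<kappa> h) (\<lambda>x. h x - of_real \<kappa> * causal_conv \<kappa> h x)"
  unfolding is_prim_def
proof (intro ballI impI)
  fix p q :: real assume pq: "p \<le> q"
  have [measurable]: "h \<in> borel_measurable borel" using L2_measurable[OF h] by simp
  define e where "e t = complex_of_real (exp (\<kappa> * t)) * h t" for t
  define P where "P x = (LINT t:{..x}|lborel. e t)" for x
  \<comment> \<open>exp(kappa t) decays to the left, so it is square integrable on the half-line up
    to x; multiplied with h in L2 it becomes integrable there.\<close>
  have ei: "set_integrable lborel {..x} e" for x
  proof -
    define w where "w t = complex_of_real (indicator {..x} t * exp (\<kappa> * t))" for t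
    have "(\<integral>\<^sup>+t. ennreal ((cmod (w t))\<^sup>2) \<partial>lborel) = (\<integral>\<^sup>+t. ennreal (exp (2 * \<kappa> * x)) * ennreal (indicator {0..} (x + (-1) * t) * exp (- (2 * \<kappa>) * (x + (-1) * t))) \<partial>lborel)"
    proof (rule nn_integral_cong)
      fix t
      have "(cmod (w t))\<^sup>2 = exp (2 * \<kappa> * x) * (indicator {0..} (x + (-1) * t) * exp (- (2 * \<kappa>) * (x + (-1) * t)))"
        by (auto simp: w_def indicator_def power2_eq_square algebra_simps simp flip: exp_add)
      thus "ennreal ((cmod (w t))\<^sup>2) = ennreal (exp (2 * \<kappa> * x)) * ennreal (indicator {0..} (x + (-1) * t) * exp (- (2 * \<kappa>) * (x + (-1) * t)))"
        by (simp add: ennreal_mult)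
    qed
    also have "\<dots> = ennreal (exp (2 * \<kappa> * x)) * (\<integral>\<^sup>+t. ennreal (indicator {0..} (x + (-1) * t) * exp (- (2 * \<kappa>) * (x + (-1) * t))) \<partial>lborel)"
      by (rule nn_integral_cmult) measurable
    also have "(\<integral>\<^sup>+t. ennreal (indicator {0..} (x + (-1) * t) * exp (- (2 * \<kappa>) * (x + (-1) * t))) \<partial>lborel) = (\<integral>\<^sup>+t. ennreal (indicator {0..} t * exp (- (2 * \<kappa>) * t)) \<partial>lborel)"
      using nn_integral_real_affine[of "\<lambda>t. ennreal (indicator {0..} t * exp (- (2 * \<kappa>) * t))" "-1" x] by simp
    also have "\<dots> = ennreal (1 / (2 * \<kappa>))" using exp_kernel_nn_integral[of "2 * \<kappa>"] k by simp
    also have "ennreal (exp (2 * \<kappa> * x)) * ennreal (1 / (2 * \<kappa>)) < \<infinity>" by (simp add: ennreal_mult_less_top)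
    finally have "w \<in> L2 lborel" by (intro L2_nn_integralI) (auto simp: w_def[abs_def])
    from integrable_L2_mult[OF this h] have "integrable lborel (\<lambda>t. w t * h t)" .
    moreover have "(\<lambda>t. w t * h t) = (\<lambda>t. indicator {..x} t *\<^sub>R e t)"
      by (auto simp: fun_eq_iff w_def e_def indicator_def)
    ultimately show ?thesis by (simp add: set_integrable_def)
  qed
  have cP: "causal_conv \<kappa> h x = P x * of_real (exp (- \<kappa> * x))" for x
  proof -
    have "of_real (indicator {0..} (x - t) * exp (- \<kappa> * (x - t))) * h t = (indicator {..x} t *\<^sub>R e t) * of_real (exp (- \<kappa> * x))" for t
      by (auto simp: indicator_def e_def right_diff_distrib exp_diff exp_minus field_simps)
    thus ?thesis unfolding causal_conv_def P_def set_lebesgue_integral_def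
      by (simp only: integral_mult_left_zero)
  qed
  have Pd: "P x - P p = (LINT t:{p..x}|lborel. e t)" if "x \<in> {p..q}" for x
  proof -
    have "P x = (LINT t:{..p} \<union> {p<..x}|lborel. e t)"
      unfolding P_def using that by (intro arg_cong[where f = "\<lambda>A. set_lebesgue_integral lborel A e"]) auto
    also have "\<dots> = P p + (LINT t:{p<..x}|lborel. e t)"
      unfolding P_def by (rule set_integral_Un) (auto intro!: set_integrable_subset[OF ei[of x]] ei)
    also have "(LINT t:{p<..x}|lborel. e t) = (LINT t:{p..x}|lborel. e t)"
      unfolding set_lebesgue_integral_def
    proof (rule integral_cong_AE)
      show "AE t in lborel. indicat_real {p<..x} t *\<^sub>R e t = indicat_real {p..x} t *\<^sub>R e t"
        using AE_lborel_singleton[of p] by eventually_elim (auto simp: indicator_def)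
    qed (auto simp: e_def)
    finally show ?thesis by simp
  qed
  have ei2: "set_integrable lborel {p..q} e" by (rule set_integrable_subset[OF ei[of q]]) auto
  have "(LINT x:{p..q}|lborel. P x * of_real (- \<kappa> * exp (- \<kappa> * x))) + (LINT x:{p..q}|lborel. e x * of_real (exp (- \<kappa> * x)))
      = P q * of_real (exp (- \<kappa> * q)) - P p * of_real (exp (- \<kappa> * p))"
  proof (rule integral_by_parts_AC[OF pq ei2 Pd])
    fix x
    have "((\<lambda>x. exp (- \<kappa> * x)) has_real_derivative - \<kappa> * exp (- \<kappa> * x)) (at x within {p..q})"
      by (auto intro!: derivative_eq_intros)
    thus "((\<lambda>x. complex_of_real (exp (- \<kappa> * x))) has_vector_derivative complex_of_real (- \<kappa> * exp (- \<kappa> * x))) (at x within {p..q})"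
      by (intro has_vector_derivative_of_real) (simp add: has_real_derivative_iff_has_vector_derivative)
  qed (auto intro!: continuous_intros)
  moreover have "P x * of_real (- \<kappa> * exp (- \<kappa> * x)) = - (of_real \<kappa> * causal_conv \<kappa> h x)" for x by (simp add: cP)
  moreover have "e x * of_real (exp (- \<kappa> * x)) = h x" for x
    by (simp add: e_def exp_minus flip: of_real_mult)
  ultimately have *: "(LINT x:{p..q}|lborel. - (of_real \<kappa> * causal_conv \<kappa> h x)) + (LINT x:{p..q}|lborel. h x) = causal_conv \<kappa> h q - causal_conv \<kappa> h p"
    by (simp only: cP)
  have si: "set_integrable lborel {p..q} f" if "f \<in> L2 lborel" for f
    using L2_loc_integrable[OF interval_open_UNIV, of f] that by (simp add: loc_integrable_def)
  have "(LINT x:{p..q}|lborel. h x - of_real \<kappa> * causal_conv \<kappa> h x) = (LINT x:{p..q}|lborel. h x) - (LINT x:{p..q}|lborel. of_real \<kappa> * causal_conv \<kappa> h x)"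
    by (intro set_integral_diff(2) si h L2_scale causal_conv_L2[OF k h])
  thus "causal_conv \<kappa> h q - causal_conv \<kappa> h p = (LINT x:{p..q}|lborel. h x - of_real \<kappa> * causal_conv \<kappa> h x)"
    using * by (simp add: set_integral_uminus si L2_scale causal_conv_L2[OF k h])
qed

lemma L2_loc_UNIV: "f \<in> L2 lborel \<Longrightarrow> loc_integrable UNIV f"
  using L2_loc_integrable[OF interval_open_UNIV, of f] by simp

lemma causal_conv_weak:
  assumes k: "\<kappa> > 0" and h: "h \<in> L2 lborel"
  shows "weak_deriv UNIV (causal_conv \<kappa> h) (\<lambda>x. h x - of_real \<kappa> * causal_conv \<kappa> h x)"
  by (rule weak_deriv_of_prim[OF interval_open_UNIV L2_loc_UNIV causal_conv_prim[OF k h]])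
    (intro L2_diff L2_scale h causal_conv_L2[OF k h])

lemma l2_reflect:
  fixes f :: "real \<Rightarrow> complex"
  assumes "f \<in> L2 lborel"
  shows "(\<lambda>x. f (- x)) \<in> L2 lborel"
proof -
  have [measurable]: "f \<in> borel_measurable borel" using L2_measurable[OF assms] by simp
  have "(\<integral>\<^sup>+x. ennreal ((cmod (f x))\<^sup>2) \<partial>lborel) = (\<integral>\<^sup>+x. ennreal ((cmod (f (0 + (-1) * x)))\<^sup>2) \<partial>lborel)"
    by (subst nn_integral_real_affine[where c = "-1" and t = 0]) auto
  hence "(\<integral>\<^sup>+x. ennreal ((cmod (f (- x)))\<^sup>2) \<partial>lborel) = ennreal ((l2_norm lborel f)\<^sup>2)"
    using nn_integral_L2[OF assms] by simp
  thus ?thesis by (intro L2_nn_integralI) auto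
qed

lemma is_prim_reflect:
  assumes "is_prim UNIV G g"
  shows "is_prim UNIV (\<lambda>x. G (- x)) (\<lambda>x. - g (- x))"
  unfolding is_prim_def
proof (intro ballI impI)
  fix p q :: real assume pq: "p \<le> q"
  have "(LINT x|lborel. indicator {-q..-p} x *\<^sub>R g x) = \<bar>-1\<bar> *\<^sub>R (LINT x|lborel. indicator {-q..-p} (0 + (-1) * x) *\<^sub>R g (0 + (-1) * x))"
    by (rule lborel_integral_real_affine) simp
  also have "\<dots> = (LINT x:{p..q}|lborel. g (- x))"
    unfolding set_lebesgue_integral_def
    by (simp, rule Bochner_Integration.integral_cong[OF refl]) (auto simp: indicator_def)
  finally have "G (- p) - G (- q) = (LINT x:{p..q}|lborel. g (- x))"
    using is_primD[OF assms, of "-q" "-p"] pq by (simp add: set_lebesgue_integral_def)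
  thus "G (- q) - G (- p) = (LINT x:{p..q}|lborel. - g (- x))"
    by (simp add: set_lebesgue_integral_def) (metis minus_diff_eq)
qed

text \<open>The factorisation \<open>- d\<^sup>2/dx\<^sup>2 + \<kappa>\<^sup>2 = (\<kappa> - d/dx) (\<kappa> + d/dx)\<close> inverts the free operator.\<close>

lemma surj_at_H_R_free:
  assumes k: "\<kappa> > 0"
  shows "surj_at lborel (H_R (\<lambda>_. 0)) (- of_real (\<kappa>\<^sup>2))"
  unfolding surj_at_def
proof
  fix h :: "real \<Rightarrow> complex" assume h: "h \<in> L2 lborel"
  define g where "g = causal_conv \<kappa> h"
  have g: "g \<in> L2 lborel" unfolding g_def by (rule causal_conv_L2[OF k h])
  \<comment> \<open>The second factor kappa - d/dx becomes kappa + d/dx after the reflection x ->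
    -x, so the same convolution inverts both factors.\<close>
  define G where "G = causal_conv \<kappa> (\<lambda>x. g (- x))"
  have G: "G \<in> L2 lborel" unfolding G_def by (rule causal_conv_L2[OF k l2_reflect[OF g]])
  define f where "f x = G (- x)" for x
  have f: "f \<in> L2 lborel" unfolding f_def by (rule l2_reflect[OF G])
  have "is_prim UNIV f (\<lambda>x. - (g (- (- x)) - of_real \<kappa> * G (- x)))"
    unfolding f_def by (rule is_prim_reflect) (use causal_conv_prim[OF k l2_reflect[OF g]] in \<open>simp add: G_def\<close>)
  hence "is_prim UNIV f (\<lambda>x. of_real \<kappa> * f x + (-1) * g x)" by (simp add: f_def)
  hence w1: "weak_deriv UNIV f (\<lambda>x. of_real \<kappa> * f x + (-1) * g x)"
    by (rule weak_deriv_of_prim[OF interval_open_UNIV L2_loc_UNIV[OF L2_add[OF L2_scale[OF f] L2_scale[OF g]]]])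
  have w0: "weak_deriv UNIV g (\<lambda>x. h x - of_real \<kappa> * g x)" unfolding g_def by (rule causal_conv_weak[OF k h])
  have L1: "(\<lambda>x. of_real \<kappa> * f x + (-1) * g x) \<in> L2 lborel" "(\<lambda>x. h x - of_real \<kappa> * g x) \<in> L2 lborel"
    by (intro L2_add L2_diff L2_scale f g h)+
  \<comment> \<open>This is kappa^2 f - h, in the form in which the two factors deliver the second
    weak derivative.\<close>
  define f2 where "f2 x = of_real \<kappa> * (of_real \<kappa> * f x + (-1) * g x) + (-1) * (h x - of_real \<kappa> * g x)" for x
  have w2: "weak_deriv UNIV (\<lambda>x. of_real \<kappa> * f x + (-1) * g x) f2"
    unfolding f2_def by (rule weak_deriv_lincomb[OF interval_open_UNIV]) (use f g L1 w0 w1 in simp_all)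
  have f2L: "f2 \<in> L2 lborel" unfolding f2_def by (intro L2_add L2_scale L1)
  have "H2_derivs UNIV f (\<lambda>x. of_real \<kappa> * f x + (-1) * g x) f2"
    unfolding H2_derivs_def meas_on_UNIV using f L1 f2L w1 w2 by blast
  hence "(f, \<lambda>x. - f2 x) \<in> H_R (\<lambda>_. 0)"
    unfolding H_R_def meas_on_UNIV using L2_uminus[OF f2L] by (auto intro!: exI)
  moreover have "- f2 x - - of_real (\<kappa>\<^sup>2) * f x = h x" for x
    by (simp add: f2_def power2_eq_square algebra_simps)
  ultimately show "\<exists>f g. (f, g) \<in> H_R (\<lambda>_. 0) \<and> (AE x in lborel. g x - - of_real (\<kappa>\<^sup>2) * f x = h x)"
    by (intro exI[of _ f] exI[of _ "\<lambda>x. - f2 x"]) auto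
qed

section \<open>Surjectivity and the spectrum of \<open>H_R\<close>\<close>

lemma H_R_add_potential:
  assumes V: "V \<in> borel_measurable borel" "\<And>x. \<bar>V x\<bar> \<le> B" and fg: "(f, g) \<in> H_R (\<lambda>_. 0)"
  shows "(f, \<lambda>x. g x + of_real (V x) * f x) \<in> H_R V"
proof -
  obtain f1 f2 where f: "g \<in> L2 lborel" "H2_derivs UNIV f f1 f2" "AE x in lborel. g x = - f2 x + of_real 0 * f x"
    using H_RE[OF fg] by metis
  have fL: "f \<in> L2 lborel" using H_R_L2[OF fg] by simp
  have mm: "(\<lambda>x. complex_of_real (V x) * f x) \<in> borel_measurable lborel"
    using V(1) L2_measurable[OF fL] by simp
  have "(\<lambda>x. complex_of_real (V x) * f x) \<in> L2 lborel"
    by (rule L2_bound[OF fL mm, where C = B]) (use V(2) in \<open>auto simp: norm_mult intro!: mult_right_mono\<close>)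
  hence "(\<lambda>x. g x + of_real (V x) * f x) \<in> L2 lborel" by (intro L2_add f)
  moreover have "AE x in lborel. g x + of_real (V x) * f x = - f2 x + of_real (V x) * f x"
    using f(3) by eventually_elim simp
  ultimately show ?thesis unfolding H_R_def meas_on_UNIV using f(2) by blast
qed

text \<open>Self-adjointness enters here: wherever \<open>H_R\<close> is bounded below it is onto.
  Surjectivity is known far to the left; it is carried to every nonreal point and from there
  vertically to a real point, so that no path has to cross the spectrum.\<close>

lemma surj_at_H_R:
  assumes V: "V \<in> borel_measurable borel" "\<And>x. \<bar>V x\<bar> \<le> B" and b: "bdd_below_at lborel (H_R V) t m" and m: "m > 0"
  shows "surj_at lborel (H_R V) t"
proof -
  have B: "0 \<le> B" using V(2)[of 0] by simp
  \<comment> \<open>At -kappa^2 the free operator is bounded below by kappa^2 = B + 1, strictly more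
    than the bound B of the potential that perturbs it.\<close>
  define \<kappa> where "\<kappa> = sqrt (B + 1)"
  have k: "\<kappa> > 0" "\<kappa>\<^sup>2 = B + 1" using B by (auto simp: \<kappa>_def)
  define t0 where "t0 = - complex_of_real (\<kappa>\<^sup>2)"
  have "bdd_below_at lborel (H_R (\<lambda>_. 0)) t0 (- 0 - Re t0)" by (rule bdd_below_H_R_Re) auto
  hence b0: "bdd_below_at lborel (H_R (\<lambda>_. 0)) t0 (B + 1)" using k(2) by (simp add: t0_def add.commute)
  have s0: "surj_at lborel (H_R V) t0"
    unfolding surj_at_def
  proof
    fix h :: "real \<Rightarrow> complex" assume h: "h \<in> L2 lborel"
    have "\<forall>h\<in>L2 lborel. \<exists>f g. (f, g) \<in> H_R (\<lambda>_. 0) \<and> (AE x in lborel. g x - t0 * f x + of_real (V x) * f x = h x)"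
      by (rule surj_at_perturb[OF diff_closed_H_R _ b0, where c = B])
        (use surj_at_H_R_free[OF k(1)] V in \<open>auto simp: t0_def\<close>)
    then obtain f g where fg: "(f, g) \<in> H_R (\<lambda>_. 0)" "AE x in lborel. g x - t0 * f x + of_real (V x) * f x = h x"
      using h by blast
    have "AE x in lborel. (g x + of_real (V x) * f x) - t0 * f x = h x"
      using fg(2) by eventually_elim (simp add: algebra_simps)
    thus "\<exists>f g. (f, g) \<in> H_R V \<and> (AE x in lborel. g x - t0 * f x = h x)"
      using H_R_add_potential[OF V fg(1)] by blast
  qed
  have nonreal: "surj_at lborel (H_R V) z" if z: "Im z \<noteq> 0" for z
  proof -
    \<comment> \<open>Along the segment from t0 to z two bounds compete. The real part gives 1 - s
      (Re z + kappa^2), which is at least 1/2 while s K <= 1/2; after that s |Im z| takes over.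
      \<open>m'\<close> is the smaller of the two values at the switch.\<close>
    define K where "K = \<bar>Re z + \<kappa>\<^sup>2\<bar> + 1"
    have K: "K > 0" by (simp add: K_def add_nonneg_pos)
    define m' where "m' = min (1/2) (\<bar>Im z\<bar> / (2 * K))"
    have m': "m' > 0" using K z by (simp add: m'_def)
    show ?thesis
    proof (rule surj_at_segment[OF diff_closed_H_R s0 m'])
      fix s :: real assume s: "0 \<le> s" "s \<le> 1"
      define w where "w = t0 + of_real s * (z - t0)"
      have Re: "- B - Re w = 1 - s * (Re z + \<kappa>\<^sup>2)" using k(2) by (simp add: w_def t0_def algebra_simps)
      have Im: "\<bar>Im w\<bar> = s * \<bar>Im z\<bar>" using s by (simp add: w_def t0_def abs_mult)
      show "bdd_below_at lborel (H_R V) (t0 + of_real s * (z - t0)) m'"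
      proof (cases "s * K \<le> 1/2")
        case True
        have "s * (Re z + \<kappa>\<^sup>2) \<le> s * K" using s by (intro mult_left_mono) (auto simp: K_def)
        hence "m' \<le> - B - Re w" using True Re by (simp add: m'_def)
        thus ?thesis using bdd_below_at_mono[OF bdd_below_H_R_Re[OF V, of w]] by (simp add: w_def)
      next
        case False
        hence "1 / (2 * K) \<le> s" using K by (simp add: field_simps)
        hence "1 / (2 * K) * \<bar>Im z\<bar> \<le> s * \<bar>Im z\<bar>" by (intro mult_right_mono) auto
        hence "m' \<le> \<bar>Im w\<bar>" by (simp add: m'_def Im)
        thus ?thesis using bdd_below_at_mono[OF bdd_below_H_R_Im[OF V, of w]] by (simp add: w_def)
      qed
    qed
  qed
  show ?thesis
  proof (cases "Im t = 0")
    case True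
    \<comment> \<open>At height m / 2 above t the point is nonreal, and on the way down its distance
      from t is at most m / 2, so half of the bound m survives.\<close>
    define z where "z = t + \<i> * of_real (m / 2)"
    have sz: "surj_at lborel (H_R V) z" by (rule nonreal) (use True m in \<open>simp add: z_def\<close>)
    show ?thesis
    proof (rule surj_at_segment[OF diff_closed_H_R sz, of "m / 2"])
      fix s :: real assume s: "0 \<le> s" "s \<le> 1"
      have "z + of_real s * (t - z) - t = of_real ((1 - s) * (m / 2)) * \<i>" by (simp add: z_def algebra_simps)
      hence "cmod (z + of_real s * (t - z) - t) = (1 - s) * (m / 2)"
        using s m by (simp only: norm_mult norm_of_real) simp
      also have "\<dots> \<le> 1 * (m / 2)" using s m by (intro mult_right_mono) auto
      finally have "m / 2 \<le> m - cmod (z + of_real s * (t - z) - t)" by simp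
      thus "bdd_below_at lborel (H_R V) (z + of_real s * (t - z)) (m / 2)"
        using bdd_below_at_mono[OF bdd_below_at_shift[OF b]] diff_closed_H_R by (auto simp: diff_closed_def)
    qed (use m in simp)
  qed (rule nonreal)
qed

text \<open>There is no residual spectrum: boundedness below already forces surjectivity. In this
  form the spectrum feeds both the tensor products, through failing bounds, and the coefficient
  estimates, through valid ones.\<close>

lemma spectrum_H_R:
  assumes V: "V \<in> borel_measurable borel" "\<And>x. \<bar>V x\<bar> \<le> B"
  shows "t \<in> spectrum lborel (H_R V) \<longleftrightarrow> (\<forall>m>0. \<not> bdd_below_at lborel (H_R V) t m)"
proof
  assume t: "t \<in> spectrum lborel (H_R V)"
  show "\<forall>m>0. \<not> bdd_below_at lborel (H_R V) t m"
  proof (intro allI impI notI)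
    fix m :: real assume m: "m > 0" and b: "bdd_below_at lborel (H_R V) t m"
    have "surj_at lborel (H_R V) t" by (rule surj_at_H_R[OF V b m])
    moreover have "\<forall>f g. (f, g) \<in> H_R V \<longrightarrow> l2_norm lborel f \<le> (1 / m) * l2_norm lborel (\<lambda>x. g x - t * f x)"
      using b m unfolding bdd_below_at_def by (simp add: field_simps)
    ultimately have "t \<in> resolvent_set lborel (H_R V)" unfolding resolvent_set_def surj_at_def by blast
    thus False using t by (simp add: spectrum_def)
  qed
next
  assume nb: "\<forall>m>0. \<not> bdd_below_at lborel (H_R V) t m"
  show "t \<in> spectrum lborel (H_R V)"
  proof (rule ccontr)
    assume "t \<notin> spectrum lborel (H_R V)"
    then obtain C where C: "\<And>f g. (f, g) \<in> H_R V \<Longrightarrow> l2_norm lborel f \<le> C * l2_norm lborel (\<lambda>x. g x - t * f x)"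
      by (auto simp: spectrum_def resolvent_set_def)
    \<comment> \<open>The resolvent bound C may be zero or negative; |C| + 1 is positive and
      larger.\<close>
    have "bdd_below_at lborel (H_R V) t (1 / (\<bar>C\<bar> + 1))"
      unfolding bdd_below_at_def
    proof (intro allI impI)
      fix f g assume "(f, g) \<in> H_R V"
      from C[OF this] have "l2_norm lborel f \<le> C * l2_norm lborel (\<lambda>x. g x - t * f x)" .
      also have "\<dots> \<le> (\<bar>C\<bar> + 1) * l2_norm lborel (\<lambda>x. g x - t * f x)" by (intro mult_right_mono) auto
      finally show "1 / (\<bar>C\<bar> + 1) * l2_norm lborel f \<le> l2_norm lborel (\<lambda>x. g x - t * f x)"
        by (simp add: field_simps add_pos_nonneg)
    qed
    moreover have "1 / (\<bar>C\<bar> + 1) > 0" by (simp add: add_nonneg_pos)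
    ultimately show False using nb by blast
  qed
qed

section \<open>Tensor products\<close>

lemma sigma_finite_meas_on: "S \<in> sets borel \<Longrightarrow> sigma_finite_measure (meas_on S)"
  unfolding meas_on_def by (rule sigma_finite_measure_restrict_space[OF sigma_finite_lborel]) simp

lemma space_meas_on [simp]: "space (meas_on S) = S"
  by (simp add: meas_on_def space_restrict_space)

text \<open>The strip carries restricted planar Lebesgue measure, while Fubini and the fibrewise
  arguments want a product measure; sigma-finiteness reduces their equality to rectangles.\<close>

lemma meas_on_Times_UNIV:
  assumes S: "S \<in> sets (borel :: real measure)"
  shows "meas_on (UNIV \<times> S :: (real \<times> real) set) = lborel \<Otimes>\<^sub>M meas_on S"
proof -
  have US: "(UNIV :: real set) \<times> S \<in> sets borel"
    unfolding borel_prod[symmetric] using S by (intro pair_measureI) auto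
  have sl: "sets (lborel :: (real \<times> real) measure) = sets ((borel :: real measure) \<Otimes>\<^sub>M (borel :: real measure))" unfolding borel_prod by simp
  have "lborel \<Otimes>\<^sub>M meas_on S = meas_on (UNIV \<times> S :: (real \<times> real) set)"
  proof (rule pair_measure_eqI[OF sigma_finite_lborel sigma_finite_meas_on[OF S]])
    show "sets (lborel \<Otimes>\<^sub>M meas_on S) = sets (meas_on (UNIV \<times> S :: (real \<times> real) set))"
    proof
      show "sets (lborel \<Otimes>\<^sub>M meas_on S) \<subseteq> sets (meas_on (UNIV \<times> S :: (real \<times> real) set))"
        unfolding sets_pair_measure
      proof (rule sets.sigma_sets_subset', safe)
        fix A B assume AB: "A \<in> sets (lborel :: real measure)" "B \<in> sets (meas_on S)"
        then obtain B' where B': "B' \<in> sets borel" "B = S \<inter> B'" by (auto simp: meas_on_def sets_restrict_space)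
        have "A \<times> B' \<in> sets (borel \<Otimes>\<^sub>M borel)" using AB(1) B'(1) by (intro pair_measureI) auto
        moreover have "A \<times> B = (UNIV \<times> S) \<inter> (A \<times> B')" using B'(2) by auto
        ultimately show "A \<times> B \<in> sets (meas_on (UNIV \<times> S :: (real \<times> real) set))"
          unfolding meas_on_def sets_restrict_space sl by blast
      next
        have "(UNIV :: real set) \<times> S \<in> sets (meas_on (UNIV \<times> S :: (real \<times> real) set))"
          using sets.top[of "meas_on (UNIV \<times> S :: (real \<times> real) set)"] by simp
        thus "space (lborel :: real measure) \<times> space (meas_on S) \<in> sets (meas_on (UNIV \<times> S :: (real \<times> real) set))" by simp
      qed
    next
      show "sets (meas_on (UNIV \<times> S :: (real \<times> real) set)) \<subseteq> sets (lborel \<Otimes>\<^sub>M meas_on S)"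
      proof
        fix C assume "C \<in> sets (meas_on (UNIV \<times> S :: (real \<times> real) set))"
        then obtain C' where C': "C' \<in> sets (borel \<Otimes>\<^sub>M borel)" "C = (UNIV \<times> S) \<inter> C'"
          unfolding meas_on_def sets_restrict_space sl by blast
        have i: "(\<lambda>x. x) \<in> measurable (meas_on S) borel"
          unfolding meas_on_def by (intro measurable_restrict_space1) simp
        have "(\<lambda>z. (fst z, snd z)) \<in> measurable (lborel \<Otimes>\<^sub>M meas_on S) (borel \<Otimes>\<^sub>M borel)"
          by (intro measurable_Pair measurable_compose[OF measurable_snd i]) simp
        hence "(\<lambda>z. z) \<in> measurable (lborel \<Otimes>\<^sub>M meas_on S) (borel \<Otimes>\<^sub>M borel)" by simp
        from measurable_sets[OF this C'(1)] show "C \<in> sets (lborel \<Otimes>\<^sub>M meas_on S)"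
          using C'(2) by (simp add: space_pair_measure Int_commute)
      qed
    qed
    fix A B assume AB: "A \<in> sets (lborel :: real measure)" "B \<in> sets (meas_on S)"
    have B: "B \<subseteq> S" "B \<in> sets borel" using AB(2) S by (auto simp: meas_on_def sets_restrict_space)
    have "emeasure (meas_on (UNIV \<times> S :: (real \<times> real) set)) (A \<times> B) = emeasure lborel (A \<times> B)"
      unfolding meas_on_def using B US by (subst emeasure_restrict_space) auto
    also have "\<dots> = emeasure (lborel \<Otimes>\<^sub>M lborel) (A \<times> B)" by (simp add: lborel_prod)
    also have "\<dots> = emeasure lborel A * emeasure lborel B"
      using AB B by (intro sigma_finite_measure.emeasure_pair_measure_Times[OF sigma_finite_lborel]) auto
    also have "emeasure lborel B = emeasure (meas_on S) B"
      unfolding meas_on_def using B S by (subst emeasure_restrict_space) auto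
    finally show "emeasure lborel A * emeasure (meas_on S) B = emeasure (meas_on (UNIV \<times> S :: (real \<times> real) set)) (A \<times> B)" by simp
  qed
  thus ?thesis by simp
qed

section \<open>Coefficient functionals on a product space\<close>

context pair_sigma_finite
begin

lemma L2_tensor:
  assumes f: "f \<in> L2 M1" and g: "g \<in> L2 M2"
  shows "(\<lambda>z. f (fst z) * g (snd z)) \<in> L2 (M1 \<Otimes>\<^sub>M M2)"
    and "l2_norm (M1 \<Otimes>\<^sub>M M2) (\<lambda>z. f (fst z) * g (snd z)) = l2_norm M1 f * l2_norm M2 g"
proof -
  have [measurable]: "f \<in> borel_measurable M1" "g \<in> borel_measurable M2" using f g by (auto intro: L2_measurable)
  have i: "integrable (M1 \<Otimes>\<^sub>M M2) (\<lambda>z. (cmod (f (fst z)))\<^sup>2 * (cmod (g (snd z)))\<^sup>2)"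
    using integrable_prod_mult[OF _ _ L2_integrable_sq[OF f] L2_integrable_sq[OF g]]
      M1.sigma_finite_measure_axioms M2.sigma_finite_measure_axioms by blast
  show "(\<lambda>z. f (fst z) * g (snd z)) \<in> L2 (M1 \<Otimes>\<^sub>M M2)"
    using i by (simp add: L2_def norm_mult power_mult_distrib)
  have "(LINT z|(M1 \<Otimes>\<^sub>M M2). (cmod (f (fst z)))\<^sup>2 * (cmod (g (snd z)))\<^sup>2) =
    (LINT x|M1. LINT y|M2. (cmod (f x))\<^sup>2 * (cmod (g y))\<^sup>2)"
    using integral_fst'[OF i] by simp
  also have "\<dots> = (LINT x|M1. (cmod (f x))\<^sup>2) * (LINT y|M2. (cmod (g y))\<^sup>2)" by simp
  finally show "l2_norm (M1 \<Otimes>\<^sub>M M2) (\<lambda>z. f (fst z) * g (snd z)) = l2_norm M1 f * l2_norm M2 g"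
    by (simp add: l2_norm_def norm_mult power_mult_distrib real_sqrt_mult)
qed

lemma integral_tensor:
  fixes f :: "'a \<Rightarrow> complex"
  assumes "integrable M1 f" "integrable M2 g"
  shows "(LINT z|(M1 \<Otimes>\<^sub>M M2). f (fst z) * g (snd z)) = (LINT x|M1. f x) * (LINT y|M2. g y)"
proof -
  have i: "integrable (M1 \<Otimes>\<^sub>M M2) (\<lambda>z. f (fst z) * g (snd z))"
    using integrable_prod_mult[OF _ _ assms] M1.sigma_finite_measure_axioms M2.sigma_finite_measure_axioms by blast
  show ?thesis using integral_fst'[OF i] by simp
qed

lemma nn_integral_L2_fibre:
  assumes u: "u \<in> L2 (M1 \<Otimes>\<^sub>M M2)"
  shows "(\<integral>\<^sup>+x. (\<integral>\<^sup>+y. ennreal ((cmod (u (x, y)))\<^sup>2) \<partial>M2) \<partial>M1) = ennreal ((l2_norm (M1 \<Otimes>\<^sub>M M2) u)\<^sup>2)"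
proof -
  have [measurable]: "u \<in> borel_measurable (M1 \<Otimes>\<^sub>M M2)" by (rule L2_measurable[OF u])
  show ?thesis unfolding nn_integral_L2[OF u, symmetric]
    by (rule M2.nn_integral_fst) measurable
qed

lemma AE_L2_fibre:
  assumes u: "u \<in> L2 (M1 \<Otimes>\<^sub>M M2)"
  shows "AE x in M1. (\<lambda>y. u (x, y)) \<in> L2 M2"
proof -
  have [measurable]: "u \<in> borel_measurable (M1 \<Otimes>\<^sub>M M2)" by (rule L2_measurable[OF u])
  have "AE x in M1. (\<integral>\<^sup>+y. ennreal ((cmod (u (x, y)))\<^sup>2) \<partial>M2) \<noteq> \<infinity>"
    by (rule nn_integral_noteq_infinite) (auto simp: nn_integral_L2_fibre[OF u])
  thus ?thesis
  proof (rule AE_mp, intro AE_I2 impI)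
    fix x assume x: "x \<in> space M1" and fin: "(\<integral>\<^sup>+y. ennreal ((cmod (u (x, y)))\<^sup>2) \<partial>M2) \<noteq> \<infinity>"
    have "(\<lambda>y. u (x, y)) \<in> borel_measurable M2" using x by measurable
    thus "(\<lambda>y. u (x, y)) \<in> L2 M2" using fin by (intro L2_nn_integralI) (auto simp: less_top)
  qed
qed

text \<open>A bilinear pairing, without conjugate, because this is the form for which the
  transversal operator is symmetric.\<close>

definition coef :: "('b \<Rightarrow> complex) \<Rightarrow> ('a \<times> 'b \<Rightarrow> complex) \<Rightarrow> 'a \<Rightarrow> complex" where
  "coef \<eta> u x = (LINT y|M2. u (x, y) * \<eta> y)"

lemma coef_measurable:
  assumes "u \<in> borel_measurable (M1 \<Otimes>\<^sub>M M2)" "\<eta> \<in> borel_measurable M2"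
  shows "coef \<eta> u \<in> borel_measurable M1"
proof -
  have [measurable]: "u \<in> borel_measurable (M1 \<Otimes>\<^sub>M M2)" "\<eta> \<in> borel_measurable M2" by fact+
  show ?thesis unfolding coef_def[abs_def] by measurable
qed

lemma coef_L2:
  assumes u: "u \<in> L2 (M1 \<Otimes>\<^sub>M M2)" and e: "\<eta> \<in> L2 M2"
  shows "coef \<eta> u \<in> L2 M1" "l2_norm M1 (coef \<eta> u) \<le> l2_norm M2 \<eta> * l2_norm (M1 \<Otimes>\<^sub>M M2) u"
proof -
  have m: "coef \<eta> u \<in> borel_measurable M1" by (rule coef_measurable[OF L2_measurable[OF u] L2_measurable[OF e]])
  have [measurable]: "u \<in> borel_measurable (M1 \<Otimes>\<^sub>M M2)" by (rule L2_measurable[OF u])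
  have "(\<integral>\<^sup>+x. ennreal ((cmod (coef \<eta> u x))\<^sup>2) \<partial>M1) \<le> (\<integral>\<^sup>+x. (ennreal ((l2_norm M2 \<eta>)\<^sup>2) * (\<integral>\<^sup>+y. ennreal ((cmod (u (x, y)))\<^sup>2) \<partial>M2)) \<partial>M1)"
  proof (rule nn_integral_mono_AE, use AE_L2_fibre[OF u] in eventually_elim)
    case (elim x)
    have "cmod (coef \<eta> u x) \<le> l2_norm M2 (\<lambda>y. u (x, y)) * l2_norm M2 \<eta>"
      unfolding coef_def by (rule Cauchy_Schwarz_mult[OF elim e])
    hence "(cmod (coef \<eta> u x))\<^sup>2 \<le> (l2_norm M2 \<eta>)\<^sup>2 * (l2_norm M2 (\<lambda>y. u (x, y)))\<^sup>2"
      unfolding power_mult_distrib[symmetric] by (intro power_mono) (auto simp: mult.commute)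
    thus ?case unfolding nn_integral_L2[OF elim] by (subst ennreal_mult[symmetric]) (auto intro: ennreal_leI)
  qed
  also have "\<dots> = ennreal ((l2_norm M2 \<eta>)\<^sup>2) * ennreal ((l2_norm (M1 \<Otimes>\<^sub>M M2) u)\<^sup>2)"
    by (subst nn_integral_cmult) (auto simp: nn_integral_L2_fibre[OF u])
  also have "\<dots> = ennreal ((l2_norm M2 \<eta> * l2_norm (M1 \<Otimes>\<^sub>M M2) u)\<^sup>2)"
    by (simp add: ennreal_mult power_mult_distrib)
  finally show "coef \<eta> u \<in> L2 M1" "l2_norm M1 (coef \<eta> u) \<le> l2_norm M2 \<eta> * l2_norm (M1 \<Otimes>\<^sub>M M2) u"
    using l2_norm_le_nn[OF m] by simp_all
qed

text \<open>Linearity holds only almost everywhere: on exceptional lines u(x, .) may fail to be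
  square integrable, and the integral can then take its default value 0.\<close>

lemma coef_diff_AE:
  assumes u: "u \<in> L2 (M1 \<Otimes>\<^sub>M M2)" and v: "v \<in> L2 (M1 \<Otimes>\<^sub>M M2)" and e: "\<eta> \<in> L2 M2"
  shows "AE x in M1. coef \<eta> (\<lambda>z. u z - c * v z) x = coef \<eta> u x - c * coef \<eta> v x"
  using AE_L2_fibre[OF u] AE_L2_fibre[OF v]
proof eventually_elim
  case (elim x)
  note i = integrable_L2_mult[OF elim(1) e] integrable_L2_mult[OF elim(2) e]
  have "coef \<eta> (\<lambda>z. u z - c * v z) x = (LINT y|M2. u (x, y) * \<eta> y - c * (v (x, y) * \<eta> y))"
    unfolding coef_def by (simp add: algebra_simps)
  also have "\<dots> = coef \<eta> u x - c * coef \<eta> v x"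
    unfolding coef_def using i by simp
  finally show ?case .
qed

lemma coef_cong_AE:
  assumes "AE z in M1 \<Otimes>\<^sub>M M2. u z = v z" "u \<in> borel_measurable (M1 \<Otimes>\<^sub>M M2)" "v \<in> borel_measurable (M1 \<Otimes>\<^sub>M M2)" "\<eta> \<in> borel_measurable M2"
  shows "AE x in M1. coef \<eta> u x = coef \<eta> v x"
proof -
  have [measurable]: "u \<in> borel_measurable (M1 \<Otimes>\<^sub>M M2)" "v \<in> borel_measurable (M1 \<Otimes>\<^sub>M M2)" "\<eta> \<in> borel_measurable M2" by fact+
  show ?thesis
    using AE_pair[OF assms(1)]
  proof (rule AE_mp, intro AE_I2 impI)
    fix x assume x: "x \<in> space M1" and ae: "AE y in M2. u (x, y) = v (x, y)"
    show "coef \<eta> u x = coef \<eta> v x"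
      unfolding coef_def by (rule integral_cong_AE) (use x ae in \<open>auto elim!: eventually_mono\<close>)
  qed
qed

lemma coef_tensor_sum:
  assumes "\<And>i. i \<in> A \<Longrightarrow> g i \<in> L2 M2" "\<eta> \<in> L2 M2"
  shows "coef \<eta> (\<lambda>z. \<Sum>i\<in>A. f i (fst z) * g i (snd z)) x = (\<Sum>i\<in>A. (LINT y|M2. g i y * \<eta> y) * f i x)"
proof -
  have "coef \<eta> (\<lambda>z. \<Sum>i\<in>A. f i (fst z) * g i (snd z)) x = (LINT y|M2. (\<Sum>i\<in>A. f i x * (g i y * \<eta> y)))"
    unfolding coef_def by (simp add: sum_distrib_right mult.assoc)
  also have "\<dots> = (\<Sum>i\<in>A. f i x * (LINT y|M2. g i y * \<eta> y))"
    by (subst Bochner_Integration.integral_sum) (use integrable_L2_mult[OF assms(1) assms(2)] in auto)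
  finally show ?thesis by (simp add: mult.commute)
qed

end

section \<open>Product functions in the domain of the operator on the strip\<close>

lemma pair_sigma_finite_strip: "pair_sigma_finite lborel (meas_on (II a))"
  by (simp add: pair_sigma_finite_def sigma_finite_lborel sigma_finite_meas_on)

lemma meas_on_Om: "meas_on (Om a) = lborel \<Otimes>\<^sub>M meas_on (II a)"
  by (rule meas_on_Times_UNIV) simp

lemma op_closure_subset:
  assumes "(u, w) \<in> T" "u \<in> L2 M" "w \<in> L2 M"
  shows "(u, w) \<in> op_closure M T"
proof -
  have "\<exists>U W. (\<forall>n. (U n, W n) \<in> T) \<and> (\<lambda>n. l2_norm M (\<lambda>x. U n x - u x)) \<longlonglongrightarrow> 0 \<and>
    (\<lambda>n. l2_norm M (\<lambda>x. W n x - w x)) \<longlonglongrightarrow> 0"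
    by (rule exI[of _ "\<lambda>_. u"], rule exI[of _ "\<lambda>_. w"]) (use assms in simp)
  thus ?thesis unfolding op_closure_def using assms by simp
qed

lemma H_I_L2: "(g, G) \<in> H_I a \<alpha>0 \<Longrightarrow> g \<in> L2 (meas_on (II a)) \<and> G \<in> L2 (meas_on (II a))"
  by (auto simp: H_I_def H2_derivs_def)

lemma op_tensor_simple:
  assumes "(f, F) \<in> A" "(g, G) \<in> B" "(\<lambda>z. f (fst z) * g (snd z)) \<in> L2 M" "(\<lambda>z. F (fst z) * G (snd z)) \<in> L2 M"
  shows "((\<lambda>z. f (fst z) * g (snd z)), (\<lambda>z. F (fst z) * G (snd z))) \<in> op_tensor M A B"
  unfolding op_tensor_def mem_Collect_eq case_prod_conv
  by (intro conjI assms(3,4), rule exI[of _ "1::nat"], rule exI[of _ "\<lambda>_. f"], rule exI[of _ "\<lambda>_. F"],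
      rule exI[of _ "\<lambda>_. g"], rule exI[of _ "\<lambda>_. G"]) (use assms in simp)

lemma H_Om_tensor:
  assumes f: "(f, F) \<in> H_R V" and g: "(g, G) \<in> H_I a \<alpha>0"
  shows "((\<lambda>z. f (fst z) * g (snd z)), (\<lambda>z. F (fst z) * g (snd z) + f (fst z) * G (snd z))) \<in> H_Om a \<alpha>0 V"
proof -
  interpret pair_sigma_finite "lborel :: real measure" "meas_on (II a)" by (rule pair_sigma_finite_strip)
  have L: "f \<in> L2 lborel" "F \<in> L2 lborel" "g \<in> L2 (meas_on (II a))" "G \<in> L2 (meas_on (II a))"
    using H_R_L2[OF f] H_I_L2[OF g] by auto
  let ?M = "meas_on (Om a)"
  have T: "(\<lambda>z. f (fst z) * g (snd z)) \<in> L2 ?M" "(\<lambda>z. F (fst z) * g (snd z)) \<in> L2 ?M" "(\<lambda>z. f (fst z) * G (snd z)) \<in> L2 ?M"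
    unfolding meas_on_Om using L by (auto intro: L2_tensor)
  have 1: "((\<lambda>z. f (fst z) * g (snd z)), (\<lambda>z. F (fst z) * g (snd z))) \<in> op_tensor ?M (H_R V) (op_id (meas_on (II a)))"
    by (rule op_tensor_simple[OF f _ T(1,2)]) (use L in \<open>simp add: op_id_def\<close>)
  have 2: "((\<lambda>z. f (fst z) * g (snd z)), (\<lambda>z. f (fst z) * G (snd z))) \<in> op_tensor ?M (op_id (meas_on UNIV)) (H_I a \<alpha>0)"
    by (rule op_tensor_simple[OF _ g T(1,3)]) (use L in \<open>simp add: op_id_def\<close>)
  show ?thesis unfolding H_Om_def
  proof (rule op_closure_subset)
    show "((\<lambda>z. f (fst z) * g (snd z)), (\<lambda>z. F (fst z) * g (snd z) + f (fst z) * G (snd z))) \<in>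
      op_sum ?M (op_tensor ?M (H_R V) (op_id (meas_on (II a)))) (op_tensor ?M (op_id (meas_on UNIV)) (H_I a \<alpha>0))"
      unfolding op_sum_def using 1 2 L2_add[OF T(2,3)] by auto
  qed (use T L2_add[OF T(2,3)] in auto)
qed

text \<open>For a product, (H - s - t) u splits into (H_R - t) f times g plus f times (H_I - s) g,
  and L2 norms of products multiply. The reflection acts on g alone, so the indefinite form of u is
  that of g times the squared norm 1 of f.\<close>

lemma approx_eigenseq_tensor:
  assumes f: "approx_eigenseq lborel (H_R V) t f" and g: "approx_eigenseq (meas_on (II a)) (H_I a \<alpha>0) s g"
  defines "u \<equiv> \<lambda>n z. f n (fst z) * g n (snd z)"
  shows "approx_eigenseq (meas_on (Om a)) (H_Om a \<alpha>0 V) (s + t) u"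
    and "l2_inner (meas_on (Om a)) (par_Om (u n)) (u n) = l2_inner (meas_on (II a)) (par_I (g n)) (g n)"
proof -
  interpret pair_sigma_finite "lborel :: real measure" "meas_on (II a)" by (rule pair_sigma_finite_strip)
  let ?M = "meas_on (Om a)"
  let ?I = "meas_on (II a)"
  obtain F where F: "\<And>n. l2_norm lborel (f n) = 1" "\<And>n. (f n, F n) \<in> H_R V" "(\<lambda>n. l2_norm lborel (\<lambda>x. F n x - t * f n x)) \<longlonglongrightarrow> 0"
    using f by (auto simp: approx_eigenseq_def)
  obtain G where G: "\<And>n. l2_norm ?I (g n) = 1" "\<And>n. (g n, G n) \<in> H_I a \<alpha>0" "(\<lambda>n. l2_norm ?I (\<lambda>x. G n x - s * g n x)) \<longlonglongrightarrow> 0"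
    using g by (auto simp: approx_eigenseq_def)
  have L: "f n \<in> L2 lborel" "F n \<in> L2 lborel" "g n \<in> L2 ?I" "G n \<in> L2 ?I" for n
    using H_R_L2[OF F(2)] H_I_L2[OF G(2)] by auto
  define w where "w n z = F n (fst z) * g n (snd z) + f n (fst z) * G n (snd z)" for n z
  have uw: "(u n, w n) \<in> H_Om a \<alpha>0 V" for n
    unfolding u_def w_def by (rule H_Om_tensor[OF F(2) G(2)])
  have nu: "l2_norm ?M (u n) = 1" for n
    unfolding u_def meas_on_Om using L2_tensor(2)[OF L(1,3), of n n] by (simp add: F G)
  have LF: "(\<lambda>x. F n x - t * f n x) \<in> L2 lborel" "(\<lambda>x. G n x - s * g n x) \<in> L2 ?I" for n
    by (intro L2_diff L2_scale L)+
  have le: "l2_norm ?M (\<lambda>z. w n z - (s + t) * u n z) \<le> l2_norm lborel (\<lambda>x. F n x - t * f n x) + l2_norm ?I (\<lambda>x. G n x - s * g n x)" for n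
  proof -
    have "l2_norm ?M (\<lambda>z. w n z - (s + t) * u n z) = l2_norm ?M (\<lambda>z. (F n (fst z) - t * f n (fst z)) * g n (snd z) + f n (fst z) * (G n (snd z) - s * g n (snd z)))"
      by (simp add: w_def u_def algebra_simps)
    also have "\<dots> \<le> l2_norm ?M (\<lambda>z. (F n (fst z) - t * f n (fst z)) * g n (snd z)) + l2_norm ?M (\<lambda>z. f n (fst z) * (G n (snd z) - s * g n (snd z)))"
      unfolding meas_on_Om by (intro l2_norm_triangle L2_tensor(1)[OF LF(1) L(3)] L2_tensor(1)[OF L(1) LF(2)])
    also have "\<dots> = l2_norm lborel (\<lambda>x. F n x - t * f n x) + l2_norm ?I (\<lambda>x. G n x - s * g n x)"
      unfolding meas_on_Om L2_tensor(2)[OF LF(1) L(3)] L2_tensor(2)[OF L(1) LF(2)] by (simp add: F G)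
    finally show ?thesis .
  qed
  have "(\<lambda>n. l2_norm lborel (\<lambda>x. F n x - t * f n x) + l2_norm ?I (\<lambda>x. G n x - s * g n x)) \<longlonglongrightarrow> 0"
    using tendsto_add[OF F(3) G(3)] by simp
  hence "(\<lambda>n. l2_norm ?M (\<lambda>z. w n z - (s + t) * u n z)) \<longlonglongrightarrow> 0"
    by (rule Lim_null_comparison[rotated]) (rule always_eventually, use le in simp)
  thus "approx_eigenseq ?M (H_Om a \<alpha>0 V) (s + t) u" unfolding approx_eigenseq_def using nu uw by (intro conjI exI[of _ w]) auto
  have reflect: "par_I (g n) \<in> L2 ?I"
  proof -
    have Lg: "(\<lambda>x. indicator (II a) x *\<^sub>R g n x) \<in> L2 lborel"
    proof -
      have "integrable lborel (\<lambda>x. indicator (II a) x *\<^sub>R (cmod (g n x))\<^sup>2)"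
        using L2_integrable_sq[OF L(3)[of n]] unfolding meas_on_def by (subst (asm) integrable_restrict_space) auto
      moreover have "(cmod (indicator (II a) x *\<^sub>R g n x))\<^sup>2 = indicator (II a) x *\<^sub>R (cmod (g n x))\<^sup>2" for x
        by (simp add: indicator_def)
      ultimately show ?thesis
        using L2_measurable[OF L(3)[of n]] borel_measurable_meas_on[of "II a" "g n"] by (simp add: L2_def)
    qed
    have "(\<lambda>x. indicator (II a) x *\<^sub>R par_I (g n) x) = (\<lambda>x. indicator (II a) (-x) *\<^sub>R g n (-x))"
      by (auto simp: par_I_def indicator_def fun_eq_iff)
    with l2_reflect[OF Lg] have L': "(\<lambda>x. indicator (II a) x *\<^sub>R par_I (g n) x) \<in> L2 lborel" by simp
    have "(cmod (indicator (II a) x *\<^sub>R par_I (g n) x))\<^sup>2 = indicator (II a) x *\<^sub>R (cmod (par_I (g n) x))\<^sup>2" for x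
      by (simp add: indicator_def)
    hence "integrable lborel (\<lambda>x. indicator (II a) x *\<^sub>R (cmod (par_I (g n) x))\<^sup>2)"
      using L2_integrable_sq[OF L'] by simp
    hence "integrable ?I (\<lambda>x. (cmod (par_I (g n) x))\<^sup>2)"
      unfolding meas_on_def by (subst integrable_restrict_space) auto
    thus ?thesis using L2_measurable[OF L'] borel_measurable_meas_on[of "II a" "par_I (g n)"] by (simp add: L2_def)
  qed
  have "l2_inner ?M (par_Om (u n)) (u n) = (LINT z|?M. (f n (fst z) * cnj (f n (fst z))) * (par_I (g n) (snd z) * cnj (g n (snd z))))"
    unfolding l2_inner_def by (rule Bochner_Integration.integral_cong[OF refl]) (auto simp: par_Om_def u_def par_I_def split: prod.split)
  also have "\<dots> = (LINT x|lborel. f n x * cnj (f n x)) * (LINT y|?I. par_I (g n) y * cnj (g n y))"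
    unfolding meas_on_Om by (rule integral_tensor) (intro integrable_L2_mult L2_cnj L reflect)+
  also have "(LINT x|lborel. f n x * cnj (f n x)) = 1"
    using l2_norm_sq_inner[of lborel "f n"] by (simp add: l2_inner_def F)
  finally show "l2_inner ?M (par_Om (u n)) (u n) = l2_inner ?I (par_I (g n)) (g n)" by (simp add: l2_inner_def)
qed

section \<open>The transversal operator\<close>

locale strip =
  fixes a \<alpha> :: real
  assumes a: "a > 0"
begin

abbreviation MI :: "real measure" where "MI \<equiv> meas_on (II a)"

lemma Sopen [simp]: "interval_open (II a)" using a by simp

lemma MI_integral_indicator: "(LINT y|MI. f y) = (LINT y|lborel. indicator (II a) y *\<^sub>R (f y :: complex))"
  unfolding meas_on_def by (subst integral_restrict_space) auto

lemma MI_integrable_indicator: "integrable MI f \<longleftrightarrow> integrable lborel (\<lambda>y. indicator (II a) y *\<^sub>R (f y :: complex))"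
  unfolding meas_on_def by (subst integrable_restrict_space) auto

lemma MI_integral_continuous:
  fixes f :: "real \<Rightarrow> complex"
  assumes "continuous_on {-a..a} f"
  shows "(LINT y|MI. f y) = (LINT y:{-a..a}|lborel. f y)"
  unfolding MI_integral_indicator set_lebesgue_integral_def
proof (rule integral_cong_AE)
  have "II a \<subseteq> {-a..a}" by auto
  from continuous_on_subset[OF assms this] show "(\<lambda>y. indicator (II a) y *\<^sub>R f y) \<in> borel_measurable lborel"
    using borel_measurable_continuous_on_indicator[of "II a" f] by simp
  show "(\<lambda>y. indicator {-a..a} y *\<^sub>R f y) \<in> borel_measurable lborel"
    using borel_measurable_continuous_on_indicator[of "{-a..a}" f] assms by auto
  show "AE y in lborel. indicator (II a) y *\<^sub>R f y = indicator {-a..a} y *\<^sub>R f y"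
    using AE_lborel_singleton[of a] AE_lborel_singleton[of "-a"] by eventually_elim (auto simp: indicator_def)
qed

lemma MI_FTC:
  fixes f F :: "real \<Rightarrow> complex"
  assumes F: "\<And>y. (F has_vector_derivative f y) (at y)" and f: "continuous_on UNIV f"
  shows "(LINT y|MI. f y) = F a - F (-a)"
proof -
  have fc: "continuous_on {-a..a} f" using f continuous_on_subset by blast
  show ?thesis unfolding MI_integral_continuous[OF fc] set_lebesgue_integral_def
    by (rule integral_FTC_atLeastAtMost) (use a fc F in \<open>auto intro: has_vector_derivative_at_within\<close>)
qed

lemma finite_MI: "finite_measure MI"
  by (rule finite_measureI) (use a in \<open>simp add: meas_on_def emeasure_restrict_space space_restrict_space\<close>)

lemma L2_MI_continuous:
  fixes f :: "real \<Rightarrow> complex"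
  assumes "continuous_on {-a..a} f"
  shows "f \<in> L2 MI"
proof -
  have "II a \<subseteq> {-a..a}" by auto
  hence m: "f \<in> borel_measurable MI"
    by (intro continuous_on_meas_on continuous_on_subset[OF assms]) auto
  obtain B where B: "\<forall>y\<in>{-a..a}. norm (f y) \<le> B"
    using compact_imp_bounded[OF compact_continuous_image[OF assms compact_Icc]] by (auto simp: bounded_iff)
  have "integrable MI (\<lambda>y. (cmod (f y))\<^sup>2)"
  proof (rule finite_measure.integrable_const_bound[OF finite_MI])
    show "AE y in MI. norm ((cmod (f y))\<^sup>2) \<le> B\<^sup>2"
      by (rule AE_I2) (use B in \<open>auto intro!: power_mono\<close>)
  qed (use m in simp)
  thus ?thesis using m by (simp add: L2_def)
qed

lemma L2_MI_continuous': "continuous_on UNIV f \<Longrightarrow> f \<in> L2 MI"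
  by (rule L2_MI_continuous) (rule continuous_on_subset, auto)

lemma integrable_MI: "f \<in> L2 MI \<Longrightarrow> integrable MI f"
  using integrable_L2_mult[OF _ L2_MI_continuous'[OF continuous_on_const[of UNIV 1]]] by simp

definition Robin :: "(real \<Rightarrow> complex) \<Rightarrow> (real \<Rightarrow> complex) \<Rightarrow> bool" where
  "Robin \<eta> \<eta>1 \<longleftrightarrow> \<eta>1 a = - \<i> * of_real \<alpha> * \<eta> a \<and> \<eta>1 (-a) = - \<i> * of_real \<alpha> * \<eta> (-a)"

text \<open>The operator \<open>H_I\<close> is symmetric with respect to the bilinear form \<open>\<integral> f g\<close>.\<close>

lemma H_I_Green:
  assumes H: "(\<psi>, h) \<in> H_I a \<alpha>"
    and \<eta>: "\<And>y. (\<eta> has_vector_derivative \<eta>1 y) (at y)" "\<And>y. (\<eta>1 has_vector_derivative \<eta>2 y) (at y)"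
    and \<eta>2: "continuous_on UNIV \<eta>2" and R: "Robin \<eta> \<eta>1"
  shows "(LINT y|MI. h y * \<eta> y) = (LINT y|MI. \<psi> y * - \<eta>2 y)"
proof -
  obtain \<psi>1 \<psi>2 u0 u1 where H2: "H2_derivs (II a) \<psi> \<psi>1 \<psi>2"
    and u: "continuous_on {-a..a} u0" "continuous_on {-a..a} u1"
      "AE y in MI. u0 y = \<psi> y" "AE y in MI. u1 y = \<psi>1 y"
      "u1 a = - \<i> * of_real \<alpha> * u0 a" "u1 (-a) = - \<i> * of_real \<alpha> * u0 (-a)"
    and h: "h \<in> L2 MI" "AE y in MI. h y = - \<psi>2 y"
    using H unfolding H_I_def by blast
  obtain F1 F0 where F: "is_prim (II a) F1 \<psi>2" "continuous_on (II a) F1"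
      "\<And>y. y \<in> II a \<Longrightarrow> (F0 has_vector_derivative F1 y) (at y)"
    and ae: "AE y in MI. \<psi> y = F0 y" "AE y in MI. \<psi>1 y = F1 y"
    by (rule H2_derivs_classical[OF Sopen H2]) blast
  have L: "\<psi> \<in> L2 MI" "\<psi>2 \<in> L2 MI" using H2 by (auto simp: H2_derivs_def)
  have F0c: "continuous_on (II a) F0"
    using F(3) by (meson continuous_at_imp_continuous_on has_vector_derivative_continuous)
  \<comment> \<open>The boundary condition speaks of u0 and u1, the integration by parts of F0 and
    F1. They agree almost everywhere, and continuous functions that do so on an open interval agree
    there everywhere, since an open null set is empty.\<close>
  have eqc: "f y = g y" if c: "continuous_on (II a) f" "continuous_on {-a..a} g" and e: "AE y in MI. g y = f y" and y: "y \<in> II a"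
    for f g :: "real \<Rightarrow> complex" and y
  proof -
    have gc: "continuous_on (II a) g" by (rule continuous_on_subset[OF c(2)]) auto
    have "\<And>z. z \<in> II a \<Longrightarrow> (\<lambda>y. g y - f y) z = 0"
    proof (rule ccontr)
      fix z assume z: "z \<in> II a" "(\<lambda>y. g y - f y) z \<noteq> 0"
      define U where "U = II a \<inter> (\<lambda>y. g y - f y) -` (- {0})"
      have "open U" unfolding U_def
        by (intro continuous_open_preimage continuous_intros gc c(1))
      moreover have "AE y in lborel. y \<notin> U"
        using e unfolding AE_meas_on[of "II a", simplified] by eventually_elim (auto simp: U_def)
      ultimately have "U \<in> null_sets lborel" using AE_iff_null_sets[of U lborel] by simp
      hence "negligible U" unfolding negligible_iff_null_sets by (rule null_sets_completionI)
      hence "U = {}" using open_not_negligible[OF \<open>open U\<close>] by blast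
      thus False using z by (auto simp: U_def)
    qed
    from this[OF y] show ?thesis by simp
  qed
  have u0: "F0 y = u0 y" if "y \<in> II a" for y
    by (rule eqc[OF F0c u(1) _ that]) (use u(3) ae(1) in eventually_elim, simp)
  have u1: "F1 y = u1 y" if "y \<in> II a" for y
    by (rule eqc[OF F(2) u(2) _ that]) (use u(4) ae(2) in eventually_elim, simp)
  have \<eta>c: "continuous_on UNIV \<eta>" "continuous_on UNIV \<eta>1"
    using \<eta> by (meson continuous_at_imp_continuous_on has_vector_derivative_continuous)+
  \<comment> \<open>Green's formula on a compact subinterval; the limit towards the end points is
    taken afterwards, through u0 and u1, which are continuous up to the boundary.\<close>
  have seg: "(LINT y:{p..q}|lborel. \<psi>2 y * \<eta> y) - (LINT y:{p..q}|lborel. \<psi> y * \<eta>2 y) =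
     (u1 q * \<eta> q - u0 q * \<eta>1 q) - (u1 p * \<eta> p - u0 p * \<eta>1 p)" if pq: "p \<in> II a" "q \<in> II a" "p \<le> q" for p q
  proof -
    have sub: "{p..q} \<subseteq> II a" using pq by auto
    have l1: "loc_integrable (II a) \<psi>2" by (rule L2_loc_integrable[OF Sopen L(2)])
    have A: "(LINT y:{p..q}|lborel. F1 y * \<eta>1 y) + (LINT y:{p..q}|lborel. \<psi>2 y * \<eta> y) = F1 q * \<eta> q - F1 p * \<eta> p"
    proof (rule integral_by_parts_AC[OF pq(3)])
      show "set_integrable lborel {p..q} \<psi>2" using l1 sub by (simp add: loc_integrable_def)
      show "F1 x - F1 p = (LINT t:{p..x}|lborel. \<psi>2 t)" if "x \<in> {p..q}" for x
        by (rule is_primD[OF F(1)]) (use that pq sub in auto)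
      show "continuous_on {p..q} \<eta>1" by (rule continuous_on_subset[OF \<eta>c(2)]) auto
      show "(\<eta> has_vector_derivative \<eta>1 x) (at x within {p..q})" for x
        by (rule has_vector_derivative_at_within[OF \<eta>(1)])
    qed
    have B: "(LINT y:{p..q}|lborel. F0 y * \<eta>2 y) + (LINT y:{p..q}|lborel. F1 y * \<eta>1 y) = F0 q * \<eta>1 q - F0 p * \<eta>1 p"
    proof (rule integral_by_parts_AC[OF pq(3)])
      have pr: "is_prim (II a) F0 F1" "loc_integrable (II a) F1" using is_prim_of_deriv[OF Sopen F(3,2)] by auto
      show "set_integrable lborel {p..q} F1" using pr(2) sub by (simp add: loc_integrable_def)
      show "F0 x - F0 p = (LINT t:{p..x}|lborel. F1 t)" if "x \<in> {p..q}" for x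
        by (rule is_primD[OF pr(1)]) (use that pq sub in auto)
      show "continuous_on {p..q} \<eta>2" by (rule continuous_on_subset[OF \<eta>2]) auto
      show "(\<eta>1 has_vector_derivative \<eta>2 x) (at x within {p..q})" for x
        by (rule has_vector_derivative_at_within[OF \<eta>(2)])
    qed
    have C: "(LINT y:{p..q}|lborel. F0 y * \<eta>2 y) = (LINT y:{p..q}|lborel. \<psi> y * \<eta>2 y)"
    proof (rule set_integral_cong_meas_on[of "II a"])
      show "(\<lambda>y. F0 y * \<eta>2 y) \<in> borel_measurable MI"
        by (intro continuous_on_meas_on continuous_on_mult F0c continuous_on_subset[OF \<eta>2]) auto
      have "\<eta>2 \<in> borel_measurable MI" by (intro continuous_on_meas_on continuous_on_subset[OF \<eta>2]) auto
      thus "(\<lambda>y. \<psi> y * \<eta>2 y) \<in> borel_measurable MI" using L2_measurable[OF L(1)] by simp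
      show "AE y in MI. F0 y * \<eta>2 y = \<psi> y * \<eta>2 y" using ae(1) by eventually_elim simp
    qed (use sub in auto)
    have gen: "Y - Z = E1 - E2" if "X + Y = E1" "Z + X = E2" for X Y Z E1 E2 :: complex
      using that by (auto simp: algebra_simps)
    show ?thesis using gen[OF A B[unfolded C]] u0[OF pq(1)] u0[OF pq(2)] u1[OF pq(1)] u1[OF pq(2)] by simp
  qed
  define D where "D y = \<psi>2 y * \<eta> y - \<psi> y * \<eta>2 y" for y
  have \<eta>L: "\<eta> \<in> L2 MI" "\<eta>2 \<in> L2 MI" using \<eta>c(1) \<eta>2 by (auto intro: L2_MI_continuous')
  have i: "integrable MI (\<lambda>y. \<psi>2 y * \<eta> y)" "integrable MI (\<lambda>y. \<psi> y * \<eta>2 y)" by (intro integrable_L2_mult L \<eta>L)+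
  have Di: "integrable MI D" unfolding D_def by (intro Bochner_Integration.integrable_diff i)
  \<comment> \<open>The offset 2 keeps \<open>q n\<close> at least a / 2, so that the interval from
    -q n to q n is nondegenerate from the start.\<close>
  define q where "q n = a - a / real (n + 2)" for n
  have q: "q n \<in> II a" "- q n \<in> II a" "- q n \<le> q n" for n
  proof -
    have "0 < a / real (n + 2)" using a by simp
    moreover have le: "a / real (n + 2) \<le> a / 2" using a by (intro divide_left_mono) auto
    ultimately show "q n \<in> II a" "- q n \<in> II a"
      using a unfolding q_def greaterThanLessThan_iff by linarith+
    from le show "- q n \<le> q n" using a unfolding q_def by linarith
  qed
  have "(\<lambda>n. a - a * (1 / real (n + 2))) \<longlonglongrightarrow> a - a * 0"
    by (intro tendsto_intros LIMSEQ_ignore_initial_segment[OF lim_1_over_n, of 2])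
  hence qlim: "q \<longlonglongrightarrow> a" by (simp add: q_def[abs_def])
  have Deq: "(LINT y:{-q n..q n}|lborel. D y) = (u1 (q n) * \<eta> (q n) - u0 (q n) * \<eta>1 (q n)) - (u1 (- q n) * \<eta> (- q n) - u0 (- q n) * \<eta>1 (- q n))" for n
  proof -
    have si: "set_integrable lborel {-q n..q n} f" if "integrable MI f" for f :: "real \<Rightarrow> complex"
    proof -
      have "integrable lborel (\<lambda>y. indicator {-q n..q n} y *\<^sub>R indicator (II a) y *\<^sub>R f y)"
        by (rule integrable_mult_indicator) (use that MI_integrable_indicator in auto)
      moreover have "(\<lambda>y. indicator {-q n..q n} y *\<^sub>R indicator (II a) y *\<^sub>R f y) = (\<lambda>y. indicator {-q n..q n} y *\<^sub>R f y)"
        using q[of n] by (auto simp: fun_eq_iff indicator_def)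
      ultimately show ?thesis by (simp add: set_integrable_def)
    qed
    show ?thesis unfolding D_def using set_integral_diff(2)[OF si[OF i(1)] si[OF i(2)]] seg[OF q(2,1,3)] by simp
  qed
  have "(\<lambda>n. LINT y:{-q n..q n}|lborel. D y) \<longlonglongrightarrow> (LINT y|lborel. indicator (II a) y *\<^sub>R D y)"
    unfolding set_lebesgue_integral_def
  proof (rule integral_dominated_convergence[where w = "\<lambda>y. norm (indicator (II a) y *\<^sub>R D y)"])
    have Di': "integrable lborel (\<lambda>y. indicator (II a) y *\<^sub>R D y)" using Di MI_integrable_indicator by blast
    show "integrable lborel (\<lambda>y. norm (indicator (II a) y *\<^sub>R D y))" by (rule integrable_norm[OF Di'])
    show m: "(\<lambda>y. indicator (II a) y *\<^sub>R D y) \<in> borel_measurable lborel" using Di' by auto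
    have eq: "indicator {-q n..q n} y *\<^sub>R D y = indicator {-q n..q n} y *\<^sub>R indicator (II a) y *\<^sub>R D y" for n y
      using q[of n] by (auto simp: indicator_def)
    show "(\<lambda>y. indicator {-q n..q n} y *\<^sub>R D y) \<in> borel_measurable lborel" for n
      unfolding eq[of n] by (rule borel_measurable_scaleR[OF _ m]) simp
    show "AE y in lborel. norm (indicator {-q n..q n} y *\<^sub>R D y) \<le> norm (indicator (II a) y *\<^sub>R D y)" for n
      using q[of n] by (auto simp: indicator_def)
    show "AE y in lborel. (\<lambda>n. indicator {-q n..q n} y *\<^sub>R D y) \<longlonglongrightarrow> indicator (II a) y *\<^sub>R D y"
    proof (rule AE_I2)
      fix y
      show "(\<lambda>n. indicator {-q n..q n} y *\<^sub>R D y) \<longlonglongrightarrow> indicator (II a) y *\<^sub>R D y"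
      proof (cases "y \<in> II a")
        case True
        hence "\<bar>y\<bar> < a" by auto
        hence "\<forall>\<^sub>F n in sequentially. \<bar>y\<bar> < q n" using order_tendstoD(1)[OF qlim] by blast
        hence "\<forall>\<^sub>F n in sequentially. indicator (II a) y *\<^sub>R D y = indicator {-q n..q n} y *\<^sub>R D y"
        proof eventually_elim
          case (elim n)
          hence "y \<in> {-q n..q n}" unfolding atLeastAtMost_iff by linarith
          thus ?case using True by simp
        qed
        thus ?thesis by (rule Lim_transform_eventually[OF tendsto_const])
      next
        case False
        hence "y \<notin> {-q n..q n}" for n using q[of n] by auto
        thus ?thesis using False by simp
      qed
    qed
  qed
  moreover have "(\<lambda>n. (u1 (q n) * \<eta> (q n) - u0 (q n) * \<eta>1 (q n)) - (u1 (- q n) * \<eta> (- q n) - u0 (- q n) * \<eta>1 (- q n)))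
     \<longlonglongrightarrow> (u1 a * \<eta> a - u0 a * \<eta>1 a) - (u1 (-a) * \<eta> (-a) - u0 (-a) * \<eta>1 (-a))"
  proof -
    have qm: "(\<lambda>n. - q n) \<longlonglongrightarrow> - a" by (intro tendsto_intros qlim)
    have A: "(\<lambda>n. f (q n)) \<longlonglongrightarrow> f a" "(\<lambda>n. f (- q n)) \<longlonglongrightarrow> f (- a)" if f: "continuous_on {-a..a} f" for f :: "real \<Rightarrow> complex"
      using continuous_on_tendsto_compose[OF f qlim] continuous_on_tendsto_compose[OF f qm] q a by (auto intro!: always_eventually simp: less_imp_le)
    have "continuous_on {-a..a} \<eta>" "continuous_on {-a..a} \<eta>1" using \<eta>c continuous_on_subset by blast+
    thus ?thesis by (intro tendsto_intros A u)
  qed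
  ultimately have "(LINT y|lborel. indicator (II a) y *\<^sub>R D y) = (u1 a * \<eta> a - u0 a * \<eta>1 a) - (u1 (-a) * \<eta> (-a) - u0 (-a) * \<eta>1 (-a))"
    unfolding Deq by (rule LIMSEQ_unique)
  \<comment> \<open>The same Robin condition for both functions cancels u1 eta - u0 eta1 at each end
    separately; with a conjugate on eta the two terms would add up instead.\<close>
  also have "\<dots> = 0" using R u(5,6) by (simp add: Robin_def)
  finally have "(LINT y|MI. D y) = 0" by (simp add: MI_integral_indicator)
  hence *: "(LINT y|MI. \<psi>2 y * \<eta> y) = (LINT y|MI. \<psi> y * \<eta>2 y)" using i unfolding D_def by simp
  have "(LINT y|MI. h y * \<eta> y) = (LINT y|MI. - (\<psi>2 y * \<eta> y))"
  proof (rule integral_cong_AE)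
    show "AE y in MI. h y * \<eta> y = - (\<psi>2 y * \<eta> y)" using h(2) by eventually_elim simp
  qed (use L2_measurable[OF h(1)] L2_measurable[OF \<eta>L(1)] L2_measurable[OF L(2)] in auto)
  thus ?thesis using * by simp
qed

lemma H_I_classical:
  assumes \<eta>: "\<And>y. (\<eta> has_vector_derivative \<eta>1 y) (at y)" "\<And>y. (\<eta>1 has_vector_derivative \<eta>2 y) (at y)"
    and \<eta>2: "continuous_on UNIV \<eta>2" and R: "Robin \<eta> \<eta>1"
  shows "(\<eta>, \<lambda>y. - \<eta>2 y) \<in> H_I a \<alpha>"
proof -
  have c: "continuous_on UNIV \<eta>" "continuous_on UNIV \<eta>1"
    using \<eta> by (meson continuous_at_imp_continuous_on has_vector_derivative_continuous)+
  have cs: "continuous_on S \<eta>" "continuous_on S \<eta>1" "continuous_on S \<eta>2" for S using c \<eta>2 continuous_on_subset by blast+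
  have L: "\<eta> \<in> L2 MI" "\<eta>1 \<in> L2 MI" "\<eta>2 \<in> L2 MI" using c \<eta>2 by (auto intro: L2_MI_continuous')
  have w1: "weak_deriv (II a) \<eta> \<eta>1"
    using is_prim_of_deriv[OF Sopen \<eta>(1) cs(2)] weak_deriv_of_prim[OF Sopen] by blast
  have w2: "weak_deriv (II a) \<eta>1 \<eta>2"
    using is_prim_of_deriv[OF Sopen \<eta>(2) cs(3)] weak_deriv_of_prim[OF Sopen] by blast
  have H: "H2_derivs (II a) \<eta> \<eta>1 \<eta>2" using L w1 w2 by (simp add: H2_derivs_def)
  have u: "\<exists>u0 u1. continuous_on {-a..a} u0 \<and> continuous_on {-a..a} u1 \<and>
           (AE y in MI. u0 y = \<eta> y) \<and> (AE y in MI. u1 y = \<eta>1 y) \<and>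
           u1 a = - \<i> * of_real \<alpha> * u0 a \<and> u1 (-a) = - \<i> * of_real \<alpha> * u0 (-a)"
    by (rule exI[of _ \<eta>], rule exI[of _ \<eta>1]) (use cs R in \<open>simp add: Robin_def\<close>)
  show ?thesis unfolding H_I_def mem_Collect_eq case_prod_conv
    by (intro conjI L2_uminus L exI[of _ \<eta>1] exI[of _ \<eta>2] H u) simp
qed

section \<open>Transversal eigenvalues and eigenfunctions\<close>

definition kap :: "nat \<Rightarrow> real" where "kap k = pi * real k / (2 * a)"

definition lam :: "nat \<Rightarrow> real" where "lam k = (if k = 0 then \<alpha>\<^sup>2 else (kap k)\<^sup>2)"

lemma lam_eq_ev: "lam k = ev a \<alpha> k"
  by (simp add: lam_def ev_def kap_def)

lemma kap_pos: "k \<noteq> 0 \<Longrightarrow> kap k > 0"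
  using a by (simp add: kap_def)

text \<open>For k = 0 the exponential satisfies psi' = -i alpha psi at every point. For k >= 1 the
  sine vanishes at both ends, so its coefficient enters the boundary condition only through the
  derivative, which fixes it.\<close>

definition psi :: "nat \<Rightarrow> real \<Rightarrow> complex" where
  "psi k y = (if k = 0 then exp (- \<i> * of_real (\<alpha> * y))
     else of_real (cos (kap k * (y + a))) - \<i> * of_real (\<alpha> / kap k * sin (kap k * (y + a))))"

definition psi' :: "nat \<Rightarrow> real \<Rightarrow> complex" where
  "psi' k y = (if k = 0 then - \<i> * of_real \<alpha> * exp (- \<i> * of_real (\<alpha> * y))
     else - of_real (kap k * sin (kap k * (y + a))) - \<i> * of_real (\<alpha> * cos (kap k * (y + a))))"

lemma exp_deriv: "((\<lambda>y. exp (c * complex_of_real (b * y))) has_vector_derivative c * of_real b * exp (c * of_real (b * y))) (at y)"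
proof -
  have "((\<lambda>z. exp (c * (of_real b * z))) has_field_derivative exp (c * (of_real b * of_real y)) * (c * of_real b)) (at (complex_of_real y))"
    by (auto intro!: derivative_eq_intros)
  from has_vector_derivative_real_field[OF this] show ?thesis by (simp add: o_def mult.commute mult.left_commute)
qed

lemma cos_deriv: "((\<lambda>y. complex_of_real (c * cos (b * (y + a)))) has_vector_derivative of_real (- c * b * sin (b * (y + a)))) (at y)"
  by (rule has_vector_derivative_of_real)
    (auto simp: has_real_derivative_iff_has_vector_derivative[symmetric] intro!: derivative_eq_intros)

lemma sin_deriv: "((\<lambda>y. complex_of_real (c * sin (b * (y + a)))) has_vector_derivative of_real (c * b * cos (b * (y + a)))) (at y)"
  by (rule has_vector_derivative_of_real)
    (auto simp: has_real_derivative_iff_has_vector_derivative[symmetric] intro!: derivative_eq_intros)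

lemma psi_deriv: "(psi k has_vector_derivative psi' k y) (at y)"
proof (cases "k = 0")
  case True
  have "psi k = (\<lambda>y. exp (- \<i> * of_real (\<alpha> * y)))" using True by (auto simp: psi_def fun_eq_iff)
  thus ?thesis using exp_deriv[of "-\<i>" \<alpha> y] True by (simp only: psi'_def refl if_True)
next
  case False
  have "((\<lambda>y. of_real (1 * cos (kap k * (y + a))) - \<i> * of_real (\<alpha> / kap k * sin (kap k * (y + a)))) has_vector_derivative
     of_real (- 1 * kap k * sin (kap k * (y + a))) - \<i> * of_real (\<alpha> / kap k * kap k * cos (kap k * (y + a)))) (at y)"
    by (intro derivative_intros has_vector_derivative_mult_right cos_deriv sin_deriv)
  moreover have "psi k = (\<lambda>y. of_real (1 * cos (kap k * (y + a))) - \<i> * of_real (\<alpha> / kap k * sin (kap k * (y + a))))"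
    using False by (auto simp: psi_def fun_eq_iff)
  moreover have "psi' k y = of_real (- 1 * kap k * sin (kap k * (y + a))) - \<i> * of_real (\<alpha> / kap k * kap k * cos (kap k * (y + a)))"
    using False kap_pos[OF False] by (simp add: psi'_def)
  ultimately show ?thesis by (simp only:)
qed

lemma psi'_deriv: "(psi' k has_vector_derivative - (of_real (lam k) * psi k y)) (at y)"
proof (cases "k = 0")
  case True
  have "((\<lambda>y. - \<i> * of_real \<alpha> * exp (- \<i> * of_real (\<alpha> * y))) has_vector_derivative - \<i> * of_real \<alpha> * (- \<i> * of_real \<alpha> * exp (- \<i> * of_real (\<alpha> * y)))) (at y)"
    by (intro has_vector_derivative_mult_right exp_deriv)
  moreover have "psi' k = (\<lambda>y. - \<i> * of_real \<alpha> * exp (- \<i> * of_real (\<alpha> * y)))" using True by (auto simp: psi'_def fun_eq_iff)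
  moreover have "- (of_real (lam k) * psi k y) = - \<i> * of_real \<alpha> * (- \<i> * of_real \<alpha> * exp (- \<i> * of_real (\<alpha> * y)))"
    using True by (simp add: psi_def lam_def power2_eq_square algebra_simps)
  ultimately show ?thesis by (simp only:)
next
  case False
  have "((\<lambda>y. of_real (- kap k * sin (kap k * (y + a))) - \<i> * of_real (\<alpha> * cos (kap k * (y + a)))) has_vector_derivative
     of_real (- kap k * kap k * cos (kap k * (y + a))) - \<i> * of_real (- \<alpha> * kap k * sin (kap k * (y + a)))) (at y)"
    by (intro derivative_intros has_vector_derivative_mult_right cos_deriv sin_deriv)
  moreover have "psi' k = (\<lambda>y. of_real (- kap k * sin (kap k * (y + a))) - \<i> * of_real (\<alpha> * cos (kap k * (y + a))))"
    using False by (auto simp: psi'_def fun_eq_iff)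
  moreover have "- (of_real (lam k) * psi k y) = of_real (- kap k * kap k * cos (kap k * (y + a))) - \<i> * of_real (- \<alpha> * kap k * sin (kap k * (y + a)))"
    using False kap_pos[OF False] by (simp add: psi_def lam_def power2_eq_square field_simps)
  ultimately show ?thesis by (simp only:)
qed

lemma kap_2a: "kap k * (2 * a) = pi * real k"
  using a by (simp add: kap_def)

lemma Robin_psi: "Robin (psi k) (psi' k)"
proof (cases "k = 0")
  case False
  have "kap k * (a + a) = pi * real k" using kap_2a[of k] by (simp only: mult_2)
  hence "sin (kap k * (a + a)) = 0" by (simp only: sin_npi2)
  thus ?thesis using False by (simp add: Robin_def psi_def psi'_def)
qed (simp add: Robin_def psi_def psi'_def)

lemma psi_continuous: "continuous_on S (psi k)"
  using psi_deriv by (meson continuous_at_imp_continuous_on has_vector_derivative_continuous)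

lemma psi_H_I: "(psi k, \<lambda>y. of_real (lam k) * psi k y) \<in> H_I a \<alpha>"
  using H_I_classical[OF psi_deriv psi'_deriv _ Robin_psi, of k]
  by (simp add: continuous_intros psi_continuous)

lemma psi_L2: "psi k \<in> L2 MI"
  by (rule L2_MI_continuous[OF psi_continuous])

definition sg :: "nat \<Rightarrow> real" where "sg k = (if k = 0 then 1 else (-1) ^ k)"

text \<open>This is \<open>P \<psi>\<^sub>k\<close>, up to complex conjugation.\<close>

lemma cnj_psi_reflect: "cnj (psi k (- y)) = of_real (sg k) * psi k y"
proof (cases "k = 0")
  case True
  thus ?thesis by (simp add: psi_def sg_def exp_cnj)
next
  case False
  have e: "kap k * (- y + a) = pi * real k - kap k * (y + a)" using kap_2a[of k] by (simp add: algebra_simps)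
  have "cos (kap k * (- y + a)) = (-1) ^ k * cos (kap k * (y + a))" "sin (kap k * (- y + a)) = - ((-1) ^ k * sin (kap k * (y + a)))"
    unfolding e cos_diff sin_diff by (simp_all add: cos_npi2 sin_npi2)
  thus ?thesis using False by (simp add: psi_def sg_def algebra_simps)
qed

text \<open>Green's formula is bilinear, so the eigenfunction itself, rather than an eigenfunction
  of the adjoint, yields a functional that diagonalises the operator.\<close>

lemma coef_H_I:
  assumes H: "(g, G) \<in> H_I a \<alpha>"
  shows "(LINT y|MI. G y * psi k y) = of_real (lam k) * (LINT y|MI. g y * psi k y)"
proof -
  have "(LINT y|MI. G y * psi k y) = (LINT y|MI. g y * - (- (of_real (lam k) * psi k y)))"
    by (rule H_I_Green[OF H psi_deriv psi'_deriv _ Robin_psi]) (intro continuous_intros psi_continuous)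
  also have "\<dots> = (LINT y|MI. of_real (lam k) * (g y * psi k y))" by (simp add: algebra_simps)
  finally show ?thesis by simp
qed

end

section \<open>A frame of transversal eigenfunctions\<close>

lemma l2_norm_sq_sub:
  assumes f: "f \<in> L2 M" and e: "e \<in> L2 M"
  shows "(l2_norm M (\<lambda>x. f x - z * e x))\<^sup>2 = (l2_norm M f)\<^sup>2 - 2 * Re (cnj z * l2_inner M f e) + (cmod z)\<^sup>2 * (l2_norm M e)\<^sup>2"
proof -
  have i: "integrable M (\<lambda>x. f x * cnj (f x))" "integrable M (\<lambda>x. f x * cnj (e x))"
      "integrable M (\<lambda>x. e x * cnj (f x))" "integrable M (\<lambda>x. e x * cnj (e x))"
    by (intro integrable_L2_mult L2_cnj f e)+
  have ef: "l2_inner M e f = cnj (l2_inner M f e)"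
    unfolding l2_inner_def using integral_bounded_linear[OF bounded_linear_cnj i(2)] by (simp add: mult.commute)
  have "complex_of_real ((l2_norm M (\<lambda>x. f x - z * e x))\<^sup>2) = (LINT x|M. (f x - z * e x) * cnj (f x - z * e x))"
    using l2_norm_sq_inner[of M "\<lambda>x. f x - z * e x"] by (simp only: l2_inner_def)
  also have "\<dots> = (LINT x|M. (f x * cnj (f x) - cnj z * (f x * cnj (e x))) - (z * (e x * cnj (f x)) - z * cnj z * (e x * cnj (e x))))"
    by (simp add: algebra_simps)
  also have "\<dots> = (l2_inner M f f - cnj z * l2_inner M f e) - (z * l2_inner M e f - z * cnj z * l2_inner M e e)"
    unfolding l2_inner_def using i by simp
  also have "\<dots> = of_real ((l2_norm M f)\<^sup>2) - (cnj z * l2_inner M f e + cnj (cnj z * l2_inner M f e)) + of_real ((cmod z)\<^sup>2 * (l2_norm M e)\<^sup>2)"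
    unfolding ef l2_norm_sq_inner by (simp add: complex_norm_square algebra_simps del: of_real_power flip: of_real_mult complex_norm_square)
  also have "cnj z * l2_inner M f e + cnj (cnj z * l2_inner M f e) = of_real (2 * Re (cnj z * l2_inner M f e))"
    by (rule complex_add_cnj)
  finally show ?thesis unfolding of_real_diff[symmetric] of_real_add[symmetric] of_real_eq_iff .
qed

text \<open>The remainders \<open>r N\<close> after subtracting N Fourier terms are Cauchy by
  Bessel's inequality. Their limit is orthogonal to every \<open>e k\<close>, hence zero by
  completeness, and the norm identity for \<open>r N\<close> becomes Parseval's. The system is only
  orthogonal; \<open>n k\<close> is the squared norm.\<close>

lemma Parseval_orthogonal:
  fixes e :: "nat \<Rightarrow> 'a \<Rightarrow> complex"
  assumes e: "\<And>k. e k \<in> L2 M" and orth: "\<And>j k. l2_inner M (e j) (e k) = (if j = k then of_real (n k) else 0)"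
    and n: "\<And>k. n k > 0"
    and compl: "\<And>r. r \<in> L2 M \<Longrightarrow> (\<And>k. l2_inner M r (e k) = 0) \<Longrightarrow> AE x in M. r x = 0"
    and h: "h \<in> L2 M"
  shows "(\<lambda>k. (cmod (l2_inner M h (e k)))\<^sup>2 / n k) sums (l2_norm M h)\<^sup>2"
proof -
  define c where "c k = l2_inner M h (e k)" for k
  define s where "s k = (cmod (c k))\<^sup>2 / n k" for k
  have s0: "0 \<le> s k" for k using n[of k] by (simp add: s_def)
  define z where "z k = c k / of_real (n k)" for k
  define r where "r = rec_nat h (\<lambda>N f x. f x - z N * e N x)"
  have r0: "r 0 = h" and rS: "r (Suc N) = (\<lambda>x. r N x - z N * e N x)" for N by (auto simp: r_def)
  have rL: "r N \<in> L2 M" for N by (induction N) (auto simp: r0 rS h intro!: L2_diff L2_scale e)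
  have norm_e: "(l2_norm M (e k))\<^sup>2 = n k" for k
  proof -
    have "complex_of_real ((l2_norm M (e k))\<^sup>2) = of_real (n k)" unfolding l2_norm_sq_inner[symmetric] orth by simp
    thus ?thesis unfolding of_real_eq_iff .
  qed
  have lin: "l2_inner M (\<lambda>x. f x - w * g x) k = l2_inner M f k - w * l2_inner M g k"
    if "f \<in> L2 M" "g \<in> L2 M" "k \<in> L2 M" for f g k w
  proof -
    have i: "integrable M (\<lambda>x. f x * cnj (k x))" "integrable M (\<lambda>x. g x * cnj (k x))"
      by (intro integrable_L2_mult L2_cnj that)+
    have "l2_inner M (\<lambda>x. f x - w * g x) k = (LINT x|M. f x * cnj (k x) - w * (g x * cnj (k x)))"
      unfolding l2_inner_def by (simp add: algebra_simps)
    thus ?thesis unfolding l2_inner_def using i by simp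
  qed
  have ri: "l2_inner M (r N) (e k) = (if k < N then 0 else c k)" for N k
  proof (induction N)
    case 0
    show ?case by (simp add: r0 c_def)
  next
    case (Suc N)
    have "n k \<noteq> 0" using n[of k] by simp
    thus ?case unfolding rS lin[OF rL e e] Suc orth by (cases "k = N") (auto simp: z_def less_Suc_eq)
  qed
  have zs: "(cmod (z k))\<^sup>2 * n k = s k" for k
    using n[of k] by (simp add: z_def s_def norm_divide power_divide power2_eq_square)
  have nr: "(l2_norm M (r N))\<^sup>2 = (l2_norm M h)\<^sup>2 - (\<Sum>k<N. s k)" for N
  proof (induction N)
    case (Suc N)
    have "Re (cnj (z N) * c N) = s N"
    proof -
      have "cnj (z N) * c N = of_real ((cmod (c N))\<^sup>2) / of_real (n N)"
        by (simp only: complex_norm_square z_def complex_cnj_divide complex_cnj_complex_of_real) simp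
      thus ?thesis by (simp add: s_def flip: of_real_divide)
    qed
    thus ?case unfolding rS l2_norm_sq_sub[OF rL e] ri norm_e zs Suc by simp
  qed (simp add: r0)
  have sums_le: "(\<Sum>k<N. s k) \<le> (l2_norm M h)\<^sup>2" for N
    using nr[of N] zero_le_power2[of "l2_norm M (r N)"] by linarith
  have summ: "summable s"
    by (rule summableI_nonneg_bounded[OF s0 sums_le])
  \<comment> \<open>Each further term is orthogonal to the difference collected so far, so the
    squares add up to a piece of the convergent series.\<close>
  have dist: "(l2_norm M (\<lambda>x. r N x - r (N + m) x))\<^sup>2 = (\<Sum>k=N..<N+m. s k)" for N m
  proof (induction m)
    case (Suc m)
    have "l2_inner M (\<lambda>x. r N x - r (N + m) x) (e (N + m)) = 0"
      using lin[OF rL rL e, of N 1 "N + m" "N + m"] by (simp add: ri)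
    moreover have "(\<lambda>x. r N x - r (N + Suc m) x) = (\<lambda>x. (r N x - r (N + m) x) - (- z (N + m)) * e (N + m) x)"
      by (simp add: rS algebra_simps)
    ultimately have "(l2_norm M (\<lambda>x. r N x - r (N + Suc m) x))\<^sup>2 = (l2_norm M (\<lambda>x. r N x - r (N + m) x))\<^sup>2 + s (N + m)"
      using l2_norm_sq_sub[OF L2_diff[OF rL rL] e, of N "N + m" "- z (N + m)" "N + m"] by (simp add: norm_e zs)
    thus ?case using Suc by simp
  qed simp
  have "\<exists>f\<in>L2 M. (\<lambda>N. l2_norm M (\<lambda>x. r N x - f x)) \<longlonglongrightarrow> 0"
  proof (rule L2_complete[OF rL])
    fix \<epsilon> :: real assume \<epsilon>: "\<epsilon> > 0"
    hence "\<epsilon>\<^sup>2 > 0" by simp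
    from summ have "Cauchy (\<lambda>N. \<Sum>k<N. s k)" by (simp add: summable_iff_convergent Cauchy_convergent_iff)
    then obtain N0 where N0: "\<And>M N. M \<ge> N0 \<Longrightarrow> N \<ge> N0 \<Longrightarrow> norm ((\<Sum>k<M. s k) - (\<Sum>k<N. s k)) < \<epsilon>\<^sup>2"
      using CauchyD[OF _ \<open>\<epsilon>\<^sup>2 > 0\<close>] by blast
    have *: "l2_norm M (\<lambda>x. r N x - r K x) < \<epsilon>" if "N \<ge> N0" "K \<ge> N" for N K
    proof -
      have "(l2_norm M (\<lambda>x. r N x - r K x))\<^sup>2 = (\<Sum>k=N..<K. s k)" using dist[of N "K - N"] that by simp
      also have "\<dots> = (\<Sum>k<K. s k) - (\<Sum>k<N. s k)"
        using that by (simp add: sum_diff_nat_ivl[of 0 N K s, symmetric] lessThan_atLeast0)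
      also have "\<dots> < \<epsilon>\<^sup>2" using N0[of K N] that by (auto simp: abs_less_iff)
      finally show ?thesis using \<epsilon> by (simp add: power_less_imp_less_base)
    qed
    show "\<exists>N. \<forall>m\<ge>N. \<forall>n\<ge>N. l2_norm M (\<lambda>x. r m x - r n x) < \<epsilon>"
    proof (intro exI[of _ N0] allI impI)
      fix m n assume mn: "N0 \<le> m" "N0 \<le> n"
      show "l2_norm M (\<lambda>x. r m x - r n x) < \<epsilon>"
        using *[of n m] *[of m n] mn by (cases "n \<le> m") (auto simp: l2_norm_minus_commute[of M "r m"])
    qed
  qed
  then obtain f where f: "f \<in> L2 M" "(\<lambda>N. l2_norm M (\<lambda>x. r N x - f x)) \<longlonglongrightarrow> 0" by blast
  have "l2_inner M f (e k) = 0" for k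
  proof -
    have "cmod (l2_inner M f (e k)) \<le> l2_norm M (\<lambda>x. r N x - f x) * l2_norm M (e k)" if "N > k" for N
    proof -
      have "l2_inner M (\<lambda>x. r N x - f x) (e k) = - l2_inner M f (e k)"
        using lin[OF rL f(1) e, of N 1 k] that by (simp add: ri)
      thus ?thesis using Cauchy_Schwarz_L2[OF L2_diff[OF rL f(1)] e, of N k] by simp
    qed
    hence "\<forall>N\<ge>Suc k. cmod (l2_inner M f (e k)) \<le> l2_norm M (\<lambda>x. r N x - f x) * l2_norm M (e k)" by auto
    moreover have "(\<lambda>N. l2_norm M (\<lambda>x. r N x - f x) * l2_norm M (e k)) \<longlonglongrightarrow> 0 * l2_norm M (e k)"
      by (intro tendsto_intros f(2))
    ultimately have "cmod (l2_inner M f (e k)) \<le> 0 * l2_norm M (e k)"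
      by (intro LIMSEQ_le_const) auto
    thus ?thesis by simp
  qed
  hence "AE x in M. f x = 0" by (intro compl f)
  hence "l2_norm M f = 0" using l2_norm_eq_0[OF f(1)] by simp
  hence "(\<lambda>N. l2_norm M (r N)) \<longlonglongrightarrow> 0" using l2_norm_tendsto[OF rL f] by simp
  hence "(\<lambda>N. (l2_norm M (r N))\<^sup>2) \<longlonglongrightarrow> 0\<^sup>2" by (intro tendsto_intros)
  hence "(\<lambda>N. (l2_norm M h)\<^sup>2 - (l2_norm M (r N))\<^sup>2) \<longlonglongrightarrow> (l2_norm M h)\<^sup>2 - 0\<^sup>2"
    by (rule tendsto_diff[OF tendsto_const])
  hence "(\<lambda>N. \<Sum>k<N. s k) \<longlonglongrightarrow> (l2_norm M h)\<^sup>2" by (simp add: nr)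
  thus ?thesis by (simp add: sums_def s_def c_def)
qed

section \<open>The cosine basis of the cross-section\<close>

context strip
begin

definition ecos :: "nat \<Rightarrow> real \<Rightarrow> complex" where
  "ecos k y = of_real (cos (kap k * (y + a)))"

lemma ecos_continuous: "continuous_on S (ecos k)"
  unfolding ecos_def[abs_def] by (intro continuous_intros)

lemma ecos_L2: "ecos k \<in> L2 MI" by (rule L2_MI_continuous[OF ecos_continuous])

text \<open>Integer frequencies cover both the difference and the sum of two indices in the product
  formula for cosines.\<close>

lemma integral_cos_int:
  "(LINT y|MI. complex_of_real (cos (pi * of_int m / (2 * a) * (y + a)))) = (if m = 0 then of_real (2 * a) else 0)"
proof (cases "m = 0")
  case True
  have "(LINT y|MI. (1::complex)) = of_real a - of_real (-a)"
    by (rule MI_FTC) (auto intro!: derivative_eq_intros has_vector_derivative_of_real)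
  thus ?thesis using True by simp
next
  case False
  define b where "b = pi * of_int m / (2 * a)"
  have b: "b \<noteq> 0" using False a by (simp add: b_def)
  have "(LINT y|MI. complex_of_real (1 / b * b * cos (b * (y + a)))) = of_real (1 / b * sin (b * (a + a))) - of_real (1 / b * sin (b * (- a + a)))"
    by (rule MI_FTC[OF sin_deriv]) (intro continuous_intros)
  moreover have "b * (a + a) = of_int m * pi" using a by (simp add: b_def)
  hence "sin (b * (a + a)) = 0" using sin_zero_iff_int2 by blast
  ultimately show ?thesis using b False by (simp add: b_def)
qed

lemma ecos_orth: "l2_inner MI (ecos j) (ecos k) = (if j = k then of_real (if k = 0 then 2 * a else a) else 0)"
proof -
  have *: "kap j * (y + a) - kap k * (y + a) = pi * of_int (int j - int k) / (2 * a) * (y + a)"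
      "kap j * (y + a) + kap k * (y + a) = pi * of_int (int j + int k) / (2 * a) * (y + a)" for y
    using a by (simp_all add: kap_def field_simps)
  have "ecos j y * cnj (ecos k y) = (1/2) * (complex_of_real (cos (pi * of_int (int j - int k) / (2 * a) * (y + a)))
      + complex_of_real (cos (pi * of_int (int j + int k) / (2 * a) * (y + a))))" for y
    unfolding *[symmetric] ecos_def cos_diff cos_add by simp
  hence "l2_inner MI (ecos j) (ecos k) = (LINT y|MI. (1/2) * (complex_of_real (cos (pi * of_int (int j - int k) / (2 * a) * (y + a)))
      + complex_of_real (cos (pi * of_int (int j + int k) / (2 * a) * (y + a)))))"
    unfolding l2_inner_def by (simp only:)
  also have "\<dots> = (1/2) * ((LINT y|MI. complex_of_real (cos (pi * of_int (int j - int k) / (2 * a) * (y + a))))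
      + (LINT y|MI. complex_of_real (cos (pi * of_int (int j + int k) / (2 * a) * (y + a)))))"
  proof -
    have "integrable MI (\<lambda>y. complex_of_real (cos (pi * of_int m / (2 * a) * (y + a))))" for m :: int
      by (intro integrable_MI L2_MI_continuous continuous_intros)
    thus ?thesis by (simp only: integral_mult_right_zero Bochner_Integration.integral_add)
  qed
  also have "\<dots> = (if j = k then of_real (if k = 0 then 2 * a else a) else 0)"
    unfolding integral_cos_int using a by auto
  finally show ?thesis .
qed

text \<open>Orthogonality to all cos(k theta) gives orthogonality to all powers of cos(theta) by the
  product formula. Since cos maps [0, pi] bijectively onto [-1, 1], the Weierstrass theorem extends
  this to all continuous functions; bumps then give vanishing integrals over all intervals.\<close>

lemma ecos_complete:
  assumes h: "h \<in> L2 MI" and z: "\<And>k. l2_inner MI h (ecos k) = 0"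
  shows "AE y in MI. h y = 0"
proof -
  define th where "th y = kap 1 * (y + a)" for y
  have hi: "integrable MI h" by (rule integrable_MI[OF h])
  have hc: "integrable MI (\<lambda>y. h y * of_real (f y))" if "continuous_on {-a..a} f" for f :: "real \<Rightarrow> real"
    by (intro integrable_L2_mult h L2_MI_continuous continuous_intros that)
  define L where "L f = (LINT y|MI. h y * of_real (f y))" for f :: "real \<Rightarrow> real"
  have thk: "kap k * (y + a) = real k * th y" for k y by (simp add: th_def kap_def)
  have thc: "continuous_on S th" for S unfolding th_def[abs_def] by (intro continuous_intros)
  have Lcos: "L (\<lambda>y. cos (real k * th y)) = 0" for k
    using z[of k] by (simp add: L_def l2_inner_def ecos_def thk)
  have Lpow: "L (\<lambda>y. cos (th y) ^ j * cos (real k * th y)) = 0" for j k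
  proof (induction j arbitrary: k)
    case 0
    show ?case using Lcos by simp
  next
    case (Suc j)
    \<comment> \<open>The product formula produces the indices k + 1 and k - 1; cosine is even, so
      index -1 is replaced by 1.\<close>
    define k' where "k' = (if k = 0 then 1 else k - 1)"
    have "cos (th y) * cos (real k * th y) = (1/2) * (cos (real (Suc k) * th y) + cos (real k' * th y))" for y
    proof (cases "k = 0")
      case False
      hence kk: "real k' = real k - 1" by (simp add: k'_def)
      have e: "real (Suc k) * th y = real k * th y + th y" by (simp add: algebra_simps)
      have e': "real k' * th y = real k * th y - th y" unfolding kk by (simp add: left_diff_distrib)
      show ?thesis unfolding e e' cos_add cos_diff by simp
    qed (simp add: k'_def)
    hence "h y * of_real (cos (th y) ^ Suc j * cos (real k * th y)) =
       (1/2) * (h y * of_real (cos (th y) ^ j * cos (real (Suc k) * th y)) + h y * of_real (cos (th y) ^ j * cos (real k' * th y)))" for y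
    proof -
      have "cos (th y) ^ Suc j * cos (real k * th y) = cos (th y) ^ j * (cos (th y) * cos (real k * th y))" by simp
      also have "\<dots> = (1/2) * (cos (th y) ^ j * cos (real (Suc k) * th y) + cos (th y) ^ j * cos (real k' * th y))"
        unfolding \<open>\<And>y. cos (th y) * cos (real k * th y) = _ y\<close> by (simp add: algebra_simps)
      finally show ?thesis by (simp add: algebra_simps)
    qed
    hence "L (\<lambda>y. cos (th y) ^ Suc j * cos (real k * th y)) = (LINT y|MI.
       (1/2) * (h y * of_real (cos (th y) ^ j * cos (real (Suc k) * th y)) + h y * of_real (cos (th y) ^ j * cos (real k' * th y))))"
      unfolding L_def by (simp only:)
    also have "\<dots> = (1/2) * (L (\<lambda>y. cos (th y) ^ j * cos (real (Suc k) * th y)) + L (\<lambda>y. cos (th y) ^ j * cos (real k' * th y)))"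
      unfolding L_def integral_mult_right_zero
      by (subst Bochner_Integration.integral_add) (auto intro!: hc continuous_intros thc simp del: of_real_mult)
    finally show ?case by (simp only: Suc) simp
  qed
  have Lpoly: "L (\<lambda>y. \<Sum>i\<le>n. c i * cos (th y) ^ i) = 0" for c :: "nat \<Rightarrow> real" and n
  proof -
    have "L (\<lambda>y. \<Sum>i\<le>n. c i * cos (th y) ^ i) = (LINT y|MI. (\<Sum>i\<le>n. of_real (c i) * (h y * of_real (cos (th y) ^ i))))"
      unfolding L_def by (simp add: sum_distrib_left mult_ac)
    also have "\<dots> = (\<Sum>i\<le>n. of_real (c i) * L (\<lambda>y. cos (th y) ^ i))"
      unfolding L_def by (subst Bochner_Integration.integral_sum) (auto intro!: integrable_mult_right hc continuous_intros thc simp del: of_real_power)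
    also have "\<dots> = 0" using Lpow[of _ 0] by simp
    finally show ?thesis .
  qed
  have Lcont: "L f = 0" if f: "continuous_on {-a..a} f" for f
  proof (rule ccontr)
    assume nz: "L f \<noteq> 0"
    \<comment> \<open>Adding 1 to the L1 norm of h makes K positive and the final estimate strict,
      by the factor (K - 1) / K.\<close>
    define K where "K = (LINT y|MI. cmod (h y)) + 1"
    have "0 \<le> (LINT y|MI. cmod (h y))" by (rule integral_nonneg_AE) simp
    hence K: "K > 0" unfolding K_def by linarith
    \<comment> \<open>The function f in the variable x = cos(theta), obtained by inverting theta =
      kap 1 (y + a) on [0, pi].\<close>
    define F where "F x = f (arccos x / kap 1 - a)" for x
    have k1: "kap 1 > 0" by (rule kap_pos) simp
    have rng: "arccos x / kap 1 - a \<in> {-a..a}" if "x \<in> {-1..1}" for x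
    proof -
      have "0 \<le> arccos x" "arccos x \<le> pi" using that arccos_lbound arccos_ubound by auto
      moreover have "pi / kap 1 = 2 * a" using a by (simp add: kap_def)
      ultimately have "0 \<le> arccos x / kap 1" "arccos x / kap 1 \<le> 2 * a"
        using k1 divide_right_mono[of "arccos x" pi "kap 1"] by auto
      thus ?thesis by auto
    qed
    have Fc: "continuous_on {-1..1} F" unfolding F_def[abs_def]
      by (rule continuous_on_compose2[OF f]) (use rng k1 in \<open>auto intro!: continuous_intros continuous_on_arccos'\<close>)
    have Ff: "F (cos (th y)) = f y" if "y \<in> {-a..a}" for y
    proof -
      have "0 \<le> th y" using that k1 by (simp add: th_def)
      moreover have "th y \<le> pi"
      proof -
        have "th y \<le> kap 1 * (2 * a)" unfolding th_def using that k1 by (intro mult_left_mono) auto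
        thus ?thesis using a by (simp add: kap_def)
      qed
      ultimately have "arccos (cos (th y)) = th y" by (rule arccos_cos)
      thus ?thesis using k1 by (simp add: F_def th_def)
    qed
    obtain p where p: "real_polynomial_function p" "\<And>x. x \<in> {-1..1} \<Longrightarrow> \<bar>F x - p x\<bar> < cmod (L f) / K"
      using Stone_Weierstrass_real_polynomial_function[OF compact_Icc Fc, of "cmod (L f) / K"] nz K by auto
    obtain n c where pc: "p = (\<lambda>x. \<Sum>i\<le>n. c i * x ^ i)" using p(1) by (auto simp: real_polynomial_function_iff_sum)
    define P where "P y = p (cos (th y))" for y
    have LP: "L P = 0" unfolding P_def[abs_def] pc by (rule Lpoly)
    have Pc: "continuous_on {-a..a} P" unfolding P_def[abs_def] pc by (intro continuous_intros thc)
    have close: "\<bar>f y - P y\<bar> \<le> cmod (L f) / K" if "y \<in> II a" for y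
      using p(2)[of "cos (th y)"] Ff[of y] that by (auto simp: P_def less_imp_le)
    have "L f = L f - L P" using LP by simp
    also have "\<dots> = (LINT y|MI. h y * of_real (f y - P y))"
      unfolding L_def using hc[OF f] hc[OF Pc] by (simp add: right_diff_distrib)
    finally have "cmod (L f) = cmod (LINT y|MI. h y * of_real (f y - P y))" by simp
    also have "\<dots> \<le> (LINT y|MI. cmod (h y * of_real (f y - P y)))" by (rule integral_norm_bound)
    also have "\<dots> \<le> (LINT y|MI. cmod (h y) * (cmod (L f) / K))"
    proof (rule integral_mono)
      show "integrable MI (\<lambda>y. cmod (h y * complex_of_real (f y - P y)))"
        by (intro integrable_norm hc continuous_intros f Pc)
      show "integrable MI (\<lambda>y. cmod (h y) * (cmod (L f) / K))"
        using integrable_norm[OF hi] by simp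
      show "cmod (h y * complex_of_real (f y - P y)) \<le> cmod (h y) * (cmod (L f) / K)" if "y \<in> space MI" for y
        unfolding norm_mult norm_of_real using close[of y] that by (intro mult_left_mono) auto
    qed
    also have "\<dots> = (K - 1) * (cmod (L f) / K)" by (simp add: K_def)
    also have "\<dots> < cmod (L f)" using nz K by (simp add: field_simps)
    finally show False by simp
  qed
  have loc: "loc_integrable (II a) h" by (rule L2_loc_integrable[OF Sopen h])
  have "AE y in lborel. y \<in> II a \<longrightarrow> h y = 0"
  proof (rule loc_zero_AE[OF Sopen loc])
    fix p q :: real assume pq: "p \<le> q" "{p..q} \<subseteq> II a"
    define hh where "hh y = indicator (II a) y *\<^sub>R h y" for y
    have hhi: "integrable lborel hh" using hi unfolding hh_def MI_integrable_indicator .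
    have si: "set_integrable lborel {-a..a} hh"
      unfolding set_integrable_def by (rule integrable_mult_indicator[OF _ hhi]) simp
    have "{p..q} \<subseteq> {-a..a}" using pq by auto
    from bump_integral_tendsto[OF si this]
    have "(\<lambda>n. LINT y:{-a..a}|lborel. hh y * complex_of_real (bump p q (real (Suc n)) y)) \<longlonglongrightarrow> (LINT y:{p..q}|lborel. hh y)" .
    moreover have "(LINT y:{-a..a}|lborel. hh y * complex_of_real (bump p q (real (Suc n)) y)) = L (bump p q (real (Suc n)))" for n
      unfolding L_def MI_integral_indicator set_lebesgue_integral_def
      by (rule Bochner_Integration.integral_cong[OF refl]) (auto simp: hh_def indicator_def)
    moreover have "L (bump p q (real (Suc n))) = 0" for n
      by (intro Lcont smooth_continuous_on smooth_bump)
    ultimately have "(LINT y:{p..q}|lborel. hh y) = 0" by (simp add: LIMSEQ_const_iff)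
    moreover have "(LINT y:{p..q}|lborel. hh y) = (LINT y:{p..q}|lborel. h y)"
      unfolding set_lebesgue_integral_def
      by (rule Bochner_Integration.integral_cong[OF refl]) (use pq in \<open>auto simp: hh_def indicator_def\<close>)
    ultimately show "(LINT y:{p..q}|lborel. h y) = 0" by simp
  qed
  thus ?thesis by (simp add: AE_meas_on)
qed

lemma cos_Parseval:
  assumes "h \<in> L2 MI"
  shows "(\<lambda>k. (cmod (LINT y|MI. h y * ecos k y))\<^sup>2 / (if k = 0 then 2 * a else a)) sums (l2_norm MI h)\<^sup>2"
proof -
  have "(\<lambda>k. (cmod (l2_inner MI h (ecos k)))\<^sup>2 / (if k = 0 then 2 * a else a)) sums (l2_norm MI h)\<^sup>2"
    by (rule Parseval_orthogonal[OF ecos_L2 ecos_orth _ ecos_complete assms]) (use a in auto)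
  thus ?thesis by (simp add: l2_inner_def ecos_def)
qed

section \<open>The Volterra operator and its bounds\<close>

definition ext :: "(real \<Rightarrow> complex) \<Rightarrow> real \<Rightarrow> complex" where
  "ext g y = indicator (II a) y *\<^sub>R g y"

definition tailint :: "(real \<Rightarrow> complex) \<Rightarrow> real \<Rightarrow> complex" where
  "tailint g y = (LINT t:{y..a}|lborel. ext g t)"

text \<open>The triangular operator \<open>1 - i \<alpha> V\<close>, with \<open>V\<close> the integration operator, carries the functionals
  \<open>\<integral> g \<psi>\<^sub>k\<close> with \<open>k \<ge> 1\<close> to cosine coefficients.\<close>

definition volt :: "(real \<Rightarrow> complex) \<Rightarrow> real \<Rightarrow> complex" where
  "volt g y = g y - \<i> * of_real \<alpha> * tailint g y"

lemma ext_integrable: "integrable MI g \<Longrightarrow> integrable lborel (ext g)"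
  unfolding MI_integrable_indicator ext_def[abs_def] .

lemma ext_set_integrable: "integrable MI g \<Longrightarrow> A \<in> sets borel \<Longrightarrow> set_integrable lborel A (ext g)"
  unfolding set_integrable_def by (rule integrable_mult_indicator[OF _ ext_integrable]) auto

lemma MI_integral_ext: "(LINT y|MI. g y * f y) = (LINT y:{-a..a}|lborel. ext g y * f y)"
  unfolding MI_integral_indicator set_lebesgue_integral_def
  by (rule Bochner_Integration.integral_cong[OF refl]) (auto simp: ext_def indicator_def)

lemma tailint_diff:
  assumes g: "integrable MI g" and "-a \<le> y" "y \<le> x" "x \<le> a"
  shows "tailint g x - tailint g y = (LINT t:{y..x}|lborel. - ext g t)"
proof -
  note si = ext_set_integrable[OF g]
  have "tailint g y = (LINT t:{y..x} \<union> {x<..a}|lborel. ext g t)"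
    unfolding tailint_def using assms by (intro arg_cong[where f = "\<lambda>A. set_lebesgue_integral lborel A (ext g)"]) auto
  also have "\<dots> = (LINT t:{y..x}|lborel. ext g t) + (LINT t:{x<..a}|lborel. ext g t)"
    by (rule set_integral_Un) (auto intro!: si)
  also have "(LINT t:{x<..a}|lborel. ext g t) = tailint g x"
    unfolding tailint_def set_lebesgue_integral_def
  proof (rule integral_cong_AE)
    have [measurable]: "ext g \<in> borel_measurable borel" using ext_integrable[OF g] by auto
    show "(\<lambda>t. indicat_real {x<..a} t *\<^sub>R ext g t) \<in> borel_measurable lborel" by measurable
    show "(\<lambda>t. indicat_real {x..a} t *\<^sub>R ext g t) \<in> borel_measurable lborel" by measurable
    show "AE t in lborel. indicat_real {x<..a} t *\<^sub>R ext g t = indicat_real {x..a} t *\<^sub>R ext g t"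
      using AE_lborel_singleton[of x] by eventually_elim (auto simp: indicator_def)
  qed
  finally show ?thesis by (simp add: set_integral_uminus si)
qed

lemma tailint_end: "tailint g a = 0"
proof -
  have "(\<lambda>t. indicat_real {a..a} t *\<^sub>R ext g t) = (\<lambda>t. 0)" by (auto simp: fun_eq_iff indicator_def ext_def)
  thus ?thesis unfolding tailint_def set_lebesgue_integral_def by (simp only: integral_zero)
qed

lemma tailint_continuous:
  assumes g: "integrable MI g"
  shows "continuous_on {-a..a} (tailint g)"
proof -
  have "continuous_on {-a..a} (\<lambda>x. tailint g (-a) + integral {-a..x} (\<lambda>t. - ext g t))"
    by (intro continuous_intros indefinite_integral_continuous_1 set_borel_integral_eq_integral)
       (use ext_set_integrable[OF g, of "{-a..a}"] in \<open>simp add: set_integrable_def\<close>)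
  moreover have "tailint g (-a) + integral {-a..x} (\<lambda>t. - ext g t) = tailint g x" if "x \<in> {-a..a}" for x
  proof -
    have "set_integrable lborel {-a..x} (\<lambda>t. - ext g t)"
      using ext_set_integrable[OF g, of "{-a..x}"] by (simp add: set_integrable_def)
    thus ?thesis using tailint_diff[OF g, of "-a" x] that a set_borel_integral_eq_integral(2)[of "{-a..x}" "\<lambda>t. - ext g t"]
      by (simp add: algebra_simps)
  qed
  ultimately show ?thesis by (rule continuous_on_eq)
qed

lemma tailint_L2: "g \<in> L2 MI \<Longrightarrow> tailint g \<in> L2 MI"
  by (rule L2_MI_continuous[OF tailint_continuous[OF integrable_MI]])

lemma volt_L2: "g \<in> L2 MI \<Longrightarrow> volt g \<in> L2 MI"
  unfolding volt_def[abs_def] by (intro L2_diff L2_scale tailint_L2)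

lemma tailint_by_parts:
  assumes g: "integrable MI g" and \<phi>: "\<And>y. (\<phi> has_vector_derivative \<phi>' y) (at y)" and \<phi>': "continuous_on UNIV \<phi>'"
    and s: "-a \<le> s" "s \<le> a"
  shows "(LINT y:{s..a}|lborel. tailint g y * \<phi>' y) = (LINT y:{s..a}|lborel. ext g y * \<phi> y) - tailint g s * \<phi> s"
proof -
  have "(LINT y:{s..a}|lborel. tailint g y * \<phi>' y) + (LINT y:{s..a}|lborel. - ext g y * \<phi> y) = tailint g a * \<phi> a - tailint g s * \<phi> s"
  proof (rule integral_by_parts_AC[OF s(2)])
    show "set_integrable lborel {s..a} (\<lambda>y. - ext g y)"
      using ext_set_integrable[OF g, of "{s..a}"] by (simp add: set_integrable_def)
    show "tailint g x - tailint g s = (LINT t:{s..x}|lborel. - ext g t)" if "x \<in> {s..a}" for x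
      by (rule tailint_diff[OF g]) (use that s in auto)
    show "continuous_on {s..a} \<phi>'" using \<phi>' continuous_on_subset by blast
  qed (use \<phi> in \<open>auto intro: has_vector_derivative_at_within\<close>)
  moreover have "(LINT y:{s..a}|lborel. - ext g y * \<phi> y) = - (LINT y:{s..a}|lborel. ext g y * \<phi> y)"
    by (simp add: set_lebesgue_integral_def)
  ultimately show ?thesis by (simp add: tailint_end algebra_simps)
qed

lemma MI_integral_continuous_mult:
  fixes f \<phi> :: "real \<Rightarrow> complex"
  assumes "continuous_on {-a..a} f" "continuous_on UNIV \<phi>"
  shows "(LINT y|MI. f y * \<phi> y) = (LINT y:{-a..a}|lborel. f y * \<phi> y)"
  by (rule MI_integral_continuous) (intro continuous_intros assms continuous_on_subset[OF assms(2)], simp)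

text \<open>Integrate by parts with the primitive sin / kap of the cosine: the tail integral
  vanishes at a and the sine at -a, so the Volterra part becomes the sine term of
  \<open>psi k\<close>. For k = 0 the frequency vanishes and this primitive does not exist.\<close>

lemma volt_ecos:
  assumes g: "g \<in> L2 MI" and k: "k \<noteq> 0"
  shows "(LINT y|MI. volt g y * ecos k y) = (LINT y|MI. g y * psi k y)"
proof -
  define sn where "sn y = complex_of_real (1 / kap k * sin (kap k * (y + a)))" for y
  have kp: "kap k > 0" by (rule kap_pos[OF k])
  have gi: "integrable MI g" by (rule integrable_MI[OF g])
  have D: "(sn has_vector_derivative ecos k y) (at y)" for y
    using sin_deriv[of "1 / kap k" "kap k" y] kp by (simp add: sn_def[abs_def] ecos_def)
  have snc: "continuous_on S sn" for S unfolding sn_def[abs_def] by (intro continuous_intros)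
  have "(LINT y:{-a..a}|lborel. tailint g y * ecos k y) = (LINT y:{-a..a}|lborel. ext g y * sn y) - tailint g (-a) * sn (-a)"
    by (rule tailint_by_parts[OF gi D ecos_continuous]) (use a in auto)
  moreover have "sn (-a) = 0" by (simp add: sn_def)
  ultimately have T: "(LINT y|MI. tailint g y * ecos k y) = (LINT y|MI. g y * sn y)"
    using MI_integral_continuous_mult[OF tailint_continuous[OF gi] ecos_continuous] by (simp add: MI_integral_ext)
  have i: "integrable MI (\<lambda>y. g y * ecos k y)" "integrable MI (\<lambda>y. tailint g y * ecos k y)" "integrable MI (\<lambda>y. g y * sn y)"
    by (intro integrable_L2_mult g ecos_L2 tailint_L2 L2_MI_continuous snc)+
  have "(LINT y|MI. volt g y * ecos k y) = (LINT y|MI. g y * ecos k y - \<i> * of_real \<alpha> * (tailint g y * ecos k y))"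
    by (simp add: volt_def algebra_simps)
  also have "\<dots> = (LINT y|MI. g y * ecos k y) - \<i> * of_real \<alpha> * (LINT y|MI. g y * sn y)"
    using i T by simp
  also have "\<dots> = (LINT y|MI. g y * ecos k y - \<i> * of_real \<alpha> * (g y * sn y))" using i by simp
  also have "\<dots> = (LINT y|MI. g y * psi k y)"
    using k by (simp add: psi_def ecos_def sn_def algebra_simps)
  finally show ?thesis .
qed

lemma norm_tailint_le:
  assumes g: "integrable MI g"
  shows "norm (tailint g y) \<le> (LINT t|MI. norm (g t))"
proof -
  have "norm (tailint g y) \<le> (LINT t|lborel. norm (indicator {y..a} t *\<^sub>R ext g t))"
    unfolding tailint_def set_lebesgue_integral_def by (rule integral_norm_bound)
  also have "\<dots> \<le> (LINT t|lborel. norm (ext g t))"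
  proof (rule integral_mono)
    show "integrable lborel (\<lambda>t. norm (indicator {y..a} t *\<^sub>R ext g t))"
      using ext_set_integrable[OF g, of "{y..a}"] unfolding set_integrable_def by (intro integrable_norm) auto
    show "integrable lborel (\<lambda>t. norm (ext g t))" by (intro integrable_norm ext_integrable[OF g])
  qed (simp add: indicator_def)
  also have "(LINT t|lborel. norm (ext g t)) = (LINT t|MI. norm (g t))"
    unfolding meas_on_def by (subst integral_restrict_space) (auto simp: ext_def indicator_def intro!: Bochner_Integration.integral_cong)
  finally show ?thesis .
qed

lemma measure_MI: "(LINT y|MI. (1::real)) = 2 * a"
  using a by (simp add: meas_on_def measure_restrict_space space_restrict_space)

lemma L1_le_L2:
  assumes g: "g \<in> L2 MI"
  shows "(LINT t|MI. norm (g t)) \<le> sqrt (2 * a) * l2_norm MI g"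
proof -
  have 1: "(\<lambda>_. 1) \<in> L2 MI" by (rule L2_MI_continuous) (rule continuous_on_const)
  have "l2_norm MI (\<lambda>_. 1) = sqrt (2 * a)" using measure_MI by (simp add: l2_norm_def)
  thus ?thesis using Cauchy_Schwarz_abs[OF 1 g] by simp
qed

lemma l2_norm_le_sup:
  assumes f: "f \<in> L2 MI" and B: "\<And>y. y \<in> II a \<Longrightarrow> norm (f y) \<le> B" "0 \<le> B"
  shows "l2_norm MI f \<le> sqrt (2 * a) * B"
proof -
  have 1: "(\<lambda>_. 1) \<in> L2 MI" by (rule L2_MI_continuous) (rule continuous_on_const)
  have n1: "l2_norm MI (\<lambda>_. 1) = sqrt (2 * a)" using measure_MI by (simp add: l2_norm_def)
  have "l2_norm MI f \<le> B * l2_norm MI (\<lambda>_. 1)"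
    by (rule l2_norm_mono[OF 1 L2_measurable[OF f]]) (use B in auto)
  thus ?thesis by (simp add: n1 mult.commute)
qed

text \<open>The constant 2 a is a product of two factors sqrt (2 a): one from bounding the L1 norm
  by the L2 norm, one from bounding the L2 norm by the supremum.\<close>

lemma volt_upper:
  assumes g: "g \<in> L2 MI"
  shows "l2_norm MI (volt g) \<le> (1 + 2 * a * \<bar>\<alpha>\<bar>) * l2_norm MI g"
proof -
  have "norm (tailint g y) \<le> sqrt (2 * a) * l2_norm MI g" for y
    using norm_tailint_le[OF integrable_MI[OF g], of y] L1_le_L2[OF g] by linarith
  hence "l2_norm MI (tailint g) \<le> sqrt (2 * a) * (sqrt (2 * a) * l2_norm MI g)"
    using a by (intro l2_norm_le_sup tailint_L2 g) auto
  also have "\<dots> = 2 * a * l2_norm MI g" using a by (simp flip: mult.assoc)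
  finally have t: "l2_norm MI (tailint g) \<le> 2 * a * l2_norm MI g" .
  have "l2_norm MI (volt g) \<le> l2_norm MI g + l2_norm MI (\<lambda>y. \<i> * of_real \<alpha> * tailint g y)"
    unfolding volt_def[abs_def] by (intro l2_norm_triangle_diff g L2_scale tailint_L2)
  also have "\<dots> \<le> l2_norm MI g + \<bar>\<alpha>\<bar> * (2 * a * l2_norm MI g)"
    unfolding l2_norm_scale using mult_left_mono[OF t, of "\<bar>\<alpha>\<bar>"] by (simp add: norm_mult)
  finally show ?thesis by (simp add: algebra_simps)
qed

text \<open>With h = volt g, the tail integral t solves t' = -h - i alpha t and t(a) = 0. The
  integrating factor exp(i alpha y) has modulus 1, so t is bounded by the L1 norm of h just as it is
  by that of g in the upper bound; hence the same constant.\<close>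

lemma volt_lower:
  assumes g: "g \<in> L2 MI"
  shows "l2_norm MI g \<le> (1 + 2 * a * \<bar>\<alpha>\<bar>) * l2_norm MI (volt g)"
proof -
  define h where "h = volt g"
  have h: "h \<in> L2 MI" unfolding h_def by (rule volt_L2[OF g])
  have gi: "integrable MI g" by (rule integrable_MI[OF g])
  define ph where "ph y = exp (\<i> * complex_of_real (\<alpha> * y))" for y
  have D: "(ph has_vector_derivative \<i> * of_real \<alpha> * ph y) (at y)" for y
    using exp_deriv[of \<i> \<alpha> y] by (simp add: ph_def[abs_def])
  have phc: "continuous_on S ph" for S unfolding ph_def[abs_def] by (intro continuous_intros)
  have nph: "norm (ph y) = 1" for y by (simp add: ph_def)
  have b: "norm (tailint g s) \<le> sqrt (2 * a) * l2_norm MI h" if s: "s \<in> II a" for s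
  proof -
    have tc: "continuous_on {s..a} (tailint g)" by (rule continuous_on_subset[OF tailint_continuous[OF gi]]) (use s in auto)
    have "(LINT y:{s..a}|lborel. tailint g y * (\<i> * of_real \<alpha> * ph y)) = (LINT y:{s..a}|lborel. ext g y * ph y) - tailint g s * ph s"
      by (rule tailint_by_parts[OF gi D]) (use s in \<open>auto intro!: continuous_intros phc\<close>)
    hence "tailint g s * ph s = (LINT y:{s..a}|lborel. ext g y * ph y) - (LINT y:{s..a}|lborel. tailint g y * (\<i> * of_real \<alpha> * ph y))" by simp
    also have "\<dots> = (LINT y:{s..a}|lborel. ext g y * ph y - tailint g y * (\<i> * of_real \<alpha> * ph y))"
    proof (rule set_integral_diff(2)[symmetric])
      show "set_integrable lborel {s..a} (\<lambda>y. ext g y * ph y)"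
        by (intro set_integrable_mult_continuous ext_set_integrable gi phc) simp
      show "set_integrable lborel {s..a} (\<lambda>y. tailint g y * (\<i> * of_real \<alpha> * ph y))"
        by (intro borel_integrable_atLeastAtMost' continuous_intros tc phc)
    qed
    also have "\<dots> = (LINT y:{s..a}|lborel. ext h y * ph y)"
      unfolding set_lebesgue_integral_def
    proof (rule integral_cong_AE)
      have [measurable]: "ext g \<in> borel_measurable borel" "ext h \<in> borel_measurable borel"
        using ext_integrable[OF gi] ext_integrable[OF integrable_MI[OF h]] by auto
      have [measurable]: "ph \<in> borel_measurable borel" by (rule borel_measurable_continuous_onI[OF phc])
      show "(\<lambda>y. indicator {s..a} y *\<^sub>R (ext h y * ph y)) \<in> borel_measurable lborel" by measurable
      have "(\<lambda>y. indicator {s..a} y *\<^sub>R (tailint g y * (\<i> * of_real \<alpha> * ph y))) \<in> borel_measurable borel"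
        by (rule borel_measurable_continuous_on_indicator) (auto intro!: continuous_intros tc phc)
      hence "(\<lambda>y. indicator {s..a} y *\<^sub>R (ext g y * ph y) - indicator {s..a} y *\<^sub>R (tailint g y * (\<i> * of_real \<alpha> * ph y))) \<in> borel_measurable lborel"
        by measurable
      thus "(\<lambda>y. indicator {s..a} y *\<^sub>R (ext g y * ph y - tailint g y * (\<i> * of_real \<alpha> * ph y))) \<in> borel_measurable lborel"
        by (simp only: scaleR_diff_right)
      show "AE y in lborel. indicator {s..a} y *\<^sub>R (ext g y * ph y - tailint g y * (\<i> * of_real \<alpha> * ph y)) = indicator {s..a} y *\<^sub>R (ext h y * ph y)"
        using AE_lborel_singleton[of a]
      proof eventually_elim
        case (elim y)
        show ?case
        proof (cases "y \<in> {s..a}")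
          case True
          hence "y \<in> II a" using elim s by auto
          thus ?thesis by (simp add: ext_def h_def volt_def algebra_simps)
        qed simp
      qed
    qed
    finally have "norm (tailint g s * ph s) = norm (LINT y:{s..a}|lborel. ext h y * ph y)" by simp
    also have "\<dots> \<le> (LINT y|lborel. norm (indicator {s..a} y *\<^sub>R (ext h y * ph y)))"
      unfolding set_lebesgue_integral_def by (rule integral_norm_bound)
    also have "\<dots> \<le> (LINT y|lborel. norm (ext h y))"
    proof (rule integral_mono)
      have "set_integrable lborel {s..a} (\<lambda>y. ext h y * ph y)"
        by (intro set_integrable_mult_continuous ext_set_integrable integrable_MI h phc) auto
      thus "integrable lborel (\<lambda>y. norm (indicator {s..a} y *\<^sub>R (ext h y * ph y)))"
        unfolding set_integrable_def by (rule integrable_norm)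
      show "integrable lborel (\<lambda>t. norm (ext h t))" by (intro integrable_norm ext_integrable integrable_MI h)
    qed (simp add: indicator_def norm_mult nph)
    also have "(LINT t|lborel. norm (ext h t)) = (LINT t|MI. norm (h t))"
      unfolding meas_on_def by (subst integral_restrict_space) (auto simp: ext_def indicator_def intro!: Bochner_Integration.integral_cong)
    also have "\<dots> \<le> sqrt (2 * a) * l2_norm MI h" by (rule L1_le_L2[OF h])
    finally show ?thesis by (simp add: norm_mult nph)
  qed
  have "l2_norm MI (tailint g) \<le> sqrt (2 * a) * (sqrt (2 * a) * l2_norm MI h)"
    using a by (intro l2_norm_le_sup tailint_L2 g b) auto
  also have "\<dots> = 2 * a * l2_norm MI h" using a by (simp flip: mult.assoc)
  finally have t: "l2_norm MI (tailint g) \<le> 2 * a * l2_norm MI h" .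
  have "l2_norm MI g = l2_norm MI (\<lambda>y. h y + \<i> * of_real \<alpha> * tailint g y)" by (simp add: h_def volt_def)
  also have "\<dots> \<le> l2_norm MI h + l2_norm MI (\<lambda>y. \<i> * of_real \<alpha> * tailint g y)"
    by (intro l2_norm_triangle h L2_scale tailint_L2 g)
  also have "\<dots> \<le> l2_norm MI h + \<bar>\<alpha>\<bar> * (2 * a * l2_norm MI h)"
    unfolding l2_norm_scale using mult_left_mono[OF t, of "\<bar>\<alpha>\<bar>"] by (simp add: norm_mult)
  finally show ?thesis by (simp add: algebra_simps h_def)
qed

text \<open>The preimage of the constant 1 under \<open>volt\<close>: the equation volt g = 1
  amounts to g' = -i alpha g with g(a) = 1.\<close>

definition gone :: "real \<Rightarrow> complex" where
  "gone y = exp (\<i> * of_real (\<alpha> * a)) * psi 0 y"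

lemma gone_L2: "gone \<in> L2 MI" unfolding gone_def[abs_def] by (intro L2_scale psi_L2)

lemma volt_gone:
  assumes y: "y \<in> II a"
  shows "volt gone y = 1"
proof -
  have "(gone has_vector_derivative exp (\<i> * of_real (\<alpha> * a)) * psi' 0 y) (at y)" for y
    unfolding gone_def[abs_def] by (intro has_vector_derivative_mult_right psi_deriv)
  moreover have "exp (\<i> * of_real (\<alpha> * a)) * psi' 0 y = - \<i> * of_real \<alpha> * gone y" for y
    by (simp add: psi'_def gone_def psi_def)
  ultimately have D: "(gone has_vector_derivative - \<i> * of_real \<alpha> * gone y) (at y)" for y by simp
  have gc: "continuous_on S gone" for S using D by (meson continuous_at_imp_continuous_on has_vector_derivative_continuous)
  have "\<i> * of_real \<alpha> * tailint gone y = (LINT t:{y..a}|lborel. \<i> * of_real \<alpha> * ext gone t)"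
    by (simp add: tailint_def)
  also have "\<dots> = (LINT t:{y..a}|lborel. \<i> * of_real \<alpha> * gone t)"
    unfolding set_lebesgue_integral_def
  proof (rule integral_cong_AE)
    have [measurable]: "gone \<in> borel_measurable borel" by (rule borel_measurable_continuous_onI[OF gc])
    have [measurable]: "ext gone \<in> borel_measurable borel" using ext_integrable[OF integrable_MI[OF gone_L2]] by auto
    show "(\<lambda>t. indicat_real {y..a} t *\<^sub>R (\<i> * of_real \<alpha> * ext gone t)) \<in> borel_measurable lborel" by measurable
    show "(\<lambda>t. indicat_real {y..a} t *\<^sub>R (\<i> * of_real \<alpha> * gone t)) \<in> borel_measurable lborel" by measurable
    show "AE t in lborel. indicat_real {y..a} t *\<^sub>R (\<i> * of_real \<alpha> * ext gone t) = indicat_real {y..a} t *\<^sub>R (\<i> * of_real \<alpha> * gone t)"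
      using AE_lborel_singleton[of a] by eventually_elim (use y in \<open>auto simp: indicator_def ext_def\<close>)
  qed
  also have "\<dots> = - gone a - - gone y"
    unfolding set_lebesgue_integral_def
  proof (rule integral_FTC_atLeastAtMost)
    show "((\<lambda>t. - gone t) has_vector_derivative \<i> * of_real \<alpha> * gone t) (at t within {y..a})" for t
    proof -
      have "((\<lambda>t. - gone t) has_vector_derivative - (- \<i> * of_real \<alpha> * gone t)) (at t)"
        by (rule has_vector_derivative_minus[OF D])
      moreover have "- (- \<i> * of_real \<alpha> * gone t) = \<i> * of_real \<alpha> * gone t" by simp
      ultimately show ?thesis by (simp only: has_vector_derivative_at_within)
    qed
    show "continuous_on {y..a} (\<lambda>t. \<i> * of_real \<alpha> * gone t)" by (intro continuous_intros gc)
  qed (use y in auto)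
  also have "gone a = 1" by (simp add: gone_def psi_def exp_minus_inverse)
  finally show ?thesis by (simp add: volt_def)
qed

lemma volt_sub:
  assumes g: "g \<in> L2 MI" and f: "f \<in> L2 MI"
  shows "volt (\<lambda>y. g y - c * f y) y = volt g y - c * volt f y"
proof -
  have "tailint (\<lambda>y. g y - c * f y) y = (LINT t:{y..a}|lborel. ext g t - c * ext f t)"
    unfolding tailint_def ext_def by (simp add: algebra_simps)
  also have "\<dots> = tailint g y - c * tailint f y"
    unfolding tailint_def
    by (subst set_integral_diff(2)) (auto intro!: ext_set_integrable integrable_MI g f)
  finally have T: "tailint (\<lambda>y. g y - c * f y) y = tailint g y - c * tailint f y" .
  show ?thesis unfolding volt_def T by (simp add: algebra_simps)
qed

text \<open>Slot 0 is left open: \<open>volt_ecos\<close> says nothing about it, and a degenerate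
  eigenvalue calls for a functional other than \<open>psi 0\<close> there.\<close>

definition frm :: "(real \<Rightarrow> complex) \<Rightarrow> nat \<Rightarrow> real \<Rightarrow> complex" where
  "frm z k = (if k = 0 then z else psi k)"

lemma frm_L2: "z \<in> L2 MI \<Longrightarrow> frm z k \<in> L2 MI"
  by (simp add: frm_def psi_L2)

text \<open>The functionals with k >= 1 determine, by Parseval, the image of g under the Volterra
  operator up to its mean. Subtracting h0 times \<open>gone\<close> removes the mean, and the
  functional z recovers h0 because it does not annihilate \<open>gone\<close>, a multiple of
  \<open>psi 0\<close>.\<close>

lemma frame_bounds:
  assumes z: "z \<in> L2 MI" and nz: "(LINT y|MI. psi 0 y * z y) \<noteq> 0"
  obtains B where "B > 0"
    "\<And>g. g \<in> L2 MI \<Longrightarrow> summable (\<lambda>k. (cmod (LINT y|MI. g y * frm z k y))\<^sup>2)"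
    "\<And>g. g \<in> L2 MI \<Longrightarrow> (l2_norm MI g)\<^sup>2 \<le> B * (\<Sum>k. (cmod (LINT y|MI. g y * frm z k y))\<^sup>2)"
    "\<And>g. g \<in> L2 MI \<Longrightarrow> (\<Sum>k. (cmod (LINT y|MI. g y * frm z k y))\<^sup>2) \<le> B * (l2_norm MI g)\<^sup>2"
proof -
  define C where "C = 1 + 2 * a * \<bar>\<alpha>\<bar>"
  have C: "C \<ge> 1" using a by (simp add: C_def)
  define Z where "Z = l2_norm MI z"
  have Z: "Z \<ge> 0" by (simp add: Z_def)
  define d where "d = (LINT y|MI. gone y * z y)"
  have d: "d \<noteq> 0"
  proof -
    have "d = exp (\<i> * of_real (\<alpha> * a)) * (LINT y|MI. psi 0 y * z y)"
      unfolding d_def gone_def by (simp add: mult.assoc)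
    thus ?thesis using nz by simp
  qed
  define Q where "Q g k = (cmod (LINT y|MI. g y * frm z k y))\<^sup>2" for g k
  define P where "P h k = (cmod (LINT y|MI. h y * ecos k y))\<^sup>2" for h k
  have Pars: "summable (P h)" "(\<Sum>k. P h (Suc k)) = a * ((l2_norm MI h)\<^sup>2 - P h 0 / (2 * a))" if h: "h \<in> L2 MI" for h
  proof -
    have s: "(\<lambda>k. P h k / (if k = 0 then 2 * a else a)) sums (l2_norm MI h)\<^sup>2"
      using cos_Parseval[OF h] by (simp add: P_def)
    hence "(\<lambda>k. P h (Suc k) / a) sums ((l2_norm MI h)\<^sup>2 - P h 0 / (2 * a))"
      using sums_Suc_iff[of "\<lambda>k. P h k / (if k = 0 then 2 * a else a)" "(l2_norm MI h)\<^sup>2 - P h 0 / (2 * a)"] by simp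
    from sums_mult[OF this, of a] a have s': "(\<lambda>k. P h (Suc k)) sums (a * ((l2_norm MI h)\<^sup>2 - P h 0 / (2 * a)))" by simp
    thus "(\<Sum>k. P h (Suc k)) = a * ((l2_norm MI h)\<^sup>2 - P h 0 / (2 * a))" by (rule sums_unique[symmetric])
    show "summable (P h)" using sums_summable[OF s'] summable_Suc_iff[of "P h"] by blast
  qed
  have QP: "Q g (Suc k) = P (volt g) (Suc k)" if "g \<in> L2 MI" for g k
    using volt_ecos[OF that, of "Suc k"] by (simp add: Q_def P_def frm_def)
  have summ: "summable (Q g)" if g: "g \<in> L2 MI" for g
  proof -
    have "summable (\<lambda>k. P (volt g) (Suc k))" using Pars(1)[OF volt_L2[OF g]] by (simp add: summable_Suc_iff)
    hence "summable (\<lambda>k. Q g (Suc k))" by (simp add: QP[OF g])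
    thus ?thesis by (simp add: summable_Suc_iff)
  qed
  have split: "(\<Sum>k. Q g k) = Q g 0 + (\<Sum>k. P (volt g) (Suc k))" if g: "g \<in> L2 MI" for g
    using suminf_split_head[OF summ[OF g]] by (simp add: QP[OF g])
  have upper: "(\<Sum>k. Q g k) \<le> (Z\<^sup>2 + a * C\<^sup>2) * (l2_norm MI g)\<^sup>2" if g: "g \<in> L2 MI" for g
  proof -
    have "Q g 0 \<le> (l2_norm MI g * Z)\<^sup>2"
      unfolding Q_def frm_def Z_def using Cauchy_Schwarz_mult[OF g z] by (intro power_mono) auto
    moreover have "(\<Sum>k. P (volt g) (Suc k)) \<le> a * (l2_norm MI (volt g))\<^sup>2"
      unfolding Pars(2)[OF volt_L2[OF g]] using a by (intro mult_left_mono) (auto simp: P_def)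
    moreover have "a * (l2_norm MI (volt g))\<^sup>2 \<le> a * (C * l2_norm MI g)\<^sup>2"
      using volt_upper[OF g] a by (intro mult_left_mono power_mono) (auto simp: C_def)
    ultimately show ?thesis unfolding split[OF g] by (simp add: power_mult_distrib algebra_simps)
  qed
  \<comment> \<open>Dominates both coefficients with which sqrt (S / a) and sqrt (Q g 0) enter the
    estimate for the norm of g below.\<close>
  define E where "E = (1 + l2_norm MI gone / cmod d * Z) * C + l2_norm MI gone / cmod d"
  have g0: "0 \<le> l2_norm MI gone / cmod d" by simp
  have E: "E > 0"
  proof -
    have "(1 + l2_norm MI gone / cmod d * Z) * C \<ge> 1 * 1" using g0 Z C by (intro mult_mono) auto
    thus ?thesis unfolding E_def using g0 by linarith
  qed
  have lower: "(l2_norm MI g)\<^sup>2 \<le> 2 * E\<^sup>2 * (1 / a + 1) * (\<Sum>k. Q g k)" if g: "g \<in> L2 MI" for g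
  proof -
    \<comment> \<open>The mean of the Volterra image, that is, its Fourier coefficient for the
      constant cosine.\<close>
    define h0 where "h0 = (LINT y|MI. volt g y * ecos 0 y) / of_real (2 * a)"
    define g' where "g' y = g y - h0 * gone y" for y
    have g'L: "g' \<in> L2 MI" unfolding g'_def[abs_def] by (intro L2_diff L2_scale g gone_L2)
    define S where "S = (\<Sum>k. P (volt g) (Suc k))"
    have "summable (\<lambda>k. P (volt g) (Suc k))"
      using Pars(1)[OF volt_L2[OF g]] summable_Suc_iff[of "P (volt g)"] by blast
    hence S0: "S \<ge> 0" unfolding S_def by (rule suminf_nonneg) (simp add: P_def)
    have e0: "ecos 0 = (\<lambda>y. 1)" by (auto simp: ecos_def kap_def)
    have "(l2_norm MI (volt g'))\<^sup>2 = S / a"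
    proof -
      have "(l2_norm MI (volt g'))\<^sup>2 = (l2_norm MI (\<lambda>y. volt g y - h0 * ecos 0 y))\<^sup>2"
      proof (rule arg_cong[where f = "\<lambda>x. x\<^sup>2"], rule l2_norm_cong_AE)
        show "AE y in MI. volt g' y = volt g y - h0 * ecos 0 y"
          unfolding g'_def[abs_def] by (rule AE_I2) (simp add: volt_sub[OF g gone_L2] volt_gone e0)
      qed (auto intro!: L2_measurable volt_L2 g'L L2_diff L2_scale g ecos_L2)
      also have "\<dots> = (l2_norm MI (volt g))\<^sup>2 - 2 * Re (cnj h0 * l2_inner MI (volt g) (ecos 0)) + (cmod h0)\<^sup>2 * (l2_norm MI (ecos 0))\<^sup>2"
        by (rule l2_norm_sq_sub[OF volt_L2[OF g] ecos_L2])
      also have "(l2_norm MI (ecos 0))\<^sup>2 = 2 * a"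
        using measure_MI by (simp add: l2_norm_sq e0)
      also have "l2_inner MI (volt g) (ecos 0) = of_real (2 * a) * h0"
        using a by (simp add: h0_def l2_inner_def e0)
      also have "cnj h0 * (of_real (2 * a) * h0) = of_real (2 * a * (cmod h0)\<^sup>2)"
        using complex_norm_square[of h0] by (simp add: mult_ac)
      also have "P (volt g) 0 = (2 * a)\<^sup>2 * (cmod h0)\<^sup>2"
        using a by (simp add: P_def h0_def norm_divide power_divide norm_mult power_mult_distrib)
      hence "(l2_norm MI (volt g))\<^sup>2 - 2 * Re (of_real (2 * a * (cmod h0)\<^sup>2)) + (cmod h0)\<^sup>2 * (2 * a) =
        (l2_norm MI (volt g))\<^sup>2 - P (volt g) 0 / (2 * a)" using a by (simp add: power2_eq_square)
      also have "\<dots> = S / a" unfolding S_def Pars(2)[OF volt_L2[OF g]] using a by simp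
      finally show ?thesis .
    qed
    hence vg': "l2_norm MI (volt g') = sqrt (S / a)" by (metis l2_norm_nonneg real_sqrt_unique)
    have ng': "l2_norm MI g' \<le> C * sqrt (S / a)" using volt_lower[OF g'L] vg' by (simp add: C_def)
    have "(LINT y|MI. g' y * z y) = (LINT y|MI. g y * z y) - h0 * d"
    proof -
      have i: "integrable MI (\<lambda>y. g y * z y)" "integrable MI (\<lambda>y. gone y * z y)" by (intro integrable_L2_mult g gone_L2 z)+
      have "(LINT y|MI. g' y * z y) = (LINT y|MI. g y * z y - h0 * (gone y * z y))"
        by (simp add: g'_def algebra_simps)
      thus ?thesis using i by (simp add: d_def)
    qed
    hence "h0 * d = (LINT y|MI. g y * z y) - (LINT y|MI. g' y * z y)" by simp
    hence "cmod h0 * cmod d \<le> cmod (LINT y|MI. g y * z y) + cmod (LINT y|MI. g' y * z y)"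
      by (metis norm_mult norm_triangle_ineq4)
    also have "cmod (LINT y|MI. g y * z y) = sqrt (Q g 0)" by (simp add: Q_def frm_def)
    also have "cmod (LINT y|MI. g' y * z y) \<le> C * sqrt (S / a) * Z"
      using Cauchy_Schwarz_mult[OF g'L z] mult_right_mono[OF ng' Z] by (simp add: Z_def)
    finally have h0: "cmod h0 \<le> (sqrt (Q g 0) + C * sqrt (S / a) * Z) / cmod d"
      using d by (simp add: field_simps)
    have "l2_norm MI g = l2_norm MI (\<lambda>y. g' y + h0 * gone y)" by (simp add: g'_def)
    also have "\<dots> \<le> l2_norm MI g' + l2_norm MI (\<lambda>y. h0 * gone y)" by (intro l2_norm_triangle g'L L2_scale gone_L2)
    also have "\<dots> \<le> C * sqrt (S / a) + (sqrt (Q g 0) + C * sqrt (S / a) * Z) / cmod d * l2_norm MI gone"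
      unfolding l2_norm_scale by (intro add_mono ng' mult_right_mono h0) auto
    also have "\<dots> = (1 + l2_norm MI gone / cmod d * Z) * C * sqrt (S / a) + l2_norm MI gone / cmod d * sqrt (Q g 0)"
      by (simp add: algebra_simps add_divide_distrib)
    also have "\<dots> \<le> E * sqrt (S / a) + E * sqrt (Q g 0)"
    proof (intro add_mono mult_right_mono)
      show "(1 + l2_norm MI gone / cmod d * Z) * C \<le> E" using g0 by (simp add: E_def)
      have "0 \<le> (1 + l2_norm MI gone / cmod d * Z) * C" using g0 Z C by (intro mult_nonneg_nonneg add_nonneg_nonneg) auto
      thus "l2_norm MI gone / cmod d \<le> E" by (simp add: E_def)
    qed (use S0 a in \<open>auto simp: Q_def\<close>)
    finally have "l2_norm MI g \<le> E * (sqrt (S / a) + sqrt (Q g 0))" by (simp add: algebra_simps)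
    hence "(l2_norm MI g)\<^sup>2 \<le> (E * (sqrt (S / a) + sqrt (Q g 0)))\<^sup>2" by (intro power_mono) auto
    also have "\<dots> = E\<^sup>2 * (sqrt (S / a) + sqrt (Q g 0))\<^sup>2" by (simp add: power_mult_distrib)
    also have "\<dots> \<le> E\<^sup>2 * (2 * (S / a + Q g 0))"
    proof (rule mult_left_mono)
      have q0: "Q g 0 \<ge> 0" by (simp add: Q_def)
      have "2 * sqrt (S / a) * sqrt (Q g 0) \<le> (sqrt (S / a))\<^sup>2 + (sqrt (Q g 0))\<^sup>2" by (rule sum_squares_bound)
      thus "(sqrt (S / a) + sqrt (Q g 0))\<^sup>2 \<le> 2 * (S / a + Q g 0)"
        using S0 a q0 by (simp add: power2_sum)
    qed simp
    also have "\<dots> \<le> E\<^sup>2 * (2 * ((1 / a + 1) * (S + Q g 0)))"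
    proof (intro mult_left_mono)
      have q0: "Q g 0 \<ge> 0" by (simp add: Q_def)
      have "0 \<le> S" "0 \<le> Q g 0 / a" using S0 q0 a by auto
      thus "S / a + Q g 0 \<le> (1 / a + 1) * (S + Q g 0)" by (simp add: algebra_simps add_divide_distrib)
    qed auto
    also have "S + Q g 0 = (\<Sum>k. Q g k)" unfolding split[OF g] S_def by simp
    finally show ?thesis by (simp add: mult_ac)
  qed
  \<comment> \<open>The sum of the two one-sided constants serves both inequalities.\<close>
  define B where "B = (Z\<^sup>2 + a * C\<^sup>2) + 2 * E\<^sup>2 * (1 / a + 1)"
  have B12: "Z\<^sup>2 + a * C\<^sup>2 \<le> B" "2 * E\<^sup>2 * (1 / a + 1) \<le> B" using a by (auto simp: B_def)
  have "2 * E\<^sup>2 * (1 / a + 1) > 0" using E a by (intro mult_pos_pos add_pos_pos) auto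
  hence B0: "B > 0" using B12 by linarith
  show thesis
  proof (rule that[OF B0])
    fix g assume g: "g \<in> L2 MI"
    show "summable (\<lambda>k. (cmod (LINT y|MI. g y * frm z k y))\<^sup>2)" using summ[OF g] by (simp add: Q_def[abs_def])
    have "0 \<le> (\<Sum>k. Q g k)" by (intro suminf_nonneg summ g) (simp add: Q_def)
    hence "2 * E\<^sup>2 * (1 / a + 1) * (\<Sum>k. Q g k) \<le> B * (\<Sum>k. Q g k)" by (intro mult_right_mono B12)
    thus "(l2_norm MI g)\<^sup>2 \<le> B * (\<Sum>k. (cmod (LINT y|MI. g y * frm z k y))\<^sup>2)"
      using lower[OF g] by (simp add: Q_def[abs_def])
    have "(Z\<^sup>2 + a * C\<^sup>2) * (l2_norm MI g)\<^sup>2 \<le> B * (l2_norm MI g)\<^sup>2" by (intro mult_right_mono B12) simp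
    thus "(\<Sum>k. (cmod (LINT y|MI. g y * frm z k y))\<^sup>2) \<le> B * (l2_norm MI g)\<^sup>2"
      using upper[OF g] by (simp add: Q_def[abs_def])
  qed
qed

section \<open>Types and multiplicities of the transversal eigenvalues\<close>

definition Nv :: "nat \<Rightarrow> real" where
  "Nv k = (if k = 0 then (if \<alpha> = 0 then 2 * a else sin (2 * \<alpha> * a) / \<alpha>)
     else (-1) ^ k * a * (1 - \<alpha>\<^sup>2 / (kap k)\<^sup>2))"

lemma sg_sq: "sg k * sg k = 1"
  by (simp add: sg_def flip: power_add mult_2)

lemma int_one: "(LINT y|MI. (1::complex)) = of_real (2 * a)"
  using integral_cos_int[of 0] by simp

text \<open>Since the pairing has no conjugate, the squared sine enters with a minus sign: for k >=
  1 the squares of cosine and sine both integrate to a and their product to 0, leaving a (1 -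
  alpha^2 / kap^2), which can vanish or be negative.\<close>

lemma psi_sq: "(LINT y|MI. psi k y * psi k y) = of_real (sg k * Nv k)"
proof (cases "k = 0")
  case True
  show ?thesis
  proof (cases "\<alpha> = 0")
    case True
    have p: "psi k y * psi k y = 1" for y unfolding psi_def using True \<open>k = 0\<close> by simp
    have "sg k * Nv k = 2 * a" unfolding sg_def Nv_def using True \<open>k = 0\<close> by simp
    thus ?thesis unfolding p by (simp only: int_one)
  next
    case False
    define w where "w = complex_of_real (2 * \<alpha>)"
    have w: "w \<noteq> 0" using False by (simp add: w_def)
    have D: "((\<lambda>y. (\<i> / w) * exp (- \<i> * of_real (2 * \<alpha> * y))) has_vector_derivative
       (\<i> / w) * (- \<i> * of_real (2 * \<alpha>) * exp (- \<i> * of_real (2 * \<alpha> * y)))) (at y)" for y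
      by (intro has_vector_derivative_mult_right exp_deriv)
    have "(\<i> / w) * (- \<i> * of_real (2 * \<alpha>) * exp (- \<i> * of_real (2 * \<alpha> * y))) = psi 0 y * psi 0 y" for y
    proof -
      have "psi 0 y * psi 0 y = exp (- \<i> * of_real (2 * \<alpha> * y))"
        by (simp add: psi_def exp_add[symmetric] algebra_simps)
      moreover have "(\<i> / w) * (- \<i> * of_real (2 * \<alpha>)) = 1" using w by (simp add: w_def)
      ultimately show ?thesis by (metis mult.assoc mult_1)
    qed
    hence "(LINT y|MI. psi 0 y * psi 0 y) = (\<i> / w) * exp (- \<i> * of_real (2 * \<alpha> * a)) - (\<i> / w) * exp (- \<i> * of_real (2 * \<alpha> * (-a)))"
      using MI_FTC[OF D] by (simp add: continuous_intros psi_continuous)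
    also have "\<dots> = (\<i> / w) * (exp (- (\<i> * of_real (2 * \<alpha> * a))) - exp (\<i> * of_real (2 * \<alpha> * a)))"
      by (simp add: algebra_simps)
    also have "exp (- (\<i> * of_real (2 * \<alpha> * a))) - exp (\<i> * of_real (2 * \<alpha> * a)) = - (2 * \<i> * of_real (sin (2 * \<alpha> * a)))"
      using sin_exp_eq[of "complex_of_real (2 * \<alpha> * a)"] unfolding sin_of_real by (simp add: field_simps)
    also have "(\<i> / w) * - (2 * \<i> * of_real (sin (2 * \<alpha> * a))) = of_real (sin (2 * \<alpha> * a) / \<alpha>)"
      using False by (simp add: w_def)
    finally show ?thesis using True False by (simp add: Nv_def sg_def)
  qed
next
  case False
  define sn where "sn y = complex_of_real (sin (kap k * (y + a)))" for y
  have snL: "sn \<in> L2 MI" unfolding sn_def[abs_def] by (intro L2_MI_continuous continuous_intros)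
  note kp = kap_pos[OF False]
  have cc: "(LINT y|MI. ecos k y * ecos k y) = of_real a"
    using ecos_orth[of k k] False by (simp add: l2_inner_def ecos_def)
  have i: "integrable MI (\<lambda>y. ecos k y * ecos k y)" "integrable MI (\<lambda>y. ecos k y * sn y)" "integrable MI (\<lambda>y. sn y * sn y)"
    by (intro integrable_L2_mult ecos_L2 snL)+
  have "ecos k y * ecos k y + sn y * sn y = 1" for y
  proof -
    have "ecos k y * ecos k y + sn y * sn y = of_real ((cos (kap k * (y + a)))\<^sup>2 + (sin (kap k * (y + a)))\<^sup>2)"
      by (simp only: ecos_def sn_def power2_eq_square of_real_add of_real_mult)
    thus ?thesis by simp
  qed
  hence "(LINT y|MI. ecos k y * ecos k y + sn y * sn y) = of_real (2 * a)" using int_one by simp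
  hence ss: "(LINT y|MI. sn y * sn y) = of_real a" using i cc by simp
  have "((\<lambda>y. complex_of_real ((sin (kap k * (y + a)))\<^sup>2 / (2 * kap k))) has_vector_derivative of_real (cos (kap k * (y + a)) * sin (kap k * (y + a)))) (at y)" for y
    using kp by (intro has_vector_derivative_of_real)
      (auto simp: has_real_derivative_iff_has_vector_derivative[symmetric] intro!: derivative_eq_intros)
  from MI_FTC[OF this] have cs0: "(LINT y|MI. complex_of_real (cos (kap k * (y + a)) * sin (kap k * (y + a)))) =
     of_real ((sin (kap k * (a + a)))\<^sup>2 / (2 * kap k)) - of_real ((sin (kap k * (- a + a)))\<^sup>2 / (2 * kap k))"
    by (simp add: continuous_intros)
  have "kap k * (a + a) = pi * real k" using kap_2a[of k] by (simp only: mult_2)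
  hence "sin (kap k * (a + a)) = 0" by (simp only: sin_npi2)
  hence cs: "(LINT y|MI. ecos k y * sn y) = 0" using cs0 by (simp add: ecos_def sn_def)
  have "(LINT y|MI. psi k y * psi k y) = (LINT y|MI. ecos k y * ecos k y - 2 * \<i> * of_real (\<alpha> / kap k) * (ecos k y * sn y) - of_real ((\<alpha> / kap k)\<^sup>2) * (sn y * sn y))"
  proof (rule Bochner_Integration.integral_cong[OF refl])
    fix y
    have e: "psi k y = ecos k y - \<i> * of_real (\<alpha> / kap k) * sn y" using False by (simp add: psi_def ecos_def sn_def)
    have gen: "(c - \<i> * t * s) * (c - \<i> * t * s) = c * c - 2 * \<i> * t * (c * s) - t\<^sup>2 * (s * s)" for c s t :: complex
      by (simp add: algebra_simps power2_eq_square)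
    show "psi k y * psi k y = ecos k y * ecos k y - 2 * \<i> * of_real (\<alpha> / kap k) * (ecos k y * sn y) - of_real ((\<alpha> / kap k)\<^sup>2) * (sn y * sn y)"
      unfolding e gen of_real_power ..
  qed
  also have "\<dots> = of_real a - of_real ((\<alpha> / kap k)\<^sup>2) * of_real a"
    using i cc cs ss by simp
  also have "\<dots> = of_real (sg k * Nv k)"
  proof -
    have "sg k * Nv k = (sg k * (-1) ^ k) * (a * (1 - \<alpha>\<^sup>2 / (kap k)\<^sup>2))" using False by (simp add: Nv_def)
    also have "sg k * (-1) ^ k = 1" using sg_sq[of k] False by (simp add: sg_def)
    finally have "sg k * Nv k = a - (\<alpha> / kap k)\<^sup>2 * a" by (simp add: power_divide algebra_simps)
    thus ?thesis by simp
  qed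
  finally show ?thesis .
qed

text \<open>Reflection conjugates \<open>psi k\<close> up to the sign \<open>sg k\<close>, so the
  form (P psi_k, psi_k) is, up to sign and conjugation, the bilinear square. It vanishes exactly
  when \<open>lam k\<close> is degenerate.\<close>

lemma psi_type: "l2_inner MI (par_I (psi k)) (psi k) = of_real (Nv k)"
proof -
  have "psi k (- y) = of_real (sg k) * cnj (psi k y)" for y
    using arg_cong[OF cnj_psi_reflect[of k y], of cnj] by simp
  hence "l2_inner MI (par_I (psi k)) (psi k) = (LINT y|MI. of_real (sg k) * cnj (psi k y * psi k y))"
    unfolding l2_inner_def par_I_def by (simp add: mult.assoc)
  also have "\<dots> = of_real (sg k) * cnj (LINT y|MI. psi k y * psi k y)"
    using integral_bounded_linear[OF bounded_linear_cnj integrable_L2_mult[OF psi_L2 psi_L2], of k k] by simp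
  also have "\<dots> = of_real (sg k * (sg k * Nv k))" unfolding psi_sq by simp
  finally show ?thesis using sg_sq[of k] by (simp flip: mult.assoc)
qed

lemma psi_orth:
  assumes "lam j \<noteq> lam k"
  shows "(LINT y|MI. psi j y * psi k y) = 0"
proof -
  have "(LINT y|MI. (of_real (lam j) * psi j y) * psi k y) = of_real (lam k) * (LINT y|MI. psi j y * psi k y)"
    by (rule coef_H_I[OF psi_H_I])
  moreover have "(LINT y|MI. (of_real (lam j) * psi j y) * psi k y) = of_real (lam j) * (LINT y|MI. psi j y * psi k y)"
    by (simp add: mult.assoc)
  ultimately show ?thesis using assms by simp
qed

lemma lam_inj: "j \<noteq> 0 \<Longrightarrow> k \<noteq> 0 \<Longrightarrow> lam j = lam k \<Longrightarrow> j = k"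
  using kap_pos[of j] kap_pos[of k] a by (auto simp: lam_def kap_def)

text \<open>At a coincidence |alpha| = \<open>kap m\<close>, and both formulas for \<open>Nv\<close>
  vanish. An eigenfunction that is null for the bilinear form is the mark of a Jordan block.\<close>

lemma Nv_coincidence:
  assumes "m \<noteq> 0" "lam m = lam 0"
  shows "Nv m = 0" "Nv 0 = 0"
proof -
  have e: "(kap m)\<^sup>2 = \<alpha>\<^sup>2" using assms by (simp add: lam_def)
  thus "Nv m = 0" using assms kap_pos[OF assms(1)] by (auto simp: Nv_def)
  have "\<alpha> \<noteq> 0" using e kap_pos[OF assms(1)] by auto
  moreover have "sin (2 * \<alpha> * a) = 0"
  proof -
    have "\<alpha> = kap m \<or> \<alpha> = - kap m" using e by (auto simp: power2_eq_iff)
    moreover have "sin (kap m * (2 * a)) = 0" unfolding kap_2a by (rule sin_npi2)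
    ultimately show ?thesis by (auto simp: mult_ac)
  qed
  ultimately show "Nv 0 = 0" by (simp add: Nv_def)
qed

text \<open>The \<open>lam k\<close> with k >= 1 are distinct, so a coincidence involves index 0,
  and there both numbers vanish.\<close>

lemma simple_of_Nv:
  assumes "Nv k \<noteq> 0" "lam j = lam k"
  shows "j = k"
proof (rule ccontr)
  assume jk: "j \<noteq> k"
  show False
  proof (cases "k = 0")
    case True
    thus False using jk Nv_coincidence(2)[of j] assms by simp
  next
    case False
    hence "j = 0" using jk lam_inj[OF _ False assms(2)] by blast
    thus False using Nv_coincidence(1)[OF False] assms by simp
  qed
qed

text \<open>If the eigenvalue \<open>\<alpha>\<^sup>2\<close> is degenerate, it has a Jordan chain, and \<open>\<psi>\<^sub>0\<close> is replaced by a
  generalised eigenfunction.\<close>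

lemma ex_zero_functional:
  obtains z \<beta> m where "z \<in> L2 MI" "(LINT y|MI. psi 0 y * z y) \<noteq> 0"
    "\<And>g G. (g, G) \<in> H_I a \<alpha> \<Longrightarrow> (LINT y|MI. G y * z y) = of_real (lam 0) * (LINT y|MI. g y * z y) + \<beta> * (LINT y|MI. g y * psi m y)"
    "m \<noteq> 0" "\<beta> \<noteq> 0 \<Longrightarrow> lam m = lam 0" "Nv 0 \<noteq> 0 \<Longrightarrow> z = psi 0"
proof (cases "Nv 0 = 0")
  case False
  have "(LINT y|MI. psi 0 y * psi 0 y) \<noteq> 0" unfolding psi_sq using False by (simp add: sg_def)
  thus thesis using that[of "psi 0" 0 1] psi_L2 coef_H_I[of _ _ 0] by simp
next
  case True
  have al: "\<alpha> \<noteq> 0" and sn: "sin (2 * \<alpha> * a) = 0" using True a by (auto simp: Nv_def split: if_splits)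
  obtain i :: int where i: "2 * \<alpha> * a = of_int i * pi" using sn unfolding sin_zero_iff_int2 by blast
  have i0: "i \<noteq> 0" using i al a by auto
  define m where "m = nat \<bar>i\<bar>"
  have m: "m \<noteq> 0" "real m = \<bar>of_int i\<bar>" using i0 by (auto simp: m_def)
  have km: "kap m = \<bar>\<alpha>\<bar>"
  proof -
    have "\<bar>2 * \<alpha> * a\<bar> = \<bar>of_int i * pi\<bar>" using i by simp
    hence "2 * \<bar>\<alpha>\<bar> * a = real m * pi" using a m by (simp add: abs_mult)
    thus ?thesis using a by (simp add: kap_def field_simps)
  qed
  \<comment> \<open>At a coincidence the two eigenfunctions are proportional: there is one
    eigenvector for an eigenvalue listed twice.\<close>
  have psim: "psi 0 y = exp (\<i> * of_real (\<alpha> * a)) * psi m y" for y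
  proof -
    have "psi m y = of_real (cos (\<alpha> * (y + a))) - \<i> * of_real (sin (\<alpha> * (y + a)))"
      using m(1) al by (cases "\<alpha> > 0") (simp_all add: psi_def km)
    also have "\<dots> = exp (- (\<i> * of_real (\<alpha> * (y + a))))"
      using cis_conv_exp[of "- (\<alpha> * (y + a))"] by (simp add: cis.code complex_eq_iff)
    finally show ?thesis by (simp add: psi_def exp_add[symmetric] algebra_simps)
  qed
  define E where "E = exp (- (2 * \<i> * of_real (\<alpha> * a)))"
  have E: "E \<noteq> 0" by (simp add: E_def)
  \<comment> \<open>As 2 alpha a is a multiple of pi, exp(2 i alpha a) is its own inverse; one
    constant can therefore satisfy the boundary condition at both ends.\<close>
  have E2: "exp (2 * \<i> * of_real (\<alpha> * a)) = E"
  proof -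
    have "4 * \<i> * of_real (\<alpha> * a) = 2 * \<i> * of_real (2 * \<alpha> * a)" by simp
    also have "\<dots> = \<i> * (of_int i * (of_real pi * 2))" unfolding i by simp
    finally have "exp (4 * \<i> * complex_of_real (\<alpha> * a)) = 1" by (simp only: exp_2pi_1_int)
    moreover have "4 * \<i> * complex_of_real (\<alpha> * a) = 2 * \<i> * of_real (\<alpha> * a) + 2 * \<i> * of_real (\<alpha> * a)" by simp
    ultimately have "exp (2 * \<i> * of_real (\<alpha> * a)) * exp (2 * \<i> * complex_of_real (\<alpha> * a)) = 1" by (simp only: exp_add)
    thus ?thesis unfolding E_def exp_minus by (simp add: field_simps)
  qed
  define em ep where "em y = exp (- \<i> * complex_of_real (\<alpha> * y))" and "ep y = exp (\<i> * complex_of_real (\<alpha> * y))" for y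
  \<comment> \<open>y exp(-i alpha y) solves -z'' - alpha^2 z = 2 i alpha exp(-i alpha y); the
    multiple of exp(i alpha y) is a homogeneous solution that repairs the boundary condition. In
    general z' + i alpha z = \<open>em\<close> + 2 i alpha c \<open>ep\<close>, and this c makes it
    \<open>em\<close> - E \<open>ep\<close>, which vanishes at both ends.\<close>
  define c where "c = \<i> * E / (2 * of_real \<alpha>)"
  define z z1 z2 where "z y = of_real y * em y + c * ep y"
    and "z1 y = em y - \<i> * of_real \<alpha> * (of_real y * em y) + c * (\<i> * of_real \<alpha> * ep y)"
    and "z2 y = - (of_real (\<alpha>\<^sup>2) * z y) - 2 * \<i> * of_real \<alpha> * em y" for y
  have Dm: "(em has_vector_derivative - \<i> * of_real \<alpha> * em y) (at y)" for y
    using exp_deriv[of "-\<i>" \<alpha> y] by (simp add: em_def[abs_def])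
  have Dp: "(ep has_vector_derivative \<i> * of_real \<alpha> * ep y) (at y)" for y
    using exp_deriv[of \<i> \<alpha> y] by (simp add: ep_def[abs_def])
  have Dy: "(complex_of_real has_vector_derivative 1) (at y)" for y
    using has_vector_derivative_of_real[OF DERIV_ident, of "at y"] by simp
  have Dym: "((\<lambda>y. of_real y * em y) has_vector_derivative (of_real y * (- \<i> * of_real \<alpha> * em y) + 1 * em y)) (at y)" for y
    by (rule has_vector_derivative_mult[OF Dy Dm])
  have D1: "(z has_vector_derivative z1 y) (at y)" for y
  proof -
    have "(z has_vector_derivative (of_real y * (- \<i> * of_real \<alpha> * em y) + 1 * em y) + c * (\<i> * of_real \<alpha> * ep y)) (at y)"
      unfolding z_def[abs_def] by (intro has_vector_derivative_add Dym has_vector_derivative_mult_right Dp)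
    moreover have "(of_real y * (- \<i> * of_real \<alpha> * em y) + 1 * em y) + c * (\<i> * of_real \<alpha> * ep y) = z1 y"
      by (simp add: z1_def)
    ultimately show ?thesis by simp
  qed
  have D2: "(z1 has_vector_derivative z2 y) (at y)" for y
  proof -
    have "(z1 has_vector_derivative (- \<i> * of_real \<alpha> * em y) - \<i> * of_real \<alpha> * (of_real y * (- \<i> * of_real \<alpha> * em y) + 1 * em y)
       + c * (\<i> * of_real \<alpha> * (\<i> * of_real \<alpha> * ep y))) (at y)"
      unfolding z1_def[abs_def]
      by (intro has_vector_derivative_add has_vector_derivative_diff Dym has_vector_derivative_mult_right Dp Dm)
    moreover have "(- \<i> * of_real \<alpha> * em y) - \<i> * of_real \<alpha> * (of_real y * (- \<i> * of_real \<alpha> * em y) + 1 * em y)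
       + c * (\<i> * of_real \<alpha> * (\<i> * of_real \<alpha> * ep y)) = z2 y"
      by (simp add: z2_def z_def power2_eq_square algebra_simps)
    ultimately show ?thesis by simp
  qed
  have emc: "continuous_on S em" "continuous_on S ep" for S unfolding em_def[abs_def] ep_def[abs_def] by (intro continuous_intros)+
  have zc: "continuous_on S z" "continuous_on S z2" for S
    unfolding z_def[abs_def] z2_def[abs_def] by (intro continuous_intros emc)+
  have zL: "z \<in> L2 MI" "em \<in> L2 MI" by (intro L2_MI_continuous zc emc)+
  have bdry: "z1 y + \<i> * of_real \<alpha> * z y = em y + c * (2 * \<i> * of_real \<alpha>) * ep y" for y
    by (simp add: z_def z1_def algebra_simps)
  have "\<i> * (E * \<i>) = - E" by (metis complex_i_mult_minus mult.commute)
  hence c2: "c * (2 * \<i> * of_real \<alpha>) = - E" using al by (simp add: c_def)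
  have R: "Robin z z1"
  proof -
    have "em a = E * ep a" unfolding em_def ep_def E_def by (simp add: exp_add[symmetric] algebra_simps)
    moreover have "em (-a) = E * ep (-a)" unfolding em_def ep_def E2[symmetric] by (simp add: exp_add[symmetric] algebra_simps)
    ultimately show ?thesis using bdry[of a] bdry[of "-a"] unfolding c2 Robin_def
      by (simp add: eq_neg_iff_add_eq_0)
  qed
  have em0: "em y = psi 0 y" for y by (simp add: em_def psi_def)
  have G: "(LINT y|MI. h y * z y) = of_real (lam 0) * (LINT y|MI. g y * z y) + (2 * \<i> * of_real \<alpha> * exp (\<i> * of_real (\<alpha> * a))) * (LINT y|MI. g y * psi m y)"
    if gh: "(g, h) \<in> H_I a \<alpha>" for g h
  proof -
    have gL: "g \<in> L2 MI" using H_I_L2[OF gh] by simp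
    have i: "integrable MI (\<lambda>y. g y * z y)" "integrable MI (\<lambda>y. g y * em y)" by (intro integrable_L2_mult gL zL)+
    have "(LINT y|MI. h y * z y) = (LINT y|MI. g y * - z2 y)"
      by (rule H_I_Green[OF gh D1 D2 zc(2) R])
    also have "\<dots> = (LINT y|MI. of_real (\<alpha>\<^sup>2) * (g y * z y) + 2 * \<i> * of_real \<alpha> * (g y * em y))"
      by (simp add: z2_def algebra_simps)
    also have "\<dots> = of_real (\<alpha>\<^sup>2) * (LINT y|MI. g y * z y) + 2 * \<i> * of_real \<alpha> * (LINT y|MI. g y * em y)"
      using i by simp
    also have "(LINT y|MI. g y * em y) = exp (\<i> * of_real (\<alpha> * a)) * (LINT y|MI. g y * psi m y)"
      unfolding em0 psim mult.left_commute[of _ "exp (\<i> * of_real (\<alpha> * a))"] by (rule integral_mult_right_zero)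
    finally show ?thesis by (simp add: lam_def)
  qed
  \<comment> \<open>The bilinear square of \<open>psi 0\<close> vanishes here, so
    \<open>psi 0\<close> itself could not serve; the generalised eigenfunction pairs with it to 2 a
    i E / alpha.\<close>
  have nz: "(LINT y|MI. psi 0 y * z y) \<noteq> 0"
  proof -
    define w where "w = complex_of_real (2 * \<alpha>)"
    have w: "w \<noteq> 0" using al by (simp add: w_def)
    define q where "q y = exp (- \<i> * complex_of_real (2 * \<alpha> * y))" for y
    have Dq: "(q has_vector_derivative - \<i> * w * q y) (at y)" for y
      using exp_deriv[of "-\<i>" "2 * \<alpha>" y] by (simp add: q_def[abs_def] w_def)
    have "((\<lambda>y. (\<i> / w) * (of_real y * q y) + (1 / w\<^sup>2) * q y + (c * of_real y)) has_vector_derivative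
       (\<i> / w) * (of_real y * (- \<i> * w * q y) + 1 * q y) + (1 / w\<^sup>2) * (- \<i> * w * q y) + (c * 1)) (at y)" for y
      by (intro has_vector_derivative_add has_vector_derivative_mult_right has_vector_derivative_mult[OF Dy Dq] Dq Dy)
    moreover have "(\<i> / w) * (of_real y * (- \<i> * w * q y) + 1 * q y) + (1 / w\<^sup>2) * (- \<i> * w * q y) + (c * 1) = psi 0 y * z y" for y
    proof -
      have "psi 0 y * em y = q y" "psi 0 y * ep y = 1"
        by (simp_all add: psi_def em_def ep_def q_def exp_add[symmetric] algebra_simps)
      hence "psi 0 y * z y = of_real y * q y + c" by (simp add: z_def algebra_simps)
      thus ?thesis using w by (simp add: power2_eq_square field_simps)
    qed
    ultimately have Dz: "((\<lambda>y. (\<i> / w) * (of_real y * q y) + (1 / w\<^sup>2) * q y + (c * of_real y)) has_vector_derivative psi 0 y * z y) (at y)" for y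
      by simp
    have "(LINT y|MI. psi 0 y * z y) = ((\<i> / w) * (of_real a * q a) + (1 / w\<^sup>2) * q a + (c * of_real a)) -
        ((\<i> / w) * (of_real (-a) * q (-a)) + (1 / w\<^sup>2) * q (-a) + (c * of_real (-a)))"
      by (rule MI_FTC[OF Dz]) (intro continuous_intros psi_continuous zc)
    also have "q a = E" by (simp add: q_def E_def mult_ac)
    also have "q (-a) = E" unfolding E2[symmetric] by (simp add: q_def mult_ac)
    also have "((\<i> / w) * (of_real a * E) + (1 / w\<^sup>2) * E + (c * of_real a)) -
        ((\<i> / w) * (of_real (-a) * E) + (1 / w\<^sup>2) * E + (c * of_real (-a))) = of_real (2 * a) * (\<i> * E / w + c)"
      by (simp add: algebra_simps)
    also have "\<i> * E / w + c = \<i> * E / of_real \<alpha>" using al by (simp add: c_def w_def field_simps)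
    finally show ?thesis using a al E by simp
  qed
  have "lam m = lam 0" using km m by (simp add: lam_def)
  thus thesis using that[OF zL(1) nz G m(1)] True by simp
qed

end

section \<open>The strip\<close>

context strip
begin

abbreviation MO :: "(real \<times> real) measure" where "MO \<equiv> meas_on (Om a)"

sublocale P: pair_sigma_finite "lborel :: real measure" MI
  by (rule pair_sigma_finite_strip)

lemma MO_eq: "MO = lborel \<Otimes>\<^sub>M MI" by (rule meas_on_Om)

section \<open>Coefficients of the operator on the strip\<close>

lemma coef_op_tensor_left:
  assumes t: "(u, v) \<in> op_tensor MO (H_R V) (op_id MI)" and \<eta>: "\<eta> \<in> L2 MI"
  shows "(P.coef \<eta> u, P.coef \<eta> v) \<in> H_R V"
proof -
  obtain n :: nat and f f' g g' where L: "u \<in> L2 MO" "v \<in> L2 MO"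
    and fg: "\<And>i. i < n \<Longrightarrow> (f i, f' i) \<in> H_R V" "\<And>i. i < n \<Longrightarrow> (g i, g' i) \<in> op_id MI"
    and u: "AE z in MO. u z = (\<Sum>i<n. f i (fst z) * g i (snd z))"
    and v: "AE z in MO. v z = (\<Sum>i<n. f' i (fst z) * g' i (snd z))"
    using t unfolding op_tensor_def by blast
  note Lm = L[unfolded MO_eq]
  have gL: "g i \<in> L2 MI" "g' i \<in> L2 MI" "AE y in MI. g' i y = g i y" if "i < n" for i
    using fg(2)[OF that] by (auto simp: op_id_def)
  have fL: "f i \<in> L2 lborel" "f' i \<in> L2 lborel" if "i < n" for i using H_R_L2[OF fg(1)[OF that]] by auto
  define c where "c i = (LINT y|MI. g i y * \<eta> y)" for i
  have c': "(LINT y|MI. g' i y * \<eta> y) = c i" if "i < n" for i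
    unfolding c_def
  proof (rule integral_cong_AE)
    show "AE y in MI. g' i y * \<eta> y = g i y * \<eta> y" using gL(3)[OF that] by eventually_elim simp
  qed (use gL[OF that] \<eta> in \<open>auto intro!: borel_measurable_times L2_measurable\<close>)
  have mu: "(\<lambda>z. \<Sum>i<n. f i (fst z) * g i (snd z)) \<in> borel_measurable (lborel \<Otimes>\<^sub>M MI)"
    "(\<lambda>z. \<Sum>i<n. f' i (fst z) * g' i (snd z)) \<in> borel_measurable (lborel \<Otimes>\<^sub>M MI)"
    by (intro L2_measurable L2_sum P.L2_tensor(1) fL gL; simp)+
  have ct: "P.coef \<eta> (\<lambda>z. \<Sum>i<n. f i (fst z) * g i (snd z)) x = (\<Sum>i<n. c i * f i x)"
    "P.coef \<eta> (\<lambda>z. \<Sum>i<n. f' i (fst z) * g' i (snd z)) x = (\<Sum>i<n. c i * f' i x)" for x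
    using P.coef_tensor_sum[of "{..<n}" g \<eta> f x] P.coef_tensor_sum[of "{..<n}" g' \<eta> f' x] gL \<eta> c' by (simp_all add: c_def)
  have 1: "AE x in lborel. P.coef \<eta> u x = (\<Sum>i<n. c i * f i x)"
    using P.coef_cong_AE[OF u[unfolded MO_eq] L2_measurable[OF Lm(1)] mu(1) L2_measurable[OF \<eta>]]
    by (simp only: ct)
  have 2: "AE x in lborel. P.coef \<eta> v x = (\<Sum>i<n. c i * f' i x)"
    using P.coef_cong_AE[OF v[unfolded MO_eq] L2_measurable[OF Lm(2)] mu(2) L2_measurable[OF \<eta>]]
    by (simp only: ct)
  show ?thesis
    by (rule H_R_cong_AE[OF H_R_sum[OF fg(1), of n "\<lambda>i. i" c, simplified]])
       (use 1 2 P.coef_measurable[OF L2_measurable[OF Lm(1)] L2_measurable[OF \<eta>]] P.coef_measurable[OF L2_measurable[OF Lm(2)] L2_measurable[OF \<eta>]] in auto)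
qed

text \<open>The relation \<open>rel\<close> allows for a Jordan chain: beta couples the functional
  eta to psi, and beta = 0 is the case of an eigenfunctional.\<close>

lemma coef_op_tensor_right:
  assumes t: "(u, v) \<in> op_tensor MO (op_id lborel) (H_I a \<alpha>)" and \<eta>: "\<eta> \<in> L2 MI" and \<psi>: "\<psi> \<in> L2 MI"
    and rel: "\<And>g G. (g, G) \<in> H_I a \<alpha> \<Longrightarrow> (LINT y|MI. G y * \<eta> y) = l * (LINT y|MI. g y * \<eta> y) + \<beta> * (LINT y|MI. g y * \<psi> y)"
  shows "AE x in lborel. P.coef \<eta> v x = l * P.coef \<eta> u x + \<beta> * P.coef \<psi> u x"
proof -
  obtain n :: nat and f f' g g' where L: "u \<in> L2 MO" "v \<in> L2 MO"
    and fg: "\<And>i. i < n \<Longrightarrow> (f i, f' i) \<in> op_id lborel" "\<And>i. i < n \<Longrightarrow> (g i, g' i) \<in> H_I a \<alpha>"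
    and u: "AE z in MO. u z = (\<Sum>i<n. f i (fst z) * g i (snd z))"
    and v: "AE z in MO. v z = (\<Sum>i<n. f' i (fst z) * g' i (snd z))"
    using t unfolding op_tensor_def by blast
  note Lm = L[unfolded MO_eq]
  have fL: "f i \<in> L2 lborel" "f' i \<in> L2 lborel" "AE y in lborel. f' i y = f i y" if "i < n" for i
    using fg(1)[OF that] by (auto simp: op_id_def)
  have gL: "g i \<in> L2 MI" "g' i \<in> L2 MI" if "i < n" for i using H_I_L2[OF fg(2)[OF that]] by auto
  have mu: "(\<lambda>z. \<Sum>i<n. f i (fst z) * g i (snd z)) \<in> borel_measurable (lborel \<Otimes>\<^sub>M MI)"
    "(\<lambda>z. \<Sum>i<n. f' i (fst z) * g' i (snd z)) \<in> borel_measurable (lborel \<Otimes>\<^sub>M MI)"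
    by (intro L2_measurable L2_sum P.L2_tensor(1) fL gL; simp)+
  have ct: "P.coef \<theta> (\<lambda>z. \<Sum>i<n. f i (fst z) * g i (snd z)) x = (\<Sum>i<n. (LINT y|MI. g i y * \<theta> y) * f i x)"
    "P.coef \<theta> (\<lambda>z. \<Sum>i<n. f' i (fst z) * g' i (snd z)) x = (\<Sum>i<n. (LINT y|MI. g' i y * \<theta> y) * f' i x)" if "\<theta> \<in> L2 MI" for x \<theta>
    using P.coef_tensor_sum[of "{..<n}" g \<theta> f x] P.coef_tensor_sum[of "{..<n}" g' \<theta> f' x] gL that by simp_all
  have 1: "AE x in lborel. P.coef \<theta> u x = (\<Sum>i<n. (LINT y|MI. g i y * \<theta> y) * f i x)" if \<theta>: "\<theta> \<in> L2 MI" for \<theta>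
    using P.coef_cong_AE[OF u[unfolded MO_eq] L2_measurable[OF Lm(1)] mu(1) L2_measurable[OF \<theta>]]
    by (simp only: ct(1)[OF \<theta>])
  have 2: "AE x in lborel. P.coef \<eta> v x = (\<Sum>i<n. (LINT y|MI. g' i y * \<eta> y) * f' i x)"
    using P.coef_cong_AE[OF v[unfolded MO_eq] L2_measurable[OF Lm(2)] mu(2) L2_measurable[OF \<eta>]]
    by (simp only: ct(2)[OF \<eta>])
  have 3: "AE x in lborel. \<forall>i\<in>{..<n}. f' i x = f i x"
    by (rule AE_finite_allI) (use fL(3) in auto)
  show ?thesis using 1[OF \<eta>] 1[OF \<psi>] 2 3
  proof eventually_elim
    case (elim x)
    have "P.coef \<eta> v x = (\<Sum>i<n. (l * (LINT y|MI. g i y * \<eta> y) + \<beta> * (LINT y|MI. g i y * \<psi> y)) * f i x)"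
      unfolding elim(3) using elim(4) rel[OF fg(2)] by (intro sum.cong) auto
    also have "\<dots> = l * P.coef \<eta> u x + \<beta> * P.coef \<psi> u x"
      unfolding elim(1,2) by (simp add: sum_distrib_left sum.distrib[symmetric] algebra_simps)
    finally show ?case .
  qed
qed

lemma coef_diff_l2_norm_tendsto:
  assumes U: "\<And>n. U n \<in> L2 MO" and u: "u \<in> L2 MO" and \<eta>: "\<eta> \<in> L2 MI" and lim: "(\<lambda>n. l2_norm MO (\<lambda>z. U n z - u z)) \<longlonglongrightarrow> 0"
  shows "(\<lambda>n. l2_norm lborel (P.coef \<eta> (U n))) \<longlonglongrightarrow> l2_norm lborel (P.coef \<eta> u)"
proof (rule l2_norm_tendsto)
  note Um = U[unfolded MO_eq] and um = u[unfolded MO_eq]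
  show "P.coef \<eta> (U n) \<in> L2 lborel" "P.coef \<eta> u \<in> L2 lborel" for n by (intro P.coef_L2 Um um \<eta>)+
  have le: "l2_norm lborel (\<lambda>x. P.coef \<eta> (U n) x - P.coef \<eta> u x) \<le> l2_norm MI \<eta> * l2_norm MO (\<lambda>z. U n z - u z)" for n
  proof -
    have "l2_norm lborel (\<lambda>x. P.coef \<eta> (U n) x - P.coef \<eta> u x) = l2_norm lborel (P.coef \<eta> (\<lambda>z. U n z - 1 * u z))"
    proof (rule l2_norm_cong_AE)
      show "AE x in lborel. P.coef \<eta> (U n) x - P.coef \<eta> u x = P.coef \<eta> (\<lambda>z. U n z - 1 * u z) x"
        using P.coef_diff_AE[OF Um um \<eta>, of n 1] by eventually_elim simp
    qed (intro L2_measurable L2_diff P.coef_L2 Um um \<eta> L2_scale)+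
    also have "\<dots> \<le> l2_norm MI \<eta> * l2_norm (lborel \<Otimes>\<^sub>M MI) (\<lambda>z. U n z - 1 * u z)"
      by (intro P.coef_L2 L2_diff L2_scale Um um \<eta>)
    finally show ?thesis by (simp add: MO_eq)
  qed
  have "(\<lambda>n. l2_norm MI \<eta> * l2_norm MO (\<lambda>z. U n z - u z)) \<longlonglongrightarrow> l2_norm MI \<eta> * 0" by (intro tendsto_intros lim)
  hence "(\<lambda>n. l2_norm MI \<eta> * l2_norm MO (\<lambda>z. U n z - u z)) \<longlonglongrightarrow> 0" by simp
  thus "(\<lambda>n. l2_norm lborel (\<lambda>x. P.coef \<eta> (U n) x - P.coef \<eta> u x)) \<longlonglongrightarrow> 0"
    by (rule Lim_null_comparison[rotated]) (rule always_eventually, use le in simp)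
qed

lemma H_Om_L2: "(u, w) \<in> H_Om a \<alpha> V \<Longrightarrow> u \<in> L2 MO \<and> w \<in> L2 MO"
  by (simp add: H_Om_def op_closure_def)

text \<open>On finite tensor sums the coefficient of (H - zeta) u is H_R - (zeta - l) applied to the
  coefficient of u, plus beta times the coefficient for psi; the lower bound for \<open>H_R\<close>
  applies. Both sides of the resulting inequality are continuous in (u, w), so it survives the
  closure.\<close>

lemma H_Om_coef_bound:
  assumes uw: "(u, w) \<in> H_Om a \<alpha> V" and \<eta>: "\<eta> \<in> L2 MI" and \<psi>: "\<psi> \<in> L2 MI"
    and rel: "\<And>g G. (g, G) \<in> H_I a \<alpha> \<Longrightarrow> (LINT y|MI. G y * \<eta> y) = l * (LINT y|MI. g y * \<eta> y) + \<beta> * (LINT y|MI. g y * \<psi> y)"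
    and b: "bdd_below_at lborel (H_R V) (\<zeta> - l) m"
  shows "m * l2_norm lborel (P.coef \<eta> u) \<le> l2_norm lborel (P.coef \<eta> (\<lambda>z. w z - \<zeta> * u z)) + cmod \<beta> * l2_norm lborel (P.coef \<psi> u)"
proof -
  define T where "T = op_sum MO (op_tensor MO (H_R V) (op_id MI)) (op_tensor MO (op_id (meas_on UNIV)) (H_I a \<alpha>))"
  have core: "m * l2_norm lborel (P.coef \<eta> u) \<le> l2_norm lborel (P.coef \<eta> (\<lambda>z. w z - \<zeta> * u z)) + cmod \<beta> * l2_norm lborel (P.coef \<psi> u)"
    and coreL: "u \<in> L2 MO" "w \<in> L2 MO"
    if uwT: "(u, w) \<in> T" for u w
  proof -
    obtain v1 v2 where v: "w \<in> L2 MO" "(u, v1) \<in> op_tensor MO (H_R V) (op_id MI)" "(u, v2) \<in> op_tensor MO (op_id lborel) (H_I a \<alpha>)"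
      "AE z in MO. w z = v1 z + v2 z"
      using uwT unfolding T_def op_sum_def meas_on_UNIV by blast
    have L: "u \<in> L2 MO" "v1 \<in> L2 MO" "v2 \<in> L2 MO" using v by (auto simp: op_tensor_def)
    show "u \<in> L2 MO" "w \<in> L2 MO" by fact+
    note Lm = L[unfolded MO_eq] v(1)[unfolded MO_eq]
    have cw: "AE x in lborel. P.coef \<eta> w x = P.coef \<eta> v1 x - (-1) * P.coef \<eta> v2 x"
    proof -
      have m: "(\<lambda>z. v1 z - (-1) * v2 z) \<in> borel_measurable (lborel \<Otimes>\<^sub>M MI)" by (intro L2_measurable L2_diff L2_scale Lm)
      have "AE z in lborel \<Otimes>\<^sub>M MI. w z = v1 z - (-1) * v2 z" using v(4) unfolding MO_eq by eventually_elim simp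
      from P.coef_cong_AE[OF this L2_measurable[OF Lm(4)] m L2_measurable[OF \<eta>]] P.coef_diff_AE[OF Lm(2,3) \<eta>, of "-1"]
      show ?thesis by eventually_elim simp
    qed
    have r: "AE x in lborel. P.coef \<eta> v2 x = l * P.coef \<eta> u x + \<beta> * P.coef \<psi> u x"
      by (rule coef_op_tensor_right[OF v(3) \<eta> \<psi>]) (rule rel)
    note dw = P.coef_diff_AE[OF Lm(4,1) \<eta>, of \<zeta>]
    have C: "P.coef \<eta> u \<in> L2 lborel" "P.coef \<psi> u \<in> L2 lborel" "P.coef \<eta> v1 \<in> L2 lborel" "P.coef \<eta> (\<lambda>z. w z - \<zeta> * u z) \<in> L2 lborel"
      by (intro P.coef_L2 Lm \<eta> \<psi> L2_diff L2_scale)+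
    have "m * l2_norm lborel (P.coef \<eta> u) \<le> l2_norm lborel (\<lambda>x. P.coef \<eta> v1 x - (\<zeta> - l) * P.coef \<eta> u x)"
      using b coef_op_tensor_left[OF v(2) \<eta>] unfolding bdd_below_at_def by blast
    also have "\<dots> = l2_norm lborel (\<lambda>x. P.coef \<eta> (\<lambda>z. w z - \<zeta> * u z) x - \<beta> * P.coef \<psi> u x)"
    proof (rule l2_norm_cong_AE)
      show "AE x in lborel. P.coef \<eta> v1 x - (\<zeta> - l) * P.coef \<eta> u x = P.coef \<eta> (\<lambda>z. w z - \<zeta> * u z) x - \<beta> * P.coef \<psi> u x"
        using cw r dw
      proof eventually_elim
        case (elim x)
        show ?case unfolding elim(3) elim(1) elim(2) by (simp add: algebra_simps)
      qed
    qed (intro L2_measurable L2_diff L2_scale C)+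
    also have "\<dots> \<le> l2_norm lborel (P.coef \<eta> (\<lambda>z. w z - \<zeta> * u z)) + l2_norm lborel (\<lambda>x. \<beta> * P.coef \<psi> u x)"
      by (intro l2_norm_triangle_diff C L2_scale)
    finally show "m * l2_norm lborel (P.coef \<eta> u) \<le> l2_norm lborel (P.coef \<eta> (\<lambda>z. w z - \<zeta> * u z)) + cmod \<beta> * l2_norm lborel (P.coef \<psi> u)"
      by (simp add: l2_norm_scale)
  qed
  obtain U W where UW: "\<And>n. (U n, W n) \<in> T" "(\<lambda>n. l2_norm MO (\<lambda>x. U n x - u x)) \<longlonglongrightarrow> 0" "(\<lambda>n. l2_norm MO (\<lambda>x. W n x - w x)) \<longlonglongrightarrow> 0"
    and L: "u \<in> L2 MO" "w \<in> L2 MO"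
    using uw unfolding H_Om_def op_closure_def T_def by blast
  note UL = coreL[OF UW(1)]
  have DL: "(\<lambda>z. W n z - \<zeta> * U n z) \<in> L2 MO" "(\<lambda>z. w z - \<zeta> * u z) \<in> L2 MO" for n by (intro L2_diff L2_scale UL L)+
  have D: "(\<lambda>n. l2_norm MO (\<lambda>z. (W n z - \<zeta> * U n z) - (w z - \<zeta> * u z))) \<longlonglongrightarrow> 0"
  proof (rule Lim_null_comparison[OF always_eventually])
    show "\<forall>n. norm (l2_norm MO (\<lambda>z. (W n z - \<zeta> * U n z) - (w z - \<zeta> * u z))) \<le> l2_norm MO (\<lambda>z. W n z - w z) + cmod \<zeta> * l2_norm MO (\<lambda>z. U n z - u z)"
    proof
      fix n
      have "l2_norm MO (\<lambda>z. (W n z - \<zeta> * U n z) - (w z - \<zeta> * u z)) = l2_norm MO (\<lambda>z. (W n z - w z) - \<zeta> * (U n z - u z))"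
        by (simp add: algebra_simps)
      also have "\<dots> \<le> l2_norm MO (\<lambda>z. W n z - w z) + l2_norm MO (\<lambda>z. \<zeta> * (U n z - u z))"
        by (intro l2_norm_triangle_diff L2_diff L2_scale UL L)
      finally show "norm (l2_norm MO (\<lambda>z. (W n z - \<zeta> * U n z) - (w z - \<zeta> * u z))) \<le> l2_norm MO (\<lambda>z. W n z - w z) + cmod \<zeta> * l2_norm MO (\<lambda>z. U n z - u z)"
        by (simp add: l2_norm_scale)
    qed
    have "(\<lambda>n. l2_norm MO (\<lambda>z. W n z - w z) + cmod \<zeta> * l2_norm MO (\<lambda>z. U n z - u z)) \<longlonglongrightarrow> 0 + cmod \<zeta> * 0"
      by (intro tendsto_intros UW)
    thus "(\<lambda>n. l2_norm MO (\<lambda>z. W n z - w z) + cmod \<zeta> * l2_norm MO (\<lambda>z. U n z - u z)) \<longlonglongrightarrow> 0" by simp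
  qed
  have "(\<lambda>n. m * l2_norm lborel (P.coef \<eta> (U n))) \<longlonglongrightarrow> m * l2_norm lborel (P.coef \<eta> u)"
    by (intro tendsto_intros coef_diff_l2_norm_tendsto[OF UL(1) L(1) \<eta> UW(2)])
  moreover have "(\<lambda>n. l2_norm lborel (P.coef \<eta> (\<lambda>z. W n z - \<zeta> * U n z)) + cmod \<beta> * l2_norm lborel (P.coef \<psi> (U n))) \<longlonglongrightarrow>
     l2_norm lborel (P.coef \<eta> (\<lambda>z. w z - \<zeta> * u z)) + cmod \<beta> * l2_norm lborel (P.coef \<psi> u)"
    by (intro tendsto_intros coef_diff_l2_norm_tendsto[OF UL(1) L(1) \<psi> UW(2)] coef_diff_l2_norm_tendsto[OF DL \<eta> D])
  ultimately show ?thesis by (rule LIMSEQ_le) (use core[OF UW(1)] in auto)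
qed

text \<open>The frame inequalities hold on almost every fibre with the same \<open>B\<close>;
  integrating over x and exchanging sum and integral gives them on the strip.\<close>

lemma strip_frame:
  assumes z: "z \<in> L2 MI" and B: "B > 0"
    and sm: "\<And>g. g \<in> L2 MI \<Longrightarrow> summable (\<lambda>k. (cmod (LINT y|MI. g y * frm z k y))\<^sup>2)"
    and lo: "\<And>g. g \<in> L2 MI \<Longrightarrow> (l2_norm MI g)\<^sup>2 \<le> B * (\<Sum>k. (cmod (LINT y|MI. g y * frm z k y))\<^sup>2)"
    and up: "\<And>g. g \<in> L2 MI \<Longrightarrow> (\<Sum>k. (cmod (LINT y|MI. g y * frm z k y))\<^sup>2) \<le> B * (l2_norm MI g)\<^sup>2"
    and u: "u \<in> L2 MO"
  shows "summable (\<lambda>k. (l2_norm lborel (P.coef (frm z k) u))\<^sup>2)"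
    and "(l2_norm MO u)\<^sup>2 \<le> B * (\<Sum>k. (l2_norm lborel (P.coef (frm z k) u))\<^sup>2)"
    and "(\<Sum>k. (l2_norm lborel (P.coef (frm z k) u))\<^sup>2) \<le> B * (l2_norm MO u)\<^sup>2"
proof -
  note um = u[unfolded MO_eq]
  have CL: "P.coef (frm z k) u \<in> L2 lborel" for k by (intro P.coef_L2 um frm_L2 z)
  have [measurable]: "P.coef (frm z k) u \<in> borel_measurable lborel" for k by (rule L2_measurable[OF CL])
  have fib: "AE x in lborel. (\<lambda>y. u (x, y)) \<in> L2 MI" by (rule P.AE_L2_fibre[OF um])
  define N where "N x = (\<integral>\<^sup>+y. ennreal ((cmod (u (x, y)))\<^sup>2) \<partial>MI)" for x
  have NI: "(\<integral>\<^sup>+x. N x \<partial>lborel) = ennreal ((l2_norm MO u)\<^sup>2)" unfolding N_def MO_eq by (rule P.nn_integral_L2_fibre[OF um])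
  have [measurable]: "u \<in> borel_measurable (lborel \<Otimes>\<^sub>M MI)" by (rule L2_measurable[OF um])
  have [measurable]: "N \<in> borel_measurable lborel" unfolding N_def by measurable
  have S: "(\<integral>\<^sup>+x. (\<Sum>k. ennreal ((cmod (P.coef (frm z k) u x))\<^sup>2)) \<partial>lborel) = (\<Sum>k. ennreal ((l2_norm lborel (P.coef (frm z k) u))\<^sup>2))"
    by (subst nn_integral_suminf) (auto simp: nn_integral_L2[OF CL])
  have Bm: "ennreal B * ennreal t = ennreal (B * t)" if "0 \<le> t" for t
    using B that by (simp add: ennreal_mult)
  have pt: "AE x in lborel. N x \<le> ennreal B * (\<Sum>k. ennreal ((cmod (P.coef (frm z k) u x))\<^sup>2)) \<and>
     (\<Sum>k. ennreal ((cmod (P.coef (frm z k) u x))\<^sup>2)) \<le> ennreal B * N x"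
    using fib
  proof eventually_elim
    case (elim x)
    have c: "P.coef (frm z k) u x = (LINT y|MI. u (x, y) * frm z k y)" for k by (simp add: P.coef_def)
    have s: "(\<Sum>k. ennreal ((cmod (P.coef (frm z k) u x))\<^sup>2)) = ennreal (\<Sum>k. (cmod (P.coef (frm z k) u x))\<^sup>2)"
      by (rule suminf_ennreal2) (use sm[OF elim] in \<open>auto simp: c\<close>)
    have n: "N x = ennreal ((l2_norm MI (\<lambda>y. u (x, y)))\<^sup>2)" unfolding N_def by (rule nn_integral_L2[OF elim])
    have nn: "0 \<le> (\<Sum>k. (cmod (P.coef (frm z k) u x))\<^sup>2)"
      by (rule suminf_nonneg) (use sm[OF elim] in \<open>auto simp: c\<close>)
    show ?case unfolding s n Bm[OF nn] Bm[OF zero_le_power2]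
      using lo[OF elim] up[OF elim] by (auto simp only: c intro!: ennreal_leI)
  qed
  have le2: "(\<Sum>k. ennreal ((l2_norm lborel (P.coef (frm z k) u))\<^sup>2)) \<le> ennreal (B * (l2_norm MO u)\<^sup>2)"
  proof -
    have "(\<Sum>k. ennreal ((l2_norm lborel (P.coef (frm z k) u))\<^sup>2)) \<le> (\<integral>\<^sup>+x. ennreal B * N x \<partial>lborel)"
      unfolding S[symmetric] by (rule nn_integral_mono_AE) (use pt in eventually_elim, simp)
    also have "\<dots> = ennreal B * ennreal ((l2_norm MO u)\<^sup>2)" by (simp add: nn_integral_cmult NI)
    finally show ?thesis unfolding Bm[OF zero_le_power2] .
  qed
  show sm': "summable (\<lambda>k. (l2_norm lborel (P.coef (frm z k) u))\<^sup>2)"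
    by (rule summable_suminf_not_top) (use le2 in \<open>auto simp: top_unique\<close>)
  have s': "(\<Sum>k. ennreal ((l2_norm lborel (P.coef (frm z k) u))\<^sup>2)) = ennreal (\<Sum>k. (l2_norm lborel (P.coef (frm z k) u))\<^sup>2)"
    by (rule suminf_ennreal2[OF _ sm']) simp
  show "(\<Sum>k. (l2_norm lborel (P.coef (frm z k) u))\<^sup>2) \<le> B * (l2_norm MO u)\<^sup>2"
    using le2 unfolding s' using B by (simp add: ennreal_le_iff)
  have s0: "0 \<le> (\<Sum>k. (l2_norm lborel (P.coef (frm z k) u))\<^sup>2)" by (rule suminf_nonneg[OF sm']) simp
  have "ennreal ((l2_norm MO u)\<^sup>2) \<le> (\<integral>\<^sup>+x. ennreal B * (\<Sum>k. ennreal ((cmod (P.coef (frm z k) u x))\<^sup>2)) \<partial>lborel)"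
    unfolding NI[symmetric] by (rule nn_integral_mono_AE) (use pt in eventually_elim, simp)
  also have "\<dots> = ennreal (B * (\<Sum>k. (l2_norm lborel (P.coef (frm z k) u))\<^sup>2))"
    using B s0 by (subst nn_integral_cmult) (auto simp: S s' ennreal_mult)
  finally show "(l2_norm MO u)\<^sup>2 \<le> B * (\<Sum>k. (l2_norm lborel (P.coef (frm z k) u))\<^sup>2)"
    using B s0 by (simp add: ennreal_le_iff)
qed

section \<open>The reflection on the strip\<close>

lemma uminus_MI_measurable [measurable]: "(\<lambda>y. - y) \<in> measurable MI MI"
proof -
  have "(\<lambda>y::real. - y) \<in> measurable (restrict_space lborel (II a)) lborel"
    by (intro measurable_restrict_space1) simp
  thus ?thesis unfolding meas_on_def
    by (intro measurable_restrict_space2) (auto simp: space_restrict_space)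
qed

lemma distr_MI_uminus: "distr MI MI (\<lambda>y. - y) = MI"
proof (rule measure_eqI)
  fix A assume "A \<in> sets (distr MI MI (\<lambda>y. - y))"
  hence A: "A \<in> sets MI" by simp
  hence A': "A \<in> sets borel" "A \<subseteq> II a" by (auto simp: meas_on_def sets_restrict_space)
  have eq: "(\<lambda>y. - y) -` A \<inter> II a = (\<lambda>y. - y) -` A" using A'(2) by auto
  have m: "(\<lambda>y. - y) -` A \<in> sets borel"
    using measurable_sets[of "\<lambda>y::real. - y" borel borel A] A'(1) by simp
  have "emeasure (distr MI MI (\<lambda>y. - y)) A = emeasure MI ((\<lambda>y. - y) -` A)"
    using A by (subst emeasure_distr) (simp_all add: eq)
  also have "\<dots> = emeasure lborel ((\<lambda>y. - y) -` A)"
    unfolding meas_on_def using A'(2) by (subst emeasure_restrict_space) auto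
  also have "\<dots> = emeasure (distr lborel borel uminus) A"
    using A'(1) by (subst emeasure_distr) auto
  also have "\<dots> = emeasure lborel A" by (simp add: lborel_distr_uminus)
  also have "\<dots> = emeasure MI A"
    unfolding meas_on_def using A'(2) by (subst emeasure_restrict_space) auto
  finally show "emeasure (distr MI MI (\<lambda>y. - y)) A = emeasure MI A" .
qed simp

lemma integral_MI_reflect:
  fixes f :: "real \<Rightarrow> complex"
  assumes "f \<in> borel_measurable MI"
  shows "(LINT y|MI. f (- y)) = (LINT y|MI. f y)"
  using integral_distr[OF uminus_MI_measurable assms] by (simp add: distr_MI_uminus)

lemma nn_integral_MI_reflect:
  assumes "f \<in> borel_measurable MI"
  shows "(\<integral>\<^sup>+y. f (- y) \<partial>MI) = (\<integral>\<^sup>+y. f y \<partial>MI)"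
  using nn_integral_distr[OF uminus_MI_measurable, of f] assms by (simp add: distr_MI_uminus)

lemma par_Om_L2:
  assumes u: "u \<in> L2 MO"
  shows "par_Om u \<in> L2 MO" "l2_norm MO (par_Om u) = l2_norm MO u"
proof -
  note um = u[unfolded MO_eq]
  have [measurable]: "u \<in> borel_measurable (lborel \<Otimes>\<^sub>M MI)" by (rule L2_measurable[OF um])
  have pe: "par_Om u = (\<lambda>z. u (fst z, - snd z))" by (auto simp: par_Om_def)
  have mp: "(\<lambda>z. (fst z, - snd z)) \<in> measurable (lborel \<Otimes>\<^sub>M MI) (lborel \<Otimes>\<^sub>M MI)" by measurable
  have [measurable]: "par_Om u \<in> borel_measurable (lborel \<Otimes>\<^sub>M MI)"
    unfolding pe using measurable_compose[OF mp L2_measurable[OF um]] .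
  have "(\<integral>\<^sup>+z. ennreal ((cmod (par_Om u z))\<^sup>2) \<partial>(lborel \<Otimes>\<^sub>M MI)) = (\<integral>\<^sup>+x. \<integral>\<^sup>+y. ennreal ((cmod (par_Om u (x, y)))\<^sup>2) \<partial>MI \<partial>lborel)"
    by (rule P.M2.nn_integral_fst[symmetric]) measurable
  also have "\<dots> = (\<integral>\<^sup>+x. \<integral>\<^sup>+y. ennreal ((cmod (u (x, y)))\<^sup>2) \<partial>MI \<partial>lborel)"
  proof (rule nn_integral_cong)
    fix x :: real
    have "(\<lambda>y. ennreal ((cmod (u (x, y)))\<^sup>2)) \<in> borel_measurable MI" by measurable
    from nn_integral_MI_reflect[OF this]
    show "(\<integral>\<^sup>+y. ennreal ((cmod (par_Om u (x, y)))\<^sup>2) \<partial>MI) = (\<integral>\<^sup>+y. ennreal ((cmod (u (x, y)))\<^sup>2) \<partial>MI)"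
      by (simp add: pe)
  qed
  also have "\<dots> = ennreal ((l2_norm (lborel \<Otimes>\<^sub>M MI) u)\<^sup>2)" by (rule P.nn_integral_L2_fibre[OF um])
  finally have nn: "(\<integral>\<^sup>+z. ennreal ((cmod (par_Om u z))\<^sup>2) \<partial>(lborel \<Otimes>\<^sub>M MI)) = ennreal ((l2_norm (lborel \<Otimes>\<^sub>M MI) u)\<^sup>2)" .
  have pL: "par_Om u \<in> L2 (lborel \<Otimes>\<^sub>M MI)" by (rule L2_nn_integralI) (auto simp: nn)
  thus "par_Om u \<in> L2 MO" by (simp add: MO_eq)
  have "(l2_norm (lborel \<Otimes>\<^sub>M MI) (par_Om u))\<^sup>2 = (l2_norm (lborel \<Otimes>\<^sub>M MI) u)\<^sup>2"
    using nn nn_integral_L2[OF pL] by simp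
  thus "l2_norm MO (par_Om u) = l2_norm MO u" unfolding MO_eq by (metis l2_norm_nonneg power2_eq_imp_eq)
qed

text \<open>Moved onto \<open>psi k\<close>, the reflection turns the conjugate in the inner product
  into \<open>sg k\<close> times \<open>psi k\<close> itself. The inner product thus reproduces the
  bilinear coefficient, and the square of its modulus appears.\<close>

lemma par_Om_component:
  assumes u: "u \<in> L2 MO"
  shows "l2_inner MO (par_Om u) (\<lambda>z. P.coef (psi k) u (fst z) * psi k (snd z)) = of_real (sg k * (l2_norm lborel (P.coef (psi k) u))\<^sup>2)"
proof -
  note um = u[unfolded MO_eq]
  define c where "c = P.coef (psi k) u"
  have c: "c \<in> L2 lborel" unfolding c_def by (intro P.coef_L2 um psi_L2)
  have [measurable]: "u \<in> borel_measurable (lborel \<Otimes>\<^sub>M MI)" by (rule L2_measurable[OF um])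
  have [measurable]: "psi k \<in> borel_measurable MI" by (rule L2_measurable[OF psi_L2])
  have T: "(\<lambda>z. c (fst z) * psi k (snd z)) \<in> L2 (lborel \<Otimes>\<^sub>M MI)" by (rule P.L2_tensor(1)[OF c psi_L2])
  have i: "integrable (lborel \<Otimes>\<^sub>M MI) (\<lambda>z. par_Om u z * cnj (c (fst z) * psi k (snd z)))"
    by (intro integrable_L2_mult L2_cnj T par_Om_L2[OF u, unfolded MO_eq])
  have "l2_inner MO (par_Om u) (\<lambda>z. c (fst z) * psi k (snd z)) = (LINT x|lborel. LINT y|MI. par_Om u (x, y) * cnj (c x * psi k y))"
    unfolding l2_inner_def MO_eq using P.integral_fst'[OF i] by simp
  also have "\<dots> = (LINT x|lborel. of_real (sg k) * (c x * cnj (c x)))"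
  proof (rule Bochner_Integration.integral_cong[OF refl])
    fix x :: real
    have "(LINT y|MI. par_Om u (x, y) * cnj (c x * psi k y)) = (LINT y|MI. cnj (c x) * (u (x, - y) * cnj (psi k (- (- y)))))"
      by (simp add: par_Om_def mult_ac)
    also have "\<dots> = cnj (c x) * (LINT y|MI. u (x, - y) * cnj (psi k (- (- y))))"
      by (rule integral_mult_right_zero)
    also have "(LINT y|MI. u (x, - y) * cnj (psi k (- (- y)))) = (LINT y|MI. u (x, y) * cnj (psi k (- y)))"
      by (rule integral_MI_reflect[of "\<lambda>y. u (x, y) * cnj (psi k (- y))"]) measurable
    also have "\<dots> = (LINT y|MI. of_real (sg k) * (u (x, y) * psi k y))"
      unfolding cnj_psi_reflect by (simp add: mult_ac)
    also have "\<dots> = of_real (sg k) * c x" by (simp add: c_def P.coef_def)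
    finally show "(LINT y|MI. par_Om u (x, y) * cnj (c x * psi k y)) = of_real (sg k) * (c x * cnj (c x))"
      by (simp add: mult_ac)
  qed
  also have "\<dots> = of_real (sg k) * l2_inner lborel c c" by (simp add: l2_inner_def)
  also have "\<dots> = of_real (sg k * (l2_norm lborel c)\<^sup>2)" by (simp add: l2_norm_sq_inner)
  finally show ?thesis by (simp add: c_def)
qed

section \<open>Concentration of approximate eigensequences\<close>

lemma finite_lam_le: "finite {k. lam k \<le> t}"
proof (rule finite_subset)
  show "{k. lam k \<le> t} \<subseteq> insert 0 {..nat \<lceil>sqrt t * (2 * a) / pi\<rceil>}"
  proof
    fix k assume k: "k \<in> {k. lam k \<le> t}"
    show "k \<in> insert 0 {..nat \<lceil>sqrt t * (2 * a) / pi\<rceil>}"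
    proof (cases "k = 0")
      case False
      hence "(kap k)\<^sup>2 \<le> t" using k by (simp add: lam_def)
      hence "kap k \<le> sqrt t" by (rule real_le_rsqrt)
      hence "real k \<le> sqrt t * (2 * a) / pi" using a by (simp add: kap_def field_simps)
      thus ?thesis by simp linarith
    qed simp
  qed
qed simp

text \<open>The components of \<open>u\<close> along the eigenfunctions outside \<open>S\<close> are controlled by \<open>(H - \<zeta>) u\<close>; on the
  span of the remaining ones the indefinite form is definite.\<close>

lemma approx_eigenseq_definite:
  assumes V: "V \<in> borel_measurable borel" "\<And>x. \<bar>V x\<bar> \<le> Bv" and eps: "\<epsilon> = 1 \<or> \<epsilon> = (-1::real)"
    and cond: "\<And>k. (\<exists>m>0. bdd_below_at lborel (H_R V) (\<zeta> - of_real (lam k)) m) \<or> \<epsilon> * Nv k > 0"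
    and f: "approx_eigenseq MO (H_Om a \<alpha> V) \<zeta> f"
  shows "\<exists>\<delta>>0. \<forall>\<^sub>F n in sequentially. \<delta> \<le> \<epsilon> * Re (l2_inner MO (par_Om (f n)) (f n))"
proof -
  \<comment> \<open>The surviving components. Membership depends on k only through
    \<open>lam k\<close>, which matters for the Jordan chain.\<close>
  define S where "S = {k. \<not> (\<exists>m>0. bdd_below_at lborel (H_R V) (\<zeta> - of_real (lam k)) m)}"
  have SN: "\<epsilon> * Nv k > 0" if "k \<in> S" for k using cond[of k] that by (auto simp: S_def)
  \<comment> \<open>Outside T the point zeta - \<open>lam k\<close> lies at least 1 to the left of
    -Bv, where \<open>H_R\<close> is bounded below by 1. This makes S finite and gives one bound
    \<open>m0\<close> for all components outside S.\<close>
  define T where "T = {k. lam k \<le> Bv + Re \<zeta> + 1}"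
  have fT: "finite T" unfolding T_def by (rule finite_lam_le)
  have bT: "bdd_below_at lborel (H_R V) (\<zeta> - of_real (lam k)) 1" if "k \<notin> T" for k
    by (rule bdd_below_at_mono[OF bdd_below_H_R_Re[OF V]]) (use that in \<open>simp add: T_def\<close>)
  have ST: "S \<subseteq> T" using bT zero_less_one unfolding S_def by blast
  have fS: "finite S" using ST fT finite_subset by blast
  define mm where "mm k = (SOME m. m > 0 \<and> bdd_below_at lborel (H_R V) (\<zeta> - of_real (lam k)) m)" for k
  have mm: "mm k > 0 \<and> bdd_below_at lborel (H_R V) (\<zeta> - of_real (lam k)) (mm k)" if "k \<notin> S" for k
    unfolding mm_def by (rule someI_ex) (use that in \<open>simp add: S_def\<close>)
  define m0 where "m0 = Min (insert 1 (mm ` (T - S)))"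
  have fin0: "finite (insert 1 (mm ` (T - S)))" using fT by simp
  have m0: "m0 > 0" unfolding m0_def using fin0 mm by (subst Min_gr_iff) auto
  have b0: "bdd_below_at lborel (H_R V) (\<zeta> - of_real (lam k)) m0" if "k \<notin> S" for k
  proof (cases "k \<in> T")
    case True
    have "m0 \<le> mm k" unfolding m0_def using fin0 True that by (intro Min_le) auto
    thus ?thesis using mm[OF that] bdd_below_at_mono by blast
  next
    case False
    have "m0 \<le> 1" unfolding m0_def using fin0 by (intro Min_le) auto
    thus ?thesis using bT[OF False] bdd_below_at_mono by blast
  qed
  obtain z \<beta> m where z: "z \<in> L2 MI" "(LINT y|MI. psi 0 y * z y) \<noteq> 0"
    and zrel: "\<And>g G. (g, G) \<in> H_I a \<alpha> \<Longrightarrow> (LINT y|MI. G y * z y) = of_real (lam 0) * (LINT y|MI. g y * z y) + \<beta> * (LINT y|MI. g y * psi m y)"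
    and m: "m \<noteq> 0" "\<beta> \<noteq> 0 \<Longrightarrow> lam m = lam 0" and zN: "Nv 0 \<noteq> 0 \<Longrightarrow> z = psi 0"
    by (rule ex_zero_functional) blast
  obtain B where B: "B > 0"
    and frame: "\<And>g. g \<in> L2 MI \<Longrightarrow> summable (\<lambda>k. (cmod (LINT y|MI. g y * frm z k y))\<^sup>2)"
    "\<And>g. g \<in> L2 MI \<Longrightarrow> (l2_norm MI g)\<^sup>2 \<le> B * (\<Sum>k. (cmod (LINT y|MI. g y * frm z k y))\<^sup>2)"
    "\<And>g. g \<in> L2 MI \<Longrightarrow> (\<Sum>k. (cmod (LINT y|MI. g y * frm z k y))\<^sup>2) \<le> B * (l2_norm MI g)\<^sup>2"
    by (rule frame_bounds[OF z]) blast
  have SF: "summable (\<lambda>k. (l2_norm lborel (P.coef (frm z k) u))\<^sup>2)"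
    "(l2_norm MO u)\<^sup>2 \<le> B * (\<Sum>k. (l2_norm lborel (P.coef (frm z k) u))\<^sup>2)"
    "(\<Sum>k. (l2_norm lborel (P.coef (frm z k) u))\<^sup>2) \<le> B * (l2_norm MO u)\<^sup>2" if u: "u \<in> L2 MO" for u
    by (rule strip_frame[OF z(1) B _ _ _ u]; erule frame)+
  obtain g where nf: "\<And>n. l2_norm MO (f n) = 1" and fg: "\<And>n. (f n, g n) \<in> H_Om a \<alpha> V"
    and lim: "(\<lambda>n. l2_norm MO (\<lambda>x. g n x - \<zeta> * f n x)) \<longlonglongrightarrow> 0"
    using f by (auto simp: approx_eigenseq_def)
  have fL: "f n \<in> L2 MO" "g n \<in> L2 MO" for n using H_Om_L2[OF fg] by auto
  define d where "d n x = g n x - \<zeta> * f n x" for n x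
  define D where "D n = l2_norm MO (d n)" for n
  have dL: "d n \<in> L2 MO" for n unfolding d_def by (intro L2_diff L2_scale fL)
  have D0: "D n \<ge> 0" for n by (simp add: D_def)
  have Dlim: "D \<longlonglongrightarrow> 0" using lim by (simp add: D_def[abs_def] d_def[abs_def])
  define X where "X n k = l2_norm lborel (P.coef (frm z k) (f n))" for n k
  define Y where "Y n k = l2_norm lborel (P.coef (frm z k) (d n))" for n k
  have XY0: "X n k \<ge> 0" "Y n k \<ge> 0" for n k by (auto simp: X_def Y_def)
  have frk: "frm z k = psi k" if "k \<noteq> 0" for k using that by (simp add: frm_def)
  have bk: "m0 * X n k \<le> Y n k" if "k \<notin> S" "k \<noteq> 0" for n k
  proof -
    have "m0 * l2_norm lborel (P.coef (psi k) (f n)) \<le> l2_norm lborel (P.coef (psi k) (\<lambda>z. g n z - \<zeta> * f n z)) + cmod 0 * l2_norm lborel (P.coef (psi k) (f n))"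
      by (rule H_Om_coef_bound[OF fg psi_L2 psi_L2 _ b0[OF that(1)]]) (simp add: coef_H_I)
    thus ?thesis by (simp add: X_def Y_def frk[OF that(2)] d_def[abs_def])
  qed
  \<comment> \<open>From m0 X <= Y for ordinary components and m0 X_0 <= Y_0 + |beta| Y_m / m0 for
    the generalised one; the factors 2 come from (s + t)^2 <= 2 s^2 + 2 t^2.\<close>
  define K1 K2 where "K1 = 2 / m0\<^sup>2" and "K2 = 2 * (cmod \<beta>)\<^sup>2 / (m0\<^sup>2 * m0\<^sup>2)"
  have K0: "K1 > 0" "K2 \<ge> 0" using m0 by (auto simp: K1_def K2_def)
  have bnd: "(X n k)\<^sup>2 \<le> K1 * (Y n k)\<^sup>2 + (if k = 0 then K2 * (Y n m)\<^sup>2 else 0)" if kS: "k \<notin> S" for n k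
  proof (cases "k = 0")
    case False
    have "(m0 * X n k)\<^sup>2 \<le> (Y n k)\<^sup>2" using bk[OF kS False] m0 XY0 by (intro power_mono) auto
    hence "(X n k)\<^sup>2 \<le> (Y n k)\<^sup>2 / m0\<^sup>2" using m0 by (simp add: power_mult_distrib field_simps)
    also have "\<dots> \<le> 2 * ((Y n k)\<^sup>2 / m0\<^sup>2)"
    proof -
      have "0 \<le> (Y n k)\<^sup>2 / m0\<^sup>2" by simp
      thus ?thesis by linarith
    qed
    finally show ?thesis using False by (simp add: K1_def)
  next
    case True
    have "m0 * l2_norm lborel (P.coef z (f n)) \<le> l2_norm lborel (P.coef z (\<lambda>z. g n z - \<zeta> * f n z)) + cmod \<beta> * l2_norm lborel (P.coef (psi m) (f n))"
      by (rule H_Om_coef_bound[OF fg z(1) psi_L2 zrel b0]) (use kS True in auto)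
    hence 1: "m0 * X n 0 \<le> Y n 0 + cmod \<beta> * X n m" using frk[OF m(1)] by (simp add: X_def Y_def d_def[abs_def] frm_def)
    have 2: "cmod \<beta> * X n m \<le> cmod \<beta> * (Y n m / m0)"
    proof (cases "\<beta> = 0")
      case False
      \<comment> \<open>In a Jordan chain \<open>lam m\<close> = \<open>lam 0\<close>, so m is
        outside S together with 0 and its component is already controlled.\<close>
      hence "m \<notin> S" using m(2) kS True by (simp add: S_def)
      hence "X n m \<le> Y n m / m0" using bk[OF _ m(1), of n] m0 by (simp add: field_simps)
      thus ?thesis by (intro mult_left_mono) auto
    qed simp
    have "(m0 * X n 0)\<^sup>2 \<le> (Y n 0 + cmod \<beta> * (Y n m / m0))\<^sup>2" using 1 2 m0 XY0 by (intro power_mono) auto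
    also have "\<dots> \<le> 2 * (Y n 0)\<^sup>2 + 2 * (cmod \<beta> * (Y n m / m0))\<^sup>2"
      using sum_squares_bound[of "Y n 0" "cmod \<beta> * (Y n m / m0)"] by (simp add: power2_sum)
    finally have "m0\<^sup>2 * (X n 0)\<^sup>2 \<le> 2 * (Y n 0)\<^sup>2 + 2 * ((cmod \<beta>)\<^sup>2 * (Y n m)\<^sup>2 / m0\<^sup>2)"
      by (simp add: power_mult_distrib power_divide)
    hence "(X n 0)\<^sup>2 \<le> (2 * (Y n 0)\<^sup>2 + 2 * ((cmod \<beta>)\<^sup>2 * (Y n m)\<^sup>2 / m0\<^sup>2)) / m0\<^sup>2"
      using m0 by (simp add: pos_le_divide_eq mult.commute)
    also have "\<dots> = K1 * (Y n 0)\<^sup>2 + K2 * (Y n m)\<^sup>2" using m0 by (simp add: K1_def K2_def field_simps)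
    finally show ?thesis using True by simp
  qed
  define R where "R n = (\<Sum>k. if k \<in> S then 0 else (X n k)\<^sup>2)" for n
  have sX: "summable (\<lambda>k. (X n k)\<^sup>2)" for n unfolding X_def by (rule SF(1)[OF fL(1)])
  have sY: "summable (\<lambda>k. (Y n k)\<^sup>2)" for n unfolding Y_def by (rule SF(1)[OF dL])
  have sR: "summable (\<lambda>k. if k \<in> S then 0 else (X n k)\<^sup>2)" for n
    by (rule summable_comparison_test'[OF sX[of n], of 0]) auto
  define K where "K = (K1 + K2) * B"
  have K: "K > 0" using K0 B by (simp add: K_def add_pos_nonneg)
  have Rle: "R n \<le> K * (D n)\<^sup>2" for n
  proof -
    have s0: "(\<lambda>k. if k = 0 then K2 * (Y n m)\<^sup>2 else 0) sums (K2 * (Y n m)\<^sup>2)"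
      using sums_If_finite_set[of "{0}" "\<lambda>_. K2 * (Y n m)\<^sup>2"] by simp
    have "R n \<le> (\<Sum>k. K1 * (Y n k)\<^sup>2 + (if k = 0 then K2 * (Y n m)\<^sup>2 else 0))"
      unfolding R_def
    proof (rule suminf_le)
      show "(if k \<in> S then 0 else (X n k)\<^sup>2) \<le> K1 * (Y n k)\<^sup>2 + (if k = 0 then K2 * (Y n m)\<^sup>2 else 0)" for k
        using bnd[of k n] K0 by (auto intro!: add_nonneg_nonneg mult_nonneg_nonneg)
      show "summable (\<lambda>k. K1 * (Y n k)\<^sup>2 + (if k = 0 then K2 * (Y n m)\<^sup>2 else 0))"
        by (intro summable_add summable_mult sY sums_summable[OF s0])
    qed (rule sR)
    also have "\<dots> = K1 * (\<Sum>k. (Y n k)\<^sup>2) + K2 * (Y n m)\<^sup>2"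
      using suminf_add[OF summable_mult[OF sY, of K1] sums_summable[OF s0], symmetric] suminf_mult[OF sY, of K1] sums_unique[OF s0] by simp
    also have "(Y n m)\<^sup>2 \<le> (\<Sum>k. (Y n k)\<^sup>2)"
      using sum_le_suminf[OF sY, of "{m}" n] by simp
    hence "K1 * (\<Sum>k. (Y n k)\<^sup>2) + K2 * (Y n m)\<^sup>2 \<le> (K1 + K2) * (\<Sum>k. (Y n k)\<^sup>2)"
      using K0 by (simp add: distrib_right mult_left_mono)
    also have "\<dots> \<le> (K1 + K2) * (B * (D n)\<^sup>2)"
      unfolding Y_def D_def using K0 by (intro mult_left_mono SF(3)[OF dL]) auto
    finally show ?thesis by (simp add: K_def mult.assoc)
  qed
  have NS: "Nv k \<noteq> 0" if "k \<in> S" for k using SN[OF that] by auto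
  have frS: "frm z k = psi k" if "k \<in> S" for k
    using NS[OF that] zN by (cases "k = 0") (auto simp: frm_def)
  have sgn: "sg k \<noteq> 0" for k using sg_sq[of k] by auto
  \<comment> \<open>Biorthogonality of the surviving eigenfunctions with the whole frame. Their
    \<open>Nv\<close> is nonzero, so their eigenvalues are simple and every other functional, the
    generalised one included, annihilates them.\<close>
  have bi: "(LINT y|MI. psi k y * frm z j y) = (if j = k then of_real (sg k * Nv k) else 0)" if kS: "k \<in> S" for j k
  proof (cases "j = k")
    case True
    thus ?thesis using frS[OF kS] psi_sq by simp
  next
    case False
    have nl: "lam j \<noteq> lam k" using simple_of_Nv[OF NS[OF kS], of j] False by blast
    show ?thesis
    proof (cases "j = 0")
      case True
      have n0: "lam 0 \<noteq> lam k" using nl True by simp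
      have "\<beta> * (LINT y|MI. psi k y * psi m y) = 0"
        using psi_orth[of k m] m(2) n0 by (cases "\<beta> = 0") auto
      hence "(LINT y|MI. (of_real (lam k) * psi k y) * z y) = of_real (lam 0) * (LINT y|MI. psi k y * z y)"
        using zrel[OF psi_H_I, of k] by simp
      moreover have "(LINT y|MI. (of_real (lam k) * psi k y) * z y) = of_real (lam k) * (LINT y|MI. psi k y * z y)"
        by (simp add: mult.assoc)
      ultimately have "(LINT y|MI. psi k y * z y) = 0" using n0 by simp
      thus ?thesis using True False by (simp add: frm_def)
    next
      case j0: False
      show ?thesis using psi_orth[of k j] nl False by (simp add: frk[OF j0])
    qed
  qed
  \<comment> \<open>The inverse of the bilinear square of \<open>psi k\<close>, so that
    \<open>s n\<close> is the spectral projection of \<open>f n\<close> onto the surviving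
    components and \<open>v n\<close> has vanishing coefficients there.\<close>
  define w where "w k = complex_of_real (1 / (sg k * Nv k))" for k
  define s where "s n zz = (\<Sum>k\<in>S. (w k * P.coef (psi k) (f n) (fst zz)) * psi k (snd zz))" for n zz
  define v where "v n zz = f n zz - 1 * s n zz" for n zz
  note fm = fL(1)[unfolded MO_eq]
  have cL: "P.coef (psi k) (f n) \<in> L2 lborel" for n k by (intro P.coef_L2 fm psi_L2)
  have tL: "(\<lambda>zz. (w k * P.coef (psi k) (f n) (fst zz)) * psi k (snd zz)) \<in> L2 (lborel \<Otimes>\<^sub>M MI)" for n k
    by (rule P.L2_tensor(1)[OF L2_scale[OF cL] psi_L2])
  have sL: "s n \<in> L2 (lborel \<Otimes>\<^sub>M MI)" for n unfolding s_def[abs_def] by (intro L2_sum tL)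
  have vm: "v n \<in> L2 (lborel \<Otimes>\<^sub>M MI)" for n unfolding v_def[abs_def] by (intro L2_diff L2_scale fm sL)
  hence vL: "v n \<in> L2 MO" for n by (simp add: MO_eq)
  have cv: "l2_norm lborel (P.coef (frm z j) (v n)) = (if j \<in> S then 0 else X n j)" for j n
  proof -
    have cs: "P.coef (frm z j) (s n) x = (if j \<in> S then P.coef (frm z j) (f n) x else 0)" for x
    proof -
      have "P.coef (frm z j) (s n) x = (\<Sum>k\<in>S. (LINT y|MI. psi k y * frm z j y) * (w k * P.coef (psi k) (f n) x))"
        unfolding s_def[abs_def] by (rule P.coef_tensor_sum) (intro psi_L2 frm_L2 z(1))+
      also have "\<dots> = (\<Sum>k\<in>S. if j = k then P.coef (psi k) (f n) x else 0)"
      proof (rule sum.cong[OF refl])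
        fix k assume kS: "k \<in> S"
        have "of_real (sg k * Nv k) * w k = 1" using NS[OF kS] sgn[of k] by (simp add: w_def)
        thus "(LINT y|MI. psi k y * frm z j y) * (w k * P.coef (psi k) (f n) x) = (if j = k then P.coef (psi k) (f n) x else 0)"
          unfolding bi[OF kS] by (simp flip: mult.assoc)
      qed
      also have "\<dots> = (if j \<in> S then P.coef (frm z j) (f n) x else 0)" using fS frS by simp
      finally show ?thesis .
    qed
    have "AE x in lborel. P.coef (frm z j) (v n) x = P.coef (frm z j) (f n) x - 1 * P.coef (frm z j) (s n) x"
      unfolding v_def[abs_def] by (rule P.coef_diff_AE[OF fm sL frm_L2[OF z(1)]])
    hence ae: "AE x in lborel. P.coef (frm z j) (v n) x = (if j \<in> S then 0 else P.coef (frm z j) (f n) x)"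
      unfolding cs by eventually_elim simp
    have cfL: "P.coef (frm z j) (f n) \<in> L2 lborel" "P.coef (frm z j) (v n) \<in> L2 lborel"
      by (intro P.coef_L2 fm vm frm_L2 z(1))+
    have "l2_norm lborel (P.coef (frm z j) (v n)) = l2_norm lborel (\<lambda>x. if j \<in> S then 0 else P.coef (frm z j) (f n) x)"
      by (rule l2_norm_cong_AE[OF L2_measurable[OF cfL(2)] _ ae]) (use L2_measurable[OF cfL(1)] in auto)
    thus ?thesis by (simp add: X_def)
  qed
  have nv: "(l2_norm MO (v n))\<^sup>2 \<le> B * (K * (D n)\<^sup>2)" for n
  proof -
    have "(l2_norm MO (v n))\<^sup>2 \<le> B * (\<Sum>k. (if k \<in> S then 0 else X n k)\<^sup>2)"
      using SF(2)[OF vL, of n] unfolding cv .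
    also have "(\<lambda>k. (if k \<in> S then 0 else X n k)\<^sup>2) = (\<lambda>k. if k \<in> S then 0 else (X n k)\<^sup>2)" by auto
    hence "B * (\<Sum>k. (if k \<in> S then 0 else X n k)\<^sup>2) = B * R n" by (simp add: R_def)
    also have "\<dots> \<le> B * (K * (D n)\<^sup>2)" using B by (intro mult_left_mono Rle) auto
    finally show ?thesis .
  qed
  define J where "J n = l2_inner MO (par_Om (f n)) (f n)" for n
  \<comment> \<open>Each surviving component contributes sg k |c_k|^2 times the normalisation 1 /
    (sg k Nv k), hence the quotient by \<open>Nv k\<close>.\<close>
  have Jeq: "J n = l2_inner MO (par_Om (f n)) (v n) + of_real (\<Sum>k\<in>S. (X n k)\<^sup>2 / Nv k)" for n
  proof -
    note pL = par_Om_L2(1)[OF fL(1), of n]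
    note pm = pL[unfolded MO_eq]
    have iv: "integrable (lborel \<Otimes>\<^sub>M MI) (\<lambda>zz. par_Om (f n) zz * cnj (v n zz))"
      by (intro integrable_L2_mult L2_cnj pm vm)
    have ik: "integrable (lborel \<Otimes>\<^sub>M MI) (\<lambda>zz. par_Om (f n) zz * cnj (P.coef (psi k) (f n) (fst zz) * psi k (snd zz)))" for k
      by (intro integrable_L2_mult L2_cnj pm P.L2_tensor(1) cL psi_L2)
    have "par_Om (f n) zz * cnj (f n zz) = par_Om (f n) zz * cnj (v n zz) +
      (\<Sum>k\<in>S. cnj (w k) * (par_Om (f n) zz * cnj (P.coef (psi k) (f n) (fst zz) * psi k (snd zz))))" for zz
      by (simp add: v_def s_def sum_distrib_left algebra_simps)
    hence "J n = (LINT zz|(lborel \<Otimes>\<^sub>M MI). par_Om (f n) zz * cnj (v n zz) +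
      (\<Sum>k\<in>S. cnj (w k) * (par_Om (f n) zz * cnj (P.coef (psi k) (f n) (fst zz) * psi k (snd zz)))))"
      unfolding J_def l2_inner_def MO_eq by (simp only:)
    also have "\<dots> = l2_inner MO (par_Om (f n)) (v n) +
       (\<Sum>k\<in>S. cnj (w k) * l2_inner MO (par_Om (f n)) (\<lambda>zz. P.coef (psi k) (f n) (fst zz) * psi k (snd zz)))"
      unfolding l2_inner_def MO_eq using iv ik
      by (simp only: Bochner_Integration.integral_add Bochner_Integration.integral_sum integrable_mult_right
          Bochner_Integration.integrable_sum integral_mult_right_zero)
    also have "(\<Sum>k\<in>S. cnj (w k) * l2_inner MO (par_Om (f n)) (\<lambda>zz. P.coef (psi k) (f n) (fst zz) * psi k (snd zz))) =
      (\<Sum>k\<in>S. of_real ((X n k)\<^sup>2 / Nv k))"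
    proof (rule sum.cong[OF refl])
      fix k assume kS: "k \<in> S"
      have "1 / (sg k * Nv k) * (sg k * (X n k)\<^sup>2) = (X n k)\<^sup>2 / Nv k" using NS[OF kS] sgn[of k] by simp
      hence "complex_of_real (1 / (sg k * Nv k)) * of_real (sg k * (X n k)\<^sup>2) = of_real ((X n k)\<^sup>2 / Nv k)"
        by (simp only: of_real_mult[symmetric])
      thus "cnj (w k) * l2_inner MO (par_Om (f n)) (\<lambda>zz. P.coef (psi k) (f n) (fst zz) * psi k (snd zz)) = of_real ((X n k)\<^sup>2 / Nv k)"
        unfolding par_Om_component[OF fL(1)] w_def complex_cnj_complex_of_real by (simp only: X_def frS[OF kS])
    qed
    finally show ?thesis by simp
  qed
  \<comment> \<open>The least weight in the diagonal form, positive because S is finite; inserting 1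
    covers an empty S.\<close>
  define p where "p = Min (insert 1 ((\<lambda>k. 1 / (\<epsilon> * Nv k)) ` S))"
  have finp: "finite (insert 1 ((\<lambda>k. 1 / (\<epsilon> * Nv k)) ` S))" using fS by simp
  have p0: "p > 0" unfolding p_def using finp SN by (subst Min_gr_iff) auto
  have pk: "p \<le> 1 / (\<epsilon> * Nv k)" if "k \<in> S" for k unfolding p_def using finp that by (intro Min_le) auto
  \<comment> \<open>The frame inequality bounds the total of all squared coefficients below by 1 /
    B, and all but K D^2 of it sits on S. The last term is Cauchy-Schwarz with the remainder, whose
    norm is at most sqrt (B K) D.\<close>
  have low: "p * (1 / B - K * (D n)\<^sup>2) - sqrt (B * K) * D n \<le> \<epsilon> * Re (J n)" for n
  proof -
    have "(l2_norm MO (f n))\<^sup>2 \<le> B * (\<Sum>k. (X n k)\<^sup>2)" unfolding X_def by (rule SF(2)[OF fL(1)])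
    hence "1 / B \<le> (\<Sum>k. (X n k)\<^sup>2)" using B by (simp add: nf field_simps)
    also have "(\<Sum>k. (X n k)\<^sup>2) = (\<Sum>k. (if k \<in> S then (X n k)\<^sup>2 else 0) + (if k \<in> S then 0 else (X n k)\<^sup>2))"
      by (rule arg_cong[where f = suminf]) auto
    also have "\<dots> = (\<Sum>k. if k \<in> S then (X n k)\<^sup>2 else 0) + R n"
      unfolding R_def by (rule suminf_add[symmetric, OF summable_If_finite_set[OF fS] sR])
    also have "(\<Sum>k. if k \<in> S then (X n k)\<^sup>2 else 0) = (\<Sum>k\<in>S. (X n k)\<^sup>2)"
      using sums_unique[OF sums_If_finite_set[OF fS, of "\<lambda>k. (X n k)\<^sup>2"]] by simp
    finally have "1 / B - K * (D n)\<^sup>2 \<le> (\<Sum>k\<in>S. (X n k)\<^sup>2)" using Rle[of n] by linarith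
    hence "p * (1 / B - K * (D n)\<^sup>2) \<le> p * (\<Sum>k\<in>S. (X n k)\<^sup>2)" using p0 by (intro mult_left_mono) auto
    also have "\<dots> = (\<Sum>k\<in>S. p * (X n k)\<^sup>2)" by (rule sum_distrib_left)
    also have "\<dots> \<le> (\<Sum>k\<in>S. 1 / (\<epsilon> * Nv k) * (X n k)\<^sup>2)" by (intro sum_mono mult_right_mono pk) auto
    also have "\<dots> = \<epsilon> * (\<Sum>k\<in>S. (X n k)\<^sup>2 / Nv k)"
      using eps by (auto simp: sum_distrib_left sum_negf[symmetric])
    finally have 1: "p * (1 / B - K * (D n)\<^sup>2) \<le> \<epsilon> * (\<Sum>k\<in>S. (X n k)\<^sup>2 / Nv k)" .
    have "cmod (l2_inner MO (par_Om (f n)) (v n)) \<le> l2_norm MO (par_Om (f n)) * l2_norm MO (v n)"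
      by (rule Cauchy_Schwarz_L2[OF par_Om_L2(1)[OF fL(1)] vL])
    also have "\<dots> = l2_norm MO (v n)" by (simp add: par_Om_L2(2)[OF fL(1)] nf)
    also have "\<dots> \<le> sqrt (B * (K * (D n)\<^sup>2))" by (rule real_le_rsqrt[OF nv])
    also have "\<dots> = sqrt (B * K) * D n" using D0[of n] by (simp add: real_sqrt_mult)
    finally have "\<bar>Re (l2_inner MO (par_Om (f n)) (v n))\<bar> \<le> sqrt (B * K) * D n" using abs_Re_le_cmod order_trans by blast
    hence "- (sqrt (B * K) * D n) \<le> \<epsilon> * Re (l2_inner MO (par_Om (f n)) (v n))" using eps by auto
    moreover have "\<epsilon> * Re (J n) = \<epsilon> * Re (l2_inner MO (par_Om (f n)) (v n)) + \<epsilon> * (\<Sum>k\<in>S. (X n k)\<^sup>2 / Nv k)"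
      unfolding Jeq by (simp only: plus_complex.sel Re_complex_of_real distrib_left)
    ultimately show ?thesis using 1 by linarith
  qed
  have "(\<lambda>n. p * (1 / B - K * (D n)\<^sup>2) - sqrt (B * K) * D n) \<longlonglongrightarrow> p * (1 / B - K * 0\<^sup>2) - sqrt (B * K) * 0"
    by (intro tendsto_intros Dlim)
  hence "(\<lambda>n. p * (1 / B - K * (D n)\<^sup>2) - sqrt (B * K) * D n) \<longlonglongrightarrow> p / B" by simp
  \<comment> \<open>Half of the limit p / B serves as the eventual lower bound.\<close>
  moreover have pB: "0 < p / (2 * B)" "p / (2 * B) < p / B" using p0 B by (auto simp: field_simps)
  ultimately have "\<forall>\<^sub>F n in sequentially. p / (2 * B) < p * (1 / B - K * (D n)\<^sup>2) - sqrt (B * K) * D n"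
    using order_tendstoD(1) by blast
  hence "\<forall>\<^sub>F n in sequentially. p / (2 * B) \<le> \<epsilon> * Re (J n)"
  proof eventually_elim
    case (elim n)
    thus ?case using low[of n] by linarith
  qed
  thus ?thesis using pB(1) unfolding J_def by blast
qed

end

section \<open>Weyl sequences for the free longitudinal operator\<close>

lemma test_fun_deriv:
  assumes "interval_open S" "test_fun S \<phi>"
  shows "test_fun S (deriv \<phi>)"
proof -
  obtain p q where pq: "p < q" "{p..q} \<subseteq> S" "\<And>x. x \<notin> {p<..<q} \<Longrightarrow> deriv \<phi> x = 0"
    using test_fun_supp[OF assms] by metis
  have "deriv \<phi> x = 0" if "x \<notin> {p..q}" for x using that by (intro pq(3)) auto
  thus ?thesis using assms(2) pq(2) smooth_deriv unfolding test_fun_iff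
    by (intro conjI exI[of _ "{p..q}"]) auto
qed

lemma L2_dilate:
  fixes h :: "real \<Rightarrow> complex"
  assumes h: "h \<in> L2 lborel" and R: "R > 0"
  shows "(\<lambda>x. h (x / R)) \<in> L2 lborel" "l2_norm lborel (\<lambda>x. h (x / R)) = sqrt R * l2_norm lborel h"
proof -
  have [measurable]: "h \<in> borel_measurable borel" using L2_measurable[OF h] by simp
  have eq: "(\<lambda>x. (cmod (h (x / R)))\<^sup>2) = (\<lambda>x. (cmod (h (0 + (1 / R) * x)))\<^sup>2)" by simp
  have "integrable lborel (\<lambda>x. (cmod (h (0 + (1 / R) * x)))\<^sup>2)"
    by (rule lborel_integrable_real_affine[OF L2_integrable_sq[OF h]]) (use R in simp)
  thus "(\<lambda>x. h (x / R)) \<in> L2 lborel" unfolding L2_def by simp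
  have "(LINT x|lborel. (cmod (h x))\<^sup>2) = \<bar>1 / R\<bar> *\<^sub>R (LINT x|lborel. (cmod (h (0 + (1 / R) * x)))\<^sup>2)"
    by (rule lborel_integral_real_affine) (use R in simp)
  hence "(LINT x|lborel. (cmod (h (x / R)))\<^sup>2) = R * (LINT x|lborel. (cmod (h x))\<^sup>2)"
    using R by simp
  thus "l2_norm lborel (\<lambda>x. h (x / R)) = sqrt R * l2_norm lborel h"
    by (simp add: l2_norm_def real_sqrt_mult)
qed

text \<open>Plane waves with a slowly varying cut-off.\<close>

lemma free_approx_eigenseq:
  assumes t: "t \<ge> 0"
  shows "\<exists>f. approx_eigenseq lborel (H_R (\<lambda>_. 0)) (of_real t) f"
proof (rule approx_eigenseq_of_not_bdd_below[OF H_R_scale])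
  fix m :: real assume m: "m > 0"
  define b where "b = bump (-1) 1 1"
  have sb: "smooth b" by (simp add: b_def smooth_bump)
  have tb: "test_fun UNIV b"
    unfolding test_fun_iff using sb by (intro conjI exI[of _ "{-1..1}"]) (auto simp: b_def bump_zero)
  have tb': "test_fun UNIV (deriv b)" by (rule test_fun_deriv[OF interval_open_UNIV tb])
  define c0 c1 c2 where "c0 x = complex_of_real (b x)" and "c1 x = complex_of_real (deriv b x)"
    and "c2 x = complex_of_real (deriv (deriv b) x)" for x
  have cL: "c0 \<in> L2 lborel" "c1 \<in> L2 lborel" "c2 \<in> L2 lborel"
    using test_fun_L2[OF interval_open_UNIV tb] test_fun_L2[OF interval_open_UNIV tb']
    by (simp_all add: c0_def[abs_def] c1_def[abs_def] c2_def[abs_def])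
  have D0: "(c0 has_vector_derivative c1 x) (at x)" and D1: "(c1 has_vector_derivative c2 x) (at x)" for x
    unfolding c0_def[abs_def] c1_def[abs_def] c2_def
    by (intro has_vector_derivative_of_real smooth_DERIV smooth_deriv sb)+
  have cc: "continuous_on S c0" "continuous_on S c1" "continuous_on S c2" for S
    unfolding c0_def[abs_def] c1_def[abs_def] c2_def[abs_def]
    by (intro continuous_intros smooth_continuous_on smooth_deriv sb)+
  have pos: "l2_norm lborel c0 > 0"
  proof (rule ccontr)
    assume "\<not> ?thesis"
    hence "l2_norm lborel c0 = 0" using l2_norm_nonneg[of lborel c0] by linarith
    hence ae0: "AE x in lborel. c0 x = 0" using l2_norm_eq_0[OF cL(1)] by simp
    have "AE x in lborel. x \<notin> {-1<..<1::real}" using ae0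
    proof eventually_elim
      case (elim x)
      thus ?case using bump_pos[of 1 x "-1" 1] by (auto simp: c0_def b_def)
    qed
    hence "{-1<..<1::real} \<in> null_sets lborel" using AE_iff_null_sets[of "{-1<..<1::real}" lborel] by simp
    thus False by (simp add: null_sets_def)
  qed
  define k where "k = sqrt t"
  have k2: "k * k = t" using t by (simp add: k_def)
  show "\<not> bdd_below_at lborel (H_R (\<lambda>_. 0)) (of_real t) m"
  proof
    assume bd: "bdd_below_at lborel (H_R (\<lambda>_. 0)) (of_real t) m"
    define C where "C = l2_norm lborel c2 + 2 * \<bar>k\<bar> * l2_norm lborel c1"
    \<comment> \<open>For exp(i k x) b(x / R) only derivatives of the cut-off remain in (H - t) f,
      of size 1 / R and 1 / R^2. The factor sqrt R from the dilation is common to all norms and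
      cancels.\<close>
    have bound: "m * l2_norm lborel c0 \<le> C / real (Suc n)" for n
    proof -
      define R where "R = real (Suc n)"
      have R: "R \<ge> 1" by (simp add: R_def)
      define E where "E x = exp (\<i> * complex_of_real (k * x))" for x
      have DE: "(E has_vector_derivative \<i> * of_real k * E x) (at x)" for x
      proof -
        have "((\<lambda>z. exp (\<i> * (of_real k * z))) has_field_derivative exp (\<i> * (of_real k * of_real x)) * (\<i> * of_real k)) (at (complex_of_real x))"
          by (auto intro!: derivative_eq_intros)
        from has_vector_derivative_real_field[OF this] show ?thesis by (simp add: E_def[abs_def] o_def mult_ac)
      qed
      have nE: "cmod (E x) = 1" for x by (simp add: E_def)
      have Ec: "continuous_on S E" for S unfolding E_def[abs_def] by (intro continuous_intros)
      define r where "r = complex_of_real (1 / R)"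
      define d0 d1 d2 where "d0 x = c0 (x / R)" and "d1 x = c1 (x / R)" and "d2 x = c2 (x / R)" for x
      have dL: "d0 \<in> L2 lborel" "d1 \<in> L2 lborel" "d2 \<in> L2 lborel"
        using R cL by (auto simp: d0_def[abs_def] d1_def[abs_def] d2_def[abs_def] intro!: L2_dilate)
      have dn: "l2_norm lborel d0 = sqrt R * l2_norm lborel c0" "l2_norm lborel d1 = sqrt R * l2_norm lborel c1" "l2_norm lborel d2 = sqrt R * l2_norm lborel c2"
        using R cL by (auto simp: d0_def[abs_def] d1_def[abs_def] d2_def[abs_def] intro!: L2_dilate)
      have sc: "((\<lambda>x. f (x / R)) has_vector_derivative r * f' (x / R)) (at x)" if "\<And>x. (f has_vector_derivative f' x) (at x)" for f f' x
      proof -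
        have "((\<lambda>x. x / R) has_vector_derivative 1 / R) (at x)"
          using R by (auto simp: has_real_derivative_iff_has_vector_derivative[symmetric] intro!: derivative_eq_intros)
        from vector_diff_chain_at[OF this that[of "x / R"]] show ?thesis
          by (simp add: o_def r_def scaleR_conv_of_real)
      qed
      have Dd0: "(d0 has_vector_derivative r * d1 x) (at x)" and Dd1: "(d1 has_vector_derivative r * d2 x) (at x)" for x
        unfolding d0_def[abs_def] d1_def[abs_def] d2_def by (intro sc D0 D1)+
      have dc: "continuous_on S d0" "continuous_on S d1" "continuous_on S d2" for S
        unfolding d0_def[abs_def] d1_def[abs_def] d2_def[abs_def] using R
        by (intro continuous_on_compose2[OF cc(1)[of UNIV]] continuous_on_compose2[OF cc(2)[of UNIV]] continuous_on_compose2[OF cc(3)[of UNIV]] continuous_intros; simp)+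
      define f f1 f2 where "f x = d0 x * E x" and "f1 x = (r * d1 x + \<i> * of_real k * d0 x) * E x"
        and "f2 x = (r * r * d2 x + 2 * \<i> * of_real k * r * d1 x - of_real t * d0 x) * E x" for x
      have DF: "(f has_vector_derivative f1 x) (at x)" for x
        using has_vector_derivative_mult[OF Dd0 DE, of x] by (simp add: f_def[abs_def] f1_def algebra_simps)
      have Dq: "((\<lambda>x. r * d1 x + \<i> * of_real k * d0 x) has_vector_derivative r * (r * d2 x) + \<i> * of_real k * (r * d1 x)) (at x)" for x
        by (intro has_vector_derivative_add has_vector_derivative_mult_right Dd0 Dd1)
      have DF1: "(f1 has_vector_derivative f2 x) (at x)" for x
      proof -
        have "(f1 has_vector_derivative (r * d1 x + \<i> * of_real k * d0 x) * (\<i> * of_real k * E x) + (r * (r * d2 x) + \<i> * of_real k * (r * d1 x)) * E x) (at x)"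
          unfolding f1_def[abs_def] by (rule has_vector_derivative_mult[OF Dq DE])
        moreover have "(r * d1 x + \<i> * of_real k * d0 x) * (\<i> * of_real k * E x) + (r * (r * d2 x) + \<i> * of_real k * (r * d1 x)) * E x = f2 x"
        proof -
          have "of_real k * of_real k = complex_of_real t" using k2 by (simp flip: of_real_mult)
          thus ?thesis by (simp add: f2_def algebra_simps)
        qed
        ultimately show ?thesis by simp
      qed
      have fc: "continuous_on UNIV f1" "continuous_on UNIV f2"
        unfolding f1_def[abs_def] f2_def[abs_def] by (intro continuous_intros dc Ec)+
      have LE: "(\<lambda>x. h x * E x) \<in> L2 lborel" "l2_norm lborel (\<lambda>x. h x * E x) = l2_norm lborel h" if "h \<in> L2 lborel" for h
      proof -
        have Em: "E \<in> borel_measurable borel" by (rule borel_measurable_continuous_onI[OF Ec])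
        show "(\<lambda>x. h x * E x) \<in> L2 lborel"
          by (rule L2_bound[OF that, where C = 1]) (use L2_measurable[OF that] Em in \<open>auto simp: norm_mult nE\<close>)
        show "l2_norm lborel (\<lambda>x. h x * E x) = l2_norm lborel h" by (simp add: l2_norm_def norm_mult nE)
      qed
      have fL: "f \<in> L2 lborel" "f1 \<in> L2 lborel" "f2 \<in> L2 lborel"
        unfolding f_def[abs_def] f1_def[abs_def] f2_def[abs_def] by (intro LE L2_add L2_diff L2_scale dL)+
      have w: "weak_deriv UNIV f f1" "weak_deriv UNIV f1 f2"
        using is_prim_of_deriv[OF interval_open_UNIV DF fc(1)] is_prim_of_deriv[OF interval_open_UNIV DF1 fc(2)]
          weak_deriv_of_prim[OF interval_open_UNIV] by blast+
      have "H2_derivs UNIV f f1 f2" unfolding H2_derivs_def meas_on_UNIV using fL w by blast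
      hence "(f, \<lambda>x. - f2 x) \<in> H_R (\<lambda>_. 0)"
        unfolding H_R_def meas_on_UNIV using L2_uminus[OF fL(3)] by (auto intro!: exI)
      hence "m * l2_norm lborel f \<le> l2_norm lborel (\<lambda>x. - f2 x - of_real t * f x)" using bd unfolding bdd_below_at_def by blast
      also have "(\<lambda>x. - f2 x - of_real t * f x) = (\<lambda>x. (- (r * r) * d2 x - 2 * \<i> * of_real k * r * d1 x) * E x)"
        by (auto simp: f_def f2_def algebra_simps)
      also have "l2_norm lborel (\<lambda>x. (- (r * r) * d2 x - 2 * \<i> * of_real k * r * d1 x) * E x) = l2_norm lborel (\<lambda>x. - (r * r) * d2 x - 2 * \<i> * of_real k * r * d1 x)"
        by (intro LE(2) L2_diff L2_scale dL)
      also have "\<dots> \<le> l2_norm lborel (\<lambda>x. - (r * r) * d2 x) + l2_norm lborel (\<lambda>x. 2 * \<i> * of_real k * r * d1 x)"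
        by (intro l2_norm_triangle_diff L2_scale dL)
      also have "\<dots> = sqrt R * ((1 / R) * (1 / R) * l2_norm lborel c2 + 2 * \<bar>k\<bar> * (1 / R) * l2_norm lborel c1)"
        unfolding l2_norm_scale dn using R by (simp add: r_def norm_mult norm_divide algebra_simps)
      also have "\<dots> \<le> sqrt R * (1 * (1 / R) * l2_norm lborel c2 + 2 * \<bar>k\<bar> * (1 / R) * l2_norm lborel c1)"
        using R by (intro mult_left_mono add_mono mult_right_mono) auto
      also have "\<dots> = sqrt R * (C / R)" by (simp add: C_def add_divide_distrib algebra_simps)
      finally have "m * (sqrt R * l2_norm lborel c0) \<le> sqrt R * (C / R)"
        unfolding f_def[abs_def] LE(2)[OF dL(1)] dn .
      hence "sqrt R * (m * l2_norm lborel c0) \<le> sqrt R * (C / R)" by (simp add: mult_ac)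
      moreover have "sqrt R > 0" using R by simp
      ultimately show ?thesis unfolding R_def[symmetric] by (rule mult_left_le_imp_le)
    qed
    have "(\<lambda>n. C * (1 / real (Suc n))) \<longlonglongrightarrow> C * 0" by (intro tendsto_intros LIMSEQ_Suc[OF lim_1_over_n])
    hence "(\<lambda>n. C / real (Suc n)) \<longlonglongrightarrow> 0" by simp
    hence "m * l2_norm lborel c0 \<le> 0" by (rule LIMSEQ_le_const) (use bound in auto)
    thus False using m pos by (simp add: mult_le_0_iff)
  qed
qed

lemma liminf_pos_of_eventually:
  assumes "\<delta> > 0" "\<forall>\<^sub>F n in sequentially. \<delta> \<le> r n"
  shows "liminf (\<lambda>n. ereal (r n)) > 0"
proof -
  have "ereal \<delta> \<le> liminf (\<lambda>n. ereal (r n))"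
    by (rule Liminf_bounded) (use assms(2) in \<open>auto elim!: eventually_mono\<close>)
  thus ?thesis using assms(1) by (metis ereal_less(2) less_le_trans)
qed

lemma limsup_neg_of_eventually:
  assumes "\<delta> > 0" "\<forall>\<^sub>F n in sequentially. \<delta> \<le> - r n"
  shows "limsup (\<lambda>n. ereal (r n)) < 0"
proof -
  have "limsup (\<lambda>n. ereal (r n)) \<le> ereal (- \<delta>)"
    by (rule Limsup_bounded) (use assms(2) in \<open>auto elim!: eventually_mono\<close>)
  also have "\<dots> < 0" using assms(1) by simp
  finally show ?thesis .
qed

section \<open>The spectra of definite type\<close>

context strip
begin

text \<open>For k >= 1 the real part of \<open>psi k\<close> is a cosine, and \<open>psi 0\<close>
  has modulus 1; so |psi_k| dominates a function of known positive norm.\<close>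

lemma psi_norm_pos: "l2_norm MI (psi k) > 0"
proof -
  define e where "e = (if k = 0 then (\<lambda>y. 1) else ecos k)"
  have eL: "e \<in> L2 MI" by (auto simp: e_def ecos_L2 intro: L2_MI_continuous)
  have "l2_inner MI e e = of_real (if k = 0 then 2 * a else a)"
    using ecos_orth[of k k] int_one by (auto simp: e_def l2_inner_def)
  hence "(l2_norm MI e)\<^sup>2 = (if k = 0 then 2 * a else a)" unfolding l2_norm_sq_inner of_real_eq_iff .
  hence "(l2_norm MI e)\<^sup>2 > 0" using a by simp
  hence p: "l2_norm MI e > 0" using l2_norm_nonneg[of MI e] by (metis less_eq_real_def power_zero_numeral less_irrefl)
  have "cmod (e y) \<le> 1 * cmod (psi k y)" for y
  proof (cases "k = 0")
    case True
    thus ?thesis by (simp add: e_def psi_def)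
  next
    case False
    have "cmod (e y) = \<bar>Re (psi k y)\<bar>" using False by (simp add: e_def ecos_def psi_def)
    thus ?thesis using abs_Re_le_cmod[of "psi k y"] by simp
  qed
  hence "l2_norm MI e \<le> 1 * l2_norm MI (psi k)"
    by (intro l2_norm_mono[OF psi_L2 L2_measurable[OF eL]]) auto
  thus ?thesis using p by simp
qed

definition npsi :: "nat \<Rightarrow> real \<Rightarrow> complex" where
  "npsi k y = of_real (1 / l2_norm MI (psi k)) * psi k y"

lemma npsi_eigenseq: "approx_eigenseq MI (H_I a \<alpha>) (of_real (lam k)) (\<lambda>n. npsi k)"
proof -
  define c where "c = complex_of_real (1 / l2_norm MI (psi k))"
  have np: "npsi k = (\<lambda>y. c * psi k y)" by (auto simp: npsi_def c_def)
  have "((\<lambda>y. c * psi k y), \<lambda>y. - (c * - (of_real (lam k) * psi k y))) \<in> H_I a \<alpha>"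
  proof (rule H_I_classical)
    show "((\<lambda>y. c * psi k y) has_vector_derivative c * psi' k y) (at y)" for y
      by (intro has_vector_derivative_mult_right psi_deriv)
    show "((\<lambda>y. c * psi' k y) has_vector_derivative c * - (of_real (lam k) * psi k y)) (at y)" for y
      by (intro has_vector_derivative_mult_right psi'_deriv)
    show "Robin (\<lambda>y. c * psi k y) (\<lambda>y. c * psi' k y)" using Robin_psi[of k] by (simp add: Robin_def)
  qed (intro continuous_intros psi_continuous)
  hence "(npsi k, \<lambda>y. of_real (lam k) * npsi k y) \<in> H_I a \<alpha>" unfolding np by (simp add: mult.left_commute)
  moreover have "l2_norm MI (npsi k) = 1" unfolding np l2_norm_scale using psi_norm_pos[of k] by (simp add: c_def norm_divide)
  ultimately show ?thesis unfolding approx_eigenseq_def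
    by (intro conjI allI exI[of _ "\<lambda>n y. of_real (lam k) * npsi k y"]) auto
qed

lemma npsi_type: "Re (l2_inner MI (par_I (npsi k)) (npsi k)) = Nv k / (l2_norm MI (psi k))\<^sup>2"
proof -
  define c where "c = 1 / l2_norm MI (psi k)"
  have "l2_inner MI (par_I (npsi k)) (npsi k) = (LINT y|MI. of_real (c * c) * (par_I (psi k) y * cnj (psi k y)))"
    unfolding l2_inner_def by (simp add: par_I_def npsi_def c_def mult_ac)
  also have "\<dots> = of_real (c * c) * of_real (Nv k)"
    unfolding integral_mult_right_zero using psi_type[of k] by (simp only: l2_inner_def)
  finally show ?thesis by (simp add: c_def power2_eq_square)
qed

lemma npsi_spec_app: "of_real (lam k) \<in> spec_app MI (H_I a \<alpha>)"
  unfolding spec_app_def using npsi_eigenseq by blast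

text \<open>A normalised eigenfunction, repeated, is an approximate eigensequence, so positive type
  applies to it and reveals the sign of its form.\<close>

lemma Nv_pos_of_spec_pp:
  assumes "of_real (lam k) \<in> spec_pp MI par_I (H_I a \<alpha>)"
  shows "Nv k > 0"
proof -
  have "liminf (\<lambda>n. ereal (Re (l2_inner MI (par_I (npsi k)) (npsi k)))) > 0"
    using assms npsi_eigenseq[of k] unfolding spec_pp_def by blast
  hence "Nv k / (l2_norm MI (psi k))\<^sup>2 > 0" by (simp add: npsi_type Liminf_const)
  thus ?thesis using psi_norm_pos[of k] by (simp add: zero_less_divide_iff)
qed

lemma Nv_neg_of_spec_mm:
  assumes "of_real (lam k) \<in> spec_mm MI par_I (H_I a \<alpha>)"
  shows "Nv k < 0"
proof -
  have "limsup (\<lambda>n. ereal (Re (l2_inner MI (par_I (npsi k)) (npsi k)))) < 0"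
    using assms npsi_eigenseq[of k] unfolding spec_mm_def by blast
  hence "Nv k / (l2_norm MI (psi k))\<^sup>2 < 0" by (simp add: npsi_type Limsup_const)
  thus ?thesis using psi_norm_pos[of k] by (simp add: divide_less_0_iff)
qed

lemma liminf_definite:
  assumes V: "V \<in> borel_measurable borel" "\<And>x. \<bar>V x\<bar> \<le> Bv"
    and cond: "\<And>k. (\<exists>m>0. bdd_below_at lborel (H_R V) (\<zeta> - of_real (lam k)) m) \<or> Nv k > 0"
    and f: "approx_eigenseq MO (H_Om a \<alpha> V) \<zeta> f"
  shows "liminf (\<lambda>n. ereal (Re (l2_inner MO (par_Om (f n)) (f n)))) > 0"
  using approx_eigenseq_definite[OF V _ _ f, of 1] cond liminf_pos_of_eventually by auto

lemma limsup_definite: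
  assumes V: "V \<in> borel_measurable borel" "\<And>x. \<bar>V x\<bar> \<le> Bv"
    and cond: "\<And>k. (\<exists>m>0. bdd_below_at lborel (H_R V) (\<zeta> - of_real (lam k)) m) \<or> Nv k < 0"
    and f: "approx_eigenseq MO (H_Om a \<alpha> V) \<zeta> f"
  shows "limsup (\<lambda>n. ereal (Re (l2_inner MO (par_Om (f n)) (f n)))) < 0"
  using approx_eigenseq_definite[OF V _ _ f, of "-1"] cond limsup_neg_of_eventually by auto

lemma liminf_le_limsup_seq: "liminf (\<lambda>n. ereal (r n)) \<le> limsup (\<lambda>n. ereal (r n))"
  by (rule Liminf_le_Limsup) simp

text \<open>A product inherits the form of its transversal factor, so a point of
  \<open>M_minus\<close> or \<open>M_zero\<close> cannot have positive type. Conversely, if zeta is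
  outside both, every surviving \<open>lam k\<close> has positive type, and the definiteness
  estimate applies to every sequence. The same holds with the signs exchanged.\<close>

lemma spectra_Om:
  assumes V: "V \<in> borel_measurable borel" "\<And>x. \<bar>V x\<bar> \<le> Bv" and HV: "H_R V0 = H_R V"
  shows "spec_pp MO par_Om (H_Om a \<alpha> V0) = M_plus a \<alpha> V0 - (M_minus a \<alpha> V0 \<union> M_zero a \<alpha> V0)"
    and "spec_mm MO par_Om (H_Om a \<alpha> V0) = M_minus a \<alpha> V0 - (M_plus a \<alpha> V0 \<union> M_zero a \<alpha> V0)"
    and "spec_00 MO par_Om (H_Om a \<alpha> V0) = M_zero a \<alpha> V0 \<union> (M_plus a \<alpha> V0 \<inter> M_minus a \<alpha> V0)"
proof -
  define \<sigma> where "\<sigma> = spectrum lborel (H_R V0)"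
  let ?q = "\<lambda>f n. ereal (Re (l2_inner MO (par_Om (f n)) (f n)))"
  let ?q1 = "\<lambda>g n. ereal (Re (l2_inner MI (par_I (g n)) (g n)))"
  let ?ae = "approx_eigenseq MO (H_Om a \<alpha> V0)"
  let ?Mp = "M_plus a \<alpha> V0" and ?Mm = "M_minus a \<alpha> V0" and ?M0 = "M_zero a \<alpha> V0"
  have HO: "H_Om a \<alpha> V0 = H_Om a \<alpha> V" unfolding H_Om_def HV ..
  have \<sigma>: "t \<in> \<sigma> \<longleftrightarrow> (\<forall>m>0. \<not> bdd_below_at lborel (H_R V) t m)" for t
    unfolding \<sigma>_def HV by (rule spectrum_H_R[OF V])
  have M: "?Mp = {s + t |s t. s \<in> spec_pp MI par_I (H_I a \<alpha>) \<and> t \<in> \<sigma>}"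
    "?Mm = {s + t |s t. s \<in> spec_mm MI par_I (H_I a \<alpha>) \<and> t \<in> \<sigma>}"
    "?M0 = {s + t |s t. s \<in> spec_00 MI par_I (H_I a \<alpha>) \<and> t \<in> \<sigma>}"
    by (simp_all add: M_plus_def M_minus_def M_zero_def \<sigma>_def)
  have tensor: "\<exists>u. ?ae (s + t) u \<and> ?q u = ?q1 g" if g: "approx_eigenseq MI (H_I a \<alpha>) s g" and t: "t \<in> \<sigma>" for s t g
  proof -
    obtain f where f: "approx_eigenseq lborel (H_R V0) t f"
      using approx_eigenseq_of_not_bdd_below[of "H_R V0" lborel t] H_R_scale t \<sigma> HV by auto
    from approx_eigenseq_tensor[OF f g] show ?thesis
      by (intro exI[of _ "\<lambda>n z. f n (fst z) * g n (snd z)"]) simp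
  qed
  have appI: "\<exists>g. approx_eigenseq MI (H_I a \<alpha>) s g" if "s \<in> spec_app MI (H_I a \<alpha>)" for s using that by (simp add: spec_app_def)
  have NA: "\<exists>u. ?ae \<zeta> u \<and> \<not> liminf (?q u) > 0" if \<zeta>M: "\<zeta> \<in> ?Mm \<union> ?M0" for \<zeta>
  proof -
    obtain s t where st: "\<zeta> = s + t" "s \<in> spec_mm MI par_I (H_I a \<alpha>) \<or> s \<in> spec_00 MI par_I (H_I a \<alpha>)" "t \<in> \<sigma>"
      using \<zeta>M unfolding M by blast
    have "\<exists>g. approx_eigenseq MI (H_I a \<alpha>) s g \<and> \<not> liminf (?q1 g) > 0"
      using st(2)
    proof
      assume s: "s \<in> spec_mm MI par_I (H_I a \<alpha>)"
      then obtain g where g: "approx_eigenseq MI (H_I a \<alpha>) s g" using appI by (auto simp: spec_mm_def)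
      hence "limsup (?q1 g) < 0" using s by (auto simp: spec_mm_def)
      hence "\<not> liminf (?q1 g) > 0" using liminf_le_limsup_seq[of "\<lambda>n. Re (l2_inner MI (par_I (g n)) (g n))"]
        by (meson leD less_imp_le order.trans)
      thus ?thesis using g by blast
    next
      assume "s \<in> spec_00 MI par_I (H_I a \<alpha>)"
      thus ?thesis by (auto simp: spec_00_def spec_pp_def)
    qed
    then obtain g where g: "approx_eigenseq MI (H_I a \<alpha>) s g" "\<not> liminf (?q1 g) > 0" by blast
    from tensor[OF g(1) st(3)] obtain u where "?ae (s + t) u" "?q u = ?q1 g" by blast
    thus ?thesis using g(2) st(1) by (intro exI[of _ u]) simp
  qed
  have NB: "\<exists>u. ?ae \<zeta> u \<and> \<not> limsup (?q u) < 0" if \<zeta>M: "\<zeta> \<in> ?Mp \<union> ?M0" for \<zeta>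
  proof -
    obtain s t where st: "\<zeta> = s + t" "s \<in> spec_pp MI par_I (H_I a \<alpha>) \<or> s \<in> spec_00 MI par_I (H_I a \<alpha>)" "t \<in> \<sigma>"
      using \<zeta>M unfolding M by blast
    have "\<exists>g. approx_eigenseq MI (H_I a \<alpha>) s g \<and> \<not> limsup (?q1 g) < 0"
      using st(2)
    proof
      assume s: "s \<in> spec_pp MI par_I (H_I a \<alpha>)"
      then obtain g where g: "approx_eigenseq MI (H_I a \<alpha>) s g" using appI by (auto simp: spec_pp_def)
      hence "liminf (?q1 g) > 0" using s by (auto simp: spec_pp_def)
      hence "\<not> limsup (?q1 g) < 0" using liminf_le_limsup_seq[of "\<lambda>n. Re (l2_inner MI (par_I (g n)) (g n))"]
        by (meson leD less_imp_le order.trans)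
      thus ?thesis using g by blast
    next
      assume "s \<in> spec_00 MI par_I (H_I a \<alpha>)"
      thus ?thesis by (auto simp: spec_00_def spec_mm_def)
    qed
    then obtain g where g: "approx_eigenseq MI (H_I a \<alpha>) s g" "\<not> limsup (?q1 g) < 0" by blast
    from tensor[OF g(1) st(3)] obtain u where "?ae (s + t) u" "?q u = ?q1 g" by blast
    thus ?thesis using g(2) st(1) by (intro exI[of _ u]) simp
  qed
  \<comment> \<open>Every \<open>lam k\<close> is in the approximate spectrum and so has one of the
    three types; if zeta - \<open>lam k\<close> is in the longitudinal spectrum, that type puts zeta
    into the matching set.\<close>
  have cases: "of_real (lam k) \<in> spec_pp MI par_I (H_I a \<alpha>) \<or> of_real (lam k) \<in> spec_mm MI par_I (H_I a \<alpha>) \<or> of_real (lam k) \<in> spec_00 MI par_I (H_I a \<alpha>)" for k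
    using npsi_spec_app[of k] by (auto simp: spec_00_def)
  have dec: "\<zeta> = of_real (lam k) + (\<zeta> - of_real (lam k))" for \<zeta> :: complex and k by simp
  have Bp: "liminf (?q f) > 0" if \<zeta>: "\<zeta> \<notin> ?Mm \<union> ?M0" and f: "?ae \<zeta> f" for \<zeta> f
  proof (rule liminf_definite[OF V])
    show "approx_eigenseq MO (H_Om a \<alpha> V) \<zeta> f" using f unfolding HO .
    fix k
    show "(\<exists>m>0. bdd_below_at lborel (H_R V) (\<zeta> - of_real (lam k)) m) \<or> Nv k > 0"
    proof (cases "\<zeta> - of_real (lam k) \<in> \<sigma>")
      case True
      have "of_real (lam k) \<in> spec_pp MI par_I (H_I a \<alpha>)"
        using cases[of k] \<zeta> dec[of \<zeta> k] True unfolding M by blast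
      thus ?thesis using Nv_pos_of_spec_pp by blast
    qed (use \<sigma> in blast)
  qed
  have Bm: "limsup (?q f) < 0" if \<zeta>: "\<zeta> \<notin> ?Mp \<union> ?M0" and f: "?ae \<zeta> f" for \<zeta> f
  proof (rule limsup_definite[OF V])
    show "approx_eigenseq MO (H_Om a \<alpha> V) \<zeta> f" using f unfolding HO .
    fix k
    show "(\<exists>m>0. bdd_below_at lborel (H_R V) (\<zeta> - of_real (lam k)) m) \<or> Nv k < 0"
    proof (cases "\<zeta> - of_real (lam k) \<in> \<sigma>")
      case True
      have "of_real (lam k) \<in> spec_mm MI par_I (H_I a \<alpha>)"
        using cases[of k] \<zeta> dec[of \<zeta> k] True unfolding M by blast
      thus ?thesis using Nv_neg_of_spec_mm by blast
    qed (use \<sigma> in blast)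
  qed
  \<comment> \<open>Outside all three sets a sequence would have a form with positive lower and
    negative upper limit, so there is no sequence.\<close>
  have none: False if "\<zeta> \<notin> ?Mp \<union> ?Mm \<union> ?M0" "?ae \<zeta> f" for \<zeta> f
  proof -
    have "liminf (?q f) > 0" "limsup (?q f) < 0" using Bp[of \<zeta> f] Bm[of \<zeta> f] that by auto
    thus False using liminf_le_limsup_seq[of "\<lambda>n. Re (l2_inner MO (par_Om (f n)) (f n))"] by (meson leD less_trans le_less_trans)
  qed
  have app: "spec_app MO (H_Om a \<alpha> V0) = ?Mp \<union> ?Mm \<union> ?M0"
  proof
    show "spec_app MO (H_Om a \<alpha> V0) \<subseteq> ?Mp \<union> ?Mm \<union> ?M0" using none unfolding spec_app_def by blast
    show "?Mp \<union> ?Mm \<union> ?M0 \<subseteq> spec_app MO (H_Om a \<alpha> V0)" using NA NB unfolding spec_app_def by blast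
  qed
  show pp: "spec_pp MO par_Om (H_Om a \<alpha> V0) = ?Mp - (?Mm \<union> ?M0)"
  proof
    show "spec_pp MO par_Om (H_Om a \<alpha> V0) \<subseteq> ?Mp - (?Mm \<union> ?M0)"
      using NA unfolding spec_pp_def app by blast
    show "?Mp - (?Mm \<union> ?M0) \<subseteq> spec_pp MO par_Om (H_Om a \<alpha> V0)"
      using Bp unfolding spec_pp_def app by blast
  qed
  show mm: "spec_mm MO par_Om (H_Om a \<alpha> V0) = ?Mm - (?Mp \<union> ?M0)"
  proof
    show "spec_mm MO par_Om (H_Om a \<alpha> V0) \<subseteq> ?Mm - (?Mp \<union> ?M0)"
      using NB unfolding spec_mm_def app by blast
    show "?Mm - (?Mp \<union> ?M0) \<subseteq> spec_mm MO par_Om (H_Om a \<alpha> V0)"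
      using Bm unfolding spec_mm_def app by blast
  qed
  show "spec_00 MO par_Om (H_Om a \<alpha> V0) = ?M0 \<union> (?Mp \<inter> ?Mm)"
    unfolding spec_00_def app pp mm by blast
qed

section \<open>The free strip\<close>

lemma lam_mono: "j \<noteq> 0 \<Longrightarrow> k \<noteq> 0 \<Longrightarrow> lam j \<le> lam k \<longleftrightarrow> j \<le> k"
proof -
  assume jk: "j \<noteq> 0" "k \<noteq> 0"
  have "lam j \<le> lam k \<longleftrightarrow> (kap j)\<^sup>2 \<le> (kap k)\<^sup>2" using jk by (simp add: lam_def)
  also have "\<dots> \<longleftrightarrow> kap j \<le> kap k" using kap_pos[OF jk(1)] kap_pos[OF jk(2)] by (simp add: power_mono_iff)
  also have "\<dots> \<longleftrightarrow> j \<le> k" using a by (simp add: kap_def divide_le_cancel)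
  finally show ?thesis .
qed

text \<open>The types of the eigenvalues alternate along the ordered sequence, starting with \<open>+\<close>.\<close>

lemma lowest_types:
  assumes ij: "i \<noteq> j" "lam i \<le> lam j" and rest: "\<And>k. k \<noteq> i \<Longrightarrow> lam j \<le> lam k"
  shows "Nv i \<ge> 0" "Nv j \<le> 0" "lam i < lam j \<Longrightarrow> Nv i > 0"
proof -
  have low: "lam i \<le> lam k" for k using ij rest[of k] by (cases "k = i") auto
  \<comment> \<open>For alpha nonzero the sign of \<open>Nv 0\<close> is that of sin w, and
    \<open>lam 0\<close> lies among the other eigenvalues as w lies among the multiples of
    pi.\<close>
  define w where "w = 2 * \<bar>\<alpha>\<bar> * a"
  have N0: "Nv 0 = (if \<alpha> = 0 then 2 * a else sin w / \<bar>\<alpha>\<bar>)"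
    by (cases "\<alpha> \<ge> 0") (auto simp: Nv_def w_def)
  have w0: "w \<ge> 0" using a by (simp add: w_def)
  have l0: "lam 0 \<le> lam k \<longleftrightarrow> w \<le> pi * real k" "lam k \<le> lam 0 \<longleftrightarrow> pi * real k \<le> w" if "k \<noteq> 0" for k
  proof -
    have kp: "kap k > 0" by (rule kap_pos[OF that])
    have "lam 0 \<le> lam k \<longleftrightarrow> \<bar>\<alpha>\<bar> \<le> kap k" "lam k \<le> lam 0 \<longleftrightarrow> kap k \<le> \<bar>\<alpha>\<bar>"
      using that kp abs_le_square_iff[of \<alpha> "kap k"] abs_le_square_iff[of "kap k" \<alpha>] by (simp_all add: lam_def)
    thus "lam 0 \<le> lam k \<longleftrightarrow> w \<le> pi * real k" "lam k \<le> lam 0 \<longleftrightarrow> pi * real k \<le> w"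
      using a by (simp_all add: kap_def w_def field_simps)
  qed
  have N1: "Nv 1 = - (a * (1 - lam 0 / lam 1))" "Nv 2 = a * (1 - lam 0 / lam 2)" by (simp_all add: Nv_def lam_def)
  have lp: "lam 1 > 0" "lam 2 > 0" using kap_pos[of 1] kap_pos[of 2] by (simp_all add: lam_def)
  show "Nv i \<ge> 0" "Nv j \<le> 0" "lam i < lam j \<Longrightarrow> Nv i > 0"
  \<comment> \<open>Either lambda_0 and lambda_1 are lowest, in this order, and w <= pi; or lambda_1
    comes first, w >= pi, and lambda_0 or lambda_2 comes second.\<close>
  proof (atomize (full), cases "i = 0")
    case True
    have j0: "j \<noteq> 0" using ij True by simp
    have "lam j \<le> lam 1" using rest[of 1] True by simp
    hence j: "j = 1" using lam_mono[of j 1] j0 by simp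
    have le: "lam 0 \<le> lam 1" using low[of 1] True by simp
    have wpi: "w \<le> pi" using l0(1)[of 1] le by simp
    have "Nv 0 \<ge> 0" using N0 a sin_ge_zero[OF w0 wpi] by simp
    moreover have "Nv 1 \<le> 0" using N1 lp le a by simp
    moreover have "Nv 0 > 0" if "lam 0 < lam 1"
    proof (cases "\<alpha> = 0")
      case False
      have "w < pi" using l0(2)[of 1] that by auto
      moreover have "w > 0" using False a by (simp add: w_def)
      ultimately have "sin w > 0" by (rule sin_gt_zero[rotated])
      thus ?thesis using N0 False by simp
    qed (use N0 a in simp)
    ultimately show "0 \<le> Nv i \<and> Nv j \<le> 0 \<and> (lam i < lam j \<longrightarrow> 0 < Nv i)" using True j by simp
  next
    case False
    have "lam i \<le> lam 1" by (rule low)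
    hence i: "i = 1" using lam_mono[of i 1] False by simp
    have le: "lam 1 \<le> lam 0" using low[of 0] i by simp
    have Ni: "Nv 1 \<ge> 0" using N1 lp le a by (simp add: mult_nonneg_nonpos)
    have pos: "Nv 1 > 0" if "lam 1 < lam 0" using N1 lp that a by (simp add: mult_pos_neg)
    have al: "\<alpha> \<noteq> 0" using le lp by (auto simp: lam_def)
    \<comment> \<open>The second half prepares strict positivity: if the lowest two differ,
      \<open>lam 1\<close> is strictly below \<open>lam 0\<close>, which makes \<open>Nv 1\<close>
      positive.\<close>
    have Nj: "Nv j \<le> 0 \<and> (lam 1 < lam j \<longrightarrow> lam 1 < lam 0)"
    proof (cases "j = 0")
      case True
      have "lam 0 \<le> lam 2" using rest[of 2] True i by simp
      \<comment> \<open>With lambda_0 between lambda_1 and lambda_2, w lies between pi and 2 pi,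
        where the sine is nonpositive.\<close>
      hence w2: "w \<le> 2 * pi" using l0(1)[of 2] by simp
      have w1: "pi \<le> w" using l0(2)[of 1] le by simp
      have "sin w \<le> 0" using sin_le_zero[of w] w1 w2 by (cases "w = 2 * pi") auto
      thus ?thesis using N0 al True by (simp add: divide_nonpos_pos)
    next
      case j0: False
      have "lam j \<le> lam 2" using rest[of 2] i by simp
      hence "j \<le> 2" using lam_mono[of j 2] j0 by simp
      hence j: "j = 2" using j0 ij i by auto
      have "lam 2 \<le> lam 0" using rest[of 0] i j by simp
      thus ?thesis using N1 lp a j by (auto simp: mult_nonneg_nonpos)
    qed
    show "0 \<le> Nv i \<and> Nv j \<le> 0 \<and> (lam i < lam j \<longrightarrow> 0 < Nv i)" using Ni Nj pos i by auto
  qed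
qed

text \<open>Argued directly with sequences for the free operator. Away from [mu0, infinity) every
  component is bounded below; on [mu0, mu1) only the lowest one can survive, and it is positive;
  from mu1 on, products with the second eigenfunction have nonpositive form and those with the first
  a nonnegative one.\<close>

lemma spectra_Om_free:
  shows "spec_pp MO par_Om (H_Om a \<alpha> (\<lambda>_. 0)) = complex_of_real ` {ev_sorted a \<alpha> 0 ..< ev_sorted a \<alpha> 1}"
    and "spec_mm MO par_Om (H_Om a \<alpha> (\<lambda>_. 0)) = {}"
    and "spec_00 MO par_Om (H_Om a \<alpha> (\<lambda>_. 0)) = complex_of_real ` {ev_sorted a \<alpha> 1 ..}"
proof -
  let ?q = "\<lambda>f n. ereal (Re (l2_inner MO (par_Om (f n)) (f n)))"
  let ?ae = "approx_eigenseq MO (H_Om a \<alpha> (\<lambda>_. 0))"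
  define \<mu>0 \<mu>1 where "\<mu>0 = ev_sorted a \<alpha> 0" and "\<mu>1 = ev_sorted a \<alpha> 1"
  obtain \<pi> where mon: "mono (ev_sorted a \<alpha>)" and bij: "bij \<pi>" and evs: "ev_sorted a \<alpha> = ev a \<alpha> \<circ> \<pi>"
    using sorted_rearrangement_ev_sorted[OF a, of \<alpha>] unfolding sorted_rearrangement_def by blast
  \<comment> \<open>Indices of the two lowest eigenvalues in the original numbering; if these
    coincide, the indices are still distinct.\<close>
  define i j where "i = \<pi> 0" and "j = \<pi> 1"
  have ij: "i \<noteq> j" using bij by (simp add: i_def j_def bij_is_inj inj_eq)
  have mu: "\<mu>0 = lam i" "\<mu>1 = lam j" by (simp_all add: \<mu>0_def \<mu>1_def evs i_def j_def lam_eq_ev)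
  have le01: "lam i \<le> lam j" using monoD[OF mon, of 0 1] unfolding mu[symmetric] \<mu>0_def \<mu>1_def by simp
  have rest: "lam j \<le> lam k" if "k \<noteq> i" for k
  proof -
    obtain n where n: "k = \<pi> n" using bij by (meson bij_pointE)
    have "1 \<le> n" using that unfolding i_def n by (cases n) auto
    hence "ev_sorted a \<alpha> 1 \<le> ev_sorted a \<alpha> n" by (rule monoD[OF mon])
    thus ?thesis by (simp add: evs j_def n lam_eq_ev)
  qed
  note types = lowest_types[OF ij le01 rest]
  have low: "\<mu>0 \<le> lam k" for k using rest[of k] le01 by (cases "k = i") (auto simp: mu)
  have V: "(\<lambda>_. 0) \<in> borel_measurable borel" "\<And>x. \<bar>0::real\<bar> \<le> 0" by auto
  have bIm: "\<exists>m>0. bdd_below_at lborel (H_R (\<lambda>_. 0)) t m" if "Im t \<noteq> 0" for t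
    using bdd_below_H_R_Im[OF V, of t] that by (intro exI[of _ "\<bar>Im t\<bar>"]) simp
  have bRe: "\<exists>m>0. bdd_below_at lborel (H_R (\<lambda>_. 0)) t m" if "Re t < 0" for t
    using bdd_below_H_R_Re[OF V, of t] that by (intro exI[of _ "- Re t"]) simp
  have tensor: "\<exists>u. ?ae (of_real r) u \<and> ?q u = (\<lambda>n. ereal (Nv k / (l2_norm MI (psi k))\<^sup>2))" if kr: "lam k \<le> r" for r k
  proof -
    obtain f where f: "approx_eigenseq lborel (H_R (\<lambda>_. 0)) (of_real (r - lam k)) f"
      using free_approx_eigenseq[of "r - lam k"] kr by auto
    from approx_eigenseq_tensor[OF f npsi_eigenseq[of k]] show ?thesis
      by (intro exI[of _ "\<lambda>n z. f n (fst z) * npsi k (snd z)"]) (simp add: npsi_type)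
  qed
  have app1: "\<exists>r. \<zeta> = of_real r \<and> \<mu>0 \<le> r" if f: "?ae \<zeta> f" for \<zeta> f
  proof (rule ccontr)
    assume n: "\<nexists>r. \<zeta> = of_real r \<and> \<mu>0 \<le> r"
    have b: "\<exists>m>0. bdd_below_at lborel (H_R (\<lambda>_. 0)) (\<zeta> - of_real (lam k)) m" for k
    proof (cases "Im \<zeta> = 0")
      case True
      hence "\<zeta> = of_real (Re \<zeta>)" by (simp add: complex_eq_iff)
      hence "Re \<zeta> < \<mu>0" using n by (metis not_le)
      thus ?thesis using low[of k] by (intro bRe) simp
    qed (intro bIm, simp)
    \<comment> \<open>With every component controlled, the form would be definite with both signs,
      which is contradictory.\<close>
    have "liminf (?q f) > 0" by (rule liminf_definite[OF V _ f]) (use b in blast)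
    moreover have "limsup (?q f) < 0" by (rule limsup_definite[OF V _ f]) (use b in blast)
    ultimately show False using liminf_le_limsup_seq[of "\<lambda>n. Re (l2_inner MO (par_Om (f n)) (f n))"] by (meson leD less_trans le_less_trans)
  qed
  have app2: "\<exists>u. ?ae (of_real r) u \<and> \<not> limsup (?q u) < 0" if r: "\<mu>0 \<le> r" for r
  proof -
    obtain u where u: "?ae (of_real r) u" "?q u = (\<lambda>n. ereal (Nv i / (l2_norm MI (psi i))\<^sup>2))"
      using tensor[of i r] r mu by auto
    have "Nv i / (l2_norm MI (psi i))\<^sup>2 \<ge> 0" using types(1) by simp
    thus ?thesis using u by (intro exI[of _ u]) (simp add: Limsup_const)
  qed
  have app3: "\<exists>u. ?ae (of_real r) u \<and> \<not> liminf (?q u) > 0" if r: "\<mu>1 \<le> r" for r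
  proof -
    obtain u where u: "?ae (of_real r) u" "?q u = (\<lambda>n. ereal (Nv j / (l2_norm MI (psi j))\<^sup>2))"
      using tensor[of j r] r mu by auto
    have "Nv j / (l2_norm MI (psi j))\<^sup>2 \<le> 0" using types(2) by (simp add: divide_nonpos_nonneg)
    thus ?thesis using u by (intro exI[of _ u]) (simp add: Liminf_const)
  qed
  have app4: "liminf (?q f) > 0" if r: "\<mu>0 \<le> r" "r < \<mu>1" and f: "?ae (of_real r) f" for r f
  proof (rule liminf_definite[OF V _ f])
    fix k
    show "(\<exists>m>0. bdd_below_at lborel (H_R (\<lambda>_. 0)) (of_real r - of_real (lam k)) m) \<or> Nv k > 0"
    proof (cases "k = i")
      case True
      thus ?thesis using types(3) r mu by simp
    next
      case False
      hence "r < lam k" using rest[of k] r mu by simp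
      thus ?thesis using bRe[of "of_real r - of_real (lam k)"] by simp
    qed
  qed
  have app: "spec_app MO (H_Om a \<alpha> (\<lambda>_. 0)) = complex_of_real ` {\<mu>0..}"
  proof
    show "spec_app MO (H_Om a \<alpha> (\<lambda>_. 0)) \<subseteq> complex_of_real ` {\<mu>0..}"
      using app1 unfolding spec_app_def by fastforce
    show "complex_of_real ` {\<mu>0..} \<subseteq> spec_app MO (H_Om a \<alpha> (\<lambda>_. 0))"
      using app2 unfolding spec_app_def by fastforce
  qed
  have pp: "spec_pp MO par_Om (H_Om a \<alpha> (\<lambda>_. 0)) = complex_of_real ` {\<mu>0..<\<mu>1}"
  proof
    show "spec_pp MO par_Om (H_Om a \<alpha> (\<lambda>_. 0)) \<subseteq> complex_of_real ` {\<mu>0..<\<mu>1}"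
    proof
      fix \<zeta> assume z: "\<zeta> \<in> spec_pp MO par_Om (H_Om a \<alpha> (\<lambda>_. 0))"
      then obtain r where r: "\<zeta> = of_real r" "\<mu>0 \<le> r" unfolding spec_pp_def app by auto
      have "\<not> \<mu>1 \<le> r" using app3[of r] z unfolding spec_pp_def r(1) by blast
      thus "\<zeta> \<in> complex_of_real ` {\<mu>0..<\<mu>1}" using r by auto
    qed
    show "complex_of_real ` {\<mu>0..<\<mu>1} \<subseteq> spec_pp MO par_Om (H_Om a \<alpha> (\<lambda>_. 0))"
      using app4 unfolding spec_pp_def app by auto
  qed
  have mm: "spec_mm MO par_Om (H_Om a \<alpha> (\<lambda>_. 0)) = {}"
  proof -
    have "\<zeta> \<notin> spec_mm MO par_Om (H_Om a \<alpha> (\<lambda>_. 0))" for \<zeta>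
    proof
      assume z: "\<zeta> \<in> spec_mm MO par_Om (H_Om a \<alpha> (\<lambda>_. 0))"
      then obtain r where r: "\<zeta> = of_real r" "\<mu>0 \<le> r" unfolding spec_mm_def app by auto
      thus False using app2[of r] z unfolding spec_mm_def by blast
    qed
    thus ?thesis by blast
  qed
  have le: "\<mu>0 \<le> \<mu>1" using le01 mu by simp
  show "spec_pp MO par_Om (H_Om a \<alpha> (\<lambda>_. 0)) = complex_of_real ` {ev_sorted a \<alpha> 0 ..< ev_sorted a \<alpha> 1}"
    using pp by (simp add: \<mu>0_def \<mu>1_def)
  show "spec_mm MO par_Om (H_Om a \<alpha> (\<lambda>_. 0)) = {}" by (rule mm)
  have "complex_of_real ` {\<mu>0..} - (complex_of_real ` {\<mu>0..<\<mu>1} \<union> {}) = complex_of_real ` ({\<mu>0..} - {\<mu>0..<\<mu>1})"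
    by (simp add: image_set_diff inj_of_real)
  also have "{\<mu>0..} - {\<mu>0..<\<mu>1} = {\<mu>1..}" using le by auto
  finally show "spec_00 MO par_Om (H_Om a \<alpha> (\<lambda>_. 0)) = complex_of_real ` {ev_sorted a \<alpha> 1 ..}"
    unfolding spec_00_def app pp mm by (simp add: \<mu>1_def)
qed

end

theorem theorem3p6:
  fixes a \<alpha>0 :: real and V0 :: "real \<Rightarrow> real"
  assumes "a > 0" and "V0 \<in> Linfty_real"
  shows
    "(spec_pp (meas_on (Om a)) par_Om (H_Om a \<alpha>0 V0)
        = M_plus a \<alpha>0 V0 - (M_minus a \<alpha>0 V0 \<union> M_zero a \<alpha>0 V0) \<and>
      spec_mm (meas_on (Om a)) par_Om (H_Om a \<alpha>0 V0)
        = M_minus a \<alpha>0 V0 - (M_plus a \<alpha>0 V0 \<union> M_zero a \<alpha>0 V0) \<and>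
      spec_00 (meas_on (Om a)) par_Om (H_Om a \<alpha>0 V0)
        = M_zero a \<alpha>0 V0 \<union> (M_plus a \<alpha>0 V0 \<inter> M_minus a \<alpha>0 V0)) \<and>
     (spec_pp (meas_on (Om a)) par_Om (H_Om a \<alpha>0 (\<lambda>_. 0))
        = complex_of_real ` {ev_sorted a \<alpha>0 0 ..< ev_sorted a \<alpha>0 1} \<and>
      spec_mm (meas_on (Om a)) par_Om (H_Om a \<alpha>0 (\<lambda>_. 0)) = {} \<and>
      spec_00 (meas_on (Om a)) par_Om (H_Om a \<alpha>0 (\<lambda>_. 0))
        = complex_of_real ` {ev_sorted a \<alpha>0 1 ..})"
proof -
  interpret strip a \<alpha>0 by (rule strip.intro[OF assms(1)])
  obtain V B where V: "V \<in> borel_measurable borel" "\<And>x. \<bar>V x\<bar> \<le> B" "H_R V0 = H_R V"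
    using Linfty_real_borel[OF assms(2)] by metis
  show ?thesis
    by (intro conjI spectra_Om[OF V] spectra_Om_free)
qed

end
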